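(* Let $A$, $B$ and $C$ be dg algebras with enough idempotents. The assignment $(M,X)\mapsto\overline{\mathrm{HOM}}_A(M,X)$ is the definition on objects of a dg functor $$\overline{\mathrm{HOM}}_A(?,?):(C-Dg-A)^{op}\otimes(B-Dg-A)\longrightarrow B-Dg-C.$$
   Context: $K$ is a fixed commutative ring with unit, $\otimes=\otimes_K$, $|x|$ is degree. A dg category is a $K$-linear category whose Hom's are dg $K$-modules with composition of degree zero and $d(g\circ f)=d(g)\circ f+(-1)^{|g|}g\circ d(f)$; a dg functor is a $K$-linear functor preserving degrees and commuting with differentials on Hom's. $\mathcal{A}^{op}$ has the same Hom differentials and composition $\beta^o\circ\alpha^o=(-1)^{|\alpha||\beta|}(\alpha\circ\beta)^o$; $\mathcal{A}\otimes\mathcal{B}$ has pairs as objects, Hom's $\mathcal{A}(A,A')\otimes\mathcal{B}(B,B')$ with differential $d(\alpha\otimes\beta)=d(\alpha)\otimes\beta+(-1)^{|\alpha|}\alpha\otimes d(\beta)$, and composition $(\alpha_1\otimes\beta_1)\circ(\alpha_2\otimes\beta_2)=(-1)^{|\alpha_2||\beta_1|}(\alpha_1\alpha_2)\otimes(\beta_1\beta_2)$. A dg algebra with enough idempotents is a graded associative $K$-algebra $A$ having a family $(e_i)_{i\in I}$ of nonzero orthogonal degree-$0$ idempotents (a distinguished family) with $A=\bigoplus e_iA=\bigoplus Ae_i$, with a degree $+1$ square-zero map $d$ with $d(e_i)=0$ and $d(ab)=d(a)b+(-1)^{|a|}ad(b)$. Modules and bimodules are unitary unless said otherwise. A dg $B-A-$bimodule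 is a graded $B-A-$bimodule $X$ with degree $+1$ square-zero $d_X$ such that $d_X(bxa)=d_B(b)xa+(-1)^{|b|}bd_X(x)a+(-1)^{|b|+|x|}bxd_A(a)$. $B-Dg-A$ is the dg category of dg $B-A-$bimodules, where morphisms of degree $n$ are degree $n$ $K$-linear maps $f$ with $f(bxa)=(-1)^{n|b|}bf(x)a$, and $d(f)=d_Y\circ f-(-1)^{|f|}f\circ d_X$. For $M$ in $C-Dg-A$ and $X$ in $B-Dg-A$, $\mathrm{HOM}_A(M,X)$ is the dg $K$-module of finite sums of homogeneous right $A$-linear maps $M\to X$, with $d(f)=d_X\circ f-(-1)^{|f|}f\circ d_M$; it is a (possibly non-unitary) graded $B-C-$bimodule via $(bfc)(m)=bf(cm)$. $\overline{\mathrm{HOM}}_A(M,X):=B\,\mathrm{HOM}_A(M,X)\,C$ is its largest unitary graded sub-bimodule; with the restricted differential it is a dg $B-C-$bimodule. The functor meant acts on homogeneous morphisms $\alpha:N\to M$ in $C-Dg-A$ and $\varphi:X\to Y$ in $B-Dg-A$ by $\overline{\mathrm{HOM}}_A(\alpha^o\otimes\varphi):\overline{\mathrm{HOM}}_A(M,X)\to\overline{\mathrm{HOM}}_A(N,Y)$, $f\mapsto(-1)^{(|\varphi|+|f|)|\alpha|}\varphi\circ f\circ\alpha$. *)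

theory Defs
  imports "HOL-Algebra.Free_Abelian_Groups" "HOL-Algebra.Module" "HOL-Algebra.Ideal"
begin

section \<open>Graded modules and dg modules over a commutative ring\<close>

definition is_decomposition ::
    "('m, 's) ring_scheme \<Rightarrow> 'i set \<Rightarrow> ('i \<Rightarrow> 'm set) \<Rightarrow> 'm \<Rightarrow> ('i \<Rightarrow> 'm) \<Rightarrow> bool"
  where "is_decomposition M I S x c \<longleftrightarrow>
    c \<in> (\<Pi>\<^sub>E i\<in>I. S i) \<and> finite {i \<in> I. c i \<noteq> \<zero>\<^bsub>M\<^esub>} \<and>
    x = (\<Oplus>\<^bsub>M\<^esub>i\<in>{i \<in> I. c i \<noteq> \<zero>\<^bsub>M\<^esub>}. c i)"

definition internal_direct_sum ::
    "('m, 's) ring_scheme \<Rightarrow> 'i set \<Rightarrow> ('i \<Rightarrow> 'm set) \<Rightarrow> bool"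
  where "internal_direct_sum M I S \<longleftrightarrow>
    (\<forall>i\<in>I. additive_subgroup (S i) M) \<and>
    (\<forall>x\<in>carrier M. \<exists>!c. is_decomposition M I S x c)"

text \<open>The fields \<open>mult\<close> and \<open>one\<close>, inherited from the library's \<open>module\<close> record, are used only
  for dg algebras (\<open>mult\<close>); they play no role for modules, where constructions leave them
  \<open>undefined\<close>.\<close>

record ('k, 'm) dg_mod = "('k, 'm) module" +
  homog :: "int \<Rightarrow> 'm set"
  dif :: "'m \<Rightarrow> 'm"

definition ksign :: "('m, 's) ring_scheme \<Rightarrow> int \<Rightarrow> 'm \<Rightarrow> 'm"
  \<comment> \<open>\<open>(-1)\<^sup>n x\<close>\<close>
  where "ksign M n x = (if even n then x else \<ominus>\<^bsub>M\<^esub> x)"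

definition component :: "('k, 'm, 's) dg_mod_scheme \<Rightarrow> 'm \<Rightarrow> int \<Rightarrow> 'm"
  where "component M x = (THE c. is_decomposition M UNIV (homog M) x c)"

text \<open>Many operations are prescribed by a formula \<open>h n x\<close> for \<open>x\<close> homogeneous of degree \<open>n\<close>;
  this is the additive extension of such a formula to all elements of \<open>M\<close>, with values in \<open>P\<close>.\<close>

definition graded_extend ::
    "('p, 't) ring_scheme \<Rightarrow> ('k, 'm, 's) dg_mod_scheme \<Rightarrow> (int \<Rightarrow> 'm \<Rightarrow> 'p) \<Rightarrow> 'm \<Rightarrow> 'p"
  where "graded_extend P M h x =
    (\<Oplus>\<^bsub>P\<^esub>n\<in>{n. component M x n \<noteq> \<zero>\<^bsub>M\<^esub>}. h n (component M x n))"

definition linear_maps ::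
    "('k, 'r) ring_scheme \<Rightarrow> ('k, 'm, 's) module_scheme \<Rightarrow> ('k, 'n, 't) module_scheme \<Rightarrow> ('m \<Rightarrow> 'n) set"
  where "linear_maps K M N = {f \<in> carrier M \<rightarrow> carrier N.
    (\<forall>x\<in>carrier M. \<forall>y\<in>carrier M. f (x \<oplus>\<^bsub>M\<^esub> y) = f x \<oplus>\<^bsub>N\<^esub> f y) \<and>
    (\<forall>k\<in>carrier K. \<forall>x\<in>carrier M. f (k \<odot>\<^bsub>M\<^esub> x) = k \<odot>\<^bsub>N\<^esub> f x)}"

locale dg_module = module K M
  for K :: "('k, 'r) ring_scheme" and M :: "('k, 'm, 's) dg_mod_scheme" +
  assumes grading: "internal_direct_sum M UNIV (homog M)"
    and smult_homog: "\<lbrakk>k \<in> carrier K; x \<in> homog M n\<rbrakk> \<Longrightarrow> k \<odot>\<^bsub>M\<^esub> x \<in> homog M n"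
    and dif_linear: "dif M \<in> linear_maps K M M"
    and dif_degree: "x \<in> homog M n \<Longrightarrow> dif M x \<in> homog M (n + 1)"
    and dif_square: "x \<in> carrier M \<Longrightarrow> dif M (dif M x) = \<zero>\<^bsub>M\<^esub>"

section \<open>Dg algebras with enough idempotents and their bimodules\<close>

text \<open>Distinct members of a family of nonzero orthogonal idempotents are distinct elements, so a
  distinguished family is the same as a set \<open>E\<close> of idempotents, indexed by itself.\<close>

definition distinguished_family :: "('k, 'a, 's) dg_mod_scheme \<Rightarrow> 'a set \<Rightarrow> bool"
  where "distinguished_family A E \<longleftrightarrow>
    E \<subseteq> homog A 0 \<and> \<zero>\<^bsub>A\<^esub> \<notin> E \<and>
    (\<forall>e\<in>E. e \<otimes>\<^bsub>A\<^esub> e = e) \<and>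
    (\<forall>e\<in>E. \<forall>e'\<in>E. e \<noteq> e' \<longrightarrow> e \<otimes>\<^bsub>A\<^esub> e' = \<zero>\<^bsub>A\<^esub>) \<and>
    (\<forall>e\<in>E. dif A e = \<zero>\<^bsub>A\<^esub>) \<and>
    internal_direct_sum A E (\<lambda>e. {e \<otimes>\<^bsub>A\<^esub> a | a. a \<in> carrier A}) \<and>
    internal_direct_sum A E (\<lambda>e. {a \<otimes>\<^bsub>A\<^esub> e | a. a \<in> carrier A})"

locale dg_algebra = dg_module K A
  for K :: "('k, 'r) ring_scheme" and A :: "('k, 'a, 's) dg_mod_scheme" +
  assumes mult_closed:
      "\<lbrakk>a \<in> carrier A; b \<in> carrier A\<rbrakk> \<Longrightarrow> a \<otimes>\<^bsub>A\<^esub> b \<in> carrier A"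
    and mult_assoc:
      "\<lbrakk>a \<in> carrier A; b \<in> carrier A; c \<in> carrier A\<rbrakk> \<Longrightarrow>
        (a \<otimes>\<^bsub>A\<^esub> b) \<otimes>\<^bsub>A\<^esub> c = a \<otimes>\<^bsub>A\<^esub> (b \<otimes>\<^bsub>A\<^esub> c)"
    and mult_linear_left:
      "b \<in> carrier A \<Longrightarrow> (\<lambda>a. a \<otimes>\<^bsub>A\<^esub> b) \<in> linear_maps K A A"
    and mult_linear_right:
      "a \<in> carrier A \<Longrightarrow> (\<lambda>b. a \<otimes>\<^bsub>A\<^esub> b) \<in> linear_maps K A A"
    and mult_degree:
      "\<lbrakk>a \<in> homog A p; b \<in> homog A q\<rbrakk> \<Longrightarrow> a \<otimes>\<^bsub>A\<^esub> b \<in> homog A (p + q)"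
    and dif_mult:
      "\<lbrakk>a \<in> homog A p; b \<in> carrier A\<rbrakk> \<Longrightarrow>
        dif A (a \<otimes>\<^bsub>A\<^esub> b) = dif A a \<otimes>\<^bsub>A\<^esub> b \<oplus>\<^bsub>A\<^esub> ksign A p (a \<otimes>\<^bsub>A\<^esub> dif A b)"
    and enough_idempotents: "\<exists>E. distinguished_family A E"

record ('k, 'x, 'b, 'a) dg_bimod = "('k, 'x) dg_mod" +
  lact :: "'b \<Rightarrow> 'x \<Rightarrow> 'x"
  ract :: "'x \<Rightarrow> 'a \<Rightarrow> 'x"

definition additive_span :: "('m, 's) ring_scheme \<Rightarrow> 'm set \<Rightarrow> 'm set"
  where "additive_span M S = generate (add_monoid M) S"

locale dg_bimodule =
  dg_module K X + B: dg_algebra K B + A: dg_algebra K A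
  for K :: "('k, 'r) ring_scheme"
    and B :: "('k, 'b, 's) dg_mod_scheme" and A :: "('k, 'a, 't) dg_mod_scheme"
    and X :: "('k, 'x, 'b, 'a, 'u) dg_bimod_scheme" +
  assumes lact_linear_left:
      "x \<in> carrier X \<Longrightarrow> (\<lambda>b. lact X b x) \<in> linear_maps K B X"
    and lact_linear_right:
      "b \<in> carrier B \<Longrightarrow> (\<lambda>x. lact X b x) \<in> linear_maps K X X"
    and ract_linear_left:
      "a \<in> carrier A \<Longrightarrow> (\<lambda>x. ract X x a) \<in> linear_maps K X X"
    and ract_linear_right:
      "x \<in> carrier X \<Longrightarrow> (\<lambda>a. ract X x a) \<in> linear_maps K A X"
    and lact_assoc:
      "\<lbrakk>b \<in> carrier B; b' \<in> carrier B; x \<in> carrier X\<rbrakk> \<Longrightarrow>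
        lact X (b \<otimes>\<^bsub>B\<^esub> b') x = lact X b (lact X b' x)"
    and ract_assoc:
      "\<lbrakk>x \<in> carrier X; a \<in> carrier A; a' \<in> carrier A\<rbrakk> \<Longrightarrow>
        ract X x (a \<otimes>\<^bsub>A\<^esub> a') = ract X (ract X x a) a'"
    and lact_ract:
      "\<lbrakk>b \<in> carrier B; x \<in> carrier X; a \<in> carrier A\<rbrakk> \<Longrightarrow>
        ract X (lact X b x) a = lact X b (ract X x a)"
    and lact_degree:
      "\<lbrakk>b \<in> homog B p; x \<in> homog X q\<rbrakk> \<Longrightarrow> lact X b x \<in> homog X (p + q)"
    and ract_degree:
      "\<lbrakk>x \<in> homog X p; a \<in> homog A q\<rbrakk> \<Longrightarrow> ract X x a \<in> homog X (p + q)"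
    and left_unitary:
      "additive_span X {lact X b x | b x. b \<in> carrier B \<and> x \<in> carrier X} = carrier X"
    and right_unitary:
      "additive_span X {ract X x a | x a. x \<in> carrier X \<and> a \<in> carrier A} = carrier X"
    and dif_bimodule:
      "\<lbrakk>b \<in> homog B p; x \<in> homog X q; a \<in> carrier A\<rbrakk> \<Longrightarrow>
        dif X (ract X (lact X b x) a) =
          ract X (lact X (dif B b) x) a
          \<oplus>\<^bsub>X\<^esub> ksign X p (ract X (lact X b (dif X x)) a)
          \<oplus>\<^bsub>X\<^esub> ksign X (p + q) (ract X (lact X b x) (dif A a))"

section \<open>Dg categories and dg functors\<close>

text \<open>The Hom modules of different pairs of objects need not be disjoint, so composition and
  identities are indexed by objects: \<open>Comp \<C> X Y Z g f\<close> is \<open>g \<circ> f\<close> for \<open>f : X \<rightarrow> Y\<close> and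
  \<open>g : Y \<rightarrow> Z\<close>.\<close>

record ('o, 'k, 'h) dg_cat =
  Obj :: "'o set"
  Hom :: "'o \<Rightarrow> 'o \<Rightarrow> ('k, 'h) dg_mod"
  Comp :: "'o \<Rightarrow> 'o \<Rightarrow> 'o \<Rightarrow> 'h \<Rightarrow> 'h \<Rightarrow> 'h"
  Id :: "'o \<Rightarrow> 'h"

locale dg_category = cring K
  for K :: "('k, 'r) ring_scheme" and \<C> :: "('o, 'k, 'h) dg_cat" +
  assumes Hom_dg_module:
      "\<lbrakk>X \<in> Obj \<C>; Y \<in> Obj \<C>\<rbrakk> \<Longrightarrow> dg_module K (Hom \<C> X Y)"
    and Id_closed:
      "X \<in> Obj \<C> \<Longrightarrow> Id \<C> X \<in> carrier (Hom \<C> X X)"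
    and Comp_linear_left:
      "\<lbrakk>X \<in> Obj \<C>; Y \<in> Obj \<C>; Z \<in> Obj \<C>; f \<in> carrier (Hom \<C> X Y)\<rbrakk> \<Longrightarrow>
        (\<lambda>g. Comp \<C> X Y Z g f) \<in> linear_maps K (Hom \<C> Y Z) (Hom \<C> X Z)"
    and Comp_linear_right:
      "\<lbrakk>X \<in> Obj \<C>; Y \<in> Obj \<C>; Z \<in> Obj \<C>; g \<in> carrier (Hom \<C> Y Z)\<rbrakk> \<Longrightarrow>
        (\<lambda>f. Comp \<C> X Y Z g f) \<in> linear_maps K (Hom \<C> X Y) (Hom \<C> X Z)"
    and Comp_assoc:
      "\<lbrakk>W \<in> Obj \<C>; X \<in> Obj \<C>; Y \<in> Obj \<C>; Z \<in> Obj \<C>;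
        f \<in> carrier (Hom \<C> W X); g \<in> carrier (Hom \<C> X Y); h \<in> carrier (Hom \<C> Y Z)\<rbrakk> \<Longrightarrow>
        Comp \<C> W X Z (Comp \<C> X Y Z h g) f = Comp \<C> W Y Z h (Comp \<C> W X Y g f)"
    and Id_left:
      "\<lbrakk>X \<in> Obj \<C>; Y \<in> Obj \<C>; f \<in> carrier (Hom \<C> X Y)\<rbrakk> \<Longrightarrow> Comp \<C> X Y Y (Id \<C> Y) f = f"
    and Id_right:
      "\<lbrakk>X \<in> Obj \<C>; Y \<in> Obj \<C>; f \<in> carrier (Hom \<C> X Y)\<rbrakk> \<Longrightarrow> Comp \<C> X X Y f (Id \<C> X) = f"
    and Comp_degree:
      "\<lbrakk>X \<in> Obj \<C>; Y \<in> Obj \<C>; Z \<in> Obj \<C>;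
        g \<in> homog (Hom \<C> Y Z) p; f \<in> homog (Hom \<C> X Y) q\<rbrakk> \<Longrightarrow>
        Comp \<C> X Y Z g f \<in> homog (Hom \<C> X Z) (p + q)"
    and dif_Comp:
      "\<lbrakk>X \<in> Obj \<C>; Y \<in> Obj \<C>; Z \<in> Obj \<C>;
        g \<in> homog (Hom \<C> Y Z) p; f \<in> carrier (Hom \<C> X Y)\<rbrakk> \<Longrightarrow>
        dif (Hom \<C> X Z) (Comp \<C> X Y Z g f) =
          Comp \<C> X Y Z (dif (Hom \<C> Y Z) g) f
          \<oplus>\<^bsub>Hom \<C> X Z\<^esub> ksign (Hom \<C> X Z) p (Comp \<C> X Y Z g (dif (Hom \<C> X Y) f))"

locale dg_functor = source: dg_category K \<C> + target: dg_category K \<D>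
  for K :: "('k, 'r) ring_scheme"
    and \<C> :: "('o, 'k, 'h) dg_cat" and \<D> :: "('p, 'k, 'i) dg_cat"
    and Fo :: "'o \<Rightarrow> 'p" and Fm :: "'o \<Rightarrow> 'o \<Rightarrow> 'h \<Rightarrow> 'i" +
  assumes Fo_closed: "X \<in> Obj \<C> \<Longrightarrow> Fo X \<in> Obj \<D>"
    and Fm_linear:
      "\<lbrakk>X \<in> Obj \<C>; Y \<in> Obj \<C>\<rbrakk> \<Longrightarrow>
        Fm X Y \<in> linear_maps K (Hom \<C> X Y) (Hom \<D> (Fo X) (Fo Y))"
    and Fm_degree:
      "\<lbrakk>X \<in> Obj \<C>; Y \<in> Obj \<C>; f \<in> homog (Hom \<C> X Y) n\<rbrakk> \<Longrightarrow>
        Fm X Y f \<in> homog (Hom \<D> (Fo X) (Fo Y)) n"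
    and Fm_dif:
      "\<lbrakk>X \<in> Obj \<C>; Y \<in> Obj \<C>; f \<in> carrier (Hom \<C> X Y)\<rbrakk> \<Longrightarrow>
        Fm X Y (dif (Hom \<C> X Y) f) = dif (Hom \<D> (Fo X) (Fo Y)) (Fm X Y f)"
    and Fm_Id: "X \<in> Obj \<C> \<Longrightarrow> Fm X X (Id \<C> X) = Id \<D> (Fo X)"
    and Fm_Comp:
      "\<lbrakk>X \<in> Obj \<C>; Y \<in> Obj \<C>; Z \<in> Obj \<C>;
        f \<in> carrier (Hom \<C> X Y); g \<in> carrier (Hom \<C> Y Z)\<rbrakk> \<Longrightarrow>
        Fm X Z (Comp \<C> X Y Z g f) = Comp \<D> (Fo X) (Fo Y) (Fo Z) (Fm Y Z g) (Fm X Y f)"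

section \<open>Opposite dg categories\<close>

definition dg_op :: "('o, 'k, 'h) dg_cat \<Rightarrow> ('o, 'k, 'h) dg_cat"
  where "dg_op \<C> = \<lparr>
    Obj = Obj \<C>,
    Hom = (\<lambda>X Y. Hom \<C> Y X),
    Comp = (\<lambda>X Y Z \<beta> \<alpha>.
      graded_extend (Hom \<C> Z X) (Hom \<C> Z Y)
        (\<lambda>p b. graded_extend (Hom \<C> Z X) (Hom \<C> Y X)
          (\<lambda>q a. ksign (Hom \<C> Z X) (q * p) (Comp \<C> Z Y X a b)) \<alpha>) \<beta>),
    Id = Id \<C>\<rparr>"

section \<open>Tensor products\<close>

definition tensor_free ::
    "('k, 'm, 's) module_scheme \<Rightarrow> ('k, 'n, 't) module_scheme \<Rightarrow> ('m \<times> 'n \<Rightarrow>\<^sub>0 int) monoid"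
  where "tensor_free M N = free_Abelian_group (carrier M \<times> carrier N)"

definition tensor_relators ::
    "('k, 'r) ring_scheme \<Rightarrow> ('k, 'm, 's) module_scheme \<Rightarrow> ('k, 'n, 't) module_scheme
      \<Rightarrow> ('m \<times> 'n \<Rightarrow>\<^sub>0 int) set"
  where "tensor_relators K M N =
    {frag_of (x \<oplus>\<^bsub>M\<^esub> x', y) - frag_of (x, y) - frag_of (x', y) | x x' y.
       x \<in> carrier M \<and> x' \<in> carrier M \<and> y \<in> carrier N} \<union>
    {frag_of (x, y \<oplus>\<^bsub>N\<^esub> y') - frag_of (x, y) - frag_of (x, y') | x y y'.
       x \<in> carrier M \<and> y \<in> carrier N \<and> y' \<in> carrier N} \<union>
    {frag_of (k \<odot>\<^bsub>M\<^esub> x, y) - frag_of (x, k \<odot>\<^bsub>N\<^esub> y) | k x y.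
       k \<in> carrier K \<and> x \<in> carrier M \<and> y \<in> carrier N}"

definition tensor_kernel ::
    "('k, 'r) ring_scheme \<Rightarrow> ('k, 'm, 's) module_scheme \<Rightarrow> ('k, 'n, 't) module_scheme
      \<Rightarrow> ('m \<times> 'n \<Rightarrow>\<^sub>0 int) set"
  where "tensor_kernel K M N = generate (tensor_free M N) (tensor_relators K M N)"

definition pure_tensor ::
    "('k, 'r) ring_scheme \<Rightarrow> ('k, 'm, 's) module_scheme \<Rightarrow> ('k, 'n, 't) module_scheme
      \<Rightarrow> 'm \<Rightarrow> 'n \<Rightarrow> ('m \<times> 'n \<Rightarrow>\<^sub>0 int) set"
  where "pure_tensor K M N x y = tensor_kernel K M N #>\<^bsub>tensor_free M N\<^esub> frag_of (x, y)"

text \<open>The map induced on the tensor product by a balanced biadditive map \<open>b\<close> with values in \<open>P\<close>: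
  evaluate \<open>b\<close> on any representative \<open>\<Sum>\<^sub>i z\<^sub>i (x\<^sub>i, y\<^sub>i)\<close> of the coset \<open>t\<close>.\<close>

definition tensor_lift ::
    "('p, 's) ring_scheme \<Rightarrow> ('m \<Rightarrow> 'n \<Rightarrow> 'p) \<Rightarrow> ('m \<times> 'n \<Rightarrow>\<^sub>0 int) set \<Rightarrow> 'p"
  where "tensor_lift P b t = (let z = (SOME z. z \<in> t) in
    (\<Oplus>\<^bsub>P\<^esub>w\<in>Poly_Mapping.keys z. [Poly_Mapping.lookup z w] \<cdot>\<^bsub>P\<^esub> b (fst w) (snd w)))"

definition tensor_group ::
    "('k, 'r) ring_scheme \<Rightarrow> ('k, 'm, 's) module_scheme \<Rightarrow> ('k, 'n, 't) module_scheme
      \<Rightarrow> ('m \<times> 'n \<Rightarrow>\<^sub>0 int) set ring"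
  where "tensor_group K M N = (let Q = tensor_free M N Mod tensor_kernel K M N in
    \<lparr>carrier = carrier Q, mult = undefined, one = undefined,
     zero = \<one>\<^bsub>Q\<^esub>, add = (\<otimes>\<^bsub>Q\<^esub>)\<rparr>)"

definition dg_tensor ::
    "('k, 'r) ring_scheme \<Rightarrow> ('k, 'm, 's) dg_mod_scheme \<Rightarrow> ('k, 'n, 't) dg_mod_scheme
      \<Rightarrow> ('k, ('m \<times> 'n \<Rightarrow>\<^sub>0 int) set) dg_mod"
  where "dg_tensor K M N = (let T = tensor_group K M N in
    \<lparr>carrier = carrier T, mult = undefined, one = undefined,
     zero = \<zero>\<^bsub>T\<^esub>, add = (\<oplus>\<^bsub>T\<^esub>),
     smult = (\<lambda>k. tensor_lift T (\<lambda>x y. pure_tensor K M N (k \<odot>\<^bsub>M\<^esub> x) y)),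
     homog = (\<lambda>n. additive_span T
       {pure_tensor K M N x y | x y. \<exists>p q. p + q = n \<and> x \<in> homog M p \<and> y \<in> homog N q}),
     dif = tensor_lift T (\<lambda>x y.
       pure_tensor K M N (dif M x) y
       \<oplus>\<^bsub>T\<^esub> graded_extend T M (\<lambda>p x'. ksign T p (pure_tensor K M N x' (dif N y))) x)\<rparr>)"

text \<open>Composition is the biadditive extension of
  \<open>(\<alpha>\<^sub>1 \<otimes> \<beta>\<^sub>1) \<circ> (\<alpha>\<^sub>2 \<otimes> \<beta>\<^sub>2) = (-1)\<^bsup>|\<alpha>\<^sub>2||\<beta>\<^sub>1|\<^esup> (\<alpha>\<^sub>1\<alpha>\<^sub>2) \<otimes> (\<beta>\<^sub>1\<beta>\<^sub>2)\<close>.\<close>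

definition dg_tensor_cat ::
    "('k, 'r) ring_scheme \<Rightarrow> ('o, 'k, 'h) dg_cat \<Rightarrow> ('p, 'k, 'i) dg_cat
      \<Rightarrow> ('o \<times> 'p, 'k, ('h \<times> 'i \<Rightarrow>\<^sub>0 int) set) dg_cat"
  where "dg_tensor_cat K \<C> \<D> = \<lparr>
    Obj = Obj \<C> \<times> Obj \<D>,
    Hom = (\<lambda>U V. dg_tensor K (Hom \<C> (fst U) (fst V)) (Hom \<D> (snd U) (snd V))),
    Comp = (\<lambda>(X1, Y1) (X2, Y2) (X3, Y3) t s.
      let T = dg_tensor K (Hom \<C> X1 X3) (Hom \<D> Y1 Y3) in
      tensor_lift T (\<lambda>\<alpha>1 \<beta>1. tensor_lift T (\<lambda>\<alpha>2 \<beta>2.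
        graded_extend T (Hom \<C> X1 X2) (\<lambda>p a2.
          graded_extend T (Hom \<D> Y2 Y3) (\<lambda>q b1.
            ksign T (p * q)
              (pure_tensor K (Hom \<C> X1 X3) (Hom \<D> Y1 Y3)
                (Comp \<C> X1 X2 X3 \<alpha>1 a2) (Comp \<D> Y1 Y2 Y3 b1 \<beta>2))) \<beta>1) \<alpha>2) s) t),
    Id = (\<lambda>(X, Y). pure_tensor K (Hom \<C> X X) (Hom \<D> Y Y) (Id \<C> X) (Id \<D> Y))\<rparr>"

section \<open>Dg modules of graded maps\<close>

text \<open>Maps between carriers are represented by functions that are \<open>undefined\<close> outside the source
  carrier, so that equal maps are equal functions.\<close>

definition map_module ::
    "('k, 'm, 's) module_scheme \<Rightarrow> ('k, 'x, 't) module_scheme \<Rightarrow> ('k, 'm \<Rightarrow> 'x) module"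
  where "map_module M X =
    \<lparr>carrier = carrier M \<rightarrow>\<^sub>E carrier X, mult = undefined, one = undefined,
     zero = (\<lambda>m\<in>carrier M. \<zero>\<^bsub>X\<^esub>),
     add = (\<lambda>f g. \<lambda>m\<in>carrier M. f m \<oplus>\<^bsub>X\<^esub> g m),
     smult = (\<lambda>k f. \<lambda>m\<in>carrier M. k \<odot>\<^bsub>X\<^esub> f m)\<rparr>"

definition degree_maps ::
    "('k, 'r) ring_scheme \<Rightarrow> ('k, 'm, 's) dg_mod_scheme \<Rightarrow> ('k, 'x, 't) dg_mod_scheme
      \<Rightarrow> int \<Rightarrow> ('m \<Rightarrow> 'x) set"
  where "degree_maps K M X n =
    {f \<in> linear_maps K M X \<inter> extensional (carrier M).
      \<forall>p. \<forall>m\<in>homog M p. f m \<in> homog X (p + n)}"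

text \<open>The dg module of finite sums of the homogeneous maps in \<open>H n\<close>, \<open>n \<in> \<int>\<close>, with differential
  \<open>d(f) = d\<^sub>X \<circ> f - (-1)\<^bsup>|f|\<^esup> f \<circ> d\<^sub>M\<close> for homogeneous \<open>f\<close>. The auxiliary \<open>G\<close> is the same
  graded module without differential.\<close>

definition graded_map_module ::
    "('k, 'm, 's) dg_mod_scheme \<Rightarrow> ('k, 'x, 't) dg_mod_scheme \<Rightarrow> (int \<Rightarrow> ('m \<Rightarrow> 'x) set)
      \<Rightarrow> ('k, 'm \<Rightarrow> 'x) dg_mod"
  where "graded_map_module M X H = (let
      P = map_module M X;
      G = \<lparr>carrier = additive_span P (\<Union>n. H n), mult = undefined, one = undefined,
        zero = \<zero>\<^bsub>P\<^esub>, add = (\<oplus>\<^bsub>P\<^esub>), smult = (\<odot>\<^bsub>P\<^esub>), homog = H, dif = undefined\<rparr>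
    in G\<lparr>dif := graded_extend P G (\<lambda>n f.
        compose (carrier M) (dif X) f \<ominus>\<^bsub>P\<^esub> ksign P n (compose (carrier M) f (dif M)))\<rparr>)"

text \<open>The objects of \<open>bimod_cat K B A\<close>, that is of \<open>B-Dg-A\<close>, are the dg bimodules whose
  carrier is a subset of the type \<open>'x\<close>; this type plays the role of a universe. Homogeneous morphisms
  of degree \<open>n\<close> are \<open>bimod_maps K B A X Y n\<close>.\<close>

definition bimod_maps ::
    "('k, 'r) ring_scheme \<Rightarrow> ('k, 'b, 's) dg_mod_scheme \<Rightarrow> ('k, 'a, 't) dg_mod_scheme
      \<Rightarrow> ('k, 'x, 'b, 'a) dg_bimod \<Rightarrow> ('k, 'y, 'b, 'a) dg_bimod \<Rightarrow> int \<Rightarrow> ('x \<Rightarrow> 'y) set"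
  where "bimod_maps K B A X Y n = {f \<in> degree_maps K X Y n.
    \<forall>p. \<forall>b\<in>homog B p. \<forall>x\<in>carrier X. \<forall>a\<in>carrier A.
      f (ract X (lact X b x) a) = ksign Y (n * p) (ract Y (lact Y b (f x)) a)}"

definition bimod_cat ::
    "('k, 'r) ring_scheme \<Rightarrow> ('k, 'b, 's) dg_mod_scheme \<Rightarrow> ('k, 'a, 't) dg_mod_scheme
      \<Rightarrow> (('k, 'x, 'b, 'a) dg_bimod, 'k, 'x \<Rightarrow> 'x) dg_cat"
  where "bimod_cat K B A = \<lparr>
    Obj = {X. dg_bimodule K B A X},
    Hom = (\<lambda>X Y. graded_map_module X Y (bimod_maps K B A X Y)),
    Comp = (\<lambda>X Y Z g f. compose (carrier X) g f),
    Id = (\<lambda>X. \<lambda>x\<in>carrier X. x)\<rparr>"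

section \<open>The bimodules \<open>HOM\<close> and \<open>HOM_bar\<close>\<close>

definition right_linear_maps ::
    "('k, 'r) ring_scheme \<Rightarrow> ('k, 'a, 's) dg_mod_scheme
      \<Rightarrow> ('k, 'm, 'c, 'a) dg_bimod \<Rightarrow> ('k, 'x, 'b, 'a) dg_bimod \<Rightarrow> int \<Rightarrow> ('m \<Rightarrow> 'x) set"
  where "right_linear_maps K A M X n = {f \<in> degree_maps K M X n.
    \<forall>m\<in>carrier M. \<forall>a\<in>carrier A. f (ract M m a) = ract X (f m) a}"

definition HOM ::
    "('k, 'r) ring_scheme \<Rightarrow> ('k, 'a, 's) dg_mod_scheme
      \<Rightarrow> ('k, 'm, 'c, 'a) dg_bimod \<Rightarrow> ('k, 'x, 'b, 'a) dg_bimod \<Rightarrow> ('k, 'm \<Rightarrow> 'x, 'b, 'c) dg_bimod"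
  where "HOM K A M X =
    dg_mod.extend (graded_map_module M X (right_linear_maps K A M X))
      (dg_bimod.fields
        (\<lambda>b f. \<lambda>m\<in>carrier M. lact X b (f m))
        (\<lambda>f c. \<lambda>m\<in>carrier M. f (lact M c m)))"

definition HOM_bar ::
    "('k, 'r) ring_scheme \<Rightarrow> ('k, 'a, 's) dg_mod_scheme
      \<Rightarrow> ('k, 'b, 't) dg_mod_scheme \<Rightarrow> ('k, 'c, 'u) dg_mod_scheme
      \<Rightarrow> ('k, 'm, 'c, 'a) dg_bimod \<Rightarrow> ('k, 'x, 'b, 'a) dg_bimod \<Rightarrow> ('k, 'm \<Rightarrow> 'x, 'b, 'c) dg_bimod"
  where "HOM_bar K A B C M X = (let
      H = HOM K A M X;
      S = additive_span H {lact H b (ract H f c) | b f c.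
            b \<in> carrier B \<and> f \<in> carrier H \<and> c \<in> carrier C}
    in H\<lparr>carrier := S, homog := (\<lambda>n. S \<inter> homog H n)\<rparr>)"

end

theory Submission
  imports Defs
begin

text \<open>
  The functor sends a pure tensor \<open>a \<otimes> \<phi>\<close> of homogeneous morphisms \<open>a : N \<rightarrow> M\<close> and \<open>\<phi> : X \<rightarrow> Y\<close> of
  degrees \<open>p\<close> and \<open>q\<close> to the map \<open>f \<mapsto> (-1)\<^bsup>(q + r) p\<^esup> \<phi> \<circ> f \<circ> a\<close>, where \<open>r\<close> is the degree of \<open>f\<close>. That
  it respects degrees, differentials, identities and composition is a comparison of signs, once it is
  known that everything in sight is determined by homogeneous elements and pure tensors. Most of the
  work goes into making that reduction available: the source, a tensor product of an opposite dg
  category with another one, and the target have to be dg categories, and the values have to be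
  unitary dg bimodules.

  The reduction rests on two facts. A linear map on a graded module is determined by its values on
  homogeneous elements, and linear maps given degree by degree extend (\<open>linear_maps_homog_eq\<close>,
  \<open>graded_extend_linear\<close>, \<open>graded_extend_homog\<close>). A linear map on a tensor product is determined by its
  values on pure tensors, and bilinear maps extend (\<open>tensor_lift_linear\<close>). Hence the axioms of a dg
  category and of a dg functor need only be verified on generators (\<open>dg_categoryI\<close>, \<open>dg_functorI\<close>). That
  a given family of subgroups is a grading follows from linear maps that separate the degrees
  (\<open>internal_direct_sumI\<close>): for the tensor product these are the projections
  \<open>x \<otimes> y \<mapsto> \<Sum>\<^sub>p x\<^sub>p \<otimes> y\<^bsub>n-p\<^esub>\<close>, for modules of maps they are components of values.

  For the bimodules, finite sums of distinguished idempotents serve as local units. They are closed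
  of degree 0, so the conditions on \<open>b x a\<close> in the definitions of dg bimodules and of their morphisms
  split into conditions on \<open>b x\<close> and on \<open>x a\<close> (\<open>dif_lact\<close>, \<open>dif_ract\<close>, \<open>bimod_maps_iff\<close>); they also
  show that \<open>B HOM C\<close> is unitary (\<open>S_dg_bimodule\<close>).

  The sandwich \<open>\<phi> \<circ> f \<circ> a\<close> stays inside \<open>B HOM C\<close> because
  \<open>\<phi> \<circ> (b f c) \<circ> a = \<plusminus> b (\<phi> \<circ> f \<circ> a) c\<close>. The sign in front of it is the one with which
  \<open>f \<mapsto> \<plusminus> \<phi> \<circ> f \<circ> a\<close> becomes a morphism of bimodules of degree \<open>p + q\<close> (\<open>\<Psi>_bimod\<close>) and with which the
  terms containing \<open>d(f)\<close> cancel in the differential (\<open>F_dif\<close>).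
\<close>

section \<open>Linear maps, signs and spans\<close>

lemma linear_mapsI:
  assumes "\<And>x. x \<in> carrier M \<Longrightarrow> f x \<in> carrier N"
    and "\<And>x y. \<lbrakk>x \<in> carrier M; y \<in> carrier M\<rbrakk> \<Longrightarrow> f (x \<oplus>\<^bsub>M\<^esub> y) = f x \<oplus>\<^bsub>N\<^esub> f y"
    and "\<And>k x. \<lbrakk>k \<in> carrier K; x \<in> carrier M\<rbrakk> \<Longrightarrow> f (k \<odot>\<^bsub>M\<^esub> x) = k \<odot>\<^bsub>N\<^esub> f x"
  shows "f \<in> linear_maps K M N"
  using assms by (auto simp: linear_maps_def)

lemma linear_maps_closed: "\<lbrakk>f \<in> linear_maps K M N; x \<in> carrier M\<rbrakk> \<Longrightarrow> f x \<in> carrier N"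
  by (auto simp: linear_maps_def)

lemma linear_maps_add:
  "\<lbrakk>f \<in> linear_maps K M N; x \<in> carrier M; y \<in> carrier M\<rbrakk> \<Longrightarrow> f (x \<oplus>\<^bsub>M\<^esub> y) = f x \<oplus>\<^bsub>N\<^esub> f y"
  by (auto simp: linear_maps_def)

lemma linear_maps_smult:
  "\<lbrakk>f \<in> linear_maps K M N; k \<in> carrier K; x \<in> carrier M\<rbrakk> \<Longrightarrow> f (k \<odot>\<^bsub>M\<^esub> x) = k \<odot>\<^bsub>N\<^esub> f x"
  by (auto simp: linear_maps_def)

lemma linear_maps_cong:
  assumes "f \<in> linear_maps K M N" "module K M" "\<And>x. x \<in> carrier M \<Longrightarrow> f x = g x"
  shows "g \<in> linear_maps K M N"
proof -
  interpret module K M by fact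
  show ?thesis using assms(1) by (auto simp: linear_maps_def assms(3)[symmetric])
qed

lemma linear_maps_compose:
  "\<lbrakk>f \<in> linear_maps K M N; g \<in> linear_maps K N P\<rbrakk> \<Longrightarrow> (\<lambda>x. g (f x)) \<in> linear_maps K M P"
  by (auto simp: linear_maps_def Pi_iff)

lemma linear_maps_hom: "f \<in> linear_maps K M N \<Longrightarrow> f \<in> hom (add_monoid M) (add_monoid N)"
  by (auto simp: linear_maps_def hom_def)

lemma linear_maps_zero:
  assumes "f \<in> linear_maps K M N" "module K M" "module K N"
  shows "f \<zero>\<^bsub>M\<^esub> = \<zero>\<^bsub>N\<^esub>"
proof -
  interpret M: module K M by fact
  interpret N: module K N by fact
  show ?thesis
    using hom_one[OF linear_maps_hom[OF assms(1)] M.a_group N.a_group] by simp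
qed

lemma linear_maps_neg:
  assumes "f \<in> linear_maps K M N" "module K M" "module K N" "x \<in> carrier M"
  shows "f (\<ominus>\<^bsub>M\<^esub> x) = \<ominus>\<^bsub>N\<^esub> f x"
proof -
  interpret M: module K M by fact
  interpret N: module K N by fact
  have "f (\<ominus>\<^bsub>M\<^esub> x) \<oplus>\<^bsub>N\<^esub> f x = f (\<ominus>\<^bsub>M\<^esub> x \<oplus>\<^bsub>M\<^esub> x)"
    using assms by (simp add: linear_maps_add)
  also have "\<dots> = \<zero>\<^bsub>N\<^esub>" using assms by (simp add: M.l_neg linear_maps_zero)
  finally show ?thesis
    using assms by (metis M.a_inv_closed N.minus_equality linear_maps_closed)
qed

lemma linear_maps_ksign:
  assumes "f \<in> linear_maps K M N" "module K M" "module K N" "x \<in> carrier M"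
  shows "f (ksign M n x) = ksign N n (f x)"
  using linear_maps_neg[OF assms] by (simp add: ksign_def)

lemma linear_maps_minus:
  assumes "f \<in> linear_maps K M N" "module K M" "module K N" "x \<in> carrier M" "y \<in> carrier M"
  shows "f (x \<ominus>\<^bsub>M\<^esub> y) = f x \<ominus>\<^bsub>N\<^esub> f y"
proof -
  interpret M: module K M by fact
  show ?thesis using assms by (simp add: a_minus_def linear_maps_add linear_maps_neg)
qed

lemma linear_maps_finsum:
  assumes f: "f \<in> linear_maps K M N" and M: "module K M" and N: "module K N"
    and "c \<in> J \<rightarrow> carrier M"
  shows "f (\<Oplus>\<^bsub>M\<^esub>i\<in>J. c i) = (\<Oplus>\<^bsub>N\<^esub>i\<in>J. f (c i))"
proof -
  interpret M: module K M by fact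
  interpret N: module K N by fact
  show ?thesis using assms(4)
  proof (induction J rule: infinite_finite_induct)
    case (insert j J)
    then have "c \<in> J \<rightarrow> carrier M" "c j \<in> carrier M" by auto
    with insert f show ?case
      by (subst M.finsum_insert, simp_all, subst N.finsum_insert)
        (auto simp: linear_maps_add linear_maps_closed Pi_iff M.finsum_closed)
  qed (simp_all add: linear_maps_zero[OF f M N])
qed

lemma linear_maps_zero_map:
  assumes "module K M" "module K N"
  shows "(\<lambda>_. \<zero>\<^bsub>N\<^esub>) \<in> linear_maps K M N"
proof -
  interpret N: module K N by fact
  show ?thesis by (rule linear_mapsI) auto
qed

lemma linear_maps_id: "(\<lambda>x. x) \<in> linear_maps K M M"
  by (rule linear_mapsI) auto

lemma linear_maps_add_map:
  assumes "module K M" "module K N" "f \<in> linear_maps K M N" "g \<in> linear_maps K M N"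
  shows "(\<lambda>x. f x \<oplus>\<^bsub>N\<^esub> g x) \<in> linear_maps K M N"
proof -
  interpret N: module K N by fact
  show ?thesis using assms
    by (intro linear_mapsI)
      (simp_all add: linear_maps_add linear_maps_smult linear_maps_closed N.a_ac N.smult_r_distr)
qed

lemma linear_maps_smult_map:
  assumes "module K N" "f \<in> linear_maps K M N" "k \<in> carrier K"
  shows "(\<lambda>x. k \<odot>\<^bsub>N\<^esub> f x) \<in> linear_maps K M N"
proof -
  interpret N: module K N by fact
  show ?thesis using assms
    by (intro linear_mapsI)
      (simp_all add: linear_maps_add linear_maps_smult linear_maps_closed N.smult_r_distr
        flip: N.smult_assoc1, simp add: N.m_comm)
qed

lemma linear_maps_neg_map:
  assumes "module K N" "f \<in> linear_maps K M N"
  shows "(\<lambda>x. \<ominus>\<^bsub>N\<^esub> f x) \<in> linear_maps K M N"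
proof -
  interpret N: module K N by fact
  show ?thesis using assms
    by (intro linear_mapsI)
      (simp_all add: linear_maps_add linear_maps_smult linear_maps_closed N.minus_add
        N.smult_r_minus)
qed

lemma linear_maps_ksign_map:
  assumes "module K N" "f \<in> linear_maps K M N"
  shows "(\<lambda>x. ksign N n (f x)) \<in> linear_maps K M N"
  using linear_maps_neg_map[OF assms] assms(2) by (cases "even n") (simp_all add: ksign_def)

lemma linear_maps_minus_map:
  assumes "module K M" "module K N" "f \<in> linear_maps K M N" "g \<in> linear_maps K M N"
  shows "(\<lambda>x. f x \<ominus>\<^bsub>N\<^esub> g x) \<in> linear_maps K M N"
  using linear_maps_add_map[OF assms(1-3) linear_maps_neg_map[OF assms(2,4)]]
  by (simp add: a_minus_def)

lemma linear_maps_finsum_map: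
  assumes M: "module K M" and N: "module K N" and "\<And>i. i \<in> J \<Longrightarrow> f i \<in> linear_maps K M N"
  shows "(\<lambda>x. \<Oplus>\<^bsub>N\<^esub>i\<in>J. f i x) \<in> linear_maps K M N"
  using assms(3)
proof (induction J rule: infinite_finite_induct)
  interpret M: module K M by fact
  interpret N: module K N by fact
  {
    case (insert j J)
    have "(\<lambda>x. f j x \<oplus>\<^bsub>N\<^esub> (\<Oplus>\<^bsub>N\<^esub>i\<in>J. f i x)) \<in> linear_maps K M N"
      using insert by (intro linear_maps_add_map M N) auto
    then show ?case
    proof (rule linear_maps_cong[OF _ M])
      fix x assume x: "x \<in> carrier M"
      have "(\<lambda>i. f i x) \<in> J \<rightarrow> carrier N" "f j x \<in> carrier N"
        using insert.prems x by (auto dest: linear_maps_closed[OF _ x])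
      then show "f j x \<oplus>\<^bsub>N\<^esub> (\<Oplus>\<^bsub>N\<^esub>i\<in>J. f i x) = (\<Oplus>\<^bsub>N\<^esub>i\<in>insert j J. f i x)"
        using insert.hyps by simp
    qed
  }
qed (auto simp: linear_maps_zero_map[OF M N] abelian_monoid.finsum_infinite
    abelian_monoid.finsum_empty module.axioms(2)[OF N, THEN abelian_group.axioms(1)])

definition bilinear_map ::
    "('k, 'r) ring_scheme \<Rightarrow> ('k, 'm, 's) module_scheme \<Rightarrow> ('k, 'n, 't) module_scheme
      \<Rightarrow> ('k, 'p, 'u) module_scheme \<Rightarrow> ('m \<Rightarrow> 'n \<Rightarrow> 'p) \<Rightarrow> bool"
  where "bilinear_map K M N P b \<longleftrightarrow>
    (\<forall>y\<in>carrier N. (\<lambda>x. b x y) \<in> linear_maps K M P) \<and>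
    (\<forall>x\<in>carrier M. (\<lambda>y. b x y) \<in> linear_maps K N P)"

lemma bilinear_mapI:
  assumes "\<And>y. y \<in> carrier N \<Longrightarrow> (\<lambda>x. b x y) \<in> linear_maps K M P"
    and "\<And>x. x \<in> carrier M \<Longrightarrow> (\<lambda>y. b x y) \<in> linear_maps K N P"
  shows "bilinear_map K M N P b"
  using assms by (auto simp: bilinear_map_def)

lemma bilinear_map_left:
  "\<lbrakk>bilinear_map K M N P b; y \<in> carrier N\<rbrakk> \<Longrightarrow> (\<lambda>x. b x y) \<in> linear_maps K M P"
  by (simp add: bilinear_map_def)

lemma bilinear_map_right:
  "\<lbrakk>bilinear_map K M N P b; x \<in> carrier M\<rbrakk> \<Longrightarrow> (\<lambda>y. b x y) \<in> linear_maps K N P"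
  by (simp add: bilinear_map_def)

lemma bilinear_map_closed:
  "\<lbrakk>bilinear_map K M N P b; x \<in> carrier M; y \<in> carrier N\<rbrakk> \<Longrightarrow> b x y \<in> carrier P"
  using linear_maps_closed[of "b x" K N P y] bilinear_map_right[of K M N P b x] by simp

context abelian_group
begin

lemma ksign_closed [simp, intro]: "x \<in> carrier G \<Longrightarrow> ksign G n x \<in> carrier G"
  by (simp add: ksign_def)

lemma ksign_zero [simp]: "ksign G n \<zero> = \<zero>"
  by (simp add: ksign_def)

lemma ksign_add:
  "\<lbrakk>x \<in> carrier G; y \<in> carrier G\<rbrakk> \<Longrightarrow> ksign G n (x \<oplus> y) = ksign G n x \<oplus> ksign G n y"
  by (simp add: ksign_def minus_add)

lemma ksign_ksign: "x \<in> carrier G \<Longrightarrow> ksign G m (ksign G n x) = ksign G (m + n) x"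
  by (simp add: ksign_def)

lemma minus_ksign: "x \<ominus> ksign G n y = x \<oplus> ksign G (n + 1) y" if "y \<in> carrier G"
  using that by (simp add: ksign_def a_minus_def)

end

lemma ksign_even [simp]: "even n \<Longrightarrow> ksign M n x = x"
  by (simp add: ksign_def)

lemma ksign_parity: "even m = even n \<Longrightarrow> ksign M m x = ksign M n x"
  by (simp add: ksign_def)

lemma additive_subgroup_closed:
  assumes "additive_subgroup J M"
  shows "J \<subseteq> carrier M" and "\<zero>\<^bsub>M\<^esub> \<in> J" and "\<lbrakk>x \<in> J; y \<in> J\<rbrakk> \<Longrightarrow> x \<oplus>\<^bsub>M\<^esub> y \<in> J"
  by (simp_all add: assms additive_subgroup.a_subset additive_subgroup.zero_closed
      additive_subgroup.a_closed)

lemma additive_subgroup_neg: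
  assumes "additive_subgroup J M" "abelian_group M" "x \<in> J"
  shows "\<ominus>\<^bsub>M\<^esub> x \<in> J"
  by (rule additive_subgroup.a_inv_closed[OF assms(1,3)])

lemma additive_subgroup_ksign:
  assumes "additive_subgroup J M" "abelian_group M" "x \<in> J"
  shows "ksign M n x \<in> J"
  using additive_subgroup_neg[OF assms] assms(3) by (simp add: ksign_def)

lemma additive_subgroup_finsum:
  assumes "additive_subgroup J M" "abelian_group M" "c \<in> I \<rightarrow> J"
  shows "(\<Oplus>\<^bsub>M\<^esub>i\<in>I. c i) \<in> J"
proof -
  interpret abelian_group M by fact
  note cl = additive_subgroup_closed[OF assms(1)]
  show ?thesis using assms(3)
  proof (induction I rule: infinite_finite_induct)
    case (insert j I)
    then show ?case using cl(1) by (subst finsum_insert) (auto intro: cl(3))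
  qed (simp_all add: cl(2))
qed

lemma additive_subgroup_make:
  assumes "abelian_group M" "J \<subseteq> carrier M" "\<zero>\<^bsub>M\<^esub> \<in> J"
    and "\<And>x y. \<lbrakk>x \<in> J; y \<in> J\<rbrakk> \<Longrightarrow> x \<oplus>\<^bsub>M\<^esub> y \<in> J" and "\<And>x. x \<in> J \<Longrightarrow> \<ominus>\<^bsub>M\<^esub> x \<in> J"
  shows "additive_subgroup J M"
proof -
  interpret abelian_group M by fact
  show ?thesis
    by (rule additive_subgroupI, rule add.subgroupI) (use assms in auto)
qed

lemma additive_subgroup_Int:
  assumes "abelian_group M" "additive_subgroup J M" "additive_subgroup J' M"
  shows "additive_subgroup (J \<inter> J') M"
  using additive_subgroup_closed[OF assms(2)] additive_subgroup_closed[OF assms(3)]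
    additive_subgroup_neg[OF assms(2,1)] additive_subgroup_neg[OF assms(3,1)]
  by (intro additive_subgroup_make assms(1)) auto

lemma additive_span_subgroup:
  assumes "abelian_group M" "S \<subseteq> carrier M"
  shows "additive_subgroup (additive_span M S) M"
  unfolding additive_span_def
  using group.generate_is_subgroup[OF abelian_group.a_group[OF assms(1)]] assms(2)
  by (auto intro: additive_subgroupI)

lemma additive_span_incl: "x \<in> S \<Longrightarrow> x \<in> additive_span M S"
  by (simp add: additive_span_def generate.incl)

lemma additive_span_least:
  assumes "abelian_group M" "additive_subgroup J M" "S \<subseteq> J"
  shows "additive_span M S \<subseteq> J"
  unfolding additive_span_def
  using group.generate_subgroup_incl[OF abelian_group.a_group[OF assms(1)] assms(3)] assms(2)
  by (simp add: additive_subgroup_def)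

lemma additive_span_mono:
  assumes "abelian_group M" "S \<subseteq> additive_span M S'" "S' \<subseteq> carrier M"
  shows "additive_span M S \<subseteq> additive_span M S'"
  by (intro additive_span_least additive_span_subgroup assms)

lemma additive_span_subgroup_eq:
  assumes "abelian_group M" "additive_subgroup J M"
  shows "additive_span M J = J"
  using additive_span_least[OF assms order_refl] by (auto intro: additive_span_incl)

lemma linear_preimage_subgroup:
  assumes "f \<in> linear_maps K M N" "module K M" "module K N" "additive_subgroup J N"
  shows "additive_subgroup {x \<in> carrier M. f x \<in> J} M"
proof -
  interpret M: module K M by fact
  interpret N: module K N by fact
  note cl = additive_subgroup_closed[OF assms(4)] additive_subgroup_neg[OF assms(4) N.abelian_group_axioms]
  show ?thesis
    by (intro additive_subgroup_make M.abelian_group_axioms)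
      (auto simp: linear_maps_zero[OF assms(1-3)] linear_maps_add[OF assms(1)]
        linear_maps_neg[OF assms(1-3)] intro: cl)
qed

lemma linear_maps_span_into:
  assumes "f \<in> linear_maps K M N" "module K M" "module K N" "additive_subgroup J N"
    and "S \<subseteq> carrier M" "\<And>x. x \<in> S \<Longrightarrow> f x \<in> J" "x \<in> additive_span M S"
  shows "f x \<in> J"
  using additive_span_least[OF module.axioms(2)[OF assms(2)] linear_preimage_subgroup[OF assms(1-4)],
      of S] assms(5-7)
  by blast

lemma hom_span_eq:
  assumes "f \<in> hom (add_monoid M) (add_monoid N)" "g \<in> hom (add_monoid M) (add_monoid N)"
    and "abelian_group M" "abelian_group N"
    and "S \<subseteq> carrier M" "\<And>x. x \<in> S \<Longrightarrow> f x = g x" "x \<in> additive_span M S"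
  shows "f x = g x"
proof -
  interpret M: abelian_group M by fact
  interpret N: abelian_group N by fact
  \<comment> \<open>The equaliser of two homomorphisms is a subgroup.\<close>
  interpret f: group_hom "add_monoid M" "add_monoid N" f
    by (intro group_hom.intro M.a_group N.a_group) (simp add: group_hom_axioms_def assms(1))
  interpret g: group_hom "add_monoid M" "add_monoid N" g
    by (intro group_hom.intro M.a_group N.a_group) (simp add: group_hom_axioms_def assms(2))
  have "additive_subgroup {x \<in> carrier M. f x = g x} M"
    using f.hom_mult g.hom_mult f.hom_one g.hom_one f.hom_inv g.hom_inv
    by (intro additive_subgroup_make M.abelian_group_axioms) (auto simp flip: a_inv_def)
  from additive_span_least[OF M.abelian_group_axioms this, of S] assms(5-7) show ?thesis by blast
qed

lemma linear_maps_span_eq: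
  assumes "f \<in> linear_maps K M N" "g \<in> linear_maps K M N" "module K M" "module K N"
    and "S \<subseteq> carrier M" "\<And>x. x \<in> S \<Longrightarrow> f x = g x" "x \<in> additive_span M S"
  shows "f x = g x"
  by (rule hom_span_eq[OF assms(1,2)[THEN linear_maps_hom] assms(3,4)[THEN module.axioms(2)] assms(5-7)])

lemma additive_span_transfer:
  assumes "zero N = zero M" "add N = add M" "\<And>x. x \<in> S \<Longrightarrow> a_inv N x = a_inv M x"
    and "x \<in> additive_span M S"
  shows "x \<in> additive_span N S"
  using assms(4) unfolding additive_span_def
proof induction
  case one
  show ?case using generate.one[where G = "add_monoid N" and H = S] assms by simp
next
  case (incl h)
  then show ?case by (rule generate.incl)
next
  case (inv h)
  then show ?case
    using generate.inv[where G = "add_monoid N" and H = S and h = h] assms by (simp add: a_inv_def)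
next
  case (eng a b)
  then show ?case
    using generate.eng[where G = "add_monoid N" and H = S and ?h1.0 = a and ?h2.0 = b] assms by simp
qed

text \<open>Records of different types may carry the same additive group. Sums, signs and spans then agree,
  although no equation between the records can be stated.\<close>

definition same_group :: "('m, 's) ring_scheme \<Rightarrow> ('m, 't) ring_scheme \<Rightarrow> bool"
  where "same_group N M \<longleftrightarrow> carrier N = carrier M \<and> zero N = zero M \<and> add N = add M"

lemma same_group_simps:
  assumes "same_group N M"
  shows "carrier N = carrier M" "zero N = zero M" "add N = add M"
    and "finsum N = finsum M" "a_inv N = a_inv M"
    and "add_pow N = (add_pow M :: int \<Rightarrow> _)" "ksign N = ksign M"
    and "additive_span N = additive_span M"
proof -
  note [simp] = assms[unfolded same_group_def]
  show inv: "a_inv N = a_inv M" by (simp add: a_inv_def m_inv_def fun_eq_iff)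
  have pow: "pow (add_monoid N) a (n::nat) = pow (add_monoid M) a n" for a n
    by (induction n) simp_all
  show "finsum N = finsum M" by (simp add: finsum_def finprod_def fun_eq_iff)
  show "add_pow N = (add_pow M :: int \<Rightarrow> _)"
    using inv by (simp add: add_pow_def int_pow_def pow fun_eq_iff a_inv_def Let_def)
  show "ksign N = ksign M" by (simp add: ksign_def inv fun_eq_iff)
  show "additive_span N = additive_span M"
    using additive_span_transfer[of N M] additive_span_transfer[of M N] inv by (auto simp: fun_eq_iff)
qed (use assms in \<open>simp_all add: same_group_def\<close>)

lemma same_group_abelian:
  assumes "same_group N M" "abelian_group M"
  shows "abelian_group N"
  using abelian_groupE[OF assms(2)] by (intro abelian_groupI) (simp_all add: same_group_simps(1-3)[OF assms(1)])

section \<open>Graded modules\<close>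

lemma is_decompositionI:
  assumes M: "abelian_group M" and "\<And>i. i \<in> I \<Longrightarrow> c i \<in> S i" "\<And>i. i \<in> I \<Longrightarrow> S i \<subseteq> carrier M"
    and "c \<in> extensional I" "finite J" "J \<subseteq> I" "\<And>i. \<lbrakk>i \<in> I; i \<notin> J\<rbrakk> \<Longrightarrow> c i = \<zero>\<^bsub>M\<^esub>"
    and x: "x = (\<Oplus>\<^bsub>M\<^esub>i\<in>J. c i)"
  shows "is_decomposition M I S x c"
proof -
  interpret abelian_group M by fact
  have sub: "{i \<in> I. c i \<noteq> \<zero>\<^bsub>M\<^esub>} \<subseteq> J" using assms by blast
  have cc: "c i \<in> carrier M" if "i \<in> J" for i using assms that by blast
  have "(\<Oplus>\<^bsub>M\<^esub>i\<in>{i \<in> I. c i \<noteq> \<zero>\<^bsub>M\<^esub>}. c i) = (\<Oplus>\<^bsub>M\<^esub>i\<in>J. c i)"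
    using sub assms by (intro add.finprod_mono_neutral_cong_left) (auto intro: cc)
  with sub assms show ?thesis
    by (auto simp: is_decomposition_def PiE_def dest: finite_subset)
qed

text \<open>A criterion for gradings. Uniqueness of decompositions: if two of them differ in degree \<open>n\<close>, their
  difference in that degree is a nonzero element of \<open>H n\<close>, and a linear map that kills every other
  \<open>H k\<close> but not this element would take two values on the same sum.\<close>

lemma internal_direct_sumI:
  fixes N :: "('k, 'n, 's) module_scheme" and Q :: "('k, 'q, 't) module_scheme"
  assumes N: "module K N" and Q: "module K Q"
    and H: "\<And>n. additive_subgroup (H n) N"
    and span: "carrier N \<subseteq> additive_span N (\<Union>n. H n)"
    and sep: "\<And>n x. \<lbrakk>x \<in> H n; x \<noteq> \<zero>\<^bsub>N\<^esub>\<rbrakk> \<Longrightarrow> \<exists>\<pi>\<in>linear_maps K N Q. \<pi> x \<noteq> \<zero>\<^bsub>Q\<^esub> \<and>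
      (\<forall>k y. k \<noteq> n \<longrightarrow> y \<in> H k \<longrightarrow> \<pi> y = \<zero>\<^bsub>Q\<^esub>)"
  shows "internal_direct_sum N (UNIV :: int set) H"
proof -
  interpret N: module K N by fact
  interpret Q: module K Q by fact
  note ag = N.abelian_group_axioms
  have Hc: "H n \<subseteq> carrier N" for n using additive_subgroup_closed(1)[OF H] .
  \<comment> \<open>The decomposable elements form a subgroup, so they exhaust the span.\<close>
  define D where "D = {x \<in> carrier N. \<exists>c. (\<forall>n. c n \<in> H n) \<and> (\<exists>J. finite J \<and>
      (\<forall>n. n \<notin> J \<longrightarrow> c n = \<zero>\<^bsub>N\<^esub>) \<and> x = (\<Oplus>\<^bsub>N\<^esub>n\<in>J. c n))}"
  have D_I: "x \<in> D" if "\<And>n. c n \<in> H n" "finite J" "\<And>n. n \<notin> J \<Longrightarrow> c n = \<zero>\<^bsub>N\<^esub>" "x = (\<Oplus>\<^bsub>N\<^esub>n\<in>J. c n)"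
    for x c J
  proof -
    have "x \<in> carrier N" unfolding that(4) using that(1) Hc by (intro N.finsum_closed) blast
    with that show ?thesis unfolding D_def by blast
  qed
  have "additive_subgroup D N"
  proof (rule additive_subgroup_make[OF ag])
    show "\<zero>\<^bsub>N\<^esub> \<in> D"
      by (rule D_I[of "\<lambda>_. \<zero>\<^bsub>N\<^esub>" "{}"]) (auto simp: additive_subgroup_closed(2)[OF H])
  next
    fix x y assume xy: "x \<in> D" "y \<in> D"
    obtain c J where c: "\<And>n. c n \<in> H n" "finite J" "\<And>n. n \<notin> J \<Longrightarrow> c n = \<zero>\<^bsub>N\<^esub>" "x = (\<Oplus>\<^bsub>N\<^esub>n\<in>J. c n)"
      using xy(1) unfolding D_def by blast
    obtain c' J' where c': "\<And>n. c' n \<in> H n" "finite J'" "\<And>n. n \<notin> J' \<Longrightarrow> c' n = \<zero>\<^bsub>N\<^esub>"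
        "y = (\<Oplus>\<^bsub>N\<^esub>n\<in>J'. c' n)"
      using xy(2) unfolding D_def by blast
    have cc: "c n \<in> carrier N" "c' n \<in> carrier N" for n using c(1) c'(1) Hc by (blast+)
    have "x = (\<Oplus>\<^bsub>N\<^esub>n\<in>J \<union> J'. c n)" "y = (\<Oplus>\<^bsub>N\<^esub>n\<in>J \<union> J'. c' n)"
      unfolding c c' using c c' cc by (auto intro!: N.add.finprod_mono_neutral_cong_left)
    then have "x \<oplus>\<^bsub>N\<^esub> y = (\<Oplus>\<^bsub>N\<^esub>n\<in>J \<union> J'. c n \<oplus>\<^bsub>N\<^esub> c' n)"
      using cc by (simp add: N.finsum_addf)
    then show "x \<oplus>\<^bsub>N\<^esub> y \<in> D"
      using c c' by (intro D_I[of "\<lambda>n. c n \<oplus>\<^bsub>N\<^esub> c' n" "J \<union> J'"] additive_subgroup_closed(3)[OF H]) auto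
  next
    fix x assume x: "x \<in> D"
    obtain c J where c: "\<And>n. c n \<in> H n" "finite J" "\<And>n. n \<notin> J \<Longrightarrow> c n = \<zero>\<^bsub>N\<^esub>" "x = (\<Oplus>\<^bsub>N\<^esub>n\<in>J. c n)"
      using x unfolding D_def by blast
    have "\<ominus>\<^bsub>N\<^esub> x = (\<Oplus>\<^bsub>N\<^esub>n\<in>J. \<ominus>\<^bsub>N\<^esub> c n)"
      unfolding c using c(1) Hc
        linear_maps_finsum[OF linear_maps_neg_map[OF N linear_maps_id[of K N]] N N, of c J] by blast
    then show "\<ominus>\<^bsub>N\<^esub> x \<in> D"
      using c by (intro D_I[of "\<lambda>n. \<ominus>\<^bsub>N\<^esub> c n" J] additive_subgroup_neg[OF H ag]) auto
  qed (auto simp: D_def)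
  moreover have "H n \<subseteq> D" for n
  proof
    fix x assume x: "x \<in> H n"
    then have "x \<in> carrier N" using Hc by blast
    with x show "x \<in> D"
      by (intro D_I[of "\<lambda>k. if k = n then x else \<zero>\<^bsub>N\<^esub>" "{n}"]) (auto simp: additive_subgroup_closed(2)[OF H])
  qed
  ultimately have "carrier N \<subseteq> D"
    using span additive_span_least[OF ag, of D "\<Union>n. H n"] by blast
  moreover have "is_decomposition N UNIV H x c \<Longrightarrow> is_decomposition N UNIV H x c' \<Longrightarrow> c = c'" for x c c'
  proof (rule ccontr)
    assume c: "is_decomposition N UNIV H x c" and c': "is_decomposition N UNIV H x c'" and "c \<noteq> c'"
    then obtain n where n: "c n \<noteq> c' n" by blast
    have cH: "c k \<in> H k" "c' k \<in> H k" for k using c c' by (auto simp: is_decomposition_def)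
    have cc: "c k \<in> carrier N" "c' k \<in> carrier N" for k using cH Hc by auto
    have mem: "c n \<ominus>\<^bsub>N\<^esub> c' n \<in> H n"
      unfolding a_minus_def using cH by (intro additive_subgroup_closed(3)[OF H] additive_subgroup_neg[OF H ag])
    have "c n \<ominus>\<^bsub>N\<^esub> c' n \<noteq> \<zero>\<^bsub>N\<^esub>" 
    proof
      assume "c n \<ominus>\<^bsub>N\<^esub> c' n = \<zero>\<^bsub>N\<^esub>"
      then have "c n = c' n" using cc N.add.inv_equality[of "c n" "\<ominus>\<^bsub>N\<^esub> c' n"] by (simp add: a_minus_def)
      with n show False ..
    qed
    from sep[OF mem this] obtain \<pi> where \<pi>: "\<pi> \<in> linear_maps K N Q" "\<pi> (c n \<ominus>\<^bsub>N\<^esub> c' n) \<noteq> \<zero>\<^bsub>Q\<^esub>"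
      "\<And>k y. k \<noteq> n \<Longrightarrow> y \<in> H k \<Longrightarrow> \<pi> y = \<zero>\<^bsub>Q\<^esub>" by blast
    have *: "\<pi> x = \<pi> (b n)" if b: "is_decomposition N UNIV H x b" for b
    proof -
      have bH: "b k \<in> H k" for k using b by (auto simp: is_decomposition_def)
      have bc: "b k \<in> carrier N" for k using bH Hc by auto
      let ?J = "{i \<in> UNIV. b i \<noteq> \<zero>\<^bsub>N\<^esub>}"
      have fin: "finite ?J" and x: "x = (\<Oplus>\<^bsub>N\<^esub>i\<in>?J. b i)" using b by (auto simp: is_decomposition_def)
      have "\<pi> x = (\<Oplus>\<^bsub>Q\<^esub>i\<in>?J. \<pi> (b i))"
        unfolding x using bc by (intro linear_maps_finsum[OF \<pi>(1) N Q]) auto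
      also have "\<dots> = (\<Oplus>\<^bsub>Q\<^esub>i\<in>{n}. \<pi> (b i))"
      proof (rule Q.add.finprod_mono_neutral_cong)
        show "\<pi> (b i) = \<zero>\<^bsub>Q\<^esub>" if "i \<in> ?J - {n}" for i using that \<pi>(3) bH by auto
        show "\<pi> (b i) = \<zero>\<^bsub>Q\<^esub>" if "i \<in> {n} - ?J" for i
          using that by (auto simp: linear_maps_zero[OF \<pi>(1) N Q])
      qed (use fin bc in \<open>auto simp: linear_maps_closed[OF \<pi>(1)]\<close>)
      also have "\<dots> = \<pi> (b n)" using bc by (simp add: linear_maps_closed[OF \<pi>(1)])
      finally show ?thesis .
    qed
    have "\<pi> (c n) = \<pi> (c' n)" using *[OF c] *[OF c'] by simp
    with \<pi>(2) cc show False
      using linear_maps_closed[OF \<pi>(1) cc(2)[of n]]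
      by (simp add: linear_maps_minus[OF \<pi>(1) N Q], simp add: a_minus_def Q.r_neg)
  qed
  moreover have "\<exists>c. is_decomposition N UNIV H x c" if xD: "x \<in> D" for x
  proof -
    obtain c J where c: "\<And>n. c n \<in> H n" "finite J" "\<And>n. n \<notin> J \<Longrightarrow> c n = \<zero>\<^bsub>N\<^esub>" "x = (\<Oplus>\<^bsub>N\<^esub>n\<in>J. c n)"
      using xD unfolding D_def by blast
    show "\<exists>c. is_decomposition N UNIV H x c"
      using c Hc by (intro exI[of _ c] is_decompositionI[OF ag, where J = J]) auto
  qed
  ultimately show ?thesis
    unfolding internal_direct_sum_def using H by blast
qed

text \<open>Gradings are studied apart from differentials, because a differential is often itself prescribed
  through \<open>graded_extend\<close>, which presupposes the grading.\<close>

locale graded_module = module K M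
  for K :: "('k, 'r) ring_scheme" and M :: "('k, 'm, 's) dg_mod_scheme" +
  assumes grading: "internal_direct_sum M UNIV (homog M)"
    and smult_homog: "\<lbrakk>k \<in> carrier K; x \<in> homog M n\<rbrakk> \<Longrightarrow> k \<odot>\<^bsub>M\<^esub> x \<in> homog M n"
begin

lemma module: "module K M" ..

lemma homog_subgroup: "additive_subgroup (homog M n) M"
  using grading by (auto simp: internal_direct_sum_def)

lemma homog_carrier: "x \<in> homog M n \<Longrightarrow> x \<in> carrier M"
  using additive_subgroup_closed(1)[OF homog_subgroup] by blast

lemma zero_homog: "\<zero>\<^bsub>M\<^esub> \<in> homog M n"
  by (rule additive_subgroup_closed(2)[OF homog_subgroup])

lemma add_homog: "\<lbrakk>x \<in> homog M n; y \<in> homog M n\<rbrakk> \<Longrightarrow> x \<oplus>\<^bsub>M\<^esub> y \<in> homog M n"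
  by (rule additive_subgroup_closed(3)[OF homog_subgroup])

lemma ksign_homog: "x \<in> homog M n \<Longrightarrow> ksign M k x \<in> homog M n"
  by (rule additive_subgroup_ksign[OF homog_subgroup M.abelian_group_axioms])

lemma component_decomposition:
  assumes "x \<in> carrier M"
  shows "is_decomposition M UNIV (homog M) x (component M x)"
  unfolding component_def
  using theI'[of "is_decomposition M UNIV (homog M) x"] grading assms
  by (simp add: internal_direct_sum_def)

lemma component_unique:
  assumes "x \<in> carrier M" "is_decomposition M UNIV (homog M) x c"
  shows "component M x = c"
  using assms component_decomposition[OF assms(1)] grading by (auto simp: internal_direct_sum_def)

lemma component_homog: "x \<in> carrier M \<Longrightarrow> component M x n \<in> homog M n"
  using component_decomposition by (auto simp: is_decomposition_def)

lemma component_closed: "x \<in> carrier M \<Longrightarrow> component M x n \<in> carrier M"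
  using component_homog homog_carrier by blast

lemma component_finite: "x \<in> carrier M \<Longrightarrow> finite {n. component M x n \<noteq> \<zero>\<^bsub>M\<^esub>}"
  using component_decomposition by (auto simp: is_decomposition_def)

lemma component_sum: "x \<in> carrier M \<Longrightarrow> x = (\<Oplus>\<^bsub>M\<^esub>n\<in>{n. component M x n \<noteq> \<zero>\<^bsub>M\<^esub>}. component M x n)"
  using component_decomposition by (auto simp: is_decomposition_def)

lemma component_sum_superset:
  assumes "x \<in> carrier M" "finite J" "{n. component M x n \<noteq> \<zero>\<^bsub>M\<^esub>} \<subseteq> J"
  shows "x = (\<Oplus>\<^bsub>M\<^esub>n\<in>J. component M x n)"
proof -
  have "(\<Oplus>\<^bsub>M\<^esub>n\<in>{n. component M x n \<noteq> \<zero>\<^bsub>M\<^esub>}. component M x n) = (\<Oplus>\<^bsub>M\<^esub>n\<in>J. component M x n)"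
    using assms by (intro M.add.finprod_mono_neutral_cong_left) (auto simp: component_closed)
  with component_sum[OF assms(1)] show ?thesis by simp
qed

lemma component_of_sum:
  assumes "\<And>n. c n \<in> homog M n" "finite J" "\<And>n. n \<notin> J \<Longrightarrow> c n = \<zero>\<^bsub>M\<^esub>"
  shows "component M (\<Oplus>\<^bsub>M\<^esub>n\<in>J. c n) = c"
proof (rule component_unique)
  show "(\<Oplus>\<^bsub>M\<^esub>n\<in>J. c n) \<in> carrier M" using assms homog_carrier by (intro M.finsum_closed) auto
  show "is_decomposition M UNIV (homog M) (\<Oplus>\<^bsub>M\<^esub>n\<in>J. c n) c"
    using assms homog_carrier by (intro is_decompositionI[OF M.abelian_group_axioms, where J = J]) auto
qed

lemma component_of_homog:
  assumes "x \<in> homog M n"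
  shows "component M x = (\<lambda>k. if k = n then x else \<zero>\<^bsub>M\<^esub>)"
  using component_of_sum[of "\<lambda>k. if k = n then x else \<zero>\<^bsub>M\<^esub>" "{n}"] assms
  by (simp add: zero_homog homog_carrier)

lemma component_linear: "(\<lambda>x. component M x n) \<in> linear_maps K M M"
proof (rule linear_mapsI)
  show "component M x n \<in> carrier M" if "x \<in> carrier M" for x using that by (rule component_closed)
next
  fix x y assume xy: "x \<in> carrier M" "y \<in> carrier M"
  let ?J = "{n. component M x n \<noteq> \<zero>\<^bsub>M\<^esub>} \<union> {n. component M y n \<noteq> \<zero>\<^bsub>M\<^esub>}"
  have fin: "finite ?J" using xy component_finite by simp
  have "component M (\<Oplus>\<^bsub>M\<^esub>n\<in>?J. component M x n \<oplus>\<^bsub>M\<^esub> component M y n)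
      = (\<lambda>n. component M x n \<oplus>\<^bsub>M\<^esub> component M y n)"
    using xy fin by (intro component_of_sum) (auto intro: add_homog component_homog)
  moreover have "(\<Oplus>\<^bsub>M\<^esub>n\<in>?J. component M x n \<oplus>\<^bsub>M\<^esub> component M y n) = x \<oplus>\<^bsub>M\<^esub> y"
    using xy component_sum_superset[of x ?J] component_sum_superset[of y ?J] fin
    by (subst M.finsum_addf) (auto simp: component_closed)
  ultimately show "component M (x \<oplus>\<^bsub>M\<^esub> y) n = component M x n \<oplus>\<^bsub>M\<^esub> component M y n" by simp
next
  fix k x assume kx: "k \<in> carrier K" "x \<in> carrier M"
  let ?J = "{n. component M x n \<noteq> \<zero>\<^bsub>M\<^esub>}"
  have "component M (\<Oplus>\<^bsub>M\<^esub>n\<in>?J. k \<odot>\<^bsub>M\<^esub> component M x n) = (\<lambda>n. k \<odot>\<^bsub>M\<^esub> component M x n)"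
    using kx component_finite by (intro component_of_sum) (auto intro: smult_homog component_homog)
  moreover have "(\<Oplus>\<^bsub>M\<^esub>n\<in>?J. k \<odot>\<^bsub>M\<^esub> component M x n) = k \<odot>\<^bsub>M\<^esub> x"
    using kx component_sum[of x] component_finite[of x]
    by (simp add: component_closed flip: finsum_smult_ldistr)
  ultimately show "component M (k \<odot>\<^bsub>M\<^esub> x) n = k \<odot>\<^bsub>M\<^esub> component M x n" by simp
qed

lemma graded_extend_superset:
  assumes "module K P" "\<And>n. h n \<in> linear_maps K M P" "x \<in> carrier M"
    and "finite J" "{n. component M x n \<noteq> \<zero>\<^bsub>M\<^esub>} \<subseteq> J"
  shows "graded_extend P M h x = (\<Oplus>\<^bsub>P\<^esub>n\<in>J. h n (component M x n))"
proof -
  interpret P: module K P by fact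
  have "h n (component M x n) \<in> carrier P" for n
    using component_closed[OF assms(3)] linear_maps_closed[OF assms(2)] by blast
  then show ?thesis unfolding graded_extend_def
    using assms by (intro P.add.finprod_mono_neutral_cong_left)
      (auto simp: linear_maps_zero[OF assms(2) module assms(1)])
qed

lemma graded_extend_linear:
  assumes P: "module K P" and h: "\<And>n. h n \<in> linear_maps K M P"
  shows "graded_extend P M h \<in> linear_maps K M P"
proof (rule linear_mapsI)
  interpret P: module K P by fact
  fix x assume x: "x \<in> carrier M"
  have hc: "h n (component M z n) \<in> carrier P" if "z \<in> carrier M" for n z
    using component_closed[OF that] linear_maps_closed[OF h] by blast
  show "graded_extend P M h x \<in> carrier P"
    unfolding graded_extend_def using hc[OF x] by (intro P.finsum_closed) auto
  show "graded_extend P M h (k \<odot>\<^bsub>M\<^esub> x) = k \<odot>\<^bsub>P\<^esub> graded_extend P M h x" if k: "k \<in> carrier K" for k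
  proof -
    let ?J = "{n. component M x n \<noteq> \<zero>\<^bsub>M\<^esub>}"
    have *: "component M (k \<odot>\<^bsub>M\<^esub> x) n = k \<odot>\<^bsub>M\<^esub> component M x n" for n
      using linear_maps_smult[OF component_linear] x k by blast
    have "graded_extend P M h (k \<odot>\<^bsub>M\<^esub> x) = (\<Oplus>\<^bsub>P\<^esub>n\<in>?J. h n (component M (k \<odot>\<^bsub>M\<^esub> x) n))"
      using x k component_finite by (intro graded_extend_superset P h) (auto simp: *)
    also have "\<dots> = (\<Oplus>\<^bsub>P\<^esub>n\<in>?J. k \<odot>\<^bsub>P\<^esub> h n (component M x n))"
      using x k h by (simp add: * component_closed linear_maps_smult[OF h])
    also have "\<dots> = k \<odot>\<^bsub>P\<^esub> (\<Oplus>\<^bsub>P\<^esub>n\<in>?J. h n (component M x n))"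
      using x k h component_finite by (simp add: P.finsum_smult_ldistr hc)
    finally show ?thesis by (simp add: graded_extend_def)
  qed
  show "graded_extend P M h (x \<oplus>\<^bsub>M\<^esub> y) = graded_extend P M h x \<oplus>\<^bsub>P\<^esub> graded_extend P M h y"
    if y: "y \<in> carrier M" for y
  proof -
    let ?J = "{n. component M x n \<noteq> \<zero>\<^bsub>M\<^esub>} \<union> {n. component M y n \<noteq> \<zero>\<^bsub>M\<^esub>}"
    have fin: "finite ?J" using x y component_finite by simp
    have *: "component M (x \<oplus>\<^bsub>M\<^esub> y) n = component M x n \<oplus>\<^bsub>M\<^esub> component M y n" for n
      using linear_maps_add[OF component_linear] x y by blast
    have "graded_extend P M h (x \<oplus>\<^bsub>M\<^esub> y) = (\<Oplus>\<^bsub>P\<^esub>n\<in>?J. h n (component M (x \<oplus>\<^bsub>M\<^esub> y) n))"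
      using x y fin by (intro graded_extend_superset P h) (auto simp: *)
    also have "\<dots> = (\<Oplus>\<^bsub>P\<^esub>n\<in>?J. h n (component M x n) \<oplus>\<^bsub>P\<^esub> h n (component M y n))"
      using x y h by (simp add: * component_closed linear_maps_add[OF h])
    also have "\<dots> = (\<Oplus>\<^bsub>P\<^esub>n\<in>?J. h n (component M x n)) \<oplus>\<^bsub>P\<^esub> (\<Oplus>\<^bsub>P\<^esub>n\<in>?J. h n (component M y n))"
      using x y by (intro P.finsum_addf) (auto simp: hc)
    also have "\<dots> = graded_extend P M h x \<oplus>\<^bsub>P\<^esub> graded_extend P M h y"
      using graded_extend_superset[OF P h x fin] graded_extend_superset[OF P h y fin] by simp
    finally show ?thesis .
  qed
qed

lemma graded_extend_homog:
  assumes P: "module K P" and h: "\<And>n. h n \<in> linear_maps K M P" and x: "x \<in> homog M n"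
  shows "graded_extend P M h x = h n x"
proof -
  interpret P: module K P by fact
  have "graded_extend P M h x = (\<Oplus>\<^bsub>P\<^esub>k\<in>{n}. h k (component M x k))"
    using x homog_carrier by (intro graded_extend_superset P h) (auto simp: component_of_homog)
  also have "\<dots> = h n (component M x n)"
    using linear_maps_closed[OF h component_closed[OF homog_carrier[OF x]]] by simp
  finally show ?thesis using x by (simp add: component_of_homog)
qed

text \<open>For a fixed argument the defining sum runs over a fixed finite set of degrees, so linear dependence
  on a parameter is inherited termwise.\<close>

lemma graded_extend_parameter:
  assumes N: "module K N" and P: "module K P" and x: "x \<in> carrier M"
    and h: "\<And>n a. a \<in> carrier M \<Longrightarrow> (\<lambda>y. h y n a) \<in> linear_maps K N P"
  shows "(\<lambda>y. graded_extend P M (h y) x) \<in> linear_maps K N P"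
  unfolding graded_extend_def using x
  by (intro linear_maps_finsum_map N P h component_closed)

lemma homog_span: "additive_span M (\<Union>n. homog M n) = carrier M"
proof
  have sub: "(\<Union>n. homog M n) \<subseteq> carrier M" using homog_carrier by blast
  note sg = additive_span_subgroup[OF M.abelian_group_axioms sub]
  show "additive_span M (\<Union>n. homog M n) \<subseteq> carrier M" by (rule additive_subgroup_closed(1)[OF sg])
  show "carrier M \<subseteq> additive_span M (\<Union>n. homog M n)"
  proof
    fix x assume x: "x \<in> carrier M"
    then show "x \<in> additive_span M (\<Union>n. homog M n)"
      by (subst component_sum[OF x], intro additive_subgroup_finsum[OF sg M.abelian_group_axioms])
        (auto intro: additive_span_incl component_homog)
  qed
qed

lemma linear_maps_homog_eq:
  assumes "f \<in> linear_maps K M N" "g \<in> linear_maps K M N" "module K N"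
    and "\<And>n x. x \<in> homog M n \<Longrightarrow> f x = g x" "x \<in> carrier M"
  shows "f x = g x"
  by (rule linear_maps_span_eq[OF assms(1,2) module assms(3), of "\<Union>n. homog M n"])
    (use assms homog_carrier in \<open>auto simp: homog_span\<close>)

lemma linear_maps_homog_into:
  assumes "f \<in> linear_maps K M N" "module K N" "additive_subgroup J N"
    and "\<And>n x. x \<in> homog M n \<Longrightarrow> f x \<in> J" "x \<in> carrier M"
  shows "f x \<in> J"
  by (rule linear_maps_span_into[OF assms(1) module assms(2,3), of "\<Union>n. homog M n"])
    (use assms homog_carrier in \<open>auto simp: homog_span\<close>)

end

text \<open>This treats all operations whose sign depends on the degrees of two arguments: composition in opposite
  and tensor product categories, and the action of the functor on morphisms.\<close>

lemma graded_extend_bilinear: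
  assumes "graded_module K M" "graded_module K N" "module K P"
    and b: "\<And>p q. bilinear_map K M N P (h p q)"
  shows "bilinear_map K M N P
      (\<lambda>x y. graded_extend P M (\<lambda>p a. graded_extend P N (\<lambda>q b. h p q a b) y) x)"
    and "\<lbrakk>x \<in> homog M p; y \<in> homog N q\<rbrakk> \<Longrightarrow>
      graded_extend P M (\<lambda>p a. graded_extend P N (\<lambda>q b. h p q a b) y) x = h p q x y"
proof -
  interpret M: graded_module K M by fact
  interpret N: graded_module K N by fact
  have inner: "(\<lambda>a. graded_extend P N (\<lambda>q b. h p q a b) y) \<in> linear_maps K M P"
    if "y \<in> carrier N" for p y
    using that b
    by (intro N.graded_extend_parameter M.module assms(3)) (auto intro: bilinear_map_left)
  have inner': "(\<lambda>y. graded_extend P N (\<lambda>q b. h p q a b) y) \<in> linear_maps K N P"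
    if "a \<in> carrier M" for p a
    using that b by (intro N.graded_extend_linear assms(3)) (auto intro: bilinear_map_right)
  show "bilinear_map K M N P
      (\<lambda>x y. graded_extend P M (\<lambda>p a. graded_extend P N (\<lambda>q b. h p q a b) y) x)"
    by (intro bilinear_mapI M.graded_extend_linear M.graded_extend_parameter N.module assms(3) inner inner')
  show "graded_extend P M (\<lambda>p a. graded_extend P N (\<lambda>q b. h p q a b) y) x = h p q x y"
    if xy: "x \<in> homog M p" "y \<in> homog N q"
  proof -
    have "graded_extend P M (\<lambda>p a. graded_extend P N (\<lambda>q b. h p q a b) y) x
        = graded_extend P N (\<lambda>q b. h p q x b) y"
      using xy by (simp add: M.graded_extend_homog[OF assms(3) inner] N.homog_carrier)
    also have "\<dots> = h p q x y"
      using xy by (intro N.graded_extend_homog assms(3) bilinear_map_right[OF b] M.homog_carrier)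
    finally show ?thesis .
  qed
qed

lemma dg_module_graded: "dg_module K M \<Longrightarrow> graded_module K M"
  unfolding dg_module_def dg_module_axioms_def graded_module_def graded_module_axioms_def by blast

sublocale dg_module \<subseteq> graded: graded_module K M
  by (rule dg_module_graded) (rule dg_module_axioms)

section \<open>The tensor product of dg modules\<close>

text \<open>A map on the tensor product is determined by its values on pure tensors, and any balanced
  biadditive map extends: evaluation of formal sums kills the relators, hence is constant on cosets.\<close>

locale module_pair = M: module K M + N: module K N
  for K :: "('k, 'r) ring_scheme" and M :: "('k, 'm, 's) dg_mod_scheme"
    and N :: "('k, 'n, 't) dg_mod_scheme"
begin

abbreviation "F \<equiv> tensor_free M N"
abbreviation "R \<equiv> tensor_kernel K M N"
abbreviation "T \<equiv> tensor_group K M N"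
abbreviation "D \<equiv> dg_tensor K M N"
abbreviation "pure \<equiv> pure_tensor K M N"
abbreviation "pures \<equiv> {pure x y | x y. x \<in> carrier M \<and> y \<in> carrier N}"

lemma free_comm_group: "comm_group F"
  unfolding tensor_free_def by (rule abelian_free_Abelian_group)

lemma relators_free: "tensor_relators K M N \<subseteq> carrier F"
    unfolding tensor_relators_def tensor_free_def
    by (auto simp: keys_frag_of dest!: subsetD[OF keys_diff])

lemma kernel_normal: "R \<lhd> F"
proof -
  have "subgroup R F"
    unfolding tensor_kernel_def
    by (intro group.generate_is_subgroup comm_group.axioms(2) free_comm_group relators_free)
  then show ?thesis by (simp add: comm_group.normal_iff_subgroup[OF free_comm_group])
qed

lemma T_simps:
  "carrier T = carrier (F Mod R)" "zero T = one (F Mod R)" "add T = mult (F Mod R)"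
  by (simp_all add: tensor_group_def Let_def)

lemma D_same_T: "same_group D T"
  by (simp add: same_group_def dg_tensor_def Let_def)

lemma T_abelian: "abelian_group T"
proof (rule comm_group_abelian_groupI)
  have "add_monoid T = F Mod R" by (simp add: T_simps)
  then show "comm_group (add_monoid T)"
    using comm_group.abelian_FactGroup[OF free_comm_group] kernel_normal
    by (simp add: comm_group.normal_iff_subgroup[OF free_comm_group])
qed

lemma D_abelian: "abelian_group D"
  by (rule same_group_abelian[OF D_same_T T_abelian])

lemma coset_add:
  "\<lbrakk>z \<in> carrier F; z' \<in> carrier F\<rbrakk> \<Longrightarrow>
    (R #>\<^bsub>F\<^esub> z) \<oplus>\<^bsub>T\<^esub> (R #>\<^bsub>F\<^esub> z') = R #>\<^bsub>F\<^esub> (z + z')"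
  using normal.rcos_sum[OF kernel_normal, of z z'] by (simp add: T_simps FactGroup_def tensor_free_def)

lemma coset_closed: "z \<in> carrier F \<Longrightarrow> R #>\<^bsub>F\<^esub> z \<in> carrier T"
  by (auto simp: T_simps FactGroup_def RCOSETS_def)

lemma pure_closed [intro]: "\<lbrakk>x \<in> carrier M; y \<in> carrier N\<rbrakk> \<Longrightarrow> pure x y \<in> carrier T"
  unfolding pure_tensor_def by (rule coset_closed) (simp add: tensor_free_def)

text \<open>By induction over the formal integral combinations that represent the cosets.\<close>

lemma carrier_span: "carrier T = additive_span T pures"
proof
  interpret T: abelian_group T by (rule T_abelian)
  have sub: "pures \<subseteq> carrier T" by auto
  note sg = additive_span_subgroup[OF T_abelian sub]
  show "additive_span T pures \<subseteq> carrier T" by (rule additive_subgroup_closed(1)[OF sg])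
  show "carrier T \<subseteq> additive_span T pures"
  proof
    fix t assume "t \<in> carrier T"
    then obtain z where z: "z \<in> carrier F" "t = R #>\<^bsub>F\<^esub> z"
      by (auto simp: T_simps FactGroup_def RCOSETS_def)
    have "Poly_Mapping.keys z \<subseteq> carrier M \<times> carrier N" using z(1) by (simp add: tensor_free_def)
    then have "R #>\<^bsub>F\<^esub> z \<in> additive_span T pures"
    proof (rule free_Abelian_group_induct)
      have "R #>\<^bsub>F\<^esub> 0 = \<zero>\<^bsub>T\<^esub>"
        using group.coset_mult_one[OF comm_group.axioms(2)[OF free_comm_group], of R]
          subgroup.subset[OF normal_imp_subgroup[OF kernel_normal]]
        by (simp add: T_simps tensor_free_def)
      then show "R #>\<^bsub>F\<^esub> 0 \<in> additive_span T pures" using additive_subgroup_closed(2)[OF sg] by simp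
    next
      fix z z' assume 2: "Poly_Mapping.keys z \<subseteq> carrier M \<times> carrier N" "Poly_Mapping.keys z' \<subseteq> carrier M \<times> carrier N"
        "R #>\<^bsub>F\<^esub> z \<in> additive_span T pures" "R #>\<^bsub>F\<^esub> z' \<in> additive_span T pures"
      then have zz: "z - z' \<in> carrier F" "z \<in> carrier F" "z' \<in> carrier F"
        using keys_diff[of z z'] by (auto simp: tensor_free_def)
      have "(R #>\<^bsub>F\<^esub> (z - z')) \<oplus>\<^bsub>T\<^esub> (R #>\<^bsub>F\<^esub> z') = R #>\<^bsub>F\<^esub> z"
        using coset_add[OF zz(1,3)] by simp
      then have "R #>\<^bsub>F\<^esub> (z - z') = (R #>\<^bsub>F\<^esub> z) \<oplus>\<^bsub>T\<^esub> \<ominus>\<^bsub>T\<^esub> (R #>\<^bsub>F\<^esub> z')"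
        using zz coset_closed by (metis T.add.inv_solve_right')
      with 2 show "R #>\<^bsub>F\<^esub> (z - z') \<in> additive_span T pures"
        using additive_subgroup_closed(3)[OF sg] additive_subgroup_neg[OF sg T_abelian] by simp
    next
      fix a assume "a \<in> carrier M \<times> carrier N"
      then show "R #>\<^bsub>F\<^esub> frag_of a \<in> additive_span T pures" by (intro additive_span_incl) (auto simp: pure_tensor_def)
    qed
    with z show "t \<in> additive_span T pures" by simp
  qed
qed

lemma coset_eqI:
  assumes "w \<in> tensor_relators K M N" "z \<in> carrier F" "w + z = z'"
  shows "R #>\<^bsub>F\<^esub> z' = R #>\<^bsub>F\<^esub> z"
proof -
  interpret normal R F by (rule kernel_normal)
  have "w \<in> R" unfolding tensor_kernel_def using assms(1) by (rule generate.incl)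
  then have "z' \<in> R #>\<^bsub>F\<^esub> z"
    using assms(3) by (auto simp: r_coset_def tensor_free_def intro!: bexI[of _ w])
  with assms(2) show ?thesis using repr_independence[OF _ _ is_subgroup] by simp
qed

lemma frag_closed: "\<lbrakk>x \<in> carrier M; y \<in> carrier N\<rbrakk> \<Longrightarrow> frag_of (x, y) \<in> carrier F"
  by (simp add: tensor_free_def)

lemma frag_add_closed: "\<lbrakk>z \<in> carrier F; z' \<in> carrier F\<rbrakk> \<Longrightarrow> z + z' \<in> carrier F"
  using keys_add[of z z'] by (auto simp: tensor_free_def)

lemma pure_add_left:
  assumes "x \<in> carrier M" "x' \<in> carrier M" "y \<in> carrier N"
  shows "pure (x \<oplus>\<^bsub>M\<^esub> x') y = pure x y \<oplus>\<^bsub>T\<^esub> pure x' y"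
proof -
  have "R #>\<^bsub>F\<^esub> frag_of (x \<oplus>\<^bsub>M\<^esub> x', y) = R #>\<^bsub>F\<^esub> (frag_of (x, y) + frag_of (x', y))"
    by (rule coset_eqI[of "frag_of (x \<oplus>\<^bsub>M\<^esub> x', y) - frag_of (x, y) - frag_of (x', y)"])
      (use assms in \<open>auto simp: tensor_relators_def intro!: frag_closed frag_add_closed\<close>)
  then show ?thesis unfolding pure_tensor_def using assms by (simp add: coset_add frag_closed)
qed

lemma pure_add_right:
  assumes "x \<in> carrier M" "y \<in> carrier N" "y' \<in> carrier N"
  shows "pure x (y \<oplus>\<^bsub>N\<^esub> y') = pure x y \<oplus>\<^bsub>T\<^esub> pure x y'"
proof -
  have "R #>\<^bsub>F\<^esub> frag_of (x, y \<oplus>\<^bsub>N\<^esub> y') = R #>\<^bsub>F\<^esub> (frag_of (x, y) + frag_of (x, y'))"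
    by (rule coset_eqI[of "frag_of (x, y \<oplus>\<^bsub>N\<^esub> y') - frag_of (x, y) - frag_of (x, y')"])
      (use assms in \<open>auto simp: tensor_relators_def intro!: frag_closed frag_add_closed\<close>)
  then show ?thesis unfolding pure_tensor_def using assms by (simp add: coset_add frag_closed)
qed

lemma pure_balanced:
  assumes "k \<in> carrier K" "x \<in> carrier M" "y \<in> carrier N"
  shows "pure (k \<odot>\<^bsub>M\<^esub> x) y = pure x (k \<odot>\<^bsub>N\<^esub> y)"
  unfolding pure_tensor_def
  by (rule coset_eqI[of "frag_of (k \<odot>\<^bsub>M\<^esub> x, y) - frag_of (x, k \<odot>\<^bsub>N\<^esub> y)"])
    (use assms in \<open>auto simp: tensor_relators_def intro!: frag_closed\<close>)

text \<open>Evaluation \<open>ev\<close> of formal combinations is a homomorphism that kills the relators. It is therefore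
  constant on cosets, so that the value does not depend on the representative chosen in
  \<open>tensor_lift\<close>.\<close>

lemma tensor_lift_hom:
  fixes P :: "('p, 'u) ring_scheme"
  assumes P: "abelian_group P"
    and closed: "\<And>x y. \<lbrakk>x \<in> carrier M; y \<in> carrier N\<rbrakk> \<Longrightarrow> b x y \<in> carrier P"
    and left: "\<And>x x' y. \<lbrakk>x \<in> carrier M; x' \<in> carrier M; y \<in> carrier N\<rbrakk> \<Longrightarrow>
      b (x \<oplus>\<^bsub>M\<^esub> x') y = b x y \<oplus>\<^bsub>P\<^esub> b x' y"
    and right: "\<And>x y y'. \<lbrakk>x \<in> carrier M; y \<in> carrier N; y' \<in> carrier N\<rbrakk> \<Longrightarrow>
      b x (y \<oplus>\<^bsub>N\<^esub> y') = b x y \<oplus>\<^bsub>P\<^esub> b x y'"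
    and balanced: "\<And>k x y. \<lbrakk>k \<in> carrier K; x \<in> carrier M; y \<in> carrier N\<rbrakk> \<Longrightarrow>
      b (k \<odot>\<^bsub>M\<^esub> x) y = b x (k \<odot>\<^bsub>N\<^esub> y)"
  shows "tensor_lift P b \<in> hom (add_monoid T) (add_monoid P)"
    and "\<lbrakk>x \<in> carrier M; y \<in> carrier N\<rbrakk> \<Longrightarrow> tensor_lift P b (pure x y) = b x y"
proof -
  interpret P: abelian_group P by fact
  interpret normal R F by (rule kernel_normal)
  interpret T: abelian_group T by (rule T_abelian)
  define ev where "ev z = (\<Oplus>\<^bsub>P\<^esub>w\<in>Poly_Mapping.keys z.
      [Poly_Mapping.lookup z w] \<cdot>\<^bsub>P\<^esub> b (fst w) (snd w))" for z :: "'m \<times> 'n \<Rightarrow>\<^sub>0 int"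
  have pow0 [simp]: "[(0::int)] \<cdot>\<^bsub>P\<^esub> x = \<zero>\<^bsub>P\<^esub>" for x
    by (simp add: add_pow_def int_pow_def nat_pow_def)
  have ev_superset: "ev z = (\<Oplus>\<^bsub>P\<^esub>w\<in>J. [Poly_Mapping.lookup z w] \<cdot>\<^bsub>P\<^esub> b (fst w) (snd w))"
    if "finite J" "Poly_Mapping.keys z \<subseteq> J" "J \<subseteq> carrier M \<times> carrier N" for z J
    unfolding ev_def using that closed
    by (intro P.add.finprod_mono_neutral_cong_left) (auto simp: in_keys_iff)
  have ev_closed: "ev z \<in> carrier P" if "z \<in> carrier F" for z
    unfolding ev_def using that closed by (intro P.finsum_closed) (auto simp: tensor_free_def)
  have ev_add: "ev (z + z') = ev z \<oplus>\<^bsub>P\<^esub> ev z'" if z: "z \<in> carrier F" "z' \<in> carrier F" for z z'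
  proof -
    let ?J = "Poly_Mapping.keys z \<union> Poly_Mapping.keys z'"
    have J: "finite ?J" "?J \<subseteq> carrier M \<times> carrier N" "Poly_Mapping.keys (z + z') \<subseteq> ?J"
      using z keys_add[of z z'] by (auto simp: tensor_free_def)
    have bc: "b (fst w) (snd w) \<in> carrier P" if "w \<in> ?J" for w using that J(2) closed by auto
    have "ev (z + z') = (\<Oplus>\<^bsub>P\<^esub>w\<in>?J. [Poly_Mapping.lookup z w] \<cdot>\<^bsub>P\<^esub> b (fst w) (snd w)
        \<oplus>\<^bsub>P\<^esub> [Poly_Mapping.lookup z' w] \<cdot>\<^bsub>P\<^esub> b (fst w) (snd w))"
      unfolding ev_superset[OF J(1,3,2)] using bc
      by (intro P.finsum_cong') (auto simp: Poly_Mapping.lookup_add P.add.int_pow_mult)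
    also have "\<dots> = ev z \<oplus>\<^bsub>P\<^esub> ev z'"
      using bc J(2) ev_superset[OF J(1) _ J(2), of z] ev_superset[OF J(1) _ J(2), of z']
      by (subst P.finsum_addf) auto
    finally show ?thesis .
  qed
  have ev_frag: "ev (frag_of (x, y)) = b x y" if "x \<in> carrier M" "y \<in> carrier N" for x y
    using that closed unfolding ev_def keys_frag_of by simp
  have ev_diff: "ev (z - z') = ev z \<ominus>\<^bsub>P\<^esub> ev z'" and diff_closed: "z - z' \<in> carrier F"
    if z: "z \<in> carrier F" "z' \<in> carrier F" for z z'
  proof -
    show c: "z - z' \<in> carrier F" using z keys_diff[of z z'] by (auto simp: tensor_free_def)
    have "ev z = ev (z - z') \<oplus>\<^bsub>P\<^esub> ev z'" using ev_add[OF c z(2)] by simp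
    then show "ev (z - z') = ev z \<ominus>\<^bsub>P\<^esub> ev z'"
      using z c by (simp add: a_minus_def ev_closed P.a_assoc P.r_neg)
  qed
  have ev_hom: "ev \<in> hom F (add_monoid P)"
    by (rule homI) (auto simp: ev_closed ev_add tensor_free_def)
  interpret ev: group_hom F "add_monoid P" ev
    by (intro group_hom.intro P.a_group is_group) (simp add: group_hom_axioms_def ev_hom)
  have "tensor_relators K M N \<subseteq> kernel F (add_monoid P) ev"
  proof
    fix w assume w: "w \<in> tensor_relators K M N"
    then have "ev w = \<zero>\<^bsub>P\<^esub>"
      unfolding tensor_relators_def
    proof (elim UnE CollectE exE conjE)
      fix x x' y assume *: "w = frag_of (x \<oplus>\<^bsub>M\<^esub> x', y) - frag_of (x, y) - frag_of (x', y)"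
        "x \<in> carrier M" "x' \<in> carrier M" "y \<in> carrier N"
      then show ?thesis
        by (simp add: ev_diff diff_closed frag_closed ev_frag left)
          (simp add: closed P.minus_eq P.minus_add P.a_ac P.r_neg P.r_neg1 P.r_neg2)
    next
      fix x y y' assume *: "w = frag_of (x, y \<oplus>\<^bsub>N\<^esub> y') - frag_of (x, y) - frag_of (x, y')"
        "x \<in> carrier M" "y \<in> carrier N" "y' \<in> carrier N"
      then show ?thesis
        by (simp add: ev_diff diff_closed frag_closed ev_frag right)
          (simp add: closed P.minus_eq P.minus_add P.a_ac P.r_neg P.r_neg1 P.r_neg2)
    next
      fix k x y assume *: "w = frag_of (k \<odot>\<^bsub>M\<^esub> x, y) - frag_of (x, k \<odot>\<^bsub>N\<^esub> y)"
        "k \<in> carrier K" "x \<in> carrier M" "y \<in> carrier N"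
      then show ?thesis
        by (simp add: ev_diff frag_closed ev_frag balanced) (simp add: closed P.minus_eq P.r_neg)
    qed
    with w relators_free show "w \<in> kernel F (add_monoid P) ev" by (auto simp: kernel_def)
  qed
  then have R: "R \<subseteq> kernel F (add_monoid P) ev"
    unfolding tensor_kernel_def by (intro generate_subgroup_incl ev.subgroup_kernel)
  have lift: "tensor_lift P b (R #>\<^bsub>F\<^esub> z) = ev z" if z: "z \<in> carrier F" for z
  proof -
    have "z \<in> R #>\<^bsub>F\<^esub> z" using z by (rule rcos_self[OF _ is_subgroup])
    then have "(SOME z'. z' \<in> R #>\<^bsub>F\<^esub> z) \<in> R #>\<^bsub>F\<^esub> z" by (rule someI)
    then obtain k where k: "k \<in> R" "(SOME z'. z' \<in> R #>\<^bsub>F\<^esub> z) = k + z"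
      by (auto simp: r_coset_def tensor_free_def)
    have "k \<in> carrier F" "ev k = \<zero>\<^bsub>P\<^esub>" using k(1) R by (auto simp: kernel_def)
    then have "ev (k + z) = ev z" using z by (simp add: ev_add ev_closed)
    then show ?thesis unfolding tensor_lift_def Let_def ev_def[symmetric] k(2) by simp
  qed
  show "tensor_lift P b (pure x y) = b x y" if "x \<in> carrier M" "y \<in> carrier N"
    unfolding pure_tensor_def using that by (simp add: lift frag_closed ev_frag)
  show "tensor_lift P b \<in> hom (add_monoid T) (add_monoid P)"
  proof (rule homI, simp_all)
    have rep: "\<exists>z\<in>carrier F. t = R #>\<^bsub>F\<^esub> z" if "t \<in> carrier T" for t
      using that by (auto simp: T_simps FactGroup_def RCOSETS_def)
    show "tensor_lift P b t \<in> carrier P" if "t \<in> carrier T" for t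
      using rep[OF that] lift ev_closed by auto
    show "tensor_lift P b (t \<oplus>\<^bsub>T\<^esub> t') = tensor_lift P b t \<oplus>\<^bsub>P\<^esub> tensor_lift P b t'"
      if "t \<in> carrier T" "t' \<in> carrier T" for t t'
      using rep[OF that(1)] rep[OF that(2)] lift by (auto simp: coset_add ev_add frag_add_closed)
  qed
qed

end

lemma linear_maps_add_pow:
  assumes "f \<in> linear_maps K M N" "module K M" "module K N" "x \<in> carrier M"
  shows "f ([(n::int)] \<cdot>\<^bsub>M\<^esub> x) = [n] \<cdot>\<^bsub>N\<^esub> f x"
proof -
  interpret M: module K M by fact
  interpret N: module K N by fact
  interpret f: group_hom "add_monoid M" "add_monoid N" f
    by (intro group_hom.intro M.a_group N.a_group)
      (simp add: group_hom_axioms_def linear_maps_hom[OF assms(1)])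
  show ?thesis using f.hom_int_pow[of x n] assms(4) by (simp add: add_pow_def)
qed

lemma linear_maps_add_pow_map:
  assumes "module K N" "f \<in> linear_maps K M N"
  shows "(\<lambda>x. [(n::int)] \<cdot>\<^bsub>N\<^esub> f x) \<in> linear_maps K M N"
proof -
  interpret N: module K N by fact
  show ?thesis
  proof (rule linear_mapsI)
    fix k x assume kx: "k \<in> carrier K" "x \<in> carrier M"
    have "(\<lambda>y. k \<odot>\<^bsub>N\<^esub> y) \<in> linear_maps K N N"
      by (rule linear_maps_smult_map[OF assms(1) linear_maps_id kx(1)])
    from linear_maps_add_pow[OF this assms(1,1), of "f x" n]
    show "[n] \<cdot>\<^bsub>N\<^esub> f (k \<odot>\<^bsub>M\<^esub> x) = k \<odot>\<^bsub>N\<^esub> ([n] \<cdot>\<^bsub>N\<^esub> f x)"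
      using kx assms(2) by (simp add: linear_maps_smult linear_maps_closed)
  qed (use assms(2) in \<open>simp_all add: linear_maps_closed linear_maps_add N.add.int_pow_distrib\<close>)
qed

lemma tensor_lift_cong: "same_group P P' \<Longrightarrow> tensor_lift P = tensor_lift P'"
  by (simp add: tensor_lift_def fun_eq_iff same_group_simps)

lemma graded_extend_cong: "same_group P P' \<Longrightarrow> graded_extend P = graded_extend P'"
  by (simp add: graded_extend_def fun_eq_iff same_group_simps)

context module_pair
begin

lemmas D_simps = same_group_simps[OF D_same_T]

text \<open>The scalar action is defined by a lift, so its properties hold on pure tensors first; at this stage
  the tensor product is only an abelian group.\<close>

lemma smult_hom:
  assumes "k \<in> carrier K"
  shows "(\<lambda>t. k \<odot>\<^bsub>D\<^esub> t) \<in> hom (add_monoid T) (add_monoid T)"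
    and "\<lbrakk>x \<in> carrier M; y \<in> carrier N\<rbrakk> \<Longrightarrow> k \<odot>\<^bsub>D\<^esub> pure x y = pure (k \<odot>\<^bsub>M\<^esub> x) y"
proof -
  have *: "(\<lambda>t. k \<odot>\<^bsub>D\<^esub> t) = tensor_lift T (\<lambda>x y. pure (k \<odot>\<^bsub>M\<^esub> x) y)"
    by (simp add: dg_tensor_def Let_def)
  \<comment> \<open>Commutativity of K makes scaling of the left factor balanced.\<close>
  have bal: "pure (k \<odot>\<^bsub>M\<^esub> (l \<odot>\<^bsub>M\<^esub> x)) y = pure (k \<odot>\<^bsub>M\<^esub> x) (l \<odot>\<^bsub>N\<^esub> y)"
    if "l \<in> carrier K" "x \<in> carrier M" "y \<in> carrier N" for l x y
  proof -
    have "k \<odot>\<^bsub>M\<^esub> (l \<odot>\<^bsub>M\<^esub> x) = l \<odot>\<^bsub>M\<^esub> (k \<odot>\<^bsub>M\<^esub> x)"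
      using assms that by (simp flip: M.smult_assoc1 add: M.m_comm)
    then show ?thesis using assms that by (simp add: pure_balanced)
  qed
  show "(\<lambda>t. k \<odot>\<^bsub>D\<^esub> t) \<in> hom (add_monoid T) (add_monoid T)"
    unfolding * using assms
    by (intro tensor_lift_hom T_abelian) (auto simp: pure_add_left pure_add_right bal M.smult_r_distr)
  show "k \<odot>\<^bsub>D\<^esub> pure x y = pure (k \<odot>\<^bsub>M\<^esub> x) y" if "x \<in> carrier M" "y \<in> carrier N"
    unfolding * using assms that
    by (intro tensor_lift_hom T_abelian) (auto simp: pure_add_left pure_add_right bal M.smult_r_distr)
qed

lemma D_module: "module K D"
proof (rule moduleI)
  interpret T: abelian_group T by (rule T_abelian)
  show "cring K" by (rule M.is_cring)
  show "abelian_group D" by (rule D_abelian)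
  have closed: "k \<odot>\<^bsub>D\<^esub> t \<in> carrier T" if "k \<in> carrier K" "t \<in> carrier T" for k t
    using hom_carrier[OF smult_hom(1)[OF that(1)]] that(2) by auto
  then show "k \<odot>\<^bsub>D\<^esub> t \<in> carrier D" if "k \<in> carrier K" "t \<in> carrier D" for k t
    using that by (simp add: D_simps)
  have add: "k \<odot>\<^bsub>D\<^esub> (s \<oplus>\<^bsub>T\<^esub> t) = k \<odot>\<^bsub>D\<^esub> s \<oplus>\<^bsub>T\<^esub> k \<odot>\<^bsub>D\<^esub> t"
    if "k \<in> carrier K" "s \<in> carrier T" "t \<in> carrier T" for k s t
    using hom_mult[OF smult_hom(1)[OF that(1)], of s t] that by simp
  then show "k \<odot>\<^bsub>D\<^esub> (s \<oplus>\<^bsub>D\<^esub> t) = k \<odot>\<^bsub>D\<^esub> s \<oplus>\<^bsub>D\<^esub> k \<odot>\<^bsub>D\<^esub> t"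
    if "k \<in> carrier K" "s \<in> carrier D" "t \<in> carrier D" for k s t
    using that by (simp add: D_simps)
  have sub: "pures \<subseteq> carrier T" by auto
  have eq: "f t = g t" if "f \<in> hom (add_monoid T) (add_monoid T)" "g \<in> hom (add_monoid T) (add_monoid T)"
    "\<And>x y. x \<in> carrier M \<Longrightarrow> y \<in> carrier N \<Longrightarrow> f (pure x y) = g (pure x y)" "t \<in> carrier D" for f g t
    by (rule hom_span_eq[OF that(1,2) T_abelian T_abelian sub])
      (use that carrier_span in \<open>auto simp: D_simps\<close>)
  show "(k \<oplus>\<^bsub>K\<^esub> l) \<odot>\<^bsub>D\<^esub> t = k \<odot>\<^bsub>D\<^esub> t \<oplus>\<^bsub>D\<^esub> l \<odot>\<^bsub>D\<^esub> t"
    if "k \<in> carrier K" "l \<in> carrier K" "t \<in> carrier D" for k l t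
  proof (rule eq[OF _ _ _ that(3)])
    show "(\<lambda>t. (k \<oplus>\<^bsub>K\<^esub> l) \<odot>\<^bsub>D\<^esub> t) \<in> hom (add_monoid T) (add_monoid T)"
      using that by (intro smult_hom) simp
    show "(\<lambda>t. k \<odot>\<^bsub>D\<^esub> t \<oplus>\<^bsub>D\<^esub> l \<odot>\<^bsub>D\<^esub> t) \<in> hom (add_monoid T) (add_monoid T)"
      using that by (intro homI) (auto simp: D_simps closed add T.a_ac)
  qed (use that in \<open>auto simp: smult_hom(2) M.smult_l_distr pure_add_left D_simps\<close>)
  show "(k \<otimes>\<^bsub>K\<^esub> l) \<odot>\<^bsub>D\<^esub> t = k \<odot>\<^bsub>D\<^esub> (l \<odot>\<^bsub>D\<^esub> t)"
    if "k \<in> carrier K" "l \<in> carrier K" "t \<in> carrier D" for k l t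
  proof (rule eq[OF _ _ _ that(3)])
    show "(\<lambda>t. (k \<otimes>\<^bsub>K\<^esub> l) \<odot>\<^bsub>D\<^esub> t) \<in> hom (add_monoid T) (add_monoid T)"
      using that by (intro smult_hom) simp
    show "(\<lambda>t. k \<odot>\<^bsub>D\<^esub> (l \<odot>\<^bsub>D\<^esub> t)) \<in> hom (add_monoid T) (add_monoid T)"
      using that by (intro homI) (auto simp: closed add)
  qed (use that in \<open>auto simp: smult_hom(2) M.smult_assoc1\<close>)
  show "\<one>\<^bsub>K\<^esub> \<odot>\<^bsub>D\<^esub> t = t" if "t \<in> carrier D" for t
  proof (rule eq[OF _ _ _ that])
    show "(\<lambda>t. \<one>\<^bsub>K\<^esub> \<odot>\<^bsub>D\<^esub> t) \<in> hom (add_monoid T) (add_monoid T)" by (intro smult_hom) simp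
    show "(\<lambda>t. t) \<in> hom (add_monoid T) (add_monoid T)" by (rule homI) auto
  qed (auto simp: smult_hom(2))
qed

lemma pure_bilinear: "bilinear_map K M N D pure"
proof (rule bilinear_mapI)
  show "(\<lambda>x. pure x y) \<in> linear_maps K M D" if "y \<in> carrier N" for y
    using that by (intro linear_mapsI) (auto simp: D_simps pure_add_left smult_hom(2))
  show "(\<lambda>y. pure x y) \<in> linear_maps K N D" if "x \<in> carrier M" for x
    using that
    by (intro linear_mapsI) (auto simp: D_simps pure_add_right smult_hom(2) pure_balanced)
qed

lemma pure_linear_left: "y \<in> carrier N \<Longrightarrow> (\<lambda>x. pure x y) \<in> linear_maps K M D"
  by (rule bilinear_map_left[OF pure_bilinear])

lemma pure_linear_right: "x \<in> carrier M \<Longrightarrow> (\<lambda>y. pure x y) \<in> linear_maps K N D"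
  using bilinear_map_right[OF pure_bilinear] by simp

lemma pure_carrier [intro, simp]: "\<lbrakk>x \<in> carrier M; y \<in> carrier N\<rbrakk> \<Longrightarrow> pure x y \<in> carrier D"
  by (auto simp: D_simps)

lemma D_span: "additive_span D pures = carrier D"
  using carrier_span by (simp add: D_simps)

lemma tensor_lift_linear:
  assumes P: "module K P" and b: "bilinear_map K M N P b"
  shows "tensor_lift P b \<in> linear_maps K D P"
    and "\<lbrakk>x \<in> carrier M; y \<in> carrier N\<rbrakk> \<Longrightarrow> tensor_lift P b (pure x y) = b x y"
proof -
  interpret P: module K P by fact
  interpret T: abelian_group T by (rule T_abelian)
  interpret D: module K D by (rule D_module)
  note bl = bilinear_map_left[OF b] and br = bilinear_map_right[OF b] and bc = bilinear_map_closed[OF b]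
  note facts = linear_maps_add[OF bl] linear_maps_add[OF br] bc
      linear_maps_smult[OF bl] linear_maps_smult[OF br]
  have 1: "tensor_lift P b \<in> hom (add_monoid T) (add_monoid P)"
    by (rule tensor_lift_hom[OF P.abelian_group_axioms]) (simp_all add: facts)
  have 2: "tensor_lift P b (pure x y) = b x y" if "x \<in> carrier M" "y \<in> carrier N" for x y
    by (rule tensor_lift_hom[OF P.abelian_group_axioms]) (simp_all add: facts that)
  note * = 1 2
  show "tensor_lift P b (pure x y) = b x y" if "x \<in> carrier M" "y \<in> carrier N"
    using * that by blast
  show "tensor_lift P b \<in> linear_maps K D P"
  proof (rule linear_mapsI)
    show "tensor_lift P b t \<in> carrier P" if "t \<in> carrier D" for t
      using hom_carrier[OF *(1)] that by (auto simp: D_simps)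
    then have cl: "tensor_lift P b t \<in> carrier P" if "t \<in> carrier T" for t
      using that by (simp add: D_simps)
    show add: "tensor_lift P b (s \<oplus>\<^bsub>D\<^esub> t) = tensor_lift P b s \<oplus>\<^bsub>P\<^esub> tensor_lift P b t"
      if "s \<in> carrier D" "t \<in> carrier D" for s t
      using hom_mult[OF *(1), of s t] that by (simp add: D_simps)
    fix k t assume k: "k \<in> carrier K" and t: "t \<in> carrier D"
    have kt: "k \<odot>\<^bsub>D\<^esub> t \<in> carrier T" if "t \<in> carrier T" for t using that k by (auto simp flip: D_simps(1))
    show "tensor_lift P b (k \<odot>\<^bsub>D\<^esub> t) = k \<odot>\<^bsub>P\<^esub> tensor_lift P b t"
    proof (rule hom_span_eq[OF _ _ T_abelian P.abelian_group_axioms, of _ _ pures])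
      show "(\<lambda>t. tensor_lift P b (k \<odot>\<^bsub>D\<^esub> t)) \<in> hom (add_monoid T) (add_monoid P)"
        using k by (intro homI) (auto simp: cl kt add[unfolded D_simps] D.smult_r_distr[unfolded D_simps])
      show "(\<lambda>t. k \<odot>\<^bsub>P\<^esub> tensor_lift P b t) \<in> hom (add_monoid T) (add_monoid P)"
        using k by (intro homI) (auto simp: cl kt add[unfolded D_simps] P.smult_r_distr)
      show "t \<in> additive_span T pures" using t by (simp add: D_simps flip: carrier_span)
    qed (use k linear_maps_smult[OF bl k] in \<open>auto simp: *(2) smult_hom(2)\<close>)
  qed
qed

text \<open>The representative chosen for \<open>t\<close> does not depend on the parameter, so the value is a fixed integral
  combination of linear maps.\<close>

lemma tensor_lift_parameter:
  assumes L: "module K L" and P: "module K P" and t: "t \<in> carrier D"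
    and b: "\<And>x y. \<lbrakk>x \<in> carrier M; y \<in> carrier N\<rbrakk> \<Longrightarrow> (\<lambda>l. b l x y) \<in> linear_maps K L P"
  shows "(\<lambda>l. tensor_lift P (b l) t) \<in> linear_maps K L P"
proof -
  interpret normal R F by (rule kernel_normal)
  obtain z where z: "z \<in> carrier F" "t = R #>\<^bsub>F\<^esub> z"
    using t by (auto simp: D_simps T_simps FactGroup_def RCOSETS_def)
  have "z \<in> t" unfolding z(2) using z(1) by (rule rcos_self[OF _ is_subgroup])
  then have "(SOME z. z \<in> t) \<in> t" by (rule someI)
  moreover have "t \<subseteq> carrier F"
    unfolding z(2) using z(1) by (rule r_coset_subset_G[OF subset])
  ultimately have "(SOME z. z \<in> t) \<in> carrier F" by blast
  then have "Poly_Mapping.keys (SOME z. z \<in> t) \<subseteq> carrier M \<times> carrier N"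
    by (simp add: tensor_free_def)
  then show ?thesis
    unfolding tensor_lift_def Let_def
    by (intro linear_maps_finsum_map L P linear_maps_add_pow_map b) auto
qed

end

locale dg_module_pair = M: dg_module K M + N: dg_module K N
  for K :: "('k, 'r) ring_scheme" and M :: "('k, 'm, 's) dg_mod_scheme"
    and N :: "('k, 'n, 't) dg_mod_scheme"

sublocale dg_module_pair \<subseteq> module_pair K M N ..

context dg_module_pair
begin

definition homog_pures :: "int \<Rightarrow> ('m \<times> 'n \<Rightarrow>\<^sub>0 int) set set"
  where "homog_pures n = {pure x y | x y. \<exists>p q. p + q = n \<and> x \<in> homog M p \<and> y \<in> homog N q}"

lemma homog_pures_closed: "homog_pures n \<subseteq> carrier D"
  by (auto simp: homog_pures_def M.graded.homog_carrier N.graded.homog_carrier)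

lemma homog_D: "homog D n = additive_span D (homog_pures n)"
  by (simp add: homog_pures_def D_simps) (simp add: dg_tensor_def Let_def)

lemma pure_homog: "\<lbrakk>x \<in> homog M p; y \<in> homog N q\<rbrakk> \<Longrightarrow> pure x y \<in> homog D (p + q)"
  unfolding homog_D by (rule additive_span_incl) (auto simp: homog_pures_def)

lemma homog_D_subgroup: "additive_subgroup (homog D n) D"
  unfolding homog_D by (rule additive_span_subgroup[OF D_abelian homog_pures_closed])

lemma D_homog_span: "additive_span D (\<Union>n. homog D n) = carrier D"
proof
  interpret D: module K D by (rule D_module)
  have sub: "(\<Union>n. homog D n) \<subseteq> carrier D" using additive_subgroup_closed(1)[OF homog_D_subgroup] by blast
  note sg = additive_span_subgroup[OF D_abelian sub]
  show "additive_span D (\<Union>n. homog D n) \<subseteq> carrier D" by (rule additive_subgroup_closed(1)[OF sg])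
  have 1: "pure x y \<in> additive_span D (\<Union>n. homog D n)" if x: "x \<in> homog M p" and y: "y \<in> carrier N" for p x y
  proof (rule N.graded.linear_maps_homog_into[OF pure_linear_right D_module sg _ y])
    show "x \<in> carrier M" using x by (rule M.graded.homog_carrier)
    show "pure x y \<in> additive_span D (\<Union>n. homog D n)" if "y \<in> homog N q" for q y
      by (rule additive_span_incl) (use pure_homog[OF x that] in blast)
  qed
  have 2: "pure x y \<in> additive_span D (\<Union>n. homog D n)" if x: "x \<in> carrier M" and y: "y \<in> carrier N" for x y
    by (rule M.graded.linear_maps_homog_into[OF pure_linear_left D_module sg _ x])
      (use y 1 in auto)
  show "carrier D \<subseteq> additive_span D (\<Union>n. homog D n)"
    unfolding D_span[symmetric] using 2 by (intro additive_span_least D_abelian sg) auto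
qed

text \<open>The projection to degree \<open>n\<close>: \<open>x \<otimes> y \<mapsto> \<Sum>\<^sub>p x\<^sub>p \<otimes> y\<^bsub>n-p\<^esub>\<close>. It fixes pure tensors of degree \<open>n\<close> and
  kills those of other degrees, which shows that the spans of homogeneous pure tensors form a grading.\<close>

definition degree_projection :: "int \<Rightarrow> ('m \<times> 'n \<Rightarrow>\<^sub>0 int) set \<Rightarrow> ('m \<times> 'n \<Rightarrow>\<^sub>0 int) set"
  where "degree_projection n = tensor_lift D (\<lambda>x y. graded_extend D M (\<lambda>p x'. pure x' (component N y (n - p))) x)"

lemma degree_projection_linear: "degree_projection n \<in> linear_maps K D D"
  and degree_projection_pure: "\<lbrakk>x \<in> homog M p; y \<in> homog N q\<rbrakk> \<Longrightarrow>
    degree_projection n (pure x y) = (if p + q = n then pure x y else \<zero>\<^bsub>D\<^esub>)"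
proof -
  have 1: "(\<lambda>x. pure x (component N y (n - p))) \<in> linear_maps K M D" if "y \<in> carrier N" for p y
    using that by (intro pure_linear_left N.graded.component_closed)
  have 2: "(\<lambda>y. pure x (component N y (n - p))) \<in> linear_maps K N D" if "x \<in> carrier M" for p x
    by (rule linear_maps_compose[OF N.graded.component_linear pure_linear_right[OF that]])
  have b: "bilinear_map K M N D (\<lambda>x y. graded_extend D M (\<lambda>p x'. pure x' (component N y (n - p))) x)"
    by (intro bilinear_mapI M.graded.graded_extend_linear M.graded.graded_extend_parameter
        D_module N.graded.module 1 2)
  show "degree_projection n \<in> linear_maps K D D" unfolding degree_projection_def by (rule tensor_lift_linear[OF D_module b])
  show "degree_projection n (pure x y) = (if p + q = n then pure x y else \<zero>\<^bsub>D\<^esub>)" if xy: "x \<in> homog M p" "y \<in> homog N q"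
  proof -
    have c: "x \<in> carrier M" "y \<in> carrier N"
      using xy M.graded.homog_carrier N.graded.homog_carrier by auto
    have "degree_projection n (pure x y) = pure x (component N y (n - p))"
      unfolding degree_projection_def using xy c
      by (simp add: tensor_lift_linear(2)[OF D_module b]
          M.graded.graded_extend_homog[OF D_module 1])
    also have "\<dots> = (if p + q = n then pure x y else \<zero>\<^bsub>D\<^esub>)"
      using xy linear_maps_zero[OF pure_linear_right[OF c(1)] N.graded.module D_module]
      by (auto simp: N.graded.component_of_homog)
    finally show ?thesis .
  qed
qed

lemma D_graded: "graded_module K D"
proof -
  interpret D: module K D by (rule D_module)
  have fixed: "degree_projection n t = t" if "t \<in> homog D n" for n t
    by (rule linear_maps_span_eq[OF degree_projection_linear linear_maps_id D_module D_module homog_pures_closed])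
      (use that in \<open>auto simp: homog_D homog_pures_def degree_projection_pure\<close>)
  have killed: "degree_projection n t = \<zero>\<^bsub>D\<^esub>" if "t \<in> homog D k" "k \<noteq> n" for n k t
    by (rule linear_maps_span_eq[OF degree_projection_linear linear_maps_zero_map[OF D_module D_module] D_module D_module
          homog_pures_closed])
      (use that in \<open>auto simp: homog_D homog_pures_def degree_projection_pure\<close>)
  show ?thesis
  proof (intro graded_module.intro D_module graded_module_axioms.intro)
    show "internal_direct_sum D UNIV (homog D)"
    proof (rule internal_direct_sumI[OF D_module D_module homog_D_subgroup])
      fix n t assume "t \<in> homog D n" "t \<noteq> \<zero>\<^bsub>D\<^esub>"
      then show "\<exists>\<pi>\<in>linear_maps K D D. \<pi> t \<noteq> \<zero>\<^bsub>D\<^esub> \<and> (\<forall>k y. k \<noteq> n \<longrightarrow> y \<in> homog D k \<longrightarrow> \<pi> y = \<zero>\<^bsub>D\<^esub>)"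
        using fixed killed by (intro bexI[OF _ degree_projection_linear[of n]]) auto
    qed (simp add: D_homog_span)
    fix k t n assume k: "k \<in> carrier K" and t: "t \<in> homog D n"
    show "k \<odot>\<^bsub>D\<^esub> t \<in> homog D n"
    proof (rule linear_maps_span_into[where f = "\<lambda>t. k \<odot>\<^bsub>D\<^esub> t",
          OF _ D_module D_module homog_D_subgroup homog_pures_closed])
      show "(\<lambda>t. k \<odot>\<^bsub>D\<^esub> t) \<in> linear_maps K D D"
        by (rule linear_maps_smult_map[OF D_module linear_maps_id k])
      show "t \<in> additive_span D (homog_pures n)" using t by (simp add: homog_D)
      show "k \<odot>\<^bsub>D\<^esub> s \<in> homog D n" if "s \<in> homog_pures n" for s
        using that k
        by (auto simp: homog_pures_def smult_hom(2) M.graded.homog_carrier N.graded.homog_carrier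
            intro!: pure_homog M.smult_homog)
    qed
  qed
qed

lemma dif_linear: "dif D \<in> linear_maps K D D"
  and dif_pure: "\<lbrakk>x \<in> homog M p; y \<in> carrier N\<rbrakk> \<Longrightarrow>
    dif D (pure x y) = pure (dif M x) y \<oplus>\<^bsub>D\<^esub> ksign D p (pure x (dif N y))"
proof -
  let ?g = "\<lambda>x y. graded_extend D M (\<lambda>p x'. ksign D p (pure x' (dif N y))) x"
  let ?b = "\<lambda>x y. pure (dif M x) y \<oplus>\<^bsub>D\<^esub> ?g x y"
  have "dif D = tensor_lift T (\<lambda>x y. pure (dif M x) y \<oplus>\<^bsub>T\<^esub>
      graded_extend T M (\<lambda>p x'. ksign T p (pure x' (dif N y))) x)"
    by (simp add: dg_tensor_def Let_def)
  then have *: "dif D = tensor_lift D ?b"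
    by (simp only: tensor_lift_cong[OF D_same_T] graded_extend_cong[OF D_same_T] D_simps)
  have dM: "dif M x \<in> carrier M" if "x \<in> carrier M" for x
    using that by (rule linear_maps_closed[OF M.dif_linear])
  have dN: "dif N x \<in> carrier N" if "x \<in> carrier N" for x
    using that by (rule linear_maps_closed[OF N.dif_linear])
  have 1: "(\<lambda>x. ksign D p (pure x (dif N y))) \<in> linear_maps K M D" if "y \<in> carrier N" for p y
    using that by (intro linear_maps_ksign_map D_module pure_linear_left dN)
  have 2: "(\<lambda>y. ksign D p (pure x (dif N y))) \<in> linear_maps K N D" if "x \<in> carrier M" for p x
    by (intro linear_maps_ksign_map D_module linear_maps_compose[OF N.dif_linear pure_linear_right[OF that]])
  have b: "bilinear_map K M N D ?b"
    by (intro bilinear_mapI linear_maps_add_map D_module M.graded.module N.graded.module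
        M.graded.graded_extend_linear[OF D_module 1] pure_linear_right dM
        M.graded.graded_extend_parameter[OF N.graded.module D_module _ 2]
        linear_maps_compose[OF M.dif_linear pure_linear_left])
  show "dif D \<in> linear_maps K D D" unfolding * by (rule tensor_lift_linear[OF D_module b])
  show "dif D (pure x y) = pure (dif M x) y \<oplus>\<^bsub>D\<^esub> ksign D p (pure x (dif N y))"
    if "x \<in> homog M p" "y \<in> carrier N"
    unfolding * using that
    by (simp add: tensor_lift_linear(2)[OF D_module b] M.graded.homog_carrier
        M.graded.graded_extend_homog[OF D_module 1])
qed

lemma pure_ksign_left:
  "\<lbrakk>x \<in> carrier M; y \<in> carrier N\<rbrakk> \<Longrightarrow> pure (ksign M n x) y = ksign D n (pure x y)"
  by (rule linear_maps_ksign[OF pure_linear_left M.graded.module D_module])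

lemma pure_ksign_right:
  "\<lbrakk>x \<in> carrier M; y \<in> carrier N\<rbrakk> \<Longrightarrow> pure x (ksign N n y) = ksign D n (pure x y)"
  by (rule linear_maps_ksign[OF pure_linear_right N.graded.module D_module])

lemma D_homog_linear_eq:
  assumes "f \<in> linear_maps K D P" "g \<in> linear_maps K D P" "module K P"
    and "\<And>p q x y. \<lbrakk>x \<in> homog M p; y \<in> homog N q\<rbrakk> \<Longrightarrow> f (pure x y) = g (pure x y)" "t \<in> carrier D"
  shows "f t = g t"
proof (rule graded_module.linear_maps_homog_eq[OF D_graded assms(1-3) _ assms(5)])
  fix n t assume t: "t \<in> homog D n"
  show "f t = g t"
    by (rule linear_maps_span_eq[OF assms(1,2) D_module assms(3) homog_pures_closed[of n]])
      (use t in \<open>auto simp: homog_D homog_pures_def assms(4)\<close>)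
qed

lemma tensor_dg_module: "dg_module K D"
proof (intro dg_module.intro D_module dg_module_axioms.intro)
  interpret D: module K D by (rule D_module)
  interpret D: graded_module K D by (rule D_graded)
  show "internal_direct_sum D UNIV (homog D)" by (rule D.grading)
  show "k \<odot>\<^bsub>D\<^esub> t \<in> homog D n" if "k \<in> carrier K" "t \<in> homog D n" for k t n
    using that by (rule D.smult_homog)
  show "dif D \<in> linear_maps K D D" by (rule dif_linear)
  have cM: "x \<in> homog M p \<Longrightarrow> x \<in> carrier M" for x p by (rule M.graded.homog_carrier)
  have cN: "x \<in> homog N p \<Longrightarrow> x \<in> carrier N" for x p by (rule N.graded.homog_carrier)
  have pure_homog': "pure x y \<in> homog D n" if "x \<in> homog M p" "y \<in> homog N q" "p + q = n" for x y p q n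
    using pure_homog[OF that(1,2)] that(3) by simp
  show "dif D t \<in> homog D (n + 1)" if t: "t \<in> homog D n" for t n
  proof (rule linear_maps_span_into[OF dif_linear D_module D_module homog_D_subgroup homog_pures_closed])
    show "t \<in> additive_span D (homog_pures n)" using t by (simp add: homog_D)
    fix s assume "s \<in> homog_pures n"
    then obtain x y p q where s: "s = pure x y" "p + q = n" "x \<in> homog M p" "y \<in> homog N q"
      by (auto simp: homog_pures_def)
    then show "dif D s \<in> homog D (n + 1)"
      by (auto simp: dif_pure cN intro!: D.add_homog D.ksign_homog
          intro: pure_homog'[OF M.dif_degree _] pure_homog'[OF _ N.dif_degree])
  qed
  show "dif D (dif D t) = \<zero>\<^bsub>D\<^esub>" if "t \<in> carrier D" for t
  proof (rule D_homog_linear_eq[OF _ linear_maps_zero_map[OF D_module D_module] D_module _ that])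
    show "(\<lambda>t. dif D (dif D t)) \<in> linear_maps K D D" by (rule linear_maps_compose[OF dif_linear dif_linear])
    fix p q x y assume xy: "x \<in> homog M p" "y \<in> homog N q"
    note d = M.dif_degree[OF xy(1)] N.dif_degree[OF xy(2)] 
    have z: "pure \<zero>\<^bsub>M\<^esub> y = \<zero>\<^bsub>D\<^esub>" "pure x \<zero>\<^bsub>N\<^esub> = \<zero>\<^bsub>D\<^esub>"
      using xy linear_maps_zero[OF pure_linear_left M.graded.module D_module]
        linear_maps_zero[OF pure_linear_right N.graded.module D_module] cM cN by auto
    show "dif D (dif D (pure x y)) = \<zero>\<^bsub>D\<^esub>"
      using xy d
      by (simp add: dif_pure cM cN linear_maps_add[OF dif_linear] M.dif_square N.dif_square z
          linear_maps_ksign[OF dif_linear D_module D_module])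
        (simp add: ksign_def cM cN D.r_neg D.l_neg)
  qed
qed

end

section \<open>Dg categories and dg functors from homogeneous generators\<close>

text \<open>In an opposite category or a category of bimodules all homogeneous elements are taken as generators, in
  a tensor product only the pure tensors of homogeneous elements.\<close>

definition homog_generators :: "('k, 'm, 's) dg_mod_scheme \<Rightarrow> (int \<Rightarrow> 'm set) \<Rightarrow> bool"
  where "homog_generators M G \<longleftrightarrow> (\<forall>n. G n \<subseteq> carrier M \<and> homog M n = additive_span M (G n))"

lemma homog_generators_homog:
  assumes "dg_module K M"
  shows "homog_generators M (homog M)"
proof -
  interpret dg_module K M by fact
  show ?thesis
    unfolding homog_generators_def
    using additive_span_subgroup_eq[OF M.abelian_group_axioms graded.homog_subgroup] graded.homog_carrier
    by auto
qed

lemma generators_carrier: "homog_generators M G \<Longrightarrow> x \<in> G n \<Longrightarrow> x \<in> carrier M"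
  by (auto simp: homog_generators_def)

lemma generators_homog_eq:
  assumes M: "dg_module K M" and G: "homog_generators M G" and N: "module K N"
    and "f \<in> linear_maps K M N" "g \<in> linear_maps K M N" "\<And>x. x \<in> G n \<Longrightarrow> f x = g x"
    and "x \<in> homog M n"
  shows "f x = g x"
proof -
  interpret dg_module K M by fact
  show ?thesis
    by (rule linear_maps_span_eq[OF assms(4,5) graded.module N, of "G n"])
      (use assms in \<open>auto simp: homog_generators_def\<close>)
qed

lemma generators_eq:
  assumes M: "dg_module K M" and G: "homog_generators M G" and N: "module K N"
    and "f \<in> linear_maps K M N" "g \<in> linear_maps K M N" "\<And>n x. x \<in> G n \<Longrightarrow> f x = g x"
    and "x \<in> carrier M"
  shows "f x = g x"
proof -
  interpret dg_module K M by fact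
  show ?thesis
    by (rule graded.linear_maps_homog_eq[OF assms(4,5) N _ assms(7)])
      (rule generators_homog_eq[OF M G N assms(4,5)], rule assms(6))
qed

lemma generators_into:
  assumes M: "dg_module K M" and G: "homog_generators M G" and N: "module K N"
    and "f \<in> linear_maps K M N" "additive_subgroup J N" "\<And>x. x \<in> G n \<Longrightarrow> f x \<in> J"
    and "x \<in> homog M n"
  shows "f x \<in> J"
proof -
  interpret dg_module K M by fact
  show ?thesis
    by (rule linear_maps_span_into[OF assms(4) graded.module N assms(5), of "G n"])
      (use assms in \<open>auto simp: homog_generators_def\<close>)
qed

text \<open>Both sides of each axiom are linear in every argument, so the arguments are made general one at a
  time. The sign in the Leibniz rule depends on the degree of the left argument only, which is therefore
  extended within a fixed degree first.\<close>

lemma dg_categoryI: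
  fixes \<C> :: "('o, 'k, 'h) dg_cat"
  assumes K: "cring K"
    and Hom: "\<And>X Y. \<lbrakk>X \<in> Obj \<C>; Y \<in> Obj \<C>\<rbrakk> \<Longrightarrow> dg_module K (Hom \<C> X Y)"
    and gen: "\<And>X Y. \<lbrakk>X \<in> Obj \<C>; Y \<in> Obj \<C>\<rbrakk> \<Longrightarrow> homog_generators (Hom \<C> X Y) (G X Y)"
    and Id: "\<And>X. X \<in> Obj \<C> \<Longrightarrow> Id \<C> X \<in> carrier (Hom \<C> X X)"
    and bil: "\<And>X Y Z. \<lbrakk>X \<in> Obj \<C>; Y \<in> Obj \<C>; Z \<in> Obj \<C>\<rbrakk> \<Longrightarrow>
      bilinear_map K (Hom \<C> Y Z) (Hom \<C> X Y) (Hom \<C> X Z) (Comp \<C> X Y Z)"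
    and assoc: "\<And>W X Y Z f g h p q r. \<lbrakk>W \<in> Obj \<C>; X \<in> Obj \<C>; Y \<in> Obj \<C>; Z \<in> Obj \<C>;
        f \<in> G W X r; g \<in> G X Y q; h \<in> G Y Z p\<rbrakk> \<Longrightarrow>
        Comp \<C> W X Z (Comp \<C> X Y Z h g) f = Comp \<C> W Y Z h (Comp \<C> W X Y g f)"
    and Id_left: "\<And>X Y f p. \<lbrakk>X \<in> Obj \<C>; Y \<in> Obj \<C>; f \<in> G X Y p\<rbrakk> \<Longrightarrow> Comp \<C> X Y Y (Id \<C> Y) f = f"
    and Id_right: "\<And>X Y f p. \<lbrakk>X \<in> Obj \<C>; Y \<in> Obj \<C>; f \<in> G X Y p\<rbrakk> \<Longrightarrow> Comp \<C> X X Y f (Id \<C> X) = f"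
    and degree: "\<And>X Y Z f g p q. \<lbrakk>X \<in> Obj \<C>; Y \<in> Obj \<C>; Z \<in> Obj \<C>; g \<in> G Y Z p; f \<in> G X Y q\<rbrakk> \<Longrightarrow>
        Comp \<C> X Y Z g f \<in> homog (Hom \<C> X Z) (p + q)"
    and dif: "\<And>X Y Z f g p q. \<lbrakk>X \<in> Obj \<C>; Y \<in> Obj \<C>; Z \<in> Obj \<C>; g \<in> G Y Z p; f \<in> G X Y q\<rbrakk> \<Longrightarrow>
        dif (Hom \<C> X Z) (Comp \<C> X Y Z g f) =
          Comp \<C> X Y Z (dif (Hom \<C> Y Z) g) f
          \<oplus>\<^bsub>Hom \<C> X Z\<^esub> ksign (Hom \<C> X Z) p (Comp \<C> X Y Z g (dif (Hom \<C> X Y) f))"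
  shows "dg_category K \<C>"
proof -
  have mod: "module K (Hom \<C> X Y)" if "X \<in> Obj \<C>" "Y \<in> Obj \<C>" for X Y
    using Hom[OF that] by (rule dg_module.axioms(1))
  have left: "(\<lambda>g. Comp \<C> X Y Z g f) \<in> linear_maps K (Hom \<C> Y Z) (Hom \<C> X Z)"
    if "X \<in> Obj \<C>" "Y \<in> Obj \<C>" "Z \<in> Obj \<C>" "f \<in> carrier (Hom \<C> X Y)" for X Y Z f
    using bilinear_map_left[OF bil] that by blast
  have right: "(\<lambda>f. Comp \<C> X Y Z g f) \<in> linear_maps K (Hom \<C> X Y) (Hom \<C> X Z)"
    if "X \<in> Obj \<C>" "Y \<in> Obj \<C>" "Z \<in> Obj \<C>" "g \<in> carrier (Hom \<C> Y Z)" for X Y Z g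
    using bilinear_map_right[OF bil[OF that(1-3)] that(4)] by simp
  have closed: "Comp \<C> X Y Z g f \<in> carrier (Hom \<C> X Z)"
    if "X \<in> Obj \<C>" "Y \<in> Obj \<C>" "Z \<in> Obj \<C>" "f \<in> carrier (Hom \<C> X Y)" "g \<in> carrier (Hom \<C> Y Z)" for X Y Z f g
    using bilinear_map_closed[OF bil] that by blast
  have Gc: "f \<in> carrier (Hom \<C> X Y)" if "X \<in> Obj \<C>" "Y \<in> Obj \<C>" "f \<in> G X Y p" for X Y f p
    using generators_carrier[OF gen] that by blast
  have dl: "dif (Hom \<C> X Y) \<in> linear_maps K (Hom \<C> X Y) (Hom \<C> X Y)" if "X \<in> Obj \<C>" "Y \<in> Obj \<C>" for X Y
    using Hom[OF that] by (rule dg_module.dif_linear)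
  note lc = linear_maps_compose
  note eqI = generators_eq[OF Hom gen mod]
  show ?thesis
  proof (intro dg_category.intro dg_category_axioms.intro)
    fix W X Y Z f g h
    assume o: "W \<in> Obj \<C>" "X \<in> Obj \<C>" "Y \<in> Obj \<C>" "Z \<in> Obj \<C>"
    assume f: "f \<in> carrier (Hom \<C> W X)" and g: "g \<in> carrier (Hom \<C> X Y)" and h: "h \<in> carrier (Hom \<C> Y Z)"
    \<comment> \<open>Generalise the outermost factor, then the middle one, then the innermost one.\<close>
    have 1: "Comp \<C> W X Z (Comp \<C> X Y Z h g) f = Comp \<C> W Y Z h (Comp \<C> W X Y g f)"
      if f: "f \<in> G W X r" and g: "g \<in> G X Y q" for f g q r
    proof (rule eqI[OF o(3,4) o(3,4) o(1,4) _ _ _ h])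
      show "(\<lambda>h. Comp \<C> W X Z (Comp \<C> X Y Z h g) f) \<in> linear_maps K (Hom \<C> Y Z) (Hom \<C> W Z)"
        by (rule lc[OF left left]) (use o f g Gc in auto)
      show "(\<lambda>h. Comp \<C> W Y Z h (Comp \<C> W X Y g f)) \<in> linear_maps K (Hom \<C> Y Z) (Hom \<C> W Z)"
        by (rule left) (use o f g Gc closed in auto)
    qed (use assoc o f g in auto)
    have 2: "Comp \<C> W X Z (Comp \<C> X Y Z h g) f = Comp \<C> W Y Z h (Comp \<C> W X Y g f)"
      if f: "f \<in> G W X r" for f r
    proof (rule eqI[OF o(2,3) o(2,3) o(1,4) _ _ _ g])
      show "(\<lambda>g. Comp \<C> W X Z (Comp \<C> X Y Z h g) f) \<in> linear_maps K (Hom \<C> X Y) (Hom \<C> W Z)"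
        by (rule lc[OF right left]) (use o f h Gc in auto)
      show "(\<lambda>g. Comp \<C> W Y Z h (Comp \<C> W X Y g f)) \<in> linear_maps K (Hom \<C> X Y) (Hom \<C> W Z)"
        by (rule lc[OF left right]) (use o f h Gc in auto)
    qed (use 1 f in auto)
    show "Comp \<C> W X Z (Comp \<C> X Y Z h g) f = Comp \<C> W Y Z h (Comp \<C> W X Y g f)"
    proof (rule eqI[OF o(1,2) o(1,2) o(1,4) _ _ _ f])
      show "(\<lambda>f. Comp \<C> W X Z (Comp \<C> X Y Z h g) f) \<in> linear_maps K (Hom \<C> W X) (Hom \<C> W Z)"
        by (rule right) (use o g h closed in auto)
      show "(\<lambda>f. Comp \<C> W Y Z h (Comp \<C> W X Y g f)) \<in> linear_maps K (Hom \<C> W X) (Hom \<C> W Z)"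
        by (rule lc[OF right right]) (use o g h in auto)
    qed (use 2 in auto)
  next
    fix X Y f assume o: "X \<in> Obj \<C>" "Y \<in> Obj \<C>" and f: "f \<in> carrier (Hom \<C> X Y)"
    show "Comp \<C> X Y Y (Id \<C> Y) f = f"
      by (rule eqI[OF o o o right linear_maps_id _ f]) (use o Id Id_left in auto)
    show "Comp \<C> X X Y f (Id \<C> X) = f"
      by (rule eqI[OF o o o left linear_maps_id _ f]) (use o Id Id_right in auto)
  next
    fix X Y Z f g p q
    assume o: "X \<in> Obj \<C>" "Y \<in> Obj \<C>" "Z \<in> Obj \<C>"
      and g: "g \<in> homog (Hom \<C> Y Z) p" and f: "f \<in> homog (Hom \<C> X Y) q"
    have sg: "additive_subgroup (homog (Hom \<C> X Z) (p + q)) (Hom \<C> X Z)"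
      by (rule graded_module.homog_subgroup[OF dg_module_graded[OF Hom]]) fact+
    have 1: "Comp \<C> X Y Z g f \<in> homog (Hom \<C> X Z) (p + q)" if g: "g \<in> G Y Z p" for g
      by (rule generators_into[OF Hom gen mod right sg _ f]) (use o g Gc degree in auto)
    show "Comp \<C> X Y Z g f \<in> homog (Hom \<C> X Z) (p + q)"
      by (rule generators_into[OF Hom gen mod left sg _ g])
        (use o 1 graded_module.homog_carrier[OF dg_module_graded[OF Hom] f] in auto)
  next
    fix X Y Z f g p
    assume o: "X \<in> Obj \<C>" "Y \<in> Obj \<C>" "Z \<in> Obj \<C>"
      and g: "g \<in> homog (Hom \<C> Y Z) p" and f: "f \<in> carrier (Hom \<C> X Y)"
    have 1: "dif (Hom \<C> X Z) (Comp \<C> X Y Z g f) =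
          Comp \<C> X Y Z (dif (Hom \<C> Y Z) g) f
          \<oplus>\<^bsub>Hom \<C> X Z\<^esub> ksign (Hom \<C> X Z) p (Comp \<C> X Y Z g (dif (Hom \<C> X Y) f))" if g: "g \<in> G Y Z p" for g
    proof (rule eqI[OF o(1,2) o(1,2) o(1,3) _ _ _ f])
      have gc: "g \<in> carrier (Hom \<C> Y Z)" using Gc o g by blast
      show "(\<lambda>f. dif (Hom \<C> X Z) (Comp \<C> X Y Z g f)) \<in> linear_maps K (Hom \<C> X Y) (Hom \<C> X Z)"
        by (rule lc[OF right dl]) (use o gc in auto)
      show "(\<lambda>f. Comp \<C> X Y Z (dif (Hom \<C> Y Z) g) f
          \<oplus>\<^bsub>Hom \<C> X Z\<^esub> ksign (Hom \<C> X Z) p (Comp \<C> X Y Z g (dif (Hom \<C> X Y) f)))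
          \<in> linear_maps K (Hom \<C> X Y) (Hom \<C> X Z)"
        by (intro linear_maps_add_map linear_maps_ksign_map mod right lc[OF dl right] o gc
            linear_maps_closed[OF dl])
    qed (use dif o g in auto)
    show "dif (Hom \<C> X Z) (Comp \<C> X Y Z g f) =
          Comp \<C> X Y Z (dif (Hom \<C> Y Z) g) f
          \<oplus>\<^bsub>Hom \<C> X Z\<^esub> ksign (Hom \<C> X Z) p (Comp \<C> X Y Z g (dif (Hom \<C> X Y) f))"
    proof (rule generators_homog_eq[OF Hom[OF o(2,3)] gen[OF o(2,3)] mod[OF o(1,3)] _ _ _ g])
      show "(\<lambda>g. dif (Hom \<C> X Z) (Comp \<C> X Y Z g f)) \<in> linear_maps K (Hom \<C> Y Z) (Hom \<C> X Z)"
        by (rule lc[OF left dl]) (use o f in auto)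
      show "(\<lambda>g. Comp \<C> X Y Z (dif (Hom \<C> Y Z) g) f
          \<oplus>\<^bsub>Hom \<C> X Z\<^esub> ksign (Hom \<C> X Z) p (Comp \<C> X Y Z g (dif (Hom \<C> X Y) f)))
          \<in> linear_maps K (Hom \<C> Y Z) (Hom \<C> X Z)"
        by (intro linear_maps_add_map linear_maps_ksign_map mod left lc[OF dl left] o f
            linear_maps_closed[OF dl])
    qed (use 1 in auto)
  qed (use K Hom Id left right in auto)
qed

text \<open>As for categories: each condition compares linear maps in every argument.\<close>

lemma dg_functorI:
  fixes \<C> :: "('o, 'k, 'h) dg_cat" and \<D> :: "('p, 'k, 'i) dg_cat"
  assumes C: "dg_category K \<C>" and D: "dg_category K \<D>"
    and gen: "\<And>X Y. \<lbrakk>X \<in> Obj \<C>; Y \<in> Obj \<C>\<rbrakk> \<Longrightarrow> homog_generators (Hom \<C> X Y) (G X Y)"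
    and Fo: "\<And>X. X \<in> Obj \<C> \<Longrightarrow> Fo X \<in> Obj \<D>"
    and lin: "\<And>X Y. \<lbrakk>X \<in> Obj \<C>; Y \<in> Obj \<C>\<rbrakk> \<Longrightarrow>
        Fm X Y \<in> linear_maps K (Hom \<C> X Y) (Hom \<D> (Fo X) (Fo Y))"
    and degree: "\<And>X Y f n. \<lbrakk>X \<in> Obj \<C>; Y \<in> Obj \<C>; f \<in> G X Y n\<rbrakk> \<Longrightarrow>
        Fm X Y f \<in> homog (Hom \<D> (Fo X) (Fo Y)) n"
    and dif: "\<And>X Y f n. \<lbrakk>X \<in> Obj \<C>; Y \<in> Obj \<C>; f \<in> G X Y n\<rbrakk> \<Longrightarrow>
        Fm X Y (dif (Hom \<C> X Y) f) = dif (Hom \<D> (Fo X) (Fo Y)) (Fm X Y f)"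
    and Id: "\<And>X. X \<in> Obj \<C> \<Longrightarrow> Fm X X (Id \<C> X) = Id \<D> (Fo X)"
    and Comp: "\<And>X Y Z f g p q. \<lbrakk>X \<in> Obj \<C>; Y \<in> Obj \<C>; Z \<in> Obj \<C>; f \<in> G X Y q; g \<in> G Y Z p\<rbrakk> \<Longrightarrow>
        Fm X Z (Comp \<C> X Y Z g f) = Comp \<D> (Fo X) (Fo Y) (Fo Z) (Fm Y Z g) (Fm X Y f)"
  shows "dg_functor K \<C> \<D> Fo Fm"
proof -
  interpret C: dg_category K \<C> by fact
  interpret D: dg_category K \<D> by fact
  have modD: "module K (Hom \<D> X Y)" if "X \<in> Obj \<D>" "Y \<in> Obj \<D>" for X Y
    using D.Hom_dg_module[OF that] by (rule dg_module.axioms(1))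
  note lc = linear_maps_compose
  show ?thesis
  proof (intro dg_functor.intro C D dg_functor_axioms.intro)
    fix X Y f n assume o: "X \<in> Obj \<C>" "Y \<in> Obj \<C>" and f: "f \<in> homog (Hom \<C> X Y) n"
    show "Fm X Y f \<in> homog (Hom \<D> (Fo X) (Fo Y)) n"
      by (rule generators_into[OF C.Hom_dg_module gen modD lin _ _ f])
        (use o Fo degree graded_module.homog_subgroup[OF dg_module_graded[OF D.Hom_dg_module]] in auto)
  next
    fix X Y f assume o: "X \<in> Obj \<C>" "Y \<in> Obj \<C>" and f: "f \<in> carrier (Hom \<C> X Y)"
    note Foo = Fo[OF o(1)] Fo[OF o(2)]
    show "Fm X Y (dif (Hom \<C> X Y) f) = dif (Hom \<D> (Fo X) (Fo Y)) (Fm X Y f)"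
      by (rule generators_eq[OF C.Hom_dg_module[OF o] gen[OF o] modD[OF Foo]
            lc[OF dg_module.dif_linear[OF C.Hom_dg_module[OF o]] lin[OF o]]
            lc[OF lin[OF o] dg_module.dif_linear[OF D.Hom_dg_module[OF Foo]]] _ f])
        (rule dif[OF o])
  next
    fix X Y Z f g assume o: "X \<in> Obj \<C>" "Y \<in> Obj \<C>" "Z \<in> Obj \<C>"
      and f: "f \<in> carrier (Hom \<C> X Y)" and g: "g \<in> carrier (Hom \<C> Y Z)"
    note Foo = Fo[OF o(1)] Fo[OF o(2)] Fo[OF o(3)]
    have 1: "Fm X Z (Comp \<C> X Y Z g f) = Comp \<D> (Fo X) (Fo Y) (Fo Z) (Fm Y Z g) (Fm X Y f)"
      if g: "g \<in> G Y Z p" for p g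
    proof (rule generators_eq[OF C.Hom_dg_module[OF o(1,2)] gen[OF o(1,2)] modD[OF Foo(1,3)] _ _ _ f])
      have gc: "g \<in> carrier (Hom \<C> Y Z)" using generators_carrier[OF gen] o g by blast
      show "(\<lambda>f. Fm X Z (Comp \<C> X Y Z g f)) \<in> linear_maps K (Hom \<C> X Y) (Hom \<D> (Fo X) (Fo Z))"
        by (rule lc[OF C.Comp_linear_right[OF o gc] lin[OF o(1,3)]])
      show "(\<lambda>f. Comp \<D> (Fo X) (Fo Y) (Fo Z) (Fm Y Z g) (Fm X Y f))
          \<in> linear_maps K (Hom \<C> X Y) (Hom \<D> (Fo X) (Fo Z))"
        by (rule lc[OF lin[OF o(1,2)] D.Comp_linear_right[OF Foo linear_maps_closed[OF lin[OF o(2,3)] gc]]])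
    qed (use Comp o g in auto)
    show "Fm X Z (Comp \<C> X Y Z g f) = Comp \<D> (Fo X) (Fo Y) (Fo Z) (Fm Y Z g) (Fm X Y f)"
    proof (rule generators_eq[OF C.Hom_dg_module[OF o(2,3)] gen[OF o(2,3)] modD[OF Foo(1,3)] _ _ _ g])
      show "(\<lambda>g. Fm X Z (Comp \<C> X Y Z g f)) \<in> linear_maps K (Hom \<C> Y Z) (Hom \<D> (Fo X) (Fo Z))"
        by (rule lc[OF C.Comp_linear_left[OF o f] lin[OF o(1,3)]])
      show "(\<lambda>g. Comp \<D> (Fo X) (Fo Y) (Fo Z) (Fm Y Z g) (Fm X Y f))
          \<in> linear_maps K (Hom \<C> Y Z) (Hom \<D> (Fo X) (Fo Z))"
        by (rule lc[OF lin[OF o(2,3)] D.Comp_linear_left[OF Foo linear_maps_closed[OF lin[OF o(1,2)] f]]])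
    qed (use 1 in auto)
  qed (use Fo lin Id in auto)
qed

context dg_category
begin

lemma Hom_graded: "\<lbrakk>X \<in> Obj \<C>; Y \<in> Obj \<C>\<rbrakk> \<Longrightarrow> graded_module K (Hom \<C> X Y)"
  by (intro dg_module_graded Hom_dg_module)

lemma Hom_module: "\<lbrakk>X \<in> Obj \<C>; Y \<in> Obj \<C>\<rbrakk> \<Longrightarrow> module K (Hom \<C> X Y)"
  by (rule graded_module.module[OF Hom_graded])

lemma Hom_carrier: "\<lbrakk>X \<in> Obj \<C>; Y \<in> Obj \<C>; f \<in> homog (Hom \<C> X Y) p\<rbrakk> \<Longrightarrow> f \<in> carrier (Hom \<C> X Y)"
  by (rule graded_module.homog_carrier[OF Hom_graded])

lemma Comp_closed:
  "\<lbrakk>X \<in> Obj \<C>; Y \<in> Obj \<C>; Z \<in> Obj \<C>; f \<in> carrier (Hom \<C> X Y); g \<in> carrier (Hom \<C> Y Z)\<rbrakk> \<Longrightarrow>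
    Comp \<C> X Y Z g f \<in> carrier (Hom \<C> X Z)"
  by (rule linear_maps_closed[OF Comp_linear_right])

lemma dif_closed: "\<lbrakk>X \<in> Obj \<C>; Y \<in> Obj \<C>; f \<in> carrier (Hom \<C> X Y)\<rbrakk> \<Longrightarrow>
    dif (Hom \<C> X Y) f \<in> carrier (Hom \<C> X Y)"
  by (rule linear_maps_closed[OF dg_module.dif_linear[OF Hom_dg_module]])

lemma dif_homog: "\<lbrakk>X \<in> Obj \<C>; Y \<in> Obj \<C>; f \<in> homog (Hom \<C> X Y) p\<rbrakk> \<Longrightarrow>
    dif (Hom \<C> X Y) f \<in> homog (Hom \<C> X Y) (p + 1)"
  by (rule dg_module.dif_degree[OF Hom_dg_module])

lemma Comp_ksign_left:
  "\<lbrakk>X \<in> Obj \<C>; Y \<in> Obj \<C>; Z \<in> Obj \<C>; f \<in> carrier (Hom \<C> X Y); g \<in> carrier (Hom \<C> Y Z)\<rbrakk> \<Longrightarrow>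
    Comp \<C> X Y Z (ksign (Hom \<C> Y Z) n g) f = ksign (Hom \<C> X Z) n (Comp \<C> X Y Z g f)"
  by (rule linear_maps_ksign[OF Comp_linear_left Hom_module Hom_module])

lemma Comp_ksign_right:
  "\<lbrakk>X \<in> Obj \<C>; Y \<in> Obj \<C>; Z \<in> Obj \<C>; f \<in> carrier (Hom \<C> X Y); g \<in> carrier (Hom \<C> Y Z)\<rbrakk> \<Longrightarrow>
    Comp \<C> X Y Z g (ksign (Hom \<C> X Y) n f) = ksign (Hom \<C> X Z) n (Comp \<C> X Y Z g f)"
  by (rule linear_maps_ksign[OF Comp_linear_right Hom_module Hom_module])

text \<open>Signs in opposite and tensor product categories involve the degrees of identities. The degree-0
  component of an identity is itself a left identity: for \<open>f\<close> of degree \<open>n\<close> compare the degree-\<open>n\<close>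
  components in \<open>id \<circ> f = f\<close>.\<close>

lemma Id_homog:
  assumes X: "X \<in> Obj \<C>"
  shows "Id \<C> X \<in> homog (Hom \<C> X X) 0"
proof -
  let ?H = "Hom \<C> X X"
  interpret H: graded_module K ?H by (rule Hom_graded[OF X X])
  let ?e = "component ?H (Id \<C> X) 0"
  note Id = Id_closed[OF X]
  have e: "?e \<in> carrier ?H" by (rule H.component_closed[OF Id])
  have left: "Comp \<C> X X X ?e f = f" if f: "f \<in> homog ?H n" for f n
  proof -
    have fc: "f \<in> carrier ?H" by (rule H.homog_carrier[OF f])
    have "component ?H (Comp \<C> X X X (Id \<C> X) f) n = Comp \<C> X X X ?e f"
    proof (rule H.linear_maps_homog_eq[OF _ _ H.module _ Id])
      show "(\<lambda>g. component ?H (Comp \<C> X X X g f) n) \<in> linear_maps K ?H ?H"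
        by (rule linear_maps_compose[OF Comp_linear_left[OF X X X fc] H.component_linear])
      show "(\<lambda>g. Comp \<C> X X X (component ?H g 0) f) \<in> linear_maps K ?H ?H"
        by (rule linear_maps_compose[OF H.component_linear Comp_linear_left[OF X X X fc]])
      fix k g assume g: "g \<in> homog ?H k"
      show "component ?H (Comp \<C> X X X g f) n = Comp \<C> X X X (component ?H g 0) f"
        using H.component_of_homog[OF Comp_degree[OF X X X g f]] H.component_of_homog[OF g]
          linear_maps_zero[OF Comp_linear_left[OF X X X fc] H.module H.module]
        by simp
    qed
    then show ?thesis using Id_left[OF X X fc] H.component_of_homog[OF f] by simp
  qed
  have "Comp \<C> X X X ?e (Id \<C> X) = Id \<C> X"
    by (rule H.linear_maps_homog_eq[OF Comp_linear_right[OF X X X e] linear_maps_id H.module left Id])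
  then have "?e = Id \<C> X" using Id_right[OF X X e] by simp
  then show ?thesis using H.component_homog[OF Id, of 0] by simp
qed

section \<open>Opposite dg categories\<close>

lemma dg_op_simps [simp]:
  "Obj (dg_op \<C>) = Obj \<C>" "Hom (dg_op \<C>) X Y = Hom \<C> Y X" "Id (dg_op \<C>) = Id \<C>"
  by (simp_all add: dg_op_def)

lemma op_Comp:
  assumes o: "X \<in> Obj \<C>" "Y \<in> Obj \<C>" "Z \<in> Obj \<C>"
  shows "bilinear_map K (Hom \<C> Z Y) (Hom \<C> Y X) (Hom \<C> Z X) (Comp (dg_op \<C>) X Y Z)"
    and "\<lbrakk>b \<in> homog (Hom \<C> Z Y) p; a \<in> homog (Hom \<C> Y X) q\<rbrakk> \<Longrightarrow>
      Comp (dg_op \<C>) X Y Z b a = ksign (Hom \<C> Z X) (q * p) (Comp \<C> Z Y X a b)"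
proof -
  have h: "bilinear_map K (Hom \<C> Z Y) (Hom \<C> Y X) (Hom \<C> Z X)
      (\<lambda>b a. ksign (Hom \<C> Z X) (q * p) (Comp \<C> Z Y X a b))" for p q
    by (intro bilinear_mapI linear_maps_ksign_map Hom_module Comp_linear_left
        Comp_linear_right[simplified] o)
  have eq: "Comp (dg_op \<C>) X Y Z = (\<lambda>b a. graded_extend (Hom \<C> Z X) (Hom \<C> Z Y)
      (\<lambda>p b. graded_extend (Hom \<C> Z X) (Hom \<C> Y X)
        (\<lambda>q a. ksign (Hom \<C> Z X) (q * p) (Comp \<C> Z Y X a b)) a) b)"
    by (simp add: dg_op_def fun_eq_iff)
  note * = graded_extend_bilinear[OF Hom_graded[OF o(3,2)] Hom_graded[OF o(2,1)] Hom_module[OF o(3,1)], of "\<lambda>p q b a. ksign (Hom \<C> Z X) (q * p) (Comp \<C> Z Y X a b)", OF h]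
  show "bilinear_map K (Hom \<C> Z Y) (Hom \<C> Y X) (Hom \<C> Z X) (Comp (dg_op \<C>) X Y Z)"
    unfolding eq by (rule *(1))
  show "Comp (dg_op \<C>) X Y Z b a = ksign (Hom \<C> Z X) (q * p) (Comp \<C> Z Y X a b)"
    if "b \<in> homog (Hom \<C> Z Y) p" "a \<in> homog (Hom \<C> Y X) q"
    unfolding eq by (rule *(2)[OF that])
qed

text \<open>Associativity: both sides acquire the sign \<open>qp + rp + rq\<close> when the factors have degrees \<open>p\<close>, \<open>q\<close> and
  \<open>r\<close>. In the Leibniz rule the two summands change places.\<close>

lemma op_dg_category: "dg_category K (dg_op \<C>)"
proof (rule dg_categoryI[where G = "\<lambda>X Y. homog (Hom \<C> Y X)"], unfold dg_op_simps)
  fix W X Y Z f g h p q r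
  assume o: "W \<in> Obj \<C>" "X \<in> Obj \<C>" "Y \<in> Obj \<C>" "Z \<in> Obj \<C>"
    and f: "f \<in> homog (Hom \<C> X W) r" and g: "g \<in> homog (Hom \<C> Y X) q" and h: "h \<in> homog (Hom \<C> Z Y) p"
  interpret ZW: graded_module K "Hom \<C> Z W" by (intro Hom_graded o)
  interpret ZX: graded_module K "Hom \<C> Z X" by (intro Hom_graded o)
  interpret YW: graded_module K "Hom \<C> Y W" by (intro Hom_graded o)
  note c = Hom_carrier[OF o(2,1) f] Hom_carrier[OF o(3,2) g] Hom_carrier[OF o(4,3) h]
  have gh: "Comp \<C> Z Y X g h \<in> homog (Hom \<C> Z X) (q + p)" and fg: "Comp \<C> Y X W f g \<in> homog (Hom \<C> Y W) (r + q)"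
    using o f g h Comp_degree by auto
  have "Comp (dg_op \<C>) W X Z (Comp (dg_op \<C>) X Y Z h g) f
      = ksign (Hom \<C> Z W) (r * (q + p) + q * p) (Comp \<C> Z X W f (Comp \<C> Z Y X g h))"
    unfolding op_Comp(2)[OF o(2,3,4) h g] op_Comp(2)[OF o(1,2,4) ZX.ksign_homog[OF gh] f]
    using o c by (simp add: Comp_ksign_right Comp_closed ZW.ksign_ksign)
  moreover have "Comp (dg_op \<C>) W Y Z h (Comp (dg_op \<C>) W X Y g f)
      = ksign (Hom \<C> Z W) ((r + q) * p + r * q) (Comp \<C> Z Y W (Comp \<C> Y X W f g) h)"
    unfolding op_Comp(2)[OF o(1,2,3) g f] op_Comp(2)[OF o(1,3,4) h YW.ksign_homog[OF fg]]
    using o c by (simp add: Comp_ksign_left Comp_closed ZW.ksign_ksign)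
  ultimately show "Comp (dg_op \<C>) W X Z (Comp (dg_op \<C>) X Y Z h g) f
      = Comp (dg_op \<C>) W Y Z h (Comp (dg_op \<C>) W X Y g f)"
    using o c by (simp add: Comp_assoc algebra_simps)
next
  fix X Y f p assume o: "X \<in> Obj \<C>" "Y \<in> Obj \<C>" and f: "f \<in> homog (Hom \<C> Y X) p"
  show "Comp (dg_op \<C>) X Y Y (Id \<C> Y) f = f" "Comp (dg_op \<C>) X X Y f (Id \<C> X) = f"
    using op_Comp(2)[OF o(1,2,2) Id_homog[OF o(2)] f] op_Comp(2)[OF o(1,1,2) f Id_homog[OF o(1)]]
      Hom_carrier[OF o(2,1) f] Id_left[OF o(2,1)] Id_right[OF o(2,1)]
    by simp_all
next
  fix X Y Z f g p q
  assume o: "X \<in> Obj \<C>" "Y \<in> Obj \<C>" "Z \<in> Obj \<C>"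
    and g: "g \<in> homog (Hom \<C> Z Y) p" and f: "f \<in> homog (Hom \<C> Y X) q"
  interpret ZX: dg_module K "Hom \<C> Z X" by (intro Hom_dg_module o)
  note mod = ZX.graded.module
  have c: "f \<in> carrier (Hom \<C> Y X)" "g \<in> carrier (Hom \<C> Z Y)" using Hom_carrier o f g by auto
  note d = dif_closed[OF o(2,1) c(1)] dif_closed[OF o(3,2) c(2)]
  have fg: "Comp \<C> Z Y X f g \<in> homog (Hom \<C> Z X) (q + p)" using Comp_degree o f g by blast
  show "Comp (dg_op \<C>) X Y Z g f \<in> homog (Hom \<C> Z X) (p + q)"
    unfolding op_Comp(2)[OF o g f] using ZX.graded.ksign_homog[OF fg] by (simp add: add.commute)
  have "dif (Hom \<C> Z X) (Comp (dg_op \<C>) X Y Z g f)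
      = ksign (Hom \<C> Z X) (q * p) (Comp \<C> Z Y X (dif (Hom \<C> Y X) f) g)
      \<oplus>\<^bsub>Hom \<C> Z X\<^esub> ksign (Hom \<C> Z X) (q * p + q) (Comp \<C> Z Y X f (dif (Hom \<C> Z Y) g))"
    unfolding op_Comp(2)[OF o g f] linear_maps_ksign[OF ZX.dif_linear mod mod Hom_carrier[OF o(3,1) fg]]
      dif_Comp[OF o(3,2,1) f c(2)]
    using o c d by (simp add: ZX.ksign_add Comp_closed ZX.ksign_ksign)
  moreover have "Comp (dg_op \<C>) X Y Z (dif (Hom \<C> Z Y) g) f
      = ksign (Hom \<C> Z X) (q * p + q) (Comp \<C> Z Y X f (dif (Hom \<C> Z Y) g))"
    unfolding op_Comp(2)[OF o dif_homog[OF o(3,2) g] f] by (simp add: algebra_simps)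
  moreover have "ksign (Hom \<C> Z X) p (Comp (dg_op \<C>) X Y Z g (dif (Hom \<C> Y X) f))
      = ksign (Hom \<C> Z X) (q * p) (Comp \<C> Z Y X (dif (Hom \<C> Y X) f) g)"
    unfolding op_Comp(2)[OF o g dif_homog[OF o(2,1) f]]
    using o c d by (simp add: ZX.ksign_ksign Comp_closed) (rule ksign_parity, simp add: algebra_simps)
  ultimately show "dif (Hom \<C> Z X) (Comp (dg_op \<C>) X Y Z g f) =
      Comp (dg_op \<C>) X Y Z (dif (Hom \<C> Z Y) g) f
      \<oplus>\<^bsub>Hom \<C> Z X\<^esub> ksign (Hom \<C> Z X) p (Comp (dg_op \<C>) X Y Z g (dif (Hom \<C> Y X) f))"
    using o c d by (simp add: ZX.M.a_comm Comp_closed)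
qed (auto intro: is_cring Hom_dg_module homog_generators_homog[OF Hom_dg_module] Id_closed op_Comp(1))

end

section \<open>Tensor products of dg categories\<close>

lemma dg_tensor_cat_simps:
  "Obj (dg_tensor_cat K \<C> \<D>) = Obj \<C> \<times> Obj \<D>"
  "Hom (dg_tensor_cat K \<C> \<D>) (X, Y) (X', Y') = dg_tensor K (Hom \<C> X X') (Hom \<D> Y Y')"
  "Id (dg_tensor_cat K \<C> \<D>) (X, Y) = pure_tensor K (Hom \<C> X X) (Hom \<D> Y Y) (Id \<C> X) (Id \<D> Y)"
  by (simp_all add: dg_tensor_cat_def)

locale dg_category_pair = C: dg_category K \<C> + D: dg_category K \<D>
  for K :: "('k, 'r) ring_scheme" and \<C> :: "('o, 'k, 'h) dg_cat" and \<D> :: "('p, 'k, 'i) dg_cat"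
begin

abbreviation "\<T> \<equiv> dg_tensor_cat K \<C> \<D>"

lemma Hom_pair:
  "\<lbrakk>X1 \<in> Obj \<C>; X2 \<in> Obj \<C>; Y1 \<in> Obj \<D>; Y2 \<in> Obj \<D>\<rbrakk> \<Longrightarrow>
    dg_module_pair K (Hom \<C> X1 X2) (Hom \<D> Y1 Y2)"
  by (intro dg_module_pair.intro C.Hom_dg_module D.Hom_dg_module)

definition generators :: "'o \<times> 'p \<Rightarrow> 'o \<times> 'p \<Rightarrow> int \<Rightarrow> ('h \<times> 'i \<Rightarrow>\<^sub>0 int) set set"
  where "generators U V n = {pure_tensor K (Hom \<C> (fst U) (fst V)) (Hom \<D> (snd U) (snd V)) a b | a b.
      \<exists>p q. p + q = n \<and> a \<in> homog (Hom \<C> (fst U) (fst V)) p \<and> b \<in> homog (Hom \<D> (snd U) (snd V)) q}"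

text \<open>The composition formula \<open>W\<close> is linear in each of the four tensor factors. The inner lift is bilinear in
  the factors of the right tensor, with those of the left one as parameters; the outer lift is then
  bilinear in the factors of the left tensor.\<close>

lemma tensor_Comp:
  assumes X: "X1 \<in> Obj \<C>" "X2 \<in> Obj \<C>" "X3 \<in> Obj \<C>" and Y: "Y1 \<in> Obj \<D>" "Y2 \<in> Obj \<D>" "Y3 \<in> Obj \<D>"
  shows "bilinear_map K (Hom \<T> (X2, Y2) (X3, Y3)) (Hom \<T> (X1, Y1) (X2, Y2)) (Hom \<T> (X1, Y1) (X3, Y3))
      (Comp \<T> (X1, Y1) (X2, Y2) (X3, Y3))" (is ?bilinear)
    and "\<lbrakk>a1 \<in> carrier (Hom \<C> X2 X3); b1 \<in> homog (Hom \<D> Y2 Y3) q;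
        a2 \<in> homog (Hom \<C> X1 X2) p; b2 \<in> carrier (Hom \<D> Y1 Y2)\<rbrakk> \<Longrightarrow>
      Comp \<T> (X1, Y1) (X2, Y2) (X3, Y3)
          (pure_tensor K (Hom \<C> X2 X3) (Hom \<D> Y2 Y3) a1 b1) (pure_tensor K (Hom \<C> X1 X2) (Hom \<D> Y1 Y2) a2 b2)
        = ksign (Hom \<T> (X1, Y1) (X3, Y3)) (p * q) (pure_tensor K (Hom \<C> X1 X3) (Hom \<D> Y1 Y3)
            (Comp \<C> X1 X2 X3 a1 a2) (Comp \<D> Y1 Y2 Y3 b1 b2))" (is "_ \<Longrightarrow> _ \<Longrightarrow> _ \<Longrightarrow> _ \<Longrightarrow> ?formula")
proof -
  interpret P12: dg_module_pair K "Hom \<C> X1 X2" "Hom \<D> Y1 Y2" by (intro Hom_pair X Y)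
  interpret P23: dg_module_pair K "Hom \<C> X2 X3" "Hom \<D> Y2 Y3" by (intro Hom_pair X Y)
  interpret P13: dg_module_pair K "Hom \<C> X1 X3" "Hom \<D> Y1 Y3" by (intro Hom_pair X Y)
  let ?T = "dg_tensor K (Hom \<C> X1 X3) (Hom \<D> Y1 Y3)"
  note T = P13.D_module and gC = C.Hom_graded[OF X(1,2)] and gD = D.Hom_graded[OF Y(2,3)]
  note mod = C.Hom_module[OF X(1,2)] C.Hom_module[OF X(2,3)] D.Hom_module[OF Y(1,2)] D.Hom_module[OF Y(2,3)]
  define h where "h a1 b2 p q a2 b1 = ksign ?T (p * q) (pure_tensor K (Hom \<C> X1 X3) (Hom \<D> Y1 Y3)
      (Comp \<C> X1 X2 X3 a1 a2) (Comp \<D> Y1 Y2 Y3 b1 b2))" for a1 b2 and p q :: int and a2 b1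
  define W where "W a1 b1 a2 b2 = graded_extend ?T (Hom \<C> X1 X2) (\<lambda>p a2.
      graded_extend ?T (Hom \<D> Y2 Y3) (\<lambda>q b1. h a1 b2 p q a2 b1) b1) a2" for a1 b1 a2 b2
  define L where "L a1 b1 s = tensor_lift ?T (W a1 b1) s" for a1 b1 s
  have Comp: "Comp \<T> (X1, Y1) (X2, Y2) (X3, Y3) t s = tensor_lift ?T (\<lambda>a1 b1. L a1 b1 s) t" for t s
    by (simp add: dg_tensor_cat_def Let_def L_def W_def[abs_def] h_def[abs_def])
  note lin = linear_maps_ksign_map[OF T]
    linear_maps_compose[OF C.Comp_linear_left[OF X] P13.pure_linear_left]
    linear_maps_compose[OF C.Comp_linear_right[OF X] P13.pure_linear_left]
    linear_maps_compose[OF D.Comp_linear_left[OF Y] P13.pure_linear_right]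
    linear_maps_compose[OF D.Comp_linear_right[OF Y] P13.pure_linear_right]
  note cl = C.Comp_closed[OF X] D.Comp_closed[OF Y]
  have h1: "(\<lambda>a1. h a1 b2 p q a2 b1) \<in> linear_maps K (Hom \<C> X2 X3) ?T"
    if "a2 \<in> carrier (Hom \<C> X1 X2)" "b1 \<in> carrier (Hom \<D> Y2 Y3)" "b2 \<in> carrier (Hom \<D> Y1 Y2)" for p q a2 b1 b2
    unfolding h_def using that by (intro lin cl)
  have h2: "(\<lambda>b2. h a1 b2 p q a2 b1) \<in> linear_maps K (Hom \<D> Y1 Y2) ?T"
    if "a2 \<in> carrier (Hom \<C> X1 X2)" "b1 \<in> carrier (Hom \<D> Y2 Y3)" "a1 \<in> carrier (Hom \<C> X2 X3)" for p q a2 b1 a1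
    unfolding h_def using that by (intro lin cl)
  have hb: "bilinear_map K (Hom \<C> X1 X2) (Hom \<D> Y2 Y3) ?T (h a1 b2 p q)"
    if "a1 \<in> carrier (Hom \<C> X2 X3)" "b2 \<in> carrier (Hom \<D> Y1 Y2)" for p q a1 b2
    unfolding h_def using that by (intro bilinear_mapI lin cl)
  note ge = graded_extend_bilinear[OF gC gD T, OF hb]
  have W_bilinear: "bilinear_map K (Hom \<C> X1 X2) (Hom \<D> Y2 Y3) ?T (\<lambda>a2 b1. W a1 b1 a2 b2)"
    if "a1 \<in> carrier (Hom \<C> X2 X3)" "b2 \<in> carrier (Hom \<D> Y1 Y2)" for a1 b2
    unfolding W_def by (rule ge(1)[OF that])
  have W_a1: "(\<lambda>a1. W a1 b1 a2 b2) \<in> linear_maps K (Hom \<C> X2 X3) ?T"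
    if "a2 \<in> carrier (Hom \<C> X1 X2)" "b1 \<in> carrier (Hom \<D> Y2 Y3)" "b2 \<in> carrier (Hom \<D> Y1 Y2)" for a2 b1 b2
    unfolding W_def using that
    by (intro graded_module.graded_extend_parameter[OF gC] graded_module.graded_extend_parameter[OF gD] mod T h1)
  have W_b2: "(\<lambda>b2. W a1 b1 a2 b2) \<in> linear_maps K (Hom \<D> Y1 Y2) ?T"
    if "a2 \<in> carrier (Hom \<C> X1 X2)" "b1 \<in> carrier (Hom \<D> Y2 Y3)" "a1 \<in> carrier (Hom \<C> X2 X3)" for a2 b1 a1
    unfolding W_def using that
    by (intro graded_module.graded_extend_parameter[OF gC] graded_module.graded_extend_parameter[OF gD] mod T h2)
  have W12: "bilinear_map K (Hom \<C> X1 X2) (Hom \<D> Y1 Y2) ?T (W a1 b1)"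
    if "a1 \<in> carrier (Hom \<C> X2 X3)" "b1 \<in> carrier (Hom \<D> Y2 Y3)" for a1 b1
    using that by (intro bilinear_mapI W_b2 bilinear_map_left[OF W_bilinear])
  have L12: "L a1 b1 \<in> linear_maps K (dg_tensor K (Hom \<C> X1 X2) (Hom \<D> Y1 Y2)) ?T"
    if "a1 \<in> carrier (Hom \<C> X2 X3)" "b1 \<in> carrier (Hom \<D> Y2 Y3)" for a1 b1
    unfolding L_def by (rule P12.tensor_lift_linear(1)[OF T W12[OF that]])
  have L23: "bilinear_map K (Hom \<C> X2 X3) (Hom \<D> Y2 Y3) ?T (\<lambda>a1 b1. L a1 b1 s)"
    if "s \<in> carrier (dg_tensor K (Hom \<C> X1 X2) (Hom \<D> Y1 Y2))" for s
    unfolding L_def using that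
    by (intro bilinear_mapI P12.tensor_lift_parameter mod T W_a1 bilinear_map_right[OF W_bilinear])
  show ?bilinear
    unfolding dg_tensor_cat_simps Comp
    by (intro bilinear_mapI P23.tensor_lift_linear(1)[OF T L23]
        P23.tensor_lift_parameter[OF P12.D_module T] L12)
  show ?formula if a: "a1 \<in> carrier (Hom \<C> X2 X3)" "b1 \<in> homog (Hom \<D> Y2 Y3) q"
        "a2 \<in> homog (Hom \<C> X1 X2) p" "b2 \<in> carrier (Hom \<D> Y1 Y2)"
  proof -
    have c: "b1 \<in> carrier (Hom \<D> Y2 Y3)" "a2 \<in> carrier (Hom \<C> X1 X2)"
      using D.Hom_carrier[OF Y(2,3) a(2)] C.Hom_carrier[OF X(1,2) a(3)] .
    have "Comp \<T> (X1, Y1) (X2, Y2) (X3, Y3)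
          (pure_tensor K (Hom \<C> X2 X3) (Hom \<D> Y2 Y3) a1 b1) (pure_tensor K (Hom \<C> X1 X2) (Hom \<D> Y1 Y2) a2 b2)
        = L a1 b1 (pure_tensor K (Hom \<C> X1 X2) (Hom \<D> Y1 Y2) a2 b2)"
      unfolding Comp using a c by (intro P23.tensor_lift_linear(2)[OF T L23] P12.pure_carrier)
    also have "\<dots> = W a1 b1 a2 b2"
      unfolding L_def using a c by (intro P12.tensor_lift_linear(2)[OF T W12])
    also have "\<dots> = h a1 b2 p q a2 b1"
      unfolding W_def by (rule ge(2)[OF a(1,4) a(3,2)])
    finally show ?thesis by (simp add: h_def dg_tensor_cat_simps)
  qed
qed

lemma tensor_generators:
  assumes "U \<in> Obj \<T>" "V \<in> Obj \<T>"
  shows "homog_generators (Hom \<T> U V) (generators U V)"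
proof -
  obtain X Y X' Y' where UV: "U = (X, Y)" "V = (X', Y')" by fastforce
  interpret P: dg_module_pair K "Hom \<C> X X'" "Hom \<D> Y Y'"
    using assms by (intro Hom_pair) (auto simp: UV dg_tensor_cat_simps)
  have "generators U V = P.homog_pures"
    by (auto simp: generators_def UV P.homog_pures_def fun_eq_iff)
  then show ?thesis
    unfolding homog_generators_def UV dg_tensor_cat_simps
    using P.homog_pures_closed P.homog_D by simp
qed

text \<open>With left factors \<open>a\<^sub>i\<close> of degrees \<open>p\<^sub>i\<close> and right factors \<open>b\<^sub>i\<close> of degrees \<open>q\<^sub>i\<close>, both ways of bracketing
  three pure tensors give the sign \<open>p\<^sub>2 q\<^sub>1 + p\<^sub>3 q\<^sub>1 + p\<^sub>3 q\<^sub>2\<close>. In the Leibniz rule the four summands, one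
  for each factor that is differentiated, are matched separately.\<close>

lemma tensor_dg_category: "dg_category K \<T>"
proof (rule dg_categoryI[where G = generators])
  show "cring K" by (rule C.is_cring)
  show "dg_module K (Hom \<T> U V)" if "U \<in> Obj \<T>" "V \<in> Obj \<T>" for U V
  proof -
    obtain X Y X' Y' where UV: "U = (X, Y)" "V = (X', Y')" by fastforce
    interpret P: dg_module_pair K "Hom \<C> X X'" "Hom \<D> Y Y'"
      using that by (intro Hom_pair) (auto simp: UV dg_tensor_cat_simps)
    show ?thesis unfolding UV dg_tensor_cat_simps by (rule P.tensor_dg_module)
  qed
  show "homog_generators (Hom \<T> U V) (generators U V)" if "U \<in> Obj \<T>" "V \<in> Obj \<T>" for U V
    using that by (rule tensor_generators)
  show "Id \<T> U \<in> carrier (Hom \<T> U U)" if "U \<in> Obj \<T>" for U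
  proof -
    obtain X Y where U: "U = (X, Y)" by fastforce
    interpret P: dg_module_pair K "Hom \<C> X X" "Hom \<D> Y Y"
      using that by (intro Hom_pair) (auto simp: U dg_tensor_cat_simps)
    show ?thesis
      unfolding U dg_tensor_cat_simps using that
      by (intro P.pure_carrier C.Id_closed D.Id_closed) (auto simp: U dg_tensor_cat_simps)
  qed
  show "bilinear_map K (Hom \<T> V W) (Hom \<T> U V) (Hom \<T> U W) (Comp \<T> U V W)"
    if "U \<in> Obj \<T>" "V \<in> Obj \<T>" "W \<in> Obj \<T>" for U V W
    using that tensor_Comp(1) by (cases U; cases V; cases W) (auto simp: dg_tensor_cat_simps(1))
next
  fix U1 U2 U3 U4 f g h p q r
  assume U: "U1 \<in> Obj \<T>" "U2 \<in> Obj \<T>" "U3 \<in> Obj \<T>" "U4 \<in> Obj \<T>"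
    and fgh: "f \<in> generators U1 U2 r" "g \<in> generators U2 U3 q" "h \<in> generators U3 U4 p"
  obtain X1 Y1 X2 Y2 X3 Y3 X4 Y4 where UX: "U1 = (X1, Y1)" "U2 = (X2, Y2)" "U3 = (X3, Y3)" "U4 = (X4, Y4)"
    by fastforce
  have X: "X1 \<in> Obj \<C>" "X2 \<in> Obj \<C>" "X3 \<in> Obj \<C>" "X4 \<in> Obj \<C>"
    and Y: "Y1 \<in> Obj \<D>" "Y2 \<in> Obj \<D>" "Y3 \<in> Obj \<D>" "Y4 \<in> Obj \<D>"
    using U by (auto simp: UX dg_tensor_cat_simps)
  interpret P14: dg_module_pair K "Hom \<C> X1 X4" "Hom \<D> Y1 Y4" by (intro Hom_pair X Y)
  interpret P13: dg_module_pair K "Hom \<C> X1 X3" "Hom \<D> Y1 Y3" by (intro Hom_pair X Y)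
  interpret P24: dg_module_pair K "Hom \<C> X2 X4" "Hom \<D> Y2 Y4" by (intro Hom_pair X Y)
  interpret P12: dg_module_pair K "Hom \<C> X1 X2" "Hom \<D> Y1 Y2" by (intro Hom_pair X Y)
  interpret P34: dg_module_pair K "Hom \<C> X3 X4" "Hom \<D> Y3 Y4" by (intro Hom_pair X Y)
  interpret T14: module K "dg_tensor K (Hom \<C> X1 X4) (Hom \<D> Y1 Y4)" by (rule P14.D_module)
  obtain a3 b3 p3 q3 where f: "f = P12.pure a3 b3" "a3 \<in> homog (Hom \<C> X1 X2) p3" "b3 \<in> homog (Hom \<D> Y1 Y2) q3"
    using fgh(1) by (auto simp: generators_def UX)
  obtain a2 b2 p2 q2 where g: "g = pure_tensor K (Hom \<C> X2 X3) (Hom \<D> Y2 Y3) a2 b2"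
      "a2 \<in> homog (Hom \<C> X2 X3) p2" "b2 \<in> homog (Hom \<D> Y2 Y3) q2"
    using fgh(2) by (auto simp: generators_def UX)
  obtain a1 b1 p1 q1 where h: "h = P34.pure a1 b1" "a1 \<in> homog (Hom \<C> X3 X4) p1" "b1 \<in> homog (Hom \<D> Y3 Y4) q1"
    using fgh(3) by (auto simp: generators_def UX)
  have ac: "a1 \<in> carrier (Hom \<C> X3 X4)" "a2 \<in> carrier (Hom \<C> X2 X3)" "a3 \<in> carrier (Hom \<C> X1 X2)"
    using f g h X C.Hom_carrier by auto
  have bc: "b1 \<in> carrier (Hom \<D> Y3 Y4)" "b2 \<in> carrier (Hom \<D> Y2 Y3)" "b3 \<in> carrier (Hom \<D> Y1 Y2)"
    using f g h Y D.Hom_carrier by auto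
  have deg: "Comp \<C> X1 X2 X3 a2 a3 \<in> homog (Hom \<C> X1 X3) (p2 + p3)"
    "Comp \<D> Y2 Y3 Y4 b1 b2 \<in> homog (Hom \<D> Y2 Y4) (q1 + q2)"
    using C.Comp_degree[OF X(1,2,3) g(2) f(2)] D.Comp_degree[OF Y(2,3,4) h(3) g(3)] .
  note l24 = bilinear_map_left[OF tensor_Comp(1)[OF X(1,2,4) Y(1,2,4)]]
  note r13 = bilinear_map_right[OF tensor_Comp(1)[OF X(1,3,4) Y(1,3,4)]]
  note ks = linear_maps_ksign[OF l24[unfolded dg_tensor_cat_simps] P24.D_module P14.D_module]
    linear_maps_ksign[OF r13[unfolded dg_tensor_cat_simps] P13.D_module P14.D_module]
  note cl = C.Comp_closed[OF X(1,2,3)] D.Comp_closed[OF Y(1,2,3)] C.Comp_closed[OF X(2,3,4)]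
    D.Comp_closed[OF Y(2,3,4)] C.Comp_closed[OF X(1,2,4)] D.Comp_closed[OF Y(1,2,4)]
    C.Comp_closed[OF X(1,3,4)] D.Comp_closed[OF Y(1,3,4)]
  have "Comp \<T> U1 U2 U4 (Comp \<T> U2 U3 U4 h g) f = ksign P14.D (p2 * q1 + p3 * (q1 + q2))
      (P14.pure (Comp \<C> X1 X2 X4 (Comp \<C> X2 X3 X4 a1 a2) a3) (Comp \<D> Y1 Y2 Y4 (Comp \<D> Y2 Y3 Y4 b1 b2) b3))"
    unfolding f g h UX using f g h ac bc deg X Y
    by (simp add: tensor_Comp(2) dg_tensor_cat_simps ks cl T14.ksign_ksign)
  moreover have "Comp \<T> U1 U3 U4 h (Comp \<T> U1 U2 U3 g f) = ksign P14.D (p3 * q2 + (p2 + p3) * q1)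
      (P14.pure (Comp \<C> X1 X3 X4 a1 (Comp \<C> X1 X2 X3 a2 a3)) (Comp \<D> Y1 Y3 Y4 b1 (Comp \<D> Y1 Y2 Y3 b2 b3)))"
    unfolding f g h UX using f g h ac bc deg X Y
    by (simp add: tensor_Comp(2) dg_tensor_cat_simps ks cl T14.ksign_ksign)
  ultimately show "Comp \<T> U1 U2 U4 (Comp \<T> U2 U3 U4 h g) f = Comp \<T> U1 U3 U4 h (Comp \<T> U1 U2 U3 g f)"
    using X Y ac bc by (simp add: C.Comp_assoc D.Comp_assoc algebra_simps)
next
  fix U V f n assume U: "U \<in> Obj \<T>" "V \<in> Obj \<T>" and f: "f \<in> generators U V n"
  obtain X Y X' Y' where UX: "U = (X, Y)" "V = (X', Y')" by fastforce
  have X: "X \<in> Obj \<C>" "X' \<in> Obj \<C>" and Y: "Y \<in> Obj \<D>" "Y' \<in> Obj \<D>"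
    using U by (auto simp: UX dg_tensor_cat_simps)
  obtain a b p q where ab: "f = pure_tensor K (Hom \<C> X X') (Hom \<D> Y Y') a b"
      "a \<in> homog (Hom \<C> X X') p" "b \<in> homog (Hom \<D> Y Y') q"
    using f by (auto simp: generators_def UX)
  have c: "a \<in> carrier (Hom \<C> X X')" "b \<in> carrier (Hom \<D> Y Y')"
    using ab X Y C.Hom_carrier D.Hom_carrier by auto
  show "Comp \<T> U V V (Id \<T> V) f = f" "Comp \<T> U U V f (Id \<T> U) = f"
    unfolding UX ab(1)
    using ab c X Y tensor_Comp(2)[OF X(1,2,2) Y(1,2,2) C.Id_closed[OF X(2)] D.Id_homog[OF Y(2)] ab(2) c(2)]
      tensor_Comp(2)[OF X(1,1,2) Y(1,1,2) c(1) ab(3) C.Id_homog[OF X(1)] D.Id_closed[OF Y(1)]]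
    by (simp_all add: dg_tensor_cat_simps(3) C.Id_left C.Id_right D.Id_left D.Id_right)
next
  fix U1 U2 U3 f g m n
  assume U: "U1 \<in> Obj \<T>" "U2 \<in> Obj \<T>" "U3 \<in> Obj \<T>"
    and fg: "g \<in> generators U2 U3 m" "f \<in> generators U1 U2 n"
  obtain X1 Y1 X2 Y2 X3 Y3 where UX: "U1 = (X1, Y1)" "U2 = (X2, Y2)" "U3 = (X3, Y3)" by fastforce
  have X: "X1 \<in> Obj \<C>" "X2 \<in> Obj \<C>" "X3 \<in> Obj \<C>" and Y: "Y1 \<in> Obj \<D>" "Y2 \<in> Obj \<D>" "Y3 \<in> Obj \<D>"
    using U by (auto simp: UX dg_tensor_cat_simps)
  interpret P12: dg_module_pair K "Hom \<C> X1 X2" "Hom \<D> Y1 Y2" by (intro Hom_pair X Y)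
  interpret P23: dg_module_pair K "Hom \<C> X2 X3" "Hom \<D> Y2 Y3" by (intro Hom_pair X Y)
  interpret P13: dg_module_pair K "Hom \<C> X1 X3" "Hom \<D> Y1 Y3" by (intro Hom_pair X Y)
  interpret T12: module K P12.D by (rule P12.D_module)
  interpret T23: module K P23.D by (rule P23.D_module)
  interpret T13: graded_module K "dg_tensor K (Hom \<C> X1 X3) (Hom \<D> Y1 Y3)" by (rule P13.D_graded)
  obtain a2 b2 p2 q2 where f: "f = P12.pure a2 b2" "a2 \<in> homog (Hom \<C> X1 X2) p2" "b2 \<in> homog (Hom \<D> Y1 Y2) q2" "p2 + q2 = n"
    using fg(2) by (auto simp: generators_def UX)
  obtain a1 b1 p1 q1 where g: "g = P23.pure a1 b1" "a1 \<in> homog (Hom \<C> X2 X3) p1" "b1 \<in> homog (Hom \<D> Y2 Y3) q1" "p1 + q1 = m"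
    using fg(1) by (auto simp: generators_def UX)
  have c: "a1 \<in> carrier (Hom \<C> X2 X3)" "a2 \<in> carrier (Hom \<C> X1 X2)"
      "b1 \<in> carrier (Hom \<D> Y2 Y3)" "b2 \<in> carrier (Hom \<D> Y1 Y2)"
    using f g X Y C.Hom_carrier D.Hom_carrier by auto
  note deg = C.Comp_degree[OF X g(2) f(2)] D.Comp_degree[OF Y g(3) f(3)]
  note Cp = tensor_Comp(2)[OF X Y, unfolded dg_tensor_cat_simps]
  have m: "m + n = (p1 + p2) + (q1 + q2)" using f g by simp
  show "Comp \<T> U1 U2 U3 g f \<in> homog (Hom \<T> U1 U3) (m + n)"
    unfolding f(1) g(1) UX dg_tensor_cat_simps Cp[OF c(1) g(3) f(2) c(4)] m
    by (intro T13.ksign_homog P13.pure_homog deg)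
  note cl = C.Comp_closed[OF X] D.Comp_closed[OF Y]
  note dc = C.dif_closed[OF X(1,2) c(2)] C.dif_closed[OF X(2,3) c(1)]
    D.dif_closed[OF Y(1,2) c(4)] D.dif_closed[OF Y(2,3) c(3)]
  note dh = C.dif_homog[OF X(1,2) f(2)] C.dif_homog[OF X(2,3) g(2)]
    D.dif_homog[OF Y(1,2) f(3)] D.dif_homog[OF Y(2,3) g(3)]
  note l = bilinear_map_left[OF tensor_Comp(1)[OF X Y], unfolded dg_tensor_cat_simps]
  note r = bilinear_map_right[OF tensor_Comp(1)[OF X Y], unfolded dg_tensor_cat_simps]
  note lk = linear_maps_ksign[OF l P23.D_module P13.D_module]
  note rk = linear_maps_ksign[OF r P12.D_module P13.D_module]
  let ?s = "ksign P13.D"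
  let ?A = "P13.pure (Comp \<C> X1 X2 X3 (dif (Hom \<C> X2 X3) a1) a2) (Comp \<D> Y1 Y2 Y3 b1 b2)"
  let ?B = "P13.pure (Comp \<C> X1 X2 X3 a1 (dif (Hom \<C> X1 X2) a2)) (Comp \<D> Y1 Y2 Y3 b1 b2)"
  let ?C = "P13.pure (Comp \<C> X1 X2 X3 a1 a2) (Comp \<D> Y1 Y2 Y3 (dif (Hom \<D> Y2 Y3) b1) b2)"
  let ?D = "P13.pure (Comp \<C> X1 X2 X3 a1 a2) (Comp \<D> Y1 Y2 Y3 b1 (dif (Hom \<D> Y1 Y2) b2))"
  have ABCD: "?A \<in> carrier P13.D" "?B \<in> carrier P13.D" "?C \<in> carrier P13.D" "?D \<in> carrier P13.D"
    using c dc cl by auto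
  have d1: "dif P13.D (Comp \<T> U1 U2 U3 g f) =
      ?s (p2 * q1) (?A \<oplus>\<^bsub>P13.D\<^esub> ?s p1 ?B \<oplus>\<^bsub>P13.D\<^esub> ?s (p1 + p2) (?C \<oplus>\<^bsub>P13.D\<^esub> ?s q1 ?D))"
    unfolding f(1) g(1) UX Cp[OF c(1) g(3) f(2) c(4)] using c cl dc
    by (simp add: linear_maps_ksign[OF P13.dif_linear P13.D_module P13.D_module]
        P13.dif_pure[OF deg(1)] C.dif_Comp[OF X g(2) c(2)] D.dif_Comp[OF Y g(3) c(4)]
        linear_maps_add[OF P13.pure_linear_left] linear_maps_add[OF P13.pure_linear_right]
        P13.pure_ksign_left P13.pure_ksign_right P13.M.ksign_closed P13.N.ksign_closed)
  have d2: "Comp \<T> U1 U2 U3 (dif P23.D g) f = ?s (p2 * q1) ?A \<oplus>\<^bsub>P13.D\<^esub> ?s (p1 + p2 * (q1 + 1)) ?C"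
    unfolding f(1) g(1) UX using c dc cl
    by (simp add: P23.dif_pure[OF g(2)] linear_maps_add[OF l] lk Cp[OF dc(2) g(3) f(2) c(4)] Cp[OF c(1) dh(4) f(2) c(4)] T13.ksign_ksign)
  have d3: "Comp \<T> U1 U2 U3 g (dif P12.D f) = ?s ((p2 + 1) * q1) ?B \<oplus>\<^bsub>P13.D\<^esub> ?s (p2 + p2 * q1) ?D"
    unfolding f(1) g(1) UX using c dc cl
    by (simp add: P12.dif_pure[OF f(2)] linear_maps_add[OF r] rk Cp[OF c(1) g(3) dh(1) c(4)] Cp[OF c(1) g(3) f(2) dc(3)] T13.ksign_ksign)
  show "dif (Hom \<T> U1 U3) (Comp \<T> U1 U2 U3 g f) = Comp \<T> U1 U2 U3 (dif (Hom \<T> U2 U3) g) f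
      \<oplus>\<^bsub>Hom \<T> U1 U3\<^esub> ksign (Hom \<T> U1 U3) m (Comp \<T> U1 U2 U3 g (dif (Hom \<T> U1 U2) f))"
  proof -
    have sB: "?s (p2 * q1 + p1) ?B = ?s (m + (p2 + 1) * q1) ?B"
      and sC: "?s (p2 * q1 + (p1 + p2)) ?C = ?s (p1 + p2 * (q1 + 1)) ?C"
      and sD: "?s (p2 * q1 + (p1 + p2) + q1) ?D = ?s (m + (p2 + p2 * q1)) ?D"
      unfolding g(4)[symmetric] by (rule ksign_parity, simp add: algebra_simps)+
    have "?s (p2 * q1) (?A \<oplus>\<^bsub>P13.D\<^esub> ?s p1 ?B \<oplus>\<^bsub>P13.D\<^esub> ?s (p1 + p2) (?C \<oplus>\<^bsub>P13.D\<^esub> ?s q1 ?D))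
      = ?s (p2 * q1) ?A \<oplus>\<^bsub>P13.D\<^esub> ?s (p2 * q1 + p1) ?B \<oplus>\<^bsub>P13.D\<^esub>
        (?s (p2 * q1 + (p1 + p2)) ?C \<oplus>\<^bsub>P13.D\<^esub> ?s (p2 * q1 + (p1 + p2) + q1) ?D)"
      using ABCD by (simp add: T13.ksign_add T13.ksign_ksign add.assoc)
    also have "\<dots> = (?s (p2 * q1) ?A \<oplus>\<^bsub>P13.D\<^esub> ?s (p1 + p2 * (q1 + 1)) ?C) \<oplus>\<^bsub>P13.D\<^esub>
        ?s m (?s ((p2 + 1) * q1) ?B \<oplus>\<^bsub>P13.D\<^esub> ?s (p2 + p2 * q1) ?D)"
      unfolding sB sC sD using ABCD by (simp add: T13.ksign_add T13.ksign_ksign T13.M.a_ac)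
    finally show ?thesis
      using d1 d2 d3 by (simp add: UX dg_tensor_cat_simps)
  qed
qed

end

section \<open>Dg modules of maps\<close>

text \<open>Modules of maps are carved out of larger ones, possibly with a different record type. This relation
  transports inverses, signs and spans between the two.\<close>

definition subgroup_record :: "('m, 's) ring_scheme \<Rightarrow> ('m, 't) ring_scheme \<Rightarrow> bool"
  where "subgroup_record N P \<longleftrightarrow> abelian_group P \<and> additive_subgroup (carrier N) P \<and>
    zero N = zero P \<and> add N = add P"

lemma subgroup_record_abelian:
  assumes "subgroup_record N P"
  shows "abelian_group N"
proof -
  note S = assms[unfolded subgroup_record_def]
  interpret P: abelian_group P using S by blast
  have sg: "additive_subgroup (carrier N) P" using S by blast
  note cl = additive_subgroup_closed[OF sg] additive_subgroup_neg[OF sg P.abelian_group_axioms]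
  have c: "x \<in> carrier P" if "x \<in> carrier N" for x using cl(1) that by blast
  show ?thesis
  proof (rule abelian_groupI)
    show "\<exists>y\<in>carrier N. y \<oplus>\<^bsub>N\<^esub> x = \<zero>\<^bsub>N\<^esub>" if "x \<in> carrier N" for x
      using that S c by (intro bexI[of _ "\<ominus>\<^bsub>P\<^esub> x"]) (auto simp: P.l_neg cl)
  qed (use S c in \<open>auto simp: cl P.a_ac\<close>)
qed

lemma subgroup_record_neg:
  assumes S: "subgroup_record N P" and x: "x \<in> carrier N"
  shows "\<ominus>\<^bsub>N\<^esub> x = \<ominus>\<^bsub>P\<^esub> x"
proof -
  interpret N: abelian_group N by (rule subgroup_record_abelian[OF S])
  interpret P: abelian_group P using S by (simp add: subgroup_record_def)
  have c: "y \<in> carrier P" if "y \<in> carrier N" for y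
    using S that additive_subgroup_closed(1) unfolding subgroup_record_def by blast
  show ?thesis
    using N.l_neg[OF x] S x c N.a_inv_closed[OF x]
    by (intro P.minus_equality[symmetric]) (auto simp: subgroup_record_def)
qed

lemma subgroup_record_ksign:
  assumes "subgroup_record N P" "x \<in> carrier N"
  shows "ksign N n x = ksign P n x"
  using subgroup_record_neg[OF assms] by (simp add: ksign_def)

lemma subgroup_record_subgroup:
  assumes S: "subgroup_record N P" and J: "additive_subgroup J P" "J \<subseteq> carrier N"
  shows "additive_subgroup J N"
proof (rule additive_subgroup_make[OF subgroup_record_abelian[OF S] J(2)])
  have P: "abelian_group P" using S by (simp add: subgroup_record_def)
  show "\<zero>\<^bsub>N\<^esub> \<in> J" "\<And>x y. \<lbrakk>x \<in> J; y \<in> J\<rbrakk> \<Longrightarrow> x \<oplus>\<^bsub>N\<^esub> y \<in> J"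
    using S additive_subgroup_closed[OF J(1)] by (auto simp: subgroup_record_def)
  show "\<ominus>\<^bsub>N\<^esub> x \<in> J" if "x \<in> J" for x
    using subgroup_record_neg[OF S, of x] that J(2) additive_subgroup_neg[OF J(1) P] by auto
qed

lemma subgroup_record_span:
  assumes S: "subgroup_record N P" and "G \<subseteq> carrier N"
  shows "additive_span N G = additive_span P G"
  using assms additive_span_transfer[of N P G] additive_span_transfer[of P N G]
    subgroup_record_neg[OF S]
  by (auto simp: subgroup_record_def subset_iff)

lemma submodule_record:
  assumes P: "module K P" and S: "subgroup_record N P" and sm: "smult N = smult P"
    and closed: "\<And>k x. \<lbrakk>k \<in> carrier K; x \<in> carrier N\<rbrakk> \<Longrightarrow> k \<odot>\<^bsub>P\<^esub> x \<in> carrier N"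
  shows "module K N"
proof -
  interpret P: module K P by fact
  have c: "y \<in> carrier P" if "y \<in> carrier N" for y
    using S that additive_subgroup_closed(1) unfolding subgroup_record_def by blast
  have add: "add N = add P" using S by (simp add: subgroup_record_def)
  show ?thesis
    by (rule moduleI[OF P.is_cring subgroup_record_abelian[OF S]])
      (use closed in \<open>auto simp: sm add c P.smult_l_distr P.smult_r_distr P.smult_assoc1\<close>)
qed

lemma linear_maps_restrict:
  assumes "f \<in> linear_maps K P Q" "subgroup_record N P" "smult N = smult P"
  shows "f \<in> linear_maps K N Q"
proof -
  have "carrier N \<subseteq> carrier P" "add N = add P"
    using assms(2) additive_subgroup_closed(1) unfolding subgroup_record_def by blast+
  with assms(1,3) show ?thesis by (auto simp: linear_maps_def subset_iff Pi_iff)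
qed

lemma linear_maps_codomain:
  assumes "f \<in> linear_maps K M P" "subgroup_record N P" "smult N = smult P"
    and "\<And>x. x \<in> carrier M \<Longrightarrow> f x \<in> carrier N"
  shows "f \<in> linear_maps K M N"
  using assms by (auto simp: linear_maps_def subgroup_record_def)

text \<open>A submodule that is stable under the differential and spanned by homogeneous elements inherits the
  grading: the components in \<open>P\<close> separate the degrees.\<close>

lemma dg_submodule_record:
  fixes N :: "('k, 'n, 's) dg_mod_scheme" and P :: "('k, 'n, 't) dg_mod_scheme"
  assumes P: "dg_module K P" and S: "subgroup_record N P" and sm: "smult N = smult P"
    and closed: "\<And>k x. \<lbrakk>k \<in> carrier K; x \<in> carrier N\<rbrakk> \<Longrightarrow> k \<odot>\<^bsub>P\<^esub> x \<in> carrier N"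
    and homog: "\<And>n. homog N n = carrier N \<inter> homog P n"
    and span: "carrier N \<subseteq> additive_span P (\<Union>n. homog N n)"
    and dif: "dif N = dif P" "\<And>x. x \<in> carrier N \<Longrightarrow> dif P x \<in> carrier N"
  shows "dg_module K N"
proof -
  interpret P: dg_module K P by fact
  have mod: "module K N" by (rule submodule_record[OF P.graded.module S sm closed])
  interpret N: module K N by (rule mod)
  have c: "y \<in> carrier P" if "y \<in> carrier N" for y
    using S that additive_subgroup_closed(1) unfolding subgroup_record_def by blast
  have ops: "add N = add P" "zero N = zero P" using S by (simp_all add: subgroup_record_def)
  have hsg: "additive_subgroup (homog N n) N" for n
    unfolding homog using S
    by (intro subgroup_record_subgroup[OF S] additive_subgroup_Int P.graded.homog_subgroup)
      (auto simp: subgroup_record_def)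
  show ?thesis
  proof (intro dg_module.intro mod dg_module_axioms.intro)
    show "internal_direct_sum N UNIV (homog N)"
    proof (rule internal_direct_sumI[OF mod P.graded.module hsg])
      show "carrier N \<subseteq> additive_span N (\<Union>n. homog N n)"
        using span subgroup_record_span[OF S, of "\<Union>n. homog N n"] by (auto simp: homog)
      fix n x assume x: "x \<in> homog N n" "x \<noteq> \<zero>\<^bsub>N\<^esub>"
      then show "\<exists>\<pi>\<in>linear_maps K N P. \<pi> x \<noteq> \<zero>\<^bsub>P\<^esub> \<and> (\<forall>k y. k \<noteq> n \<longrightarrow> y \<in> homog N k \<longrightarrow> \<pi> y = \<zero>\<^bsub>P\<^esub>)"
        using linear_maps_restrict[OF P.graded.component_linear S sm, of n]
        by (intro bexI[of _ "\<lambda>x. component P x n"]) (auto simp: homog ops P.graded.component_of_homog)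
    qed
    show "dif N \<in> linear_maps K N N"
      using dif linear_maps_codomain[OF linear_maps_restrict[OF P.dif_linear S sm] S sm] by simp
  qed (use closed c dif in \<open>auto simp: homog sm ops P.smult_homog P.dif_degree P.dif_square\<close>)
qed

lemma module_map_module:
  assumes "module K M" "module K X"
  shows "module K (map_module M X)"
proof -
  interpret M: module K M by fact
  interpret X: module K X by fact
  show ?thesis
  proof (rule moduleI)
    show "abelian_group (map_module M X)"
    proof (rule abelian_groupI)
      fix f assume f: "f \<in> carrier (map_module M X)"
      then show "\<exists>g\<in>carrier (map_module M X). g \<oplus>\<^bsub>map_module M X\<^esub> f = \<zero>\<^bsub>map_module M X\<^esub>"
        by (intro bexI[of _ "\<lambda>m\<in>carrier M. \<ominus>\<^bsub>X\<^esub> f m"])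
          (auto simp: map_module_def PiE_iff X.l_neg intro!: restrict_ext)
    qed (auto simp: map_module_def PiE_iff fun_eq_iff restrict_def extensional_def X.a_ac)
  qed (auto simp: map_module_def PiE_iff fun_eq_iff restrict_def extensional_def M.is_cring
      X.smult_l_distr X.smult_r_distr X.smult_assoc1)
qed

text \<open>The interface shared by \<open>Hom\<close> modules of bimodules, \<open>HOM\<close> and \<open>HOM_bar\<close>: dg modules of maps with
  pointwise operations. The minus sign of \<open>d \<circ> f - (-1)\<^sup>n f \<circ> d\<close> is absorbed into the exponent \<open>n + 1\<close>, so that
  only sums of signed terms have to be compared.\<close>

locale map_dg_module = M: dg_module K M + X: dg_module K X + N: dg_module K N
  for K :: "('k, 'r) ring_scheme" and M :: "('k, 'm, 's) dg_mod_scheme"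
    and X :: "('k, 'x, 't) dg_mod_scheme" and N :: "('k, 'm \<Rightarrow> 'x, 'u) dg_mod_scheme" +
  assumes map_linear: "f \<in> carrier N \<Longrightarrow> f \<in> linear_maps K M X"
    and map_extensional: "f \<in> carrier N \<Longrightarrow> f \<in> extensional (carrier M)"
    and map_zero: "zero N = zero (map_module M X)"
    and map_add: "add N = add (map_module M X)"
    and map_smult: "smult N = smult (map_module M X)"
    and map_homog: "\<lbrakk>f \<in> homog N n; m \<in> homog M p\<rbrakk> \<Longrightarrow> f m \<in> homog X (p + n)"
    and dif_apply: "\<lbrakk>f \<in> homog N n; m \<in> carrier M\<rbrakk> \<Longrightarrow>
      dif N f m = dif X (f m) \<oplus>\<^bsub>X\<^esub> ksign X (n + 1) (f (dif M m))"
begin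

lemma map_closed: "\<lbrakk>f \<in> carrier N; m \<in> carrier M\<rbrakk> \<Longrightarrow> f m \<in> carrier X"
  by (rule linear_maps_closed[OF map_linear])

lemma add_apply: "m \<in> carrier M \<Longrightarrow> (f \<oplus>\<^bsub>N\<^esub> g) m = f m \<oplus>\<^bsub>X\<^esub> g m"
  by (simp add: map_add map_module_def)

lemma smult_apply: "m \<in> carrier M \<Longrightarrow> (k \<odot>\<^bsub>N\<^esub> f) m = k \<odot>\<^bsub>X\<^esub> f m"
  by (simp add: map_smult map_module_def)

lemma eval_linear: "m \<in> carrier M \<Longrightarrow> (\<lambda>f. f m) \<in> linear_maps K N X"
  by (rule linear_mapsI) (simp_all add: map_closed add_apply smult_apply)

lemma ksign_apply: "\<lbrakk>f \<in> carrier N; m \<in> carrier M\<rbrakk> \<Longrightarrow> ksign N n f m = ksign X n (f m)"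
  using linear_maps_ksign[OF eval_linear N.graded.module X.graded.module] by simp

lemma map_eqI:
  assumes "f \<in> carrier N" "g \<in> carrier N" "\<And>m. m \<in> carrier M \<Longrightarrow> f m = g m"
  shows "f = g"
  using assms map_extensional by (blast intro: extensionalityI)

lemma subgroup_of_maps: "subgroup_record N (map_module M X)"
proof -
  interpret P: module K "map_module M X" by (intro module_map_module M.graded.module X.graded.module)
  have sub: "carrier N \<subseteq> carrier (map_module M X)"
    by (rule subsetI) (simp add: map_module_def PiE_def map_closed map_extensional)
  have neg: "\<ominus>\<^bsub>map_module M X\<^esub> f = \<ominus>\<^bsub>N\<^esub> f" if "f \<in> carrier N" for f
    using that sub N.M.l_neg[OF that] N.M.a_inv_closed[OF that]
    by (intro P.minus_equality) (auto simp: map_zero map_add)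
  show ?thesis
    unfolding subgroup_record_def
    using sub neg N.M.zero_closed N.M.a_closed
    by (auto simp: map_zero map_add intro!: P.abelian_group_axioms additive_subgroup_make)
qed

lemma ksign_maps: "f \<in> carrier N \<Longrightarrow> ksign N n f = ksign (map_module M X) n f"
  by (rule subgroup_record_ksign[OF subgroup_of_maps])

end

text \<open>Families of homogeneous maps for which \<open>graded_map_module\<close> is a dg module.\<close>

locale graded_map_family = M: dg_module K M + X: dg_module K X
  for K :: "('k, 'r) ring_scheme" and M :: "('k, 'm, 's) dg_mod_scheme"
    and X :: "('k, 'x, 't) dg_mod_scheme" +
  fixes H :: "int \<Rightarrow> ('m \<Rightarrow> 'x) set"
  assumes H_degree: "H n \<subseteq> degree_maps K M X n"
    and H_zero: "(\<lambda>m\<in>carrier M. \<zero>\<^bsub>X\<^esub>) \<in> H n"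
    and H_add: "\<lbrakk>f \<in> H n; g \<in> H n\<rbrakk> \<Longrightarrow> (\<lambda>m\<in>carrier M. f m \<oplus>\<^bsub>X\<^esub> g m) \<in> H n"
    and H_smult: "\<lbrakk>k \<in> carrier K; f \<in> H n\<rbrakk> \<Longrightarrow> (\<lambda>m\<in>carrier M. k \<odot>\<^bsub>X\<^esub> f m) \<in> H n"
    and H_dif: "f \<in> H n \<Longrightarrow>
      (\<lambda>m\<in>carrier M. dif X (f m) \<oplus>\<^bsub>X\<^esub> ksign X (n + 1) (f (dif M m))) \<in> H (n + 1)"
begin

abbreviation "P \<equiv> map_module M X"
abbreviation "N \<equiv> graded_map_module M X H"

sublocale P: module K P
  by (rule module_map_module[OF M.graded.module X.graded.module])

lemma P_apply:
  assumes "m \<in> carrier M"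
  shows "(f \<oplus>\<^bsub>P\<^esub> g) m = f m \<oplus>\<^bsub>X\<^esub> g m" "\<zero>\<^bsub>P\<^esub> m = \<zero>\<^bsub>X\<^esub>" "(k \<odot>\<^bsub>P\<^esub> f) m = k \<odot>\<^bsub>X\<^esub> f m"
  using assms by (simp_all add: map_module_def)

lemma P_closed: "\<lbrakk>f \<in> carrier P; m \<in> carrier M\<rbrakk> \<Longrightarrow> f m \<in> carrier X"
  by (auto simp: map_module_def)

lemma P_extensional: "f \<in> carrier P \<Longrightarrow> f \<in> extensional (carrier M)"
  by (auto simp: map_module_def PiE_def)

lemma P_eval: "m \<in> carrier M \<Longrightarrow> (\<lambda>f. f m) \<in> linear_maps K P X"
  by (rule linear_mapsI) (simp_all add: P_closed P_apply)

lemma P_neg: "\<lbrakk>f \<in> carrier P; m \<in> carrier M\<rbrakk> \<Longrightarrow> (\<ominus>\<^bsub>P\<^esub> f) m = \<ominus>\<^bsub>X\<^esub> f m"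
  using linear_maps_neg[OF P_eval P.module_axioms X.graded.module] by simp

lemma P_ksign: "\<lbrakk>f \<in> carrier P; m \<in> carrier M\<rbrakk> \<Longrightarrow> ksign P n f m = ksign X n (f m)"
  using P_neg by (simp add: ksign_def)

lemma H_linear: "f \<in> H n \<Longrightarrow> f \<in> linear_maps K M X"
  and H_homog: "\<lbrakk>f \<in> H n; m \<in> homog M p\<rbrakk> \<Longrightarrow> f m \<in> homog X (p + n)"
  and H_extensional: "f \<in> H n \<Longrightarrow> f \<in> extensional (carrier M)"
  using H_degree[of n] by (auto simp: degree_maps_def)

lemma H_P: "H n \<subseteq> carrier P"
  using H_linear H_extensional linear_maps_closed by (fastforce simp: map_module_def PiE_iff)

lemma H_subgroup: "additive_subgroup (H n) P"
proof (rule additive_subgroup_make[OF P.M.abelian_group_axioms H_P])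
  show "\<zero>\<^bsub>P\<^esub> \<in> H n" "\<And>f g. \<lbrakk>f \<in> H n; g \<in> H n\<rbrakk> \<Longrightarrow> f \<oplus>\<^bsub>P\<^esub> g \<in> H n"
    using H_zero H_add by (simp_all add: map_module_def)
  fix f assume f: "f \<in> H n"
  have "\<ominus>\<^bsub>P\<^esub> f = (\<ominus>\<^bsub>K\<^esub> \<one>\<^bsub>K\<^esub>) \<odot>\<^bsub>P\<^esub> f"
    using subsetD[OF H_P f] by (subst P.smult_l_minus) auto
  also have "\<dots> \<in> H n" using H_smult[OF _ f] by (simp add: map_module_def)
  finally show "\<ominus>\<^bsub>P\<^esub> f \<in> H n" .
qed

lemma N_simps:
  "carrier N = additive_span P (\<Union>n. H n)" "zero N = zero P" "add N = add P" "smult N = smult P" "homog N = H"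
  by (simp_all add: graded_map_module_def Let_def)

lemma N_subgroup: "subgroup_record N P"
  unfolding subgroup_record_def N_simps
  using H_P by (auto intro!: P.M.abelian_group_axioms additive_span_subgroup)

lemma H_N: "H n \<subseteq> carrier N"
  unfolding N_simps by (auto intro: additive_span_incl)

lemma N_span_induct:
  assumes "additive_subgroup J P" "\<And>n f. f \<in> H n \<Longrightarrow> f \<in> J" "f \<in> carrier N"
  shows "f \<in> J"
  using additive_span_least[OF P.M.abelian_group_axioms assms(1), of "\<Union>n. H n"] assms(2,3)
  unfolding N_simps by blast

lemma N_smult_closed:
  assumes k: "k \<in> carrier K" and f: "f \<in> carrier N"
  shows "k \<odot>\<^bsub>P\<^esub> f \<in> carrier N"
proof (rule linear_maps_span_into[where f = "\<lambda>f. k \<odot>\<^bsub>P\<^esub> f" and S = "\<Union>n. H n",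
      OF _ P.module_axioms P.module_axioms])
  show "(\<lambda>f. k \<odot>\<^bsub>P\<^esub> f) \<in> linear_maps K P P"
    by (rule linear_maps_smult_map[OF P.module_axioms linear_maps_id k])
  show "additive_subgroup (carrier N) P" using N_subgroup by (simp add: subgroup_record_def)
  show "(\<Union>n. H n) \<subseteq> carrier P" using H_P by blast
  show "f \<in> additive_span P (\<Union>n. H n)" using f by (simp add: N_simps)
  fix g assume "g \<in> (\<Union>n. H n)"
  then obtain n where "g \<in> H n" by blast
  then have "k \<odot>\<^bsub>P\<^esub> g \<in> H n" using H_smult[OF k] by (simp add: map_module_def)
  then show "k \<odot>\<^bsub>P\<^esub> g \<in> carrier N" using H_N by blast
qed

lemma N_module: "module K N"
  by (rule submodule_record[OF P.module_axioms N_subgroup N_simps(4) N_smult_closed])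

lemma N_linear_maps: "f \<in> carrier N \<Longrightarrow> f \<in> linear_maps K M X"
proof -
  have "additive_subgroup {f \<in> carrier P. f \<in> linear_maps K M X} P"
  proof (rule additive_subgroup_make[OF P.M.abelian_group_axioms])
    note cong = linear_maps_cong[OF _ M.graded.module]
    have mM: "module K M" and mX: "module K X" by (rule M.graded.module X.graded.module)+
    show "\<zero>\<^bsub>P\<^esub> \<in> {f \<in> carrier P. f \<in> linear_maps K M X}"
      using cong[OF linear_maps_zero_map[OF mM mX]] P_apply(2) by simp
    show "f \<oplus>\<^bsub>P\<^esub> g \<in> {f \<in> carrier P. f \<in> linear_maps K M X}"
      if "f \<in> {f \<in> carrier P. f \<in> linear_maps K M X}" "g \<in> {f \<in> carrier P. f \<in> linear_maps K M X}" for f g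
      using cong[OF linear_maps_add_map[OF mM mX, of f g]] P_apply(1) that by simp
    show "\<ominus>\<^bsub>P\<^esub> f \<in> {f \<in> carrier P. f \<in> linear_maps K M X}"
      if "f \<in> {f \<in> carrier P. f \<in> linear_maps K M X}" for f
      using cong[OF linear_maps_neg_map[OF mX, of f]] P_neg that by simp
  qed auto
  from N_span_induct[OF this] H_linear H_P
  show "f \<in> carrier N \<Longrightarrow> f \<in> linear_maps K M X" by blast
qed

lemma N_P: "f \<in> carrier N \<Longrightarrow> f \<in> carrier P"
  using N_subgroup additive_subgroup_closed(1) unfolding subgroup_record_def by blast

text \<open>A nonzero map of degree \<open>n\<close> is nonzero at some homogeneous \<open>m\<close>, of degree \<open>p\<close> say; the component of
  degree \<open>p + n\<close> of the value at \<open>m\<close> separates it from the other degrees.\<close>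

lemma N_graded: "graded_module K N"
proof (intro graded_module.intro N_module graded_module_axioms.intro)
  show "k \<odot>\<^bsub>N\<^esub> f \<in> homog N n" if "k \<in> carrier K" "f \<in> homog N n" for k f n
    using that H_smult by (simp add: N_simps map_module_def)
  show "internal_direct_sum N UNIV (homog N)"
  proof (rule internal_direct_sumI[OF N_module X.graded.module])
    show "additive_subgroup (homog N n) N" for n
      unfolding N_simps using subgroup_record_subgroup[OF N_subgroup H_subgroup H_N] .
    show "carrier N \<subseteq> additive_span N (\<Union>n. homog N n)"
      unfolding N_simps(5) using subgroup_record_span[OF N_subgroup, of "\<Union>n. H n"] H_N
      by (auto simp: N_simps(1))
    fix n f assume f: "f \<in> homog N n" "f \<noteq> \<zero>\<^bsub>N\<^esub>"
    have fH: "f \<in> H n" using f by (simp add: N_simps)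
    have "\<exists>p m. m \<in> homog M p \<and> f m \<noteq> \<zero>\<^bsub>X\<^esub>"
    proof (rule ccontr)
      assume "\<nexists>p m. m \<in> homog M p \<and> f m \<noteq> \<zero>\<^bsub>X\<^esub>"
      then have "f m = \<zero>\<^bsub>X\<^esub>" if "m \<in> carrier M" for m
        using M.graded.linear_maps_homog_eq[OF H_linear[OF fH]
            linear_maps_zero_map[OF M.graded.module X.graded.module] X.graded.module _ that] by blast
      then have "f = \<zero>\<^bsub>P\<^esub>"
        using P_extensional[of f] P_extensional[of "\<zero>\<^bsub>P\<^esub>"] fH H_P P_apply(2)
        by (intro extensionalityI) auto
      with f(2) show False by (simp add: N_simps)
    qed
    then obtain p m where m: "m \<in> homog M p" "f m \<noteq> \<zero>\<^bsub>X\<^esub>" by blast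
    have mc: "m \<in> carrier M" using m(1) by (rule M.graded.homog_carrier)
    let ?\<pi> = "\<lambda>g. component X (g m) (p + n)"
    have "?\<pi> \<in> linear_maps K N X"
      using linear_maps_restrict[OF P_eval[OF mc] N_subgroup N_simps(4)]
      by (rule linear_maps_compose[OF _ X.graded.component_linear])
    moreover have "?\<pi> f \<noteq> \<zero>\<^bsub>X\<^esub>"
      using m X.graded.component_of_homog[OF H_homog[OF fH m(1)]] by simp
    moreover have "?\<pi> g = \<zero>\<^bsub>X\<^esub>" if "k \<noteq> n" "g \<in> homog N k" for k g
      using that X.graded.component_of_homog[OF H_homog[OF _ m(1)]] by (simp add: N_simps)
    ultimately show "\<exists>\<pi>\<in>linear_maps K N X. \<pi> f \<noteq> \<zero>\<^bsub>X\<^esub> \<and> (\<forall>k g. k \<noteq> n \<longrightarrow> g \<in> homog N k \<longrightarrow> \<pi> g = \<zero>\<^bsub>X\<^esub>)"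
      by (intro bexI[of _ ?\<pi>]) auto
  qed
qed

text \<open>The formula in \<open>graded_map_module\<close> makes sense for every map, not only for those of degree \<open>n\<close>. It is
  linear with values in all maps; only afterwards are its values located in the submodule.\<close>

definition commutator :: "int \<Rightarrow> ('m \<Rightarrow> 'x) \<Rightarrow> 'm \<Rightarrow> 'x"
  where "commutator n f = compose (carrier M) (dif X) f \<ominus>\<^bsub>P\<^esub> ksign P n (compose (carrier M) f (dif M))"

lemma dM: "m \<in> carrier M \<Longrightarrow> dif M m \<in> carrier M"
  by (rule linear_maps_closed[OF M.dif_linear])

lemma dX: "x \<in> carrier X \<Longrightarrow> dif X x \<in> carrier X"
  by (rule linear_maps_closed[OF X.dif_linear])

lemma compose_linear: "compose (carrier M) (dif X) \<in> linear_maps K P P"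
    "(\<lambda>f. compose (carrier M) f (dif M)) \<in> linear_maps K P P"
  by (rule linear_mapsI;
    auto simp: map_module_def compose_def fun_eq_iff PiE_iff dM dX linear_maps_add[OF X.dif_linear]
      linear_maps_smult[OF X.dif_linear])+

lemma commutator_linear: "commutator n \<in> linear_maps K P P"
proof -
  have "(\<lambda>f. compose (carrier M) (dif X) f \<ominus>\<^bsub>P\<^esub> ksign P n (compose (carrier M) f (dif M))) \<in> linear_maps K P P"
    by (intro linear_maps_minus_map linear_maps_ksign_map P.module_axioms compose_linear)
  then show ?thesis by (simp add: commutator_def[abs_def])
qed

lemma commutator_apply:
  assumes "f \<in> carrier P" "m \<in> carrier M"
  shows "commutator n f m = dif X (f m) \<oplus>\<^bsub>X\<^esub> ksign X (n + 1) (f (dif M m))"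
proof -
  have c: "compose (carrier M) (dif X) f \<in> carrier P" "compose (carrier M) f (dif M) \<in> carrier P"
    using assms(1) linear_maps_closed[OF compose_linear(1)] linear_maps_closed[OF compose_linear(2)] by auto
  show ?thesis
    unfolding commutator_def P.M.minus_ksign[OF c(2)] using assms c
    by (simp add: P_apply P_ksign compose_eq)
qed

lemma commutator_H: "f \<in> H n \<Longrightarrow> commutator n f \<in> H (n + 1)"
proof -
  assume f: "f \<in> H n"
  then have fP: "f \<in> carrier P" using H_P by blast
  have "commutator n f = (\<lambda>m\<in>carrier M. dif X (f m) \<oplus>\<^bsub>X\<^esub> ksign X (n + 1) (f (dif M m)))"
    using P_extensional[OF linear_maps_closed[OF commutator_linear fP]]
    by (intro extensionalityI[of _ "carrier M"]) (auto simp: commutator_apply[OF fP])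
  with H_dif[OF f] show ?thesis by simp
qed

lemma dif_N: "dif N = graded_extend P N commutator"
proof -
  \<comment> \<open>The differential is prescribed through the grading of a record that differs in the field \<open>dif\<close> only.\<close>
  define G :: "('k, 'm \<Rightarrow> 'x) dg_mod" where "G = \<lparr>carrier = additive_span P (\<Union>n. H n), mult = undefined, one = undefined,
        zero = \<zero>\<^bsub>P\<^esub>, add = (\<oplus>\<^bsub>P\<^esub>), smult = (\<odot>\<^bsub>P\<^esub>), homog = H, dif = undefined\<rparr>"
  have G: "same_group G N" "homog G = homog N"
    by (simp_all add: same_group_def N_simps G_def)
  have "component G = component N"
    by (simp add: component_def[abs_def] is_decomposition_def[abs_def] same_group_simps[OF G(1)] G(2))
  then have "graded_extend P G commutator = graded_extend P N commutator"
    by (simp add: graded_extend_def[abs_def] same_group_simps[OF G(1)])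
  moreover have "dif N = graded_extend P G commutator"
    by (simp add: graded_map_module_def Let_def commutator_def[abs_def] G_def)
  ultimately show ?thesis by simp
qed

lemma commutator_N: "commutator n \<in> linear_maps K N P"
  by (rule linear_maps_restrict[OF commutator_linear N_subgroup N_simps(4)])

lemma dif_N_linear: "dif N \<in> linear_maps K N P"
  unfolding dif_N by (rule graded_module.graded_extend_linear[OF N_graded P.module_axioms commutator_N])

lemma dif_N_homog: "f \<in> H n \<Longrightarrow> dif N f = commutator n f"
  unfolding dif_N
  by (rule graded_module.graded_extend_homog[OF N_graded P.module_axioms commutator_N]) (simp add: N_simps)

lemma map_dg: "map_dg_module K M X N"
proof -
  have sg: "additive_subgroup (carrier N) P" using N_subgroup by (simp add: subgroup_record_def)
  have closed: "dif N f \<in> carrier N" if "f \<in> carrier N" for f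
    by (rule graded_module.linear_maps_homog_into[OF N_graded dif_N_linear P.module_axioms sg _ that])
      (use dif_N_homog subsetD[OF H_N commutator_H] in \<open>auto simp: N_simps(5)\<close>)
  have lin: "dif N \<in> linear_maps K N N"
    by (rule linear_maps_codomain[OF dif_N_linear N_subgroup N_simps(4) closed])
  have apply_dif: "dif N f m = dif X (f m) \<oplus>\<^bsub>X\<^esub> ksign X (n + 1) (f (dif M m))"
    if "f \<in> H n" "m \<in> carrier M" for f n m
    using that commutator_apply[OF subsetD[OF H_P that(1)]] by (simp add: dif_N_homog)
  interpret N: graded_module K N by (rule N_graded)
  have "dg_module K N"
  proof (intro dg_module.intro N_module dg_module_axioms.intro N.grading N.smult_homog lin)
    show "dif N f \<in> homog N (n + 1)" if "f \<in> homog N n" for f n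
      using that dif_N_homog commutator_H by (simp add: N_simps)
    show "dif N (dif N f) = \<zero>\<^bsub>N\<^esub>" if f: "f \<in> carrier N" for f
    proof (rule N.linear_maps_homog_eq[OF linear_maps_compose[OF lin lin]
            linear_maps_zero_map[OF N_module N_module] N_module _ f])
      fix n f assume "f \<in> homog N n"
      then have f: "f \<in> H n" by (simp add: N_simps)
      have df: "dif N f \<in> H (n + 1)" using f dif_N_homog commutator_H by simp
      have ddf: "dif N (dif N f) \<in> carrier P" using closed df H_N N_P by blast
      note fl = H_linear[OF f]
      note cl = linear_maps_closed[OF fl]
      note mods = M.graded.module X.graded.module
      show "dif N (dif N f) = \<zero>\<^bsub>N\<^esub>"
        unfolding N_simps
      proof (rule extensionalityI[OF P_extensional[OF ddf] P_extensional])
        show "\<zero>\<^bsub>P\<^esub> \<in> carrier P" by simp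
        fix m assume m: "m \<in> carrier M"
        have "dif N (dif N f) m = ksign X (n + 1) (dif X (f (dif M m))) \<oplus>\<^bsub>X\<^esub>
            ksign X (2 + n) (dif X (f (dif M m)))"
          using m
          by (simp add: apply_dif[OF df] apply_dif[OF f] dM dX cl linear_maps_add[OF X.dif_linear]
              linear_maps_ksign[OF X.dif_linear mods(2,2)] M.dif_square X.dif_square
              linear_maps_zero[OF fl mods])
        also have "\<dots> = \<zero>\<^bsub>X\<^esub>"
          using m cl dM dX by (simp add: ksign_def X.M.r_neg X.M.l_neg)
        finally show "dif N (dif N f) m = \<zero>\<^bsub>P\<^esub> m" using m by (simp add: P_apply)
      qed
    qed
  qed
  then show ?thesis
    by (intro map_dg_module.intro map_dg_module_axioms.intro M.dg_module_axioms X.dg_module_axioms)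
      (auto simp: N_simps(2-5) N_linear_maps H_homog apply_dif intro: P_extensional N_P)
qed

end

lemma compose_maps_bilinear:
  assumes f: "map_dg_module K M X N1" and g: "map_dg_module K X Y N2"
  shows "bilinear_map K N2 N1 (map_module M Y) (compose (carrier M))"
proof -
  interpret f: map_dg_module K M X N1 by fact
  interpret g: map_dg_module K X Y N2 by fact
  show ?thesis
  proof (rule bilinear_mapI)
    fix u assume u: "u \<in> carrier N1"
    show "(\<lambda>v. compose (carrier M) v u) \<in> linear_maps K N2 (map_module M Y)"
      using u f.map_closed[OF u] g.map_closed
      by (intro linear_mapsI)
        (auto simp: map_module_def compose_def fun_eq_iff g.add_apply g.smult_apply)
  next
    fix v assume v: "v \<in> carrier N2"
    show "compose (carrier M) v \<in> linear_maps K N1 (map_module M Y)"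
      using v f.map_closed g.map_closed[OF v] linear_maps_add[OF g.map_linear[OF v]]
        linear_maps_smult[OF g.map_linear[OF v]]
      by (intro linear_mapsI)
        (auto simp: map_module_def compose_def fun_eq_iff f.add_apply f.smult_apply)
  qed
qed

text \<open>The terms \<open>v \<circ> d \<circ> u\<close> coming from the two differentials on the right cancel.\<close>

lemma dif_compose_maps:
  assumes f: "map_dg_module K M X N1" and g: "map_dg_module K X Y N2" and fg: "map_dg_module K M Y N3"
    and u: "u \<in> homog N1 q" and v: "v \<in> homog N2 p" and vu: "compose (carrier M) v u \<in> homog N3 (p + q)"
    and m: "m \<in> carrier M"
  shows "dif N3 (compose (carrier M) v u) m =
    dif N2 v (u m) \<oplus>\<^bsub>Y\<^esub> ksign Y p (v (dif N1 u m))"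
proof -
  interpret f: map_dg_module K M X N1 by fact
  interpret g: map_dg_module K X Y N2 by fact
  interpret fg: map_dg_module K M Y N3 by fact
  have c: "u \<in> carrier N1" "v \<in> carrier N2"
    using u v f.N.graded.homog_carrier g.N.graded.homog_carrier by auto
  have dm: "dif M m \<in> carrier M" using m by (rule linear_maps_closed[OF f.M.dif_linear])
  note um = f.map_closed[OF c(1) m] f.map_closed[OF c(1) dm]
  have dum: "dif X (u m) \<in> carrier X" using um(1) by (rule linear_maps_closed[OF f.X.dif_linear])
  note vum = g.map_closed[OF c(2) um(1)] g.map_closed[OF c(2) um(2)] g.map_closed[OF c(2) dum]
  have dvum: "dif Y (v (u m)) \<in> carrier Y" using vum(1) by (rule linear_maps_closed[OF g.X.dif_linear])
  note mods = f.X.graded.module g.X.graded.module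
  have "dif N2 v (u m) \<oplus>\<^bsub>Y\<^esub> ksign Y p (v (dif N1 u m))
      = dif Y (v (u m)) \<oplus>\<^bsub>Y\<^esub> (ksign Y (p + 1) (v (dif X (u m)))
        \<oplus>\<^bsub>Y\<^esub> ksign Y p (v (dif X (u m)))) \<oplus>\<^bsub>Y\<^esub> ksign Y (p + (q + 1)) (v (u (dif M m)))"
    using um dum vum dvum m
    by (simp add: g.dif_apply[OF v] f.dif_apply[OF u] linear_maps_add[OF g.map_linear[OF c(2)]]
        linear_maps_ksign[OF g.map_linear[OF c(2)] mods] g.X.M.ksign_add g.X.M.ksign_ksign g.X.M.a_assoc)
  also have "ksign Y (p + 1) (v (dif X (u m))) \<oplus>\<^bsub>Y\<^esub> ksign Y p (v (dif X (u m))) = \<zero>\<^bsub>Y\<^esub>"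
    using vum by (simp add: ksign_def g.X.M.r_neg g.X.M.l_neg)
  finally show ?thesis
    using m dm dvum vum by (simp add: fg.dif_apply[OF vu] compose_eq algebra_simps)
qed

section \<open>Local units\<close>

text \<open>Finite sums of distinguished idempotents are closed elements of degree 0 that eventually, along
  the finite subsets of the distinguished family, fix any given element of the algebra or of a unitary
  module.\<close>

context dg_algebra
begin

definition idem_sum :: "'a set \<Rightarrow> 'a"
  where "idem_sum J = (\<Oplus>\<^bsub>A\<^esub>e\<in>J. e)"

context
  fixes E
  assumes E: "distinguished_family A E"
begin

lemma E_homog: "e \<in> E \<Longrightarrow> e \<in> homog A 0"
  using E by (auto simp: distinguished_family_def)

lemma E_carrier: "e \<in> E \<Longrightarrow> e \<in> carrier A"
  using E_homog graded.homog_carrier by blast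

lemma idem_sum_homog: "J \<subseteq> E \<Longrightarrow> idem_sum J \<in> homog A 0"
  unfolding idem_sum_def
  by (rule additive_subgroup_finsum[OF graded.homog_subgroup M.abelian_group_axioms]) (auto simp: E_homog)

lemma idem_sum_carrier: "J \<subseteq> E \<Longrightarrow> idem_sum J \<in> carrier A"
  using idem_sum_homog graded.homog_carrier by blast

lemma dif_idem_sum:
  assumes "J \<subseteq> E"
  shows "dif A (idem_sum J) = \<zero>\<^bsub>A\<^esub>"
proof -
  have "dif A (idem_sum J) = (\<Oplus>\<^bsub>A\<^esub>e\<in>J. dif A e)"
    unfolding idem_sum_def using assms E_carrier
    by (intro linear_maps_finsum[OF dif_linear graded.module graded.module]) auto
  also have "\<dots> = (\<Oplus>\<^bsub>A\<^esub>e\<in>J. \<zero>\<^bsub>A\<^esub>)"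
    using assms E by (intro M.finsum_cong') (auto simp: distinguished_family_def)
  finally show ?thesis by simp
qed

lemma idem_sum_absorb:
  assumes a: "a \<in> carrier A" and e: "e \<in> J" and J: "finite J" "J \<subseteq> E"
  shows "idem_sum J \<otimes>\<^bsub>A\<^esub> (e \<otimes>\<^bsub>A\<^esub> a) = e \<otimes>\<^bsub>A\<^esub> a" and "(a \<otimes>\<^bsub>A\<^esub> e) \<otimes>\<^bsub>A\<^esub> idem_sum J = a \<otimes>\<^bsub>A\<^esub> e"
proof -
  have ee: "e \<in> E" "e \<in> carrier A" using e J E_carrier by auto
  have Jc: "(\<lambda>e. e) \<in> J \<rightarrow> carrier A" using J E_carrier by auto
  have ort: "e' \<otimes>\<^bsub>A\<^esub> e'' = (if e' = e'' then e' else \<zero>\<^bsub>A\<^esub>)" if "e' \<in> E" "e'' \<in> E" for e' e''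
    using E that by (auto simp: distinguished_family_def)
  have "idem_sum J \<otimes>\<^bsub>A\<^esub> e = (\<Oplus>\<^bsub>A\<^esub>e'\<in>J. e' \<otimes>\<^bsub>A\<^esub> e)"
    unfolding idem_sum_def
    by (rule linear_maps_finsum[OF mult_linear_left[OF ee(2)] graded.module graded.module Jc])
  also have "\<dots> = (\<Oplus>\<^bsub>A\<^esub>e'\<in>J. if e = e' then e' else \<zero>\<^bsub>A\<^esub>)"
    using J ee E_carrier by (intro M.finsum_cong') (auto simp: ort)
  also have "\<dots> = e" using M.finsum_singleton[OF e J(1) Jc] by simp
  finally have l: "idem_sum J \<otimes>\<^bsub>A\<^esub> e = e" .
  have "e \<otimes>\<^bsub>A\<^esub> idem_sum J = (\<Oplus>\<^bsub>A\<^esub>e'\<in>J. e \<otimes>\<^bsub>A\<^esub> e')"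
    unfolding idem_sum_def
    by (rule linear_maps_finsum[OF mult_linear_right[OF ee(2)] graded.module graded.module Jc])
  also have "\<dots> = (\<Oplus>\<^bsub>A\<^esub>e'\<in>J. if e = e' then e' else \<zero>\<^bsub>A\<^esub>)"
    using J ee E_carrier by (intro M.finsum_cong') (auto simp: ort)
  also have "\<dots> = e" using M.finsum_singleton[OF e J(1) Jc] by simp
  finally have r: "e \<otimes>\<^bsub>A\<^esub> idem_sum J = e" .
  show "idem_sum J \<otimes>\<^bsub>A\<^esub> (e \<otimes>\<^bsub>A\<^esub> a) = e \<otimes>\<^bsub>A\<^esub> a"
    using l a ee idem_sum_carrier[OF J(2)] by (simp flip: mult_assoc)
  show "(a \<otimes>\<^bsub>A\<^esub> e) \<otimes>\<^bsub>A\<^esub> idem_sum J = a \<otimes>\<^bsub>A\<^esub> e"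
    using r a ee idem_sum_carrier[OF J(2)] by (simp add: mult_assoc)
qed

text \<open>Only finitely many summands occur when \<open>a\<close> is decomposed along \<open>A = \<Oplus> e A\<close>; every finite set of
  idempotents that contains the corresponding ones fixes \<open>a\<close>. The other side uses \<open>A = \<Oplus> A e\<close>.\<close>

lemma idem_sum_fixes:
  assumes a: "a \<in> carrier A"
  shows "\<forall>\<^sub>F J in finite_subsets_at_top E. idem_sum J \<otimes>\<^bsub>A\<^esub> a = a"
    and "\<forall>\<^sub>F J in finite_subsets_at_top E. a \<otimes>\<^bsub>A\<^esub> idem_sum J = a"
proof -
  have dec: "internal_direct_sum A E (\<lambda>e. {e \<otimes>\<^bsub>A\<^esub> a | a. a \<in> carrier A})"
    "internal_direct_sum A E (\<lambda>e. {a \<otimes>\<^bsub>A\<^esub> e | a. a \<in> carrier A})"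
    using E by (simp_all add: distinguished_family_def)
  obtain c where "is_decomposition A E (\<lambda>e. {e \<otimes>\<^bsub>A\<^esub> a | a. a \<in> carrier A}) a c"
    using dec(1) a unfolding internal_direct_sum_def by blast
  then have c: "\<And>e. e \<in> E \<Longrightarrow> \<exists>b\<in>carrier A. c e = e \<otimes>\<^bsub>A\<^esub> b" "finite {e \<in> E. c e \<noteq> \<zero>\<^bsub>A\<^esub>}"
    "a = (\<Oplus>\<^bsub>A\<^esub>e\<in>{e \<in> E. c e \<noteq> \<zero>\<^bsub>A\<^esub>}. c e)"
    by (auto simp: is_decomposition_def PiE_iff)
  have "idem_sum J \<otimes>\<^bsub>A\<^esub> a = a" if J: "finite J" "{e \<in> E. c e \<noteq> \<zero>\<^bsub>A\<^esub>} \<subseteq> J" "J \<subseteq> E" for J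
  proof -
    have cc: "c e \<in> carrier A" if "e \<in> E" for e using c(1)[OF that] E_carrier[OF that] mult_closed by auto
    have "idem_sum J \<otimes>\<^bsub>A\<^esub> a = (\<Oplus>\<^bsub>A\<^esub>e\<in>{e \<in> E. c e \<noteq> \<zero>\<^bsub>A\<^esub>}. idem_sum J \<otimes>\<^bsub>A\<^esub> c e)"
      by (subst c(3), rule linear_maps_finsum[OF mult_linear_right[OF idem_sum_carrier[OF J(3)]]
            graded.module graded.module]) (auto simp: cc)
    also have "\<dots> = (\<Oplus>\<^bsub>A\<^esub>e\<in>{e \<in> E. c e \<noteq> \<zero>\<^bsub>A\<^esub>}. c e)"
    proof (rule M.finsum_cong'[OF refl])
      fix e assume e: "e \<in> {e \<in> E. c e \<noteq> \<zero>\<^bsub>A\<^esub>}"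
      then obtain b where "b \<in> carrier A" "c e = e \<otimes>\<^bsub>A\<^esub> b" using c(1) by blast
      with e J show "idem_sum J \<otimes>\<^bsub>A\<^esub> c e = c e" by (auto intro: idem_sum_absorb(1))
    qed (use cc in auto)
    finally show ?thesis using c(3) by simp
  qed
  with c(2) show "\<forall>\<^sub>F J in finite_subsets_at_top E. idem_sum J \<otimes>\<^bsub>A\<^esub> a = a"
    unfolding eventually_finite_subsets_at_top by blast
  obtain c where "is_decomposition A E (\<lambda>e. {a \<otimes>\<^bsub>A\<^esub> e | a. a \<in> carrier A}) a c"
    using dec(2) a unfolding internal_direct_sum_def by blast
  then have c: "\<And>e. e \<in> E \<Longrightarrow> \<exists>b\<in>carrier A. c e = b \<otimes>\<^bsub>A\<^esub> e" "finite {e \<in> E. c e \<noteq> \<zero>\<^bsub>A\<^esub>}"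
    "a = (\<Oplus>\<^bsub>A\<^esub>e\<in>{e \<in> E. c e \<noteq> \<zero>\<^bsub>A\<^esub>}. c e)"
    by (auto simp: is_decomposition_def PiE_iff)
  have "a \<otimes>\<^bsub>A\<^esub> idem_sum J = a" if J: "finite J" "{e \<in> E. c e \<noteq> \<zero>\<^bsub>A\<^esub>} \<subseteq> J" "J \<subseteq> E" for J
  proof -
    have cc: "c e \<in> carrier A" if "e \<in> E" for e using c(1)[OF that] E_carrier[OF that] mult_closed by auto
    have "a \<otimes>\<^bsub>A\<^esub> idem_sum J = (\<Oplus>\<^bsub>A\<^esub>e\<in>{e \<in> E. c e \<noteq> \<zero>\<^bsub>A\<^esub>}. c e \<otimes>\<^bsub>A\<^esub> idem_sum J)"
      by (subst c(3), rule linear_maps_finsum[OF mult_linear_left[OF idem_sum_carrier[OF J(3)]]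
            graded.module graded.module]) (auto simp: cc)
    also have "\<dots> = (\<Oplus>\<^bsub>A\<^esub>e\<in>{e \<in> E. c e \<noteq> \<zero>\<^bsub>A\<^esub>}. c e)"
    proof (rule M.finsum_cong'[OF refl])
      fix e assume e: "e \<in> {e \<in> E. c e \<noteq> \<zero>\<^bsub>A\<^esub>}"
      then obtain b where "b \<in> carrier A" "c e = b \<otimes>\<^bsub>A\<^esub> e" using c(1) by blast
      with e J show "c e \<otimes>\<^bsub>A\<^esub> idem_sum J = c e" by (auto intro: idem_sum_absorb(2))
    qed (use cc in auto)
    finally show ?thesis using c(3) by simp
  qed
  with c(2) show "\<forall>\<^sub>F J in finite_subsets_at_top E. a \<otimes>\<^bsub>A\<^esub> idem_sum J = a"
    unfolding eventually_finite_subsets_at_top by blast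
qed

lemma idem_sum_witness:
  assumes "\<forall>\<^sub>F J in finite_subsets_at_top E. P (idem_sum J)"
  shows "\<exists>u\<in>homog A 0. dif A u = \<zero>\<^bsub>A\<^esub> \<and> P u"
  using assms unfolding eventually_finite_subsets_at_top
  by (blast intro: idem_sum_homog dif_idem_sum)

end

lemma local_units:
  assumes "a \<in> carrier A"
  shows "\<exists>u\<in>carrier A. u \<otimes>\<^bsub>A\<^esub> a = a" and "\<exists>u\<in>carrier A. a \<otimes>\<^bsub>A\<^esub> u = a"
proof -
  obtain E where E: "distinguished_family A E" using enough_idempotents by blast
  show "\<exists>u\<in>carrier A. u \<otimes>\<^bsub>A\<^esub> a = a" "\<exists>u\<in>carrier A. a \<otimes>\<^bsub>A\<^esub> u = a"
    using idem_sum_witness[OF E idem_sum_fixes(1)[OF E assms]]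
      idem_sum_witness[OF E idem_sum_fixes(2)[OF E assms]] graded.homog_carrier by blast+
qed

end

section \<open>Dg bimodules\<close>

context dg_bimodule
begin

lemma lact_left: "x \<in> carrier X \<Longrightarrow> (\<lambda>b. lact X b x) \<in> linear_maps K B X"
  by (rule lact_linear_left)

lemma lact_right: "b \<in> carrier B \<Longrightarrow> lact X b \<in> linear_maps K X X"
  using lact_linear_right by simp

lemma ract_left: "a \<in> carrier A \<Longrightarrow> (\<lambda>x. ract X x a) \<in> linear_maps K X X"
  by (rule ract_linear_left)

lemma ract_right: "x \<in> carrier X \<Longrightarrow> ract X x \<in> linear_maps K A X"
  using ract_linear_right by simp

lemma lact_closed: "\<lbrakk>b \<in> carrier B; x \<in> carrier X\<rbrakk> \<Longrightarrow> lact X b x \<in> carrier X"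
  by (rule linear_maps_closed[OF lact_right])

lemma ract_closed: "\<lbrakk>x \<in> carrier X; a \<in> carrier A\<rbrakk> \<Longrightarrow> ract X x a \<in> carrier X"
  by (rule linear_maps_closed[OF ract_left])

lemma lact_ksign:
  "\<lbrakk>b \<in> carrier B; x \<in> carrier X\<rbrakk> \<Longrightarrow> lact X b (ksign X n x) = ksign X n (lact X b x)"
  by (rule linear_maps_ksign[OF lact_right graded.module graded.module])

lemma ract_ksign:
  "\<lbrakk>x \<in> carrier X; a \<in> carrier A\<rbrakk> \<Longrightarrow> ract X (ksign X n x) a = ksign X n (ract X x a)"
  by (rule linear_maps_ksign[OF ract_left graded.module graded.module])

lemma lact_add:
  "\<lbrakk>b \<in> carrier B; x \<in> carrier X; y \<in> carrier X\<rbrakk> \<Longrightarrow> lact X b (x \<oplus>\<^bsub>X\<^esub> y) = lact X b x \<oplus>\<^bsub>X\<^esub> lact X b y"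
  by (rule linear_maps_add[OF lact_right])

lemma ract_add:
  "\<lbrakk>a \<in> carrier A; x \<in> carrier X; y \<in> carrier X\<rbrakk> \<Longrightarrow> ract X (x \<oplus>\<^bsub>X\<^esub> y) a = ract X x a \<oplus>\<^bsub>X\<^esub> ract X y a"
  by (rule linear_maps_add[OF ract_left])

lemma dif_X_closed: "x \<in> carrier X \<Longrightarrow> dif X x \<in> carrier X"
  by (rule linear_maps_closed[OF dif_linear])

text \<open>Being fixed eventually is closed under sums, because finitely many eventual statements hold
  simultaneously. Together with unitarity this reduces \<open>left_units\<close> and \<open>right_units\<close> to products.\<close>

lemma fixed_subgroup:
  assumes "\<And>J. J \<subseteq> E \<Longrightarrow> h J \<in> linear_maps K X X"
  shows "additive_subgroup {x \<in> carrier X. \<forall>\<^sub>F J in finite_subsets_at_top E. h J x = x} X"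
proof (rule additive_subgroup_make[OF M.abelian_group_axioms])
  have top: "\<forall>\<^sub>F J in finite_subsets_at_top E. J \<subseteq> E"
    unfolding eventually_finite_subsets_at_top by blast
  have "\<forall>\<^sub>F J in finite_subsets_at_top E. h J \<zero>\<^bsub>X\<^esub> = \<zero>\<^bsub>X\<^esub>"
    using top by eventually_elim (rule linear_maps_zero[OF assms graded.module graded.module])
  then show "\<zero>\<^bsub>X\<^esub> \<in> {x \<in> carrier X. \<forall>\<^sub>F J in finite_subsets_at_top E. h J x = x}" by simp
  fix x assume "x \<in> {x \<in> carrier X. \<forall>\<^sub>F J in finite_subsets_at_top E. h J x = x}"
  then have x: "x \<in> carrier X" "\<forall>\<^sub>F J in finite_subsets_at_top E. h J x = x" by auto
  have "\<forall>\<^sub>F J in finite_subsets_at_top E. h J (\<ominus>\<^bsub>X\<^esub> x) = \<ominus>\<^bsub>X\<^esub> x"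
    using top x(2) by eventually_elim (simp add: linear_maps_neg[OF assms graded.module graded.module] x)
  with x show "\<ominus>\<^bsub>X\<^esub> x \<in> {x \<in> carrier X. \<forall>\<^sub>F J in finite_subsets_at_top E. h J x = x}" by simp
  fix y assume "y \<in> {x \<in> carrier X. \<forall>\<^sub>F J in finite_subsets_at_top E. h J x = x}"
  then have y: "y \<in> carrier X" "\<forall>\<^sub>F J in finite_subsets_at_top E. h J y = y" by auto
  have "\<forall>\<^sub>F J in finite_subsets_at_top E. h J (x \<oplus>\<^bsub>X\<^esub> y) = x \<oplus>\<^bsub>X\<^esub> y"
    using top x(2) y(2) by eventually_elim (simp add: linear_maps_add[OF assms] x y)
  with x y show "x \<oplus>\<^bsub>X\<^esub> y \<in> {x \<in> carrier X. \<forall>\<^sub>F J in finite_subsets_at_top E. h J x = x}" by simp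
qed auto

lemma left_units:
  assumes E: "distinguished_family B E" and x: "x \<in> carrier X"
  shows "\<forall>\<^sub>F J in finite_subsets_at_top E. lact X (B.idem_sum J) x = x"
proof -
  let ?F = "{x \<in> carrier X. \<forall>\<^sub>F J in finite_subsets_at_top E. lact X (B.idem_sum J) x = x}"
  have sg: "additive_subgroup ?F X"
    by (rule fixed_subgroup) (rule lact_right[OF B.idem_sum_carrier[OF E]])
  have "{lact X b x | b x. b \<in> carrier B \<and> x \<in> carrier X} \<subseteq> ?F"
  proof clarsimp
    fix b x assume b: "b \<in> carrier B" and x: "x \<in> carrier X"
    have top: "\<forall>\<^sub>F J in finite_subsets_at_top E. J \<subseteq> E"
      unfolding eventually_finite_subsets_at_top by blast
    have "\<forall>\<^sub>F J in finite_subsets_at_top E. lact X (B.idem_sum J) (lact X b x) = lact X b x"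
      using top B.idem_sum_fixes(1)[OF E b]
      by eventually_elim (use b x in \<open>simp add: B.idem_sum_carrier[OF E] flip: lact_assoc\<close>)
    then show "lact X b x \<in> carrier X \<and> (\<forall>\<^sub>F J in finite_subsets_at_top E. lact X (B.idem_sum J) (lact X b x) = lact X b x)"
      using b x by (simp add: lact_closed)
  qed
  from additive_span_least[OF M.abelian_group_axioms sg this] x show ?thesis
    unfolding left_unitary by blast
qed

lemma right_units:
  assumes E: "distinguished_family A E" and x: "x \<in> carrier X"
  shows "\<forall>\<^sub>F J in finite_subsets_at_top E. ract X x (A.idem_sum J) = x"
proof -
  let ?F = "{x \<in> carrier X. \<forall>\<^sub>F J in finite_subsets_at_top E. ract X x (A.idem_sum J) = x}"
  have sg: "additive_subgroup ?F X"
    by (rule fixed_subgroup) (rule ract_left[OF A.idem_sum_carrier[OF E]])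
  have "{ract X x a | x a. x \<in> carrier X \<and> a \<in> carrier A} \<subseteq> ?F"
  proof clarsimp
    fix a x assume a: "a \<in> carrier A" and x: "x \<in> carrier X"
    have top: "\<forall>\<^sub>F J in finite_subsets_at_top E. J \<subseteq> E"
      unfolding eventually_finite_subsets_at_top by blast
    have "\<forall>\<^sub>F J in finite_subsets_at_top E. ract X (ract X x a) (A.idem_sum J) = ract X x a"
      using top A.idem_sum_fixes(2)[OF E a]
      by eventually_elim (use a x in \<open>simp add: A.idem_sum_carrier[OF E] flip: ract_assoc\<close>)
    then show "ract X x a \<in> carrier X \<and> (\<forall>\<^sub>F J in finite_subsets_at_top E. ract X (ract X x a) (A.idem_sum J) = ract X x a)"
      using a x by (simp add: ract_closed)
  qed
  from additive_span_least[OF M.abelian_group_axioms sg this] x show ?thesis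
    unfolding right_unitary by blast
qed

text \<open>Insert a local unit \<open>u\<close> for \<open>A\<close> in the Leibniz rule for \<open>b x u\<close>; the last term vanishes as \<open>d(u) = 0\<close>.\<close>

lemma dif_lact:
  assumes b: "b \<in> homog B p" and x: "x \<in> carrier X"
  shows "dif X (lact X b x) = lact X (dif B b) x \<oplus>\<^bsub>X\<^esub> ksign X p (lact X b (dif X x))"
proof (rule graded.linear_maps_homog_eq[OF _ _ graded.module _ x])
  have bc: "b \<in> carrier B" "dif B b \<in> carrier B"
    using b B.graded.homog_carrier linear_maps_closed[OF B.dif_linear] by auto
  show "(\<lambda>x. dif X (lact X b x)) \<in> linear_maps K X X"
    by (rule linear_maps_compose[OF lact_right[OF bc(1)] dif_linear])
  show "(\<lambda>x. lact X (dif B b) x \<oplus>\<^bsub>X\<^esub> ksign X p (lact X b (dif X x))) \<in> linear_maps K X X"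
    by (intro linear_maps_add_map linear_maps_ksign_map graded.module lact_right[OF bc(2)]
        linear_maps_compose[OF dif_linear lact_right[OF bc(1)]])
  fix q x assume x: "x \<in> homog X q"
  have xc: "x \<in> carrier X" using x by (rule graded.homog_carrier)
  note c = lact_closed[OF bc(1) xc] lact_closed[OF bc(2) xc] lact_closed[OF bc(1) dif_X_closed[OF xc]]
  obtain E where E: "distinguished_family A E" using A.enough_idempotents by blast
  obtain u where u: "u \<in> homog A 0" "dif A u = \<zero>\<^bsub>A\<^esub>" "ract X (lact X b x) u = lact X b x"
    "ract X (lact X (dif B b) x) u = lact X (dif B b) x"
    "ract X (lact X b (dif X x)) u = lact X b (dif X x)"
    using A.idem_sum_witness[OF E, of "\<lambda>u. ract X (lact X b x) u = lact X b x \<and>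
          ract X (lact X (dif B b) x) u = lact X (dif B b) x \<and>
          ract X (lact X b (dif X x)) u = lact X b (dif X x)",
        OF eventually_conj[OF right_units[OF E c(1)]
          eventually_conj[OF right_units[OF E c(2)] right_units[OF E c(3)]]]] by auto
  have "ract X (lact X b x) \<zero>\<^bsub>A\<^esub> = \<zero>\<^bsub>X\<^esub>"
    by (rule linear_maps_zero[OF ract_right[OF c(1)] A.graded.module graded.module])
  then show "dif X (lact X b x) = lact X (dif B b) x \<oplus>\<^bsub>X\<^esub> ksign X p (lact X b (dif X x))"
    using dif_bimodule[OF b x A.graded.homog_carrier[OF u(1)]] c by (simp add: u)
qed

lemma dif_ract:
  assumes x: "x \<in> homog X q" and a: "a \<in> carrier A"
  shows "dif X (ract X x a) = ract X (dif X x) a \<oplus>\<^bsub>X\<^esub> ksign X q (ract X x (dif A a))"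
proof -
  have xc: "x \<in> carrier X" using x by (rule graded.homog_carrier)
  have da: "dif A a \<in> carrier A" using a by (rule linear_maps_closed[OF A.dif_linear])
  obtain E where E: "distinguished_family B E" using B.enough_idempotents by blast
  obtain u where u: "u \<in> homog B 0" "dif B u = \<zero>\<^bsub>B\<^esub>" "lact X u x = x" "lact X u (dif X x) = dif X x"
    using B.idem_sum_witness[OF E, of "\<lambda>u. lact X u x = x \<and> lact X u (dif X x) = dif X x",
        OF eventually_conj[OF left_units[OF E xc] left_units[OF E dif_X_closed[OF xc]]]] by auto
  have "lact X \<zero>\<^bsub>B\<^esub> x = \<zero>\<^bsub>X\<^esub>"
    by (rule linear_maps_zero[OF lact_left[OF xc] B.graded.module graded.module])
  moreover have "ract X \<zero>\<^bsub>X\<^esub> a = \<zero>\<^bsub>X\<^esub>"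
    by (rule linear_maps_zero[OF ract_left[OF a] graded.module graded.module])
  ultimately show ?thesis
    using dif_bimodule[OF u(1) x a] ract_closed xc da a dif_X_closed by (simp add: u)
qed

end

text \<open>The condition on \<open>f (b x a)\<close> splits: a local unit that fixes an element and its counterpart under \<open>f\<close> can be inserted for
  \<open>b\<close> or for \<open>a\<close>. Hence morphisms of bimodules are right linear maps with one extra condition.\<close>

lemma bimod_maps_iff:
  assumes X: "dg_bimodule K B A X" and Y: "dg_bimodule K B A Y"
  shows "bimod_maps K B A X Y n = {f \<in> right_linear_maps K A X Y n.
    \<forall>p. \<forall>b\<in>homog B p. \<forall>x\<in>carrier X. f (lact X b x) = ksign Y (n * p) (lact Y b (f x))}"
    (is "_ = ?R")
proof -
  interpret X: dg_bimodule K B A X by fact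
  interpret Y: dg_bimodule K B A Y by fact
  show ?thesis
  proof
    show "?R \<subseteq> bimod_maps K B A X Y n"
    proof
      fix f assume f: "f \<in> ?R"
      then have d: "f \<in> degree_maps K X Y n" by (simp add: right_linear_maps_def)
      then have fc: "f x \<in> carrier Y" if "x \<in> carrier X" for x
        using that by (auto simp: degree_maps_def linear_maps_closed)
      have "f (ract X (lact X b x) a) = ksign Y (n * p) (ract Y (lact Y b (f x)) a)"
        if "b \<in> homog B p" "x \<in> carrier X" "a \<in> carrier A" for p b x a
        using that f fc X.B.graded.homog_carrier[OF that(1)]
        by (simp add: right_linear_maps_def X.lact_closed Y.ract_ksign Y.lact_closed)
      with d show "f \<in> bimod_maps K B A X Y n" by (auto simp: bimod_maps_def)
    qed
    show "bimod_maps K B A X Y n \<subseteq> ?R"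
    proof
      fix f assume f: "f \<in> bimod_maps K B A X Y n"
      then have d: "f \<in> degree_maps K X Y n"
        and eq: "\<And>p b x a. \<lbrakk>b \<in> homog B p; x \<in> carrier X; a \<in> carrier A\<rbrakk> \<Longrightarrow>
          f (ract X (lact X b x) a) = ksign Y (n * p) (ract Y (lact Y b (f x)) a)"
        by (auto simp: bimod_maps_def)
      have fc: "f x \<in> carrier Y" if "x \<in> carrier X" for x
        using that d by (auto simp: degree_maps_def linear_maps_closed)
      obtain E where E: "distinguished_family B E" using X.B.enough_idempotents by blast
      obtain E' where E': "distinguished_family A E'" using X.A.enough_idempotents by blast
      have "f (ract X x a) = ract Y (f x) a" if x: "x \<in> carrier X" and a: "a \<in> carrier A" for x a
      proof -
        obtain u where u: "u \<in> homog B 0" "lact X u x = x" "lact Y u (f x) = f x"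
          using X.B.idem_sum_witness[OF E, of "\<lambda>u. lact X u x = x \<and> lact Y u (f x) = f x",
              OF eventually_conj[OF X.left_units[OF E x] Y.left_units[OF E fc[OF x]]]] by auto
        show ?thesis using eq[OF u(1) x a] by (simp add: u)
      qed
      moreover have "f (lact X b x) = ksign Y (n * p) (lact Y b (f x))"
        if b: "b \<in> homog B p" and x: "x \<in> carrier X" for p b x
      proof -
        have bc: "b \<in> carrier B" using b by (rule X.B.graded.homog_carrier)
        note c = X.lact_closed[OF bc x] Y.lact_closed[OF bc fc[OF x]]
        obtain u where u: "u \<in> homog A 0" "ract X (lact X b x) u = lact X b x"
          "ract Y (lact Y b (f x)) u = lact Y b (f x)"
          using X.A.idem_sum_witness[OF E', of "\<lambda>u. ract X (lact X b x) u = lact X b x \<and>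
                ract Y (lact Y b (f x)) u = lact Y b (f x)",
              OF eventually_conj[OF X.right_units[OF E' c(1)] Y.right_units[OF E' c(2)]]] by auto
        show ?thesis using eq[OF b x X.A.graded.homog_carrier[OF u(1)]] by (simp add: u)
      qed
      ultimately show "f \<in> ?R" using d by (auto simp: right_linear_maps_def)
    qed
  qed
qed

lemma degree_mapsI:
  assumes "f \<in> linear_maps K M X" "f \<in> extensional (carrier M)"
    and "\<And>p m. m \<in> homog M p \<Longrightarrow> f m \<in> homog X (p + n)"
  shows "f \<in> degree_maps K M X n"
  using assms by (auto simp: degree_maps_def)

text \<open>The closure conditions of \<open>graded_map_family\<close> are established in three stages, for maps of degree
  \<open>n\<close>, for right linear maps, and for bimodule morphisms.\<close>

lemma degree_maps_ops:
  assumes M: "dg_module K M" and X: "dg_module K X"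
  shows "(\<lambda>m\<in>carrier M. \<zero>\<^bsub>X\<^esub>) \<in> degree_maps K M X n"
    and "\<lbrakk>f \<in> degree_maps K M X n; g \<in> degree_maps K M X n\<rbrakk> \<Longrightarrow>
      (\<lambda>m\<in>carrier M. f m \<oplus>\<^bsub>X\<^esub> g m) \<in> degree_maps K M X n"
    and "\<lbrakk>k \<in> carrier K; f \<in> degree_maps K M X n\<rbrakk> \<Longrightarrow>
      (\<lambda>m\<in>carrier M. k \<odot>\<^bsub>X\<^esub> f m) \<in> degree_maps K M X n"
    and "f \<in> degree_maps K M X n \<Longrightarrow>
      (\<lambda>m\<in>carrier M. dif X (f m) \<oplus>\<^bsub>X\<^esub> ksign X (n + 1) (f (dif M m))) \<in> degree_maps K M X (n + 1)"
proof -
  interpret M: dg_module K M by fact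
  interpret X: dg_module K X by fact
  note mods = M.graded.module X.graded.module
  note cong = linear_maps_cong[OF _ mods(1)]
  note d = degree_maps_def
  show "(\<lambda>m\<in>carrier M. \<zero>\<^bsub>X\<^esub>) \<in> degree_maps K M X n"
    by (rule degree_mapsI[OF cong[OF linear_maps_zero_map[OF mods]]])
      (auto simp: M.graded.homog_carrier X.graded.zero_homog)
  show "(\<lambda>m\<in>carrier M. f m \<oplus>\<^bsub>X\<^esub> g m) \<in> degree_maps K M X n"
    if "f \<in> degree_maps K M X n" "g \<in> degree_maps K M X n"
    by (rule degree_mapsI[OF cong[OF linear_maps_add_map[OF mods, of f g]]])
      (use that in \<open>auto simp: d M.graded.homog_carrier X.graded.add_homog\<close>)
  show "(\<lambda>m\<in>carrier M. k \<odot>\<^bsub>X\<^esub> f m) \<in> degree_maps K M X n"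
    if "k \<in> carrier K" "f \<in> degree_maps K M X n"
    by (rule degree_mapsI[OF cong[OF linear_maps_smult_map[OF mods(2), of f]]])
      (use that in \<open>auto simp: d M.graded.homog_carrier X.smult_homog\<close>)
  show "(\<lambda>m\<in>carrier M. dif X (f m) \<oplus>\<^bsub>X\<^esub> ksign X (n + 1) (f (dif M m))) \<in> degree_maps K M X (n + 1)"
    if f: "f \<in> degree_maps K M X n"
  proof -
    have fl: "f \<in> linear_maps K M X" and fh: "\<And>p m. m \<in> homog M p \<Longrightarrow> f m \<in> homog X (p + n)"
      using f by (auto simp: d)
    have 1: "(\<lambda>m. dif X (f m) \<oplus>\<^bsub>X\<^esub> ksign X (n + 1) (f (dif M m))) \<in> linear_maps K M X"
      by (intro linear_maps_add_map linear_maps_ksign_map mods linear_maps_compose[OF fl X.dif_linear]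
          linear_maps_compose[OF M.dif_linear fl])
    show ?thesis
    proof (rule degree_mapsI[OF cong[OF 1]])
      fix p m assume m: "m \<in> homog M p"
      have "dif X (f m) \<in> homog X (p + (n + 1))" using X.dif_degree[OF fh[OF m]] by (simp add: algebra_simps)
      moreover have "f (dif M m) \<in> homog X (p + (n + 1))" using fh[OF M.dif_degree[OF m]] by (simp add: algebra_simps)
      ultimately show "(\<lambda>m\<in>carrier M. dif X (f m) \<oplus>\<^bsub>X\<^esub> ksign X (n + 1) (f (dif M m))) m \<in> homog X (p + (n + 1))"
        using M.graded.homog_carrier[OF m] by (simp add: X.graded.add_homog X.graded.ksign_homog)
    qed auto
  qed
qed

lemma right_linear_ops:
  assumes M: "dg_bimodule K C A M" and X: "dg_bimodule K B A X"
  shows "(\<lambda>m\<in>carrier M. \<zero>\<^bsub>X\<^esub>) \<in> right_linear_maps K A M X n"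
    and "\<lbrakk>f \<in> right_linear_maps K A M X n; g \<in> right_linear_maps K A M X n\<rbrakk> \<Longrightarrow>
      (\<lambda>m\<in>carrier M. f m \<oplus>\<^bsub>X\<^esub> g m) \<in> right_linear_maps K A M X n"
    and "\<lbrakk>k \<in> carrier K; f \<in> right_linear_maps K A M X n\<rbrakk> \<Longrightarrow>
      (\<lambda>m\<in>carrier M. k \<odot>\<^bsub>X\<^esub> f m) \<in> right_linear_maps K A M X n"
    and "f \<in> right_linear_maps K A M X n \<Longrightarrow>
      (\<lambda>m\<in>carrier M. dif X (f m) \<oplus>\<^bsub>X\<^esub> ksign X (n + 1) (f (dif M m))) \<in> right_linear_maps K A M X (n + 1)"
proof -
  interpret M: dg_bimodule K C A M by fact
  interpret X: dg_bimodule K B A X by fact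
  note mods = M.graded.module X.graded.module
  note ops = degree_maps_ops[OF M.dg_module_axioms X.dg_module_axioms]
  note r = right_linear_maps_def
  have dc: "f m \<in> carrier X" if "f \<in> degree_maps K M X n" "m \<in> carrier M" for f m n
    using that by (auto simp: degree_maps_def linear_maps_closed)
  show "(\<lambda>m\<in>carrier M. \<zero>\<^bsub>X\<^esub>) \<in> right_linear_maps K A M X n"
    using linear_maps_zero[OF X.ract_left mods(2,2)]
    by (auto simp: r ops M.ract_closed)
  show "(\<lambda>m\<in>carrier M. f m \<oplus>\<^bsub>X\<^esub> g m) \<in> right_linear_maps K A M X n"
    if "f \<in> right_linear_maps K A M X n" "g \<in> right_linear_maps K A M X n"
    using that by (auto simp: r ops M.ract_closed X.ract_add dc)
  show "(\<lambda>m\<in>carrier M. k \<odot>\<^bsub>X\<^esub> f m) \<in> right_linear_maps K A M X n"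
    if "k \<in> carrier K" "f \<in> right_linear_maps K A M X n"
    using that linear_maps_smult[OF X.ract_left] by (auto simp: r ops M.ract_closed dc)
  show "(\<lambda>m\<in>carrier M. dif X (f m) \<oplus>\<^bsub>X\<^esub> ksign X (n + 1) (f (dif M m))) \<in> right_linear_maps K A M X (n + 1)"
    if f: "f \<in> right_linear_maps K A M X n"
  proof -
    have fd: "f \<in> degree_maps K M X n" and eq: "\<And>m a. \<lbrakk>m \<in> carrier M; a \<in> carrier A\<rbrakk> \<Longrightarrow> f (ract M m a) = ract X (f m) a"
      using f by (auto simp: r)
    have fl: "f \<in> linear_maps K M X" using fd by (simp add: degree_maps_def)
    note fc = linear_maps_closed[OF fl]
    have "dif X (f (ract M m a)) \<oplus>\<^bsub>X\<^esub> ksign X (n + 1) (f (dif M (ract M m a)))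
        = ract X (dif X (f m) \<oplus>\<^bsub>X\<^esub> ksign X (n + 1) (f (dif M m))) a" if m: "m \<in> carrier M" and a: "a \<in> carrier A" for m a
    proof (rule M.graded.linear_maps_homog_eq[OF _ _ mods(2) _ m])
      show "(\<lambda>m. dif X (f (ract M m a)) \<oplus>\<^bsub>X\<^esub> ksign X (n + 1) (f (dif M (ract M m a)))) \<in> linear_maps K M X"
        by (intro linear_maps_add_map linear_maps_ksign_map mods
            linear_maps_compose[OF linear_maps_compose[OF M.ract_left[OF a] fl] X.dif_linear]
            linear_maps_compose[OF linear_maps_compose[OF M.ract_left[OF a] M.dif_linear] fl])
      show "(\<lambda>m. ract X (dif X (f m) \<oplus>\<^bsub>X\<^esub> ksign X (n + 1) (f (dif M m))) a) \<in> linear_maps K M X"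
        by (rule linear_maps_compose[OF _ X.ract_left[OF a]])
          (intro linear_maps_add_map linear_maps_ksign_map mods linear_maps_compose[OF fl X.dif_linear]
            linear_maps_compose[OF M.dif_linear fl])
      fix q m assume m: "m \<in> homog M q"
      have mc: "m \<in> carrier M" using m by (rule M.graded.homog_carrier)
      have da: "dif A a \<in> carrier A" using a by (rule linear_maps_closed[OF M.A.dif_linear])
      have fm: "f m \<in> homog X (q + n)" using fd m by (auto simp: degree_maps_def)
      note c = fc[OF mc] M.dif_X_closed[OF mc] fc[OF M.dif_X_closed[OF mc]] X.dif_X_closed[OF fc[OF mc]]
      have "dif X (f (ract M m a)) \<oplus>\<^bsub>X\<^esub> ksign X (n + 1) (f (dif M (ract M m a)))
        = (ract X (dif X (f m)) a \<oplus>\<^bsub>X\<^esub> ksign X (q + n) (ract X (f m) (dif A a))) \<oplus>\<^bsub>X\<^esub>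
          (ksign X (n + 1) (ract X (f (dif M m)) a) \<oplus>\<^bsub>X\<^esub> ksign X (n + 1 + q) (ract X (f m) (dif A a)))"
        using mc a da c
        by (simp add: eq X.dif_ract[OF fm] M.dif_ract[OF m] linear_maps_add[OF fl]
            linear_maps_ksign[OF fl mods] M.ract_closed X.ract_closed X.M.ksign_add X.M.ksign_ksign)
      also have "\<dots> = (ract X (dif X (f m)) a \<oplus>\<^bsub>X\<^esub> ksign X (n + 1) (ract X (f (dif M m)) a)) \<oplus>\<^bsub>X\<^esub>
          (ksign X (q + n) (ract X (f m) (dif A a)) \<oplus>\<^bsub>X\<^esub> ksign X (n + 1 + q) (ract X (f m) (dif A a)))"
        using a da c by (simp add: X.ract_closed X.M.a_ac)
      also have "ksign X (q + n) (ract X (f m) (dif A a)) \<oplus>\<^bsub>X\<^esub> ksign X (n + 1 + q) (ract X (f m) (dif A a)) = \<zero>\<^bsub>X\<^esub>"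
        using a da c by (simp add: ksign_def X.ract_closed X.M.r_neg X.M.l_neg)
      finally show "dif X (f (ract M m a)) \<oplus>\<^bsub>X\<^esub> ksign X (n + 1) (f (dif M (ract M m a)))
        = ract X (dif X (f m) \<oplus>\<^bsub>X\<^esub> ksign X (n + 1) (f (dif M m))) a"
        using a c by (simp add: X.ract_closed X.ract_add X.ract_ksign)
    qed
    with ops(4)[OF fd] show ?thesis by (auto simp: r M.ract_closed)
  qed
qed

lemma right_linear_family:
  assumes M: "dg_bimodule K C A M" and X: "dg_bimodule K B A X"
  shows "graded_map_family K M X (right_linear_maps K A M X)"
proof -
  interpret M: dg_bimodule K C A M by fact
  interpret X: dg_bimodule K B A X by fact
  show ?thesis
    by unfold_locales (auto simp: right_linear_ops[OF M X], auto simp: right_linear_maps_def)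
qed

lemma bimod_family:
  assumes X: "dg_bimodule K B A X" and Y: "dg_bimodule K B A Y"
  shows "graded_map_family K X Y (bimod_maps K B A X Y)"
proof -
  interpret X: dg_bimodule K B A X by fact
  interpret Y: dg_bimodule K B A Y by fact
  note mods = X.graded.module Y.graded.module
  note ops = right_linear_ops[OF X Y]
  have fcl: "f x \<in> carrier Y" if "f \<in> right_linear_maps K A X Y n" "x \<in> carrier X" for f n x
    using that by (auto simp: right_linear_maps_def degree_maps_def linear_maps_closed)
  note Bc = X.B.graded.homog_carrier
  have lz: "lact Y b \<zero>\<^bsub>Y\<^esub> = \<zero>\<^bsub>Y\<^esub>" if "b \<in> carrier B" for b
    by (rule linear_maps_zero[OF Y.lact_right[OF that] mods(2,2)])
  have lk: "lact Y b (k \<odot>\<^bsub>Y\<^esub> x) = k \<odot>\<^bsub>Y\<^esub> lact Y b x" if "k \<in> carrier K" "b \<in> carrier B" "x \<in> carrier Y" for k b x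
    by (rule linear_maps_smult[OF Y.lact_right[OF that(2)] that(1,3)])
  have sk: "k \<odot>\<^bsub>Y\<^esub> ksign Y n x = ksign Y n (k \<odot>\<^bsub>Y\<^esub> x)" if "k \<in> carrier K" "x \<in> carrier Y" for k n x
    using that by (simp add: ksign_def Y.smult_r_minus)
  show ?thesis
  proof (intro graded_map_family.intro graded_map_family_axioms.intro X.dg_module_axioms Y.dg_module_axioms)
    show "bimod_maps K B A X Y n \<subseteq> degree_maps K X Y n" for n by (auto simp: bimod_maps_def)
    show "(\<lambda>m\<in>carrier X. \<zero>\<^bsub>Y\<^esub>) \<in> bimod_maps K B A X Y n" for n
      unfolding bimod_maps_iff[OF X Y] by (auto simp: ops(1) X.lact_closed Bc lz)
    show "(\<lambda>m\<in>carrier X. f m \<oplus>\<^bsub>Y\<^esub> g m) \<in> bimod_maps K B A X Y n"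
      if "f \<in> bimod_maps K B A X Y n" "g \<in> bimod_maps K B A X Y n" for f g n
      using that unfolding bimod_maps_iff[OF X Y]
      by (auto simp: ops(2) X.lact_closed Bc fcl Y.lact_add Y.M.ksign_add Y.lact_closed)
    show "(\<lambda>m\<in>carrier X. k \<odot>\<^bsub>Y\<^esub> f m) \<in> bimod_maps K B A X Y n"
      if "k \<in> carrier K" "f \<in> bimod_maps K B A X Y n" for k f n
      using that unfolding bimod_maps_iff[OF X Y]
      by (auto simp: ops(3) X.lact_closed Bc fcl lk sk Y.lact_closed)
    fix f n assume "f \<in> bimod_maps K B A X Y n"
    then have f: "f \<in> right_linear_maps K A X Y n"
      and eq: "\<And>p b x. \<lbrakk>b \<in> homog B p; x \<in> carrier X\<rbrakk> \<Longrightarrow> f (lact X b x) = ksign Y (n * p) (lact Y b (f x))"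
      unfolding bimod_maps_iff[OF X Y] by auto
    have fl: "f \<in> linear_maps K X Y" using f by (simp add: right_linear_maps_def degree_maps_def)
    note fc = linear_maps_closed[OF fl]
    have "dif Y (f (lact X b x)) \<oplus>\<^bsub>Y\<^esub> ksign Y (n + 1) (f (dif X (lact X b x)))
      = ksign Y ((n + 1) * p) (lact Y b (dif Y (f x) \<oplus>\<^bsub>Y\<^esub> ksign Y (n + 1) (f (dif X x))))"
      if b: "b \<in> homog B p" and x: "x \<in> carrier X" for p b x
    proof -
      have bc: "b \<in> carrier B" using b by (rule Bc)
      have db: "dif B b \<in> homog B (p + 1)" using b by (rule X.B.dif_degree)
      note dbc = Bc[OF db]
      note c = fc[OF x] X.dif_X_closed[OF x] fc[OF X.dif_X_closed[OF x]] Y.dif_X_closed[OF fc[OF x]]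
      let ?d = "lact Y (dif B b) (f x)" and ?s = "ksign Y"
      have cc: "?d \<in> carrier Y" "lact Y b (dif Y (f x)) \<in> carrier Y" "lact Y b (f (dif X x)) \<in> carrier Y"
        using Y.lact_closed bc dbc c by auto
      have 1: "dif Y (f (lact X b x)) = ?s (n * p) ?d \<oplus>\<^bsub>Y\<^esub> ?s (n * p + p) (lact Y b (dif Y (f x)))"
        using b bc dbc x c cc
        by (simp add: eq linear_maps_ksign[OF Y.dif_linear mods(2,2)] Y.dif_lact Y.lact_closed Y.M.ksign_add
            Y.M.ksign_ksign)
      have 2: "?s (n + 1) (f (dif X (lact X b x))) =
          ?s (n + 1 + n * (p + 1)) ?d \<oplus>\<^bsub>Y\<^esub> ?s (n + 1 + (p + n * p)) (lact Y b (f (dif X x)))"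
        using b bc dbc db x c cc
        by (simp add: eq X.dif_lact linear_maps_add[OF fl] linear_maps_ksign[OF fl mods] X.lact_closed
            Y.M.ksign_add Y.M.ksign_ksign)
      \<comment> \<open>The two exponents add up to an odd number, so the terms with \<open>d(b)\<close> cancel.\<close>
      have 3: "?s (n * p) ?d \<oplus>\<^bsub>Y\<^esub> ?s (n + 1 + n * (p + 1)) ?d = \<zero>\<^bsub>Y\<^esub>"
        using cc by (auto simp: ksign_def Y.M.r_neg Y.M.l_neg)
      have 4: "?s (n * p + p) (lact Y b (dif Y (f x))) = ?s ((n + 1) * p) (lact Y b (dif Y (f x)))"
        "?s (n + 1 + (p + n * p)) (lact Y b (f (dif X x))) = ?s ((n + 1) * p + (n + 1)) (lact Y b (f (dif X x)))"
        by (simp_all add: algebra_simps)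
      have 5: "(u \<oplus>\<^bsub>Y\<^esub> v) \<oplus>\<^bsub>Y\<^esub> (u' \<oplus>\<^bsub>Y\<^esub> w) = v \<oplus>\<^bsub>Y\<^esub> w"
        if "u \<in> carrier Y" "v \<in> carrier Y" "u' \<in> carrier Y" "w \<in> carrier Y" "u \<oplus>\<^bsub>Y\<^esub> u' = \<zero>\<^bsub>Y\<^esub>" for u v u' w
      proof -
        have "(u \<oplus>\<^bsub>Y\<^esub> v) \<oplus>\<^bsub>Y\<^esub> (u' \<oplus>\<^bsub>Y\<^esub> w) = (u \<oplus>\<^bsub>Y\<^esub> u') \<oplus>\<^bsub>Y\<^esub> (v \<oplus>\<^bsub>Y\<^esub> w)"
          using that(1-4) by (simp add: Y.M.a_ac)
        then show ?thesis using that by simp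
      qed
      have "dif Y (f (lact X b x)) \<oplus>\<^bsub>Y\<^esub> ?s (n + 1) (f (dif X (lact X b x)))
          = ?s ((n + 1) * p) (lact Y b (dif Y (f x))) \<oplus>\<^bsub>Y\<^esub> ?s ((n + 1) * p + (n + 1)) (lact Y b (f (dif X x)))"
        unfolding 1 2 4 by (rule 5[OF _ _ _ _ 3]) (use cc in auto)
      then show ?thesis
        using bc c cc by (simp add: Y.lact_add Y.lact_ksign Y.M.ksign_add Y.M.ksign_ksign)
    qed
    then show "(\<lambda>m\<in>carrier X. dif Y (f m) \<oplus>\<^bsub>Y\<^esub> ksign Y (n + 1) (f (dif X m))) \<in> bimod_maps K B A X Y (n + 1)"
      unfolding bimod_maps_iff[OF X Y] by (auto simp: ops(4)[OF f] X.lact_closed Bc)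
  qed
qed

section \<open>The dg category of dg bimodules\<close>

lemma bimod_cat_simps:
  "Obj (bimod_cat K B A) = {X. dg_bimodule K B A X}"
  "Hom (bimod_cat K B A) X Y = graded_map_module X Y (bimod_maps K B A X Y)"
  "Comp (bimod_cat K B A) X Y Z = compose (carrier X)"
  "Id (bimod_cat K B A) X = (\<lambda>x\<in>carrier X. x)"
  by (auto simp: bimod_cat_def fun_eq_iff)

abbreviation "bimod_hom K B A X Y \<equiv> graded_map_module X Y (bimod_maps K B A X Y)"

lemma bimod_hom_maps:
  assumes "dg_bimodule K B A X" "dg_bimodule K B A Y"
  shows "map_dg_module K X Y (bimod_hom K B A X Y)"
  by (rule graded_map_family.map_dg[OF bimod_family[OF assms]])

lemma homog_bimod_hom:
  assumes "dg_bimodule K B A X" "dg_bimodule K B A Y"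
  shows "homog (bimod_hom K B A X Y) = bimod_maps K B A X Y"
  by (rule graded_map_family.N_simps(5)[OF bimod_family[OF assms]])

lemma degree_maps_compose:
  assumes "f \<in> degree_maps K M X q" "g \<in> degree_maps K X Y p" "dg_module K M"
  shows "compose (carrier M) g f \<in> degree_maps K M Y (p + q)"
proof -
  interpret M: dg_module K M by fact
  have f: "f \<in> linear_maps K M X" and g: "g \<in> linear_maps K X Y" using assms by (auto simp: degree_maps_def)
  show ?thesis
  proof (rule degree_mapsI)
    show "compose (carrier M) g f \<in> linear_maps K M Y"
      by (rule linear_maps_cong[OF linear_maps_compose[OF f g] M.graded.module]) (simp add: compose_eq)
    show "compose (carrier M) g f m \<in> homog Y (r + (p + q))" if m: "m \<in> homog M r" for m r
    proof -
      have "f m \<in> homog X (r + q)" using assms(1) m by (auto simp: degree_maps_def)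
      then have "g (f m) \<in> homog Y (r + q + p)" using assms(2) by (auto simp: degree_maps_def)
      then show ?thesis using M.graded.homog_carrier[OF m] by (simp add: compose_eq algebra_simps)
    qed
  qed (simp add: compose_extensional)
qed

lemma right_linear_compose:
  assumes "f \<in> right_linear_maps K A M X q" "g \<in> right_linear_maps K A X Y p" "dg_bimodule K C A M"
  shows "compose (carrier M) g f \<in> right_linear_maps K A M Y (p + q)"
proof -
  interpret M: dg_bimodule K C A M by fact
  have f: "f \<in> linear_maps K M X" using assms by (auto simp: right_linear_maps_def degree_maps_def)
  show ?thesis
    using assms degree_maps_compose[OF _ _ M.dg_module_axioms] linear_maps_closed[OF f]
    by (auto simp: right_linear_maps_def compose_eq M.ract_closed)
qed

lemma bimod_compose:
  assumes X: "dg_bimodule K B A X" and Y: "dg_bimodule K B A Y" and Z: "dg_bimodule K B A Z"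
    and f: "f \<in> bimod_maps K B A X Y q" and g: "g \<in> bimod_maps K B A Y Z p"
  shows "compose (carrier X) g f \<in> bimod_maps K B A X Z (p + q)"
proof -
  interpret X: dg_bimodule K B A X by fact
  interpret Y: dg_bimodule K B A Y by fact
  interpret Z: dg_bimodule K B A Z by fact
  have f': "f \<in> right_linear_maps K A X Y q" and g': "g \<in> right_linear_maps K A Y Z p"
    using f g unfolding bimod_maps_iff[OF X Y] bimod_maps_iff[OF Y Z] by auto
  have fl: "f \<in> linear_maps K X Y" and gl: "g \<in> linear_maps K Y Z"
    using f' g' by (auto simp: right_linear_maps_def degree_maps_def)
  note c = linear_maps_closed[OF fl] linear_maps_closed[OF gl]
  have "compose (carrier X) g f (lact X b x) = ksign Z ((p + q) * r) (lact Z b (compose (carrier X) g f x))"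
    if b: "b \<in> homog B r" and x: "x \<in> carrier X" for b r x
  proof -
    have bc: "b \<in> carrier B" using b by (rule X.B.graded.homog_carrier)
    have "f (lact X b x) = ksign Y (q * r) (lact Y b (f x))"
      using f b x unfolding bimod_maps_iff[OF X Y] by auto
    moreover have "g (lact Y b (f x)) = ksign Z (p * r) (lact Z b (g (f x)))"
      using g b c(1)[OF x] unfolding bimod_maps_iff[OF Y Z] by auto
    ultimately show ?thesis
      using x bc c
      by (simp add: compose_eq X.lact_closed Y.lact_closed Z.lact_closed Z.M.ksign_ksign
          linear_maps_ksign[OF gl Y.graded.module Z.graded.module] algebra_simps)
  qed
  with right_linear_compose[OF f' g' X] show ?thesis
    unfolding bimod_maps_iff[OF X Z] by auto
qed

lemma compose_bimod_bilinear:
  assumes X: "dg_bimodule K B A X" and Y: "dg_bimodule K B A Y" and Z: "dg_bimodule K B A Z"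
  shows "bilinear_map K (bimod_hom K B A Y Z) (bimod_hom K B A X Y) (bimod_hom K B A X Z) (compose (carrier X))"
proof -
  interpret XY: map_dg_module K X Y "bimod_hom K B A X Y" by (rule bimod_hom_maps[OF X Y])
  interpret YZ: map_dg_module K Y Z "bimod_hom K B A Y Z" by (rule bimod_hom_maps[OF Y Z])
  interpret XZ: map_dg_module K X Z "bimod_hom K B A X Z" by (rule bimod_hom_maps[OF X Z])
  let ?P = "map_module X Z"
  have P: "module K ?P" by (intro module_map_module XY.M.graded.module YZ.X.graded.module)
  have sg: "additive_subgroup (carrier (bimod_hom K B A X Z)) ?P"
    using XZ.subgroup_of_maps by (simp add: subgroup_record_def)
  note b = compose_maps_bilinear[OF XY.map_dg_module_axioms YZ.map_dg_module_axioms]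
  have 1: "compose (carrier X) g f \<in> carrier (bimod_hom K B A X Z)"
    if g: "g \<in> carrier (bimod_hom K B A Y Z)" and f: "f \<in> bimod_maps K B A X Y q" for g f q
  proof (rule YZ.N.graded.linear_maps_homog_into[OF bilinear_map_left[OF b] P sg _ g])
    show "f \<in> carrier (bimod_hom K B A X Y)"
      using f XY.N.graded.homog_carrier by (simp add: homog_bimod_hom[OF X Y])
    fix p g assume "g \<in> homog (bimod_hom K B A Y Z) p"
    then show "compose (carrier X) g f \<in> carrier (bimod_hom K B A X Z)"
      using bimod_compose[OF X Y Z f] XZ.N.graded.homog_carrier[of _ "p + q"]
      by (simp add: homog_bimod_hom[OF Y Z] homog_bimod_hom[OF X Z])
  qed
  have 2: "compose (carrier X) g f \<in> carrier (bimod_hom K B A X Z)"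
    if g: "g \<in> carrier (bimod_hom K B A Y Z)" and f: "f \<in> carrier (bimod_hom K B A X Y)" for g f
    by (rule XY.N.graded.linear_maps_homog_into[OF bilinear_map_right[OF b g] P sg _ f])
      (use 1 g in \<open>simp add: homog_bimod_hom[OF X Y]\<close>)
  show ?thesis
    by (intro bilinear_mapI linear_maps_codomain[OF bilinear_map_left[OF b] XZ.subgroup_of_maps XZ.map_smult]
        linear_maps_codomain[OF bilinear_map_right[OF b] XZ.subgroup_of_maps XZ.map_smult] 2)
qed

lemma bimod_dg_category:
  fixes K :: "('k, 'r) ring_scheme" and B :: "('k, 'b, 's) dg_mod_scheme"
    and A :: "('k, 'a, 't) dg_mod_scheme"
  assumes "cring K"
  shows "dg_category K (bimod_cat K B A :: (('k, 'x, 'b, 'a) dg_bimod, 'k, 'x \<Rightarrow> 'x) dg_cat)"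
proof (rule dg_categoryI[where G = "bimod_maps K B A", OF assms], unfold bimod_cat_simps mem_Collect_eq)
  fix X :: "('k, 'x, 'b, 'a) dg_bimod" assume X: "dg_bimodule K B A X"
  interpret X: dg_bimodule K B A X by fact
  interpret XX: map_dg_module K X X "bimod_hom K B A X X" by (rule bimod_hom_maps[OF X X])
  have "(\<lambda>x\<in>carrier X. x) \<in> bimod_maps K B A X X 0"
    unfolding bimod_maps_iff[OF X X] right_linear_maps_def
    by (auto intro!: degree_mapsI linear_maps_cong[OF linear_maps_id X.graded.module]
        simp: X.ract_closed X.lact_closed X.B.graded.homog_carrier X.graded.homog_carrier)
  then show "(\<lambda>x\<in>carrier X. x) \<in> carrier (bimod_hom K B A X X)"
    using XX.N.graded.homog_carrier by (simp add: homog_bimod_hom[OF X X])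
next
  fix X Y :: "('k, 'x, 'b, 'a) dg_bimod" assume X: "dg_bimodule K B A X" and Y: "dg_bimodule K B A Y"
  interpret XY: map_dg_module K X Y "bimod_hom K B A X Y" by (rule bimod_hom_maps[OF X Y])
  show "dg_module K (bimod_hom K B A X Y)" by (rule XY.N.dg_module_axioms)
  show "homog_generators (bimod_hom K B A X Y) (bimod_maps K B A X Y)"
    using homog_generators_homog[OF XY.N.dg_module_axioms] by (simp add: homog_bimod_hom[OF X Y])
  fix f p assume f: "f \<in> bimod_maps K B A X Y p"
  then have fl: "f \<in> linear_maps K X Y" and fe: "f \<in> extensional (carrier X)"
    by (auto simp: bimod_maps_def degree_maps_def)
  show "compose (carrier X) (\<lambda>x\<in>carrier Y. x) f = f" "compose (carrier X) f (\<lambda>x\<in>carrier X. x) = f"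
    using linear_maps_closed[OF fl] fe
    by (auto simp: compose_def fun_eq_iff extensional_def)
next
  fix W X Y Z :: "('k, 'x, 'b, 'a) dg_bimod" and f g h p q r
  assume o: "dg_bimodule K B A W" "dg_bimodule K B A X"
    and f: "f \<in> bimod_maps K B A W X r"
  have "f \<in> carrier W \<rightarrow> carrier X" using f by (auto simp: bimod_maps_def degree_maps_def linear_maps_def)
  then show "compose (carrier W) (compose (carrier X) h g) f = compose (carrier W) h (compose (carrier W) g f)"
    by (rule compose_assoc[symmetric])
next
  fix X Y Z :: "('k, 'x, 'b, 'a) dg_bimod" and f g p q
  assume X: "dg_bimodule K B A X" and Y: "dg_bimodule K B A Y" and Z: "dg_bimodule K B A Z"
    and g: "g \<in> bimod_maps K B A Y Z p" and f: "f \<in> bimod_maps K B A X Y q"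
  interpret XY: map_dg_module K X Y "bimod_hom K B A X Y" by (rule bimod_hom_maps[OF X Y])
  interpret YZ: map_dg_module K Y Z "bimod_hom K B A Y Z" by (rule bimod_hom_maps[OF Y Z])
  interpret XZ: map_dg_module K X Z "bimod_hom K B A X Z" by (rule bimod_hom_maps[OF X Z])
  note b = compose_bimod_bilinear[OF X Y Z]
  show gf: "compose (carrier X) g f \<in> homog (bimod_hom K B A X Z) (p + q)"
    using bimod_compose[OF X Y Z f g] by (simp add: homog_bimod_hom[OF X Z])
  have fh: "f \<in> homog (bimod_hom K B A X Y) q" and gh: "g \<in> homog (bimod_hom K B A Y Z) p"
    using f g by (simp_all add: homog_bimod_hom[OF X Y] homog_bimod_hom[OF Y Z])
  have c: "f \<in> carrier (bimod_hom K B A X Y)" "g \<in> carrier (bimod_hom K B A Y Z)"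
    using fh gh XY.N.graded.homog_carrier YZ.N.graded.homog_carrier by auto
  have dc: "dif (bimod_hom K B A X Y) f \<in> carrier (bimod_hom K B A X Y)"
      "dif (bimod_hom K B A Y Z) g \<in> carrier (bimod_hom K B A Y Z)"
      "dif (bimod_hom K B A X Z) (compose (carrier X) g f) \<in> carrier (bimod_hom K B A X Z)"
    using c bilinear_map_closed[OF b] linear_maps_closed[OF XY.N.dif_linear]
      linear_maps_closed[OF YZ.N.dif_linear] linear_maps_closed[OF XZ.N.dif_linear] by auto
  note cc = bilinear_map_closed[OF b]
  show "dif (bimod_hom K B A X Z) (compose (carrier X) g f) =
      compose (carrier X) (dif (bimod_hom K B A Y Z) g) f \<oplus>\<^bsub>bimod_hom K B A X Z\<^esub>
      ksign (bimod_hom K B A X Z) p (compose (carrier X) g (dif (bimod_hom K B A X Y) f))"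
  proof (rule XZ.map_eqI[OF dc(3)])
    show "compose (carrier X) (dif (bimod_hom K B A Y Z) g) f \<oplus>\<^bsub>bimod_hom K B A X Z\<^esub>
        ksign (bimod_hom K B A X Z) p (compose (carrier X) g (dif (bimod_hom K B A X Y) f))
        \<in> carrier (bimod_hom K B A X Z)"
      using c dc cc by (simp add: XZ.N.M.a_closed XZ.N.M.ksign_closed)
    fix m assume m: "m \<in> carrier X"
    show "dif (bimod_hom K B A X Z) (compose (carrier X) g f) m =
      (compose (carrier X) (dif (bimod_hom K B A Y Z) g) f \<oplus>\<^bsub>bimod_hom K B A X Z\<^esub>
      ksign (bimod_hom K B A X Z) p (compose (carrier X) g (dif (bimod_hom K B A X Y) f))) m"
      using dif_compose_maps[OF XY.map_dg_module_axioms YZ.map_dg_module_axioms XZ.map_dg_module_axioms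
          fh gh gf m] m c dc cc
      by (simp add: XZ.add_apply XZ.ksign_apply compose_eq)
  qed
qed (rule compose_bimod_bilinear)

section \<open>The bimodule of right linear maps\<close>

lemma HOM_simps:
  "carrier (HOM K A M X) = carrier (graded_map_module M X (right_linear_maps K A M X))"
  "zero (HOM K A M X) = zero (graded_map_module M X (right_linear_maps K A M X))"
  "add (HOM K A M X) = add (graded_map_module M X (right_linear_maps K A M X))"
  "smult (HOM K A M X) = smult (graded_map_module M X (right_linear_maps K A M X))"
  "homog (HOM K A M X) = homog (graded_map_module M X (right_linear_maps K A M X))"
  "dif (HOM K A M X) = dif (graded_map_module M X (right_linear_maps K A M X))"
  "lact (HOM K A M X) = (\<lambda>b f. \<lambda>m\<in>carrier M. lact X b (f m))"
  "ract (HOM K A M X) = (\<lambda>f c. \<lambda>m\<in>carrier M. f (lact M c m))"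
  by (simp_all add: HOM_def dg_mod.defs dg_bimod.defs)

text \<open>The homogeneous elements \<open>b f c\<close> with homogeneous factors. They span \<open>B HOM C\<close> and make its grading and
  its stability under the differential visible.\<close>

definition bar_generators where
  "bar_generators K A B C M X n = {lact (HOM K A M X) b (ract (HOM K A M X) f c) | b f c.
    \<exists>p q r. b \<in> homog B p \<and> f \<in> homog (HOM K A M X) q \<and> c \<in> homog C r \<and> n = p + q + r}"

lemma HOM_bar_simps:
  "carrier (HOM_bar K A B C M X) = additive_span (HOM K A M X)
    {lact (HOM K A M X) b (ract (HOM K A M X) f c) | b f c.
      b \<in> carrier B \<and> f \<in> carrier (HOM K A M X) \<and> c \<in> carrier C}"
  "zero (HOM_bar K A B C M X) = zero (HOM K A M X)"
  "add (HOM_bar K A B C M X) = add (HOM K A M X)"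
  "smult (HOM_bar K A B C M X) = smult (HOM K A M X)"
  "homog (HOM_bar K A B C M X) n = carrier (HOM_bar K A B C M X) \<inter> homog (HOM K A M X) n"
  "dif (HOM_bar K A B C M X) = dif (HOM K A M X)"
  "lact (HOM_bar K A B C M X) = lact (HOM K A M X)"
  "ract (HOM_bar K A B C M X) = ract (HOM K A M X)"
  by (simp_all add: HOM_bar_def Let_def)

locale HOM_pair = M: dg_bimodule K C A M + X: dg_bimodule K B A X
  for K :: "('k, 'r) ring_scheme" and A :: "('k, 'a, 's) dg_mod_scheme"
    and B :: "('k, 'b, 't) dg_mod_scheme" and C :: "('k, 'c, 'u) dg_mod_scheme"
    and M :: "('k, 'm, 'c, 'a) dg_bimod" and X :: "('k, 'x, 'b, 'a) dg_bimod"
begin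

abbreviation "H \<equiv> HOM K A M X"
abbreviation "S \<equiv> HOM_bar K A B C M X"
abbreviation "P \<equiv> map_module M X"

lemma H_maps: "map_dg_module K M X H"
proof -
  let ?G = "graded_map_module M X (right_linear_maps K A M X)"
  interpret G: map_dg_module K M X ?G
    by (rule graded_map_family.map_dg[OF right_linear_family[OF M.dg_bimodule_axioms X.dg_bimodule_axioms]])
  have sr: "subgroup_record H ?G"
    unfolding subgroup_record_def HOM_simps
    by (auto intro!: G.N.M.abelian_group_axioms additive_subgroup_make)
  have "dg_module K H"
  proof (rule dg_submodule_record[OF G.N.dg_module_axioms sr HOM_simps(4)])
    show "homog H n = carrier H \<inter> homog ?G n" for n
      using G.N.graded.homog_carrier by (auto simp: HOM_simps)
    show "dif ?G f \<in> carrier H" if "f \<in> carrier H" for f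
      using that linear_maps_closed[OF G.N.dif_linear] by (simp add: HOM_simps)
  qed (simp_all add: HOM_simps G.N.graded.homog_span)
  then show ?thesis
    by (intro map_dg_module.intro map_dg_module_axioms.intro M.dg_module_axioms X.dg_module_axioms)
      (simp_all add: HOM_simps G.map_linear G.map_extensional G.map_zero G.map_add G.map_smult
        G.map_homog G.dif_apply)
qed

sublocale H: map_dg_module K M X H
  by (rule H_maps)

lemma homog_H: "homog H n = right_linear_maps K A M X n"
  by (simp add: HOM_simps graded_map_family.N_simps(5)[OF right_linear_family[OF M.dg_bimodule_axioms X.dg_bimodule_axioms]])

lemma P_module: "module K P"
  by (rule module_map_module[OF M.graded.module X.graded.module])

lemma H_subgroup: "additive_subgroup (carrier H) P"
  using H.subgroup_of_maps by (simp add: subgroup_record_def)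

lemma lact_apply: "m \<in> carrier M \<Longrightarrow> lact H b f m = lact X b (f m)"
  and ract_apply: "m \<in> carrier M \<Longrightarrow> ract H f c m = f (lact M c m)"
  by (simp_all add: HOM_simps)

lemma lact_homog:
  assumes b: "b \<in> homog B p" and f: "f \<in> homog H n"
  shows "lact H b f \<in> homog H (p + n)"
proof -
  have bc: "b \<in> carrier B" using b by (rule X.B.graded.homog_carrier)
  have f': "f \<in> right_linear_maps K A M X n" using f by (simp add: homog_H)
  then have fl: "f \<in> linear_maps K M X" by (simp add: right_linear_maps_def degree_maps_def)
  have "lact H b f \<in> degree_maps K M X (p + n)"
  proof (rule degree_mapsI)
    show "lact H b f \<in> linear_maps K M X"
      by (rule linear_maps_cong[OF linear_maps_compose[OF fl X.lact_right[OF bc]] M.graded.module])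
        (simp add: lact_apply)
    show "lact H b f \<in> extensional (carrier M)" by (simp add: HOM_simps)
    show "lact H b f m \<in> homog X (q + (p + n))" if "m \<in> homog M q" for m q
      using X.lact_degree[OF b H.map_homog[OF f that]] M.graded.homog_carrier[OF that]
      by (simp add: lact_apply algebra_simps)
  qed
  then show ?thesis
    using f' bc linear_maps_closed[OF fl]
    by (auto simp: homog_H right_linear_maps_def lact_apply M.ract_closed X.lact_ract)
qed

lemma ract_homog:
  assumes f: "f \<in> homog H n" and c: "c \<in> homog C q"
  shows "ract H f c \<in> homog H (n + q)"
proof -
  have cc: "c \<in> carrier C" using c by (rule M.B.graded.homog_carrier)
  have f': "f \<in> right_linear_maps K A M X n" using f by (simp add: homog_H)
  then have fl: "f \<in> linear_maps K M X" by (simp add: right_linear_maps_def degree_maps_def)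
  have "ract H f c \<in> degree_maps K M X (n + q)"
  proof (rule degree_mapsI)
    show "ract H f c \<in> linear_maps K M X"
      by (rule linear_maps_cong[OF linear_maps_compose[OF M.lact_right[OF cc] fl] M.graded.module])
        (simp add: ract_apply)
    show "ract H f c \<in> extensional (carrier M)" by (simp add: HOM_simps)
    show "ract H f c m \<in> homog X (r + (n + q))" if "m \<in> homog M r" for m r
      using H.map_homog[OF f M.lact_degree[OF c that]] M.graded.homog_carrier[OF that]
      by (simp add: ract_apply algebra_simps)
  qed
  then show ?thesis
    using f' cc by (auto simp: homog_H right_linear_maps_def ract_apply M.ract_closed M.lact_closed simp flip: M.lact_ract)
qed

lemma lact_bilinear_P: "bilinear_map K B H P (lact H)"
proof (rule bilinear_mapI)
  show "(\<lambda>b. lact H b f) \<in> linear_maps K B P" if f: "f \<in> carrier H" for f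
    using H.map_closed[OF f] linear_maps_add[OF X.lact_left] linear_maps_smult[OF X.lact_left] X.lact_closed
    by (intro linear_mapsI) (auto simp: map_module_def HOM_simps(7) fun_eq_iff)
  show "lact H b \<in> linear_maps K H P" if b: "b \<in> carrier B" for b
    using H.map_closed X.lact_add[OF b] linear_maps_smult[OF X.lact_right[OF b]] X.lact_closed[OF b]
    by (intro linear_mapsI) (auto simp: map_module_def HOM_simps(7) fun_eq_iff H.add_apply H.smult_apply)
qed

lemma ract_bilinear_P: "bilinear_map K H C P (ract H)"
proof (rule bilinear_mapI)
  show "(\<lambda>f. ract H f c) \<in> linear_maps K H P" if c: "c \<in> carrier C" for c
    using H.map_closed M.lact_closed[OF c]
    by (intro linear_mapsI) (auto simp: map_module_def HOM_simps(8) fun_eq_iff H.add_apply H.smult_apply)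
  show "ract H f \<in> linear_maps K C P" if f: "f \<in> carrier H" for f
    using H.map_closed[OF f] M.lact_closed linear_maps_add[OF M.lact_left] linear_maps_smult[OF M.lact_left]
      linear_maps_add[OF H.map_linear[OF f]] linear_maps_smult[OF H.map_linear[OF f]]
    by (intro linear_mapsI) (auto simp: map_module_def HOM_simps(8) fun_eq_iff)
qed

lemma lact_closed: "\<lbrakk>b \<in> carrier B; f \<in> carrier H\<rbrakk> \<Longrightarrow> lact H b f \<in> carrier H"
proof (rule X.B.graded.linear_maps_homog_into[OF bilinear_map_left[OF lact_bilinear_P] P_module H_subgroup])
  fix p b assume f: "f \<in> carrier H" and b: "b \<in> homog B p"
  show "lact H b f \<in> carrier H"
    by (rule H.N.graded.linear_maps_homog_into[OF bilinear_map_right[OF lact_bilinear_P] P_module H_subgroup _ f])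
      (use b lact_homog[OF b] X.B.graded.homog_carrier H.N.graded.homog_carrier in blast)+
qed

lemma ract_closed: "\<lbrakk>f \<in> carrier H; c \<in> carrier C\<rbrakk> \<Longrightarrow> ract H f c \<in> carrier H"
proof (rule H.N.graded.linear_maps_homog_into[OF bilinear_map_left[OF ract_bilinear_P] P_module H_subgroup])
  fix n f assume c: "c \<in> carrier C" and f: "f \<in> homog H n"
  show "ract H f c \<in> carrier H"
    by (rule M.B.graded.linear_maps_homog_into[OF bilinear_map_right[OF ract_bilinear_P] P_module H_subgroup _ c])
      (use f ract_homog[OF f] H.N.graded.homog_carrier in blast)+
qed

lemma lact_bilinear: "bilinear_map K B H H (lact H)"
  by (intro bilinear_mapI linear_maps_codomain[OF bilinear_map_left[OF lact_bilinear_P] H.subgroup_of_maps H.map_smult]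
      linear_maps_codomain[OF bilinear_map_right[OF lact_bilinear_P] H.subgroup_of_maps H.map_smult] lact_closed)

lemma ract_bilinear: "bilinear_map K H C H (ract H)"
  by (intro bilinear_mapI linear_maps_codomain[OF bilinear_map_left[OF ract_bilinear_P] H.subgroup_of_maps H.map_smult]
      linear_maps_codomain[OF bilinear_map_right[OF ract_bilinear_P] H.subgroup_of_maps H.map_smult] ract_closed)

lemma lact_linear_left: "f \<in> carrier H \<Longrightarrow> (\<lambda>b. lact H b f) \<in> linear_maps K B H"
  by (rule bilinear_map_left[OF lact_bilinear])

lemma lact_linear_right: "b \<in> carrier B \<Longrightarrow> lact H b \<in> linear_maps K H H"
  by (rule bilinear_map_right[OF lact_bilinear])

lemma ract_linear_left: "c \<in> carrier C \<Longrightarrow> (\<lambda>f. ract H f c) \<in> linear_maps K H H"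
  by (rule bilinear_map_left[OF ract_bilinear])

lemma ract_linear_right: "f \<in> carrier H \<Longrightarrow> ract H f \<in> linear_maps K C H"
  by (rule bilinear_map_right[OF ract_bilinear])

lemma lact_assoc:
  "\<lbrakk>b \<in> carrier B; b' \<in> carrier B; f \<in> carrier H\<rbrakk> \<Longrightarrow> lact H (b \<otimes>\<^bsub>B\<^esub> b') f = lact H b (lact H b' f)"
  by (rule H.map_eqI) (simp_all add: lact_closed lact_apply X.B.mult_closed X.lact_assoc H.map_closed)

lemma ract_assoc:
  "\<lbrakk>f \<in> carrier H; c \<in> carrier C; c' \<in> carrier C\<rbrakk> \<Longrightarrow> ract H f (c \<otimes>\<^bsub>C\<^esub> c') = ract H (ract H f c) c'"
  by (rule H.map_eqI) (simp_all add: ract_closed ract_apply M.B.mult_closed M.lact_assoc M.lact_closed)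

lemma lact_ract:
  "\<lbrakk>b \<in> carrier B; f \<in> carrier H; c \<in> carrier C\<rbrakk> \<Longrightarrow> ract H (lact H b f) c = lact H b (ract H f c)"
  by (rule H.map_eqI) (simp_all add: ract_closed lact_closed lact_apply ract_apply M.lact_closed)

lemma dif_H_closed: "f \<in> carrier H \<Longrightarrow> dif H f \<in> carrier H"
  by (rule linear_maps_closed[OF H.N.dif_linear])

lemma dif_lact:
  assumes b: "b \<in> homog B p" and f: "f \<in> homog H n"
  shows "dif H (lact H b f) = lact H (dif B b) f \<oplus>\<^bsub>H\<^esub> ksign H p (lact H b (dif H f))"
proof -
  have c: "b \<in> carrier B" "dif B b \<in> carrier B" "f \<in> carrier H" "dif H f \<in> carrier H"
    using b f X.B.graded.homog_carrier H.N.graded.homog_carrier linear_maps_closed[OF X.B.dif_linear] dif_H_closed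
    by auto
  show ?thesis
  proof (rule H.map_eqI)
    show "dif H (lact H b f) \<in> carrier H" using c by (simp add: dif_H_closed lact_closed)
    show "lact H (dif B b) f \<oplus>\<^bsub>H\<^esub> ksign H p (lact H b (dif H f)) \<in> carrier H"
      using c by (simp add: lact_closed H.N.M.ksign_closed H.N.M.a_closed)
    fix m assume m: "m \<in> carrier M"
    note mc = H.map_closed[OF c(3) m] H.map_closed[OF c(3) M.dif_X_closed[OF m]]
      X.dif_X_closed[OF H.map_closed[OF c(3) m]]
    show "dif H (lact H b f) m = (lact H (dif B b) f \<oplus>\<^bsub>H\<^esub> ksign H p (lact H b (dif H f))) m"
      using m c mc
      by (simp add: H.dif_apply[OF lact_homog[OF b f]] H.dif_apply[OF f] lact_apply H.add_apply
          H.ksign_apply lact_closed X.dif_lact[OF b] M.dif_X_closed X.lact_add X.lact_ksign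
          X.lact_closed X.M.ksign_add X.M.ksign_ksign X.M.a_assoc)
        (simp add: add.assoc)
  qed
qed

lemma dif_ract:
  assumes f: "f \<in> homog H n" and c: "c \<in> carrier C"
  shows "dif H (ract H f c) = ract H (dif H f) c \<oplus>\<^bsub>H\<^esub> ksign H n (ract H f (dif C c))"
proof (rule M.B.graded.linear_maps_homog_eq[OF _ _ H.N.graded.module _ c])
  have fc: "f \<in> carrier H" "dif H f \<in> carrier H"
    using f H.N.graded.homog_carrier dif_H_closed by auto
  note fl = H.map_linear[OF fc(1)]
  note mods = M.graded.module X.graded.module
  show "(\<lambda>c. dif H (ract H f c)) \<in> linear_maps K C H"
    by (rule linear_maps_compose[OF ract_linear_right[OF fc(1)] H.N.dif_linear])
  show "(\<lambda>c. ract H (dif H f) c \<oplus>\<^bsub>H\<^esub> ksign H n (ract H f (dif C c))) \<in> linear_maps K C H"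
    by (intro linear_maps_add_map linear_maps_ksign_map M.B.graded.module H.N.graded.module
        ract_linear_right[OF fc(2)] linear_maps_compose[OF M.B.dif_linear ract_linear_right[OF fc(1)]])
  fix q c assume c: "c \<in> homog C q"
  have cc: "c \<in> carrier C" "dif C c \<in> carrier C"
    using c M.B.graded.homog_carrier linear_maps_closed[OF M.B.dif_linear] by auto
  show "dif H (ract H f c) = ract H (dif H f) c \<oplus>\<^bsub>H\<^esub> ksign H n (ract H f (dif C c))"
  proof (rule H.map_eqI)
    show "dif H (ract H f c) \<in> carrier H" using fc cc by (simp add: dif_H_closed ract_closed)
    show "ract H (dif H f) c \<oplus>\<^bsub>H\<^esub> ksign H n (ract H f (dif C c)) \<in> carrier H"
      using fc cc by (simp add: ract_closed H.N.M.ksign_closed H.N.M.a_closed)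
    fix m assume m: "m \<in> carrier M"
    note lm = M.lact_closed[OF cc(1) m] M.lact_closed[OF cc(2) m] M.lact_closed[OF cc(1) M.dif_X_closed[OF m]]
    note fm = H.map_closed[OF fc(1) lm(1)] H.map_closed[OF fc(1) lm(2)] H.map_closed[OF fc(1) lm(3)]
    note dfm = X.dif_X_closed[OF fm(1)]
    let ?u = "dif X (f (lact M c m))" and ?v = "f (lact M (dif C c) m)" and ?w = "f (lact M c (dif M m))"
    have "(ract H (dif H f) c \<oplus>\<^bsub>H\<^esub> ksign H n (ract H f (dif C c))) m =
        ?u \<oplus>\<^bsub>X\<^esub> (ksign X (n + 1) ?v \<oplus>\<^bsub>X\<^esub> ksign X (n + 1 + q) ?w) \<oplus>\<^bsub>X\<^esub> ksign X n ?v"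
      using m fc cc lm fm dfm
      by (simp add: H.add_apply H.ksign_apply ract_closed ract_apply H.dif_apply[OF f] M.dif_lact[OF c]
          linear_maps_add[OF fl] linear_maps_ksign[OF fl mods] X.M.ksign_add X.M.ksign_ksign)
    also have "\<dots> = ?u \<oplus>\<^bsub>X\<^esub> ksign X (n + 1 + q) ?w \<oplus>\<^bsub>X\<^esub> (ksign X (n + 1) ?v \<oplus>\<^bsub>X\<^esub> ksign X n ?v)"
      using fm dfm by (simp add: X.M.a_ac)
    also have "ksign X (n + 1) ?v \<oplus>\<^bsub>X\<^esub> ksign X n ?v = \<zero>\<^bsub>X\<^esub>"
      using fm by (simp add: ksign_def X.M.r_neg X.M.l_neg)
    finally have "(ract H (dif H f) c \<oplus>\<^bsub>H\<^esub> ksign H n (ract H f (dif C c))) m =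
        ?u \<oplus>\<^bsub>X\<^esub> ksign X (n + 1 + q) ?w" using fm dfm by simp
    then show "dif H (ract H f c) m = (ract H (dif H f) c \<oplus>\<^bsub>H\<^esub> ksign H n (ract H f (dif C c))) m"
      using m by (simp add: H.dif_apply[OF ract_homog[OF f c]] ract_apply M.dif_X_closed) (simp add: ac_simps)
  qed
qed

section \<open>The largest unitary sub-bimodule\<close>

abbreviation "triples \<equiv> {lact H b (ract H f c) | b f c. b \<in> carrier B \<and> f \<in> carrier H \<and> c \<in> carrier C}"

lemma triples_closed: "triples \<subseteq> carrier H"
  by (auto simp: lact_closed ract_closed)

lemma S_carrier: "carrier S = additive_span H triples"
  by (rule HOM_bar_simps(1))

lemma triple_S: "\<lbrakk>b \<in> carrier B; f \<in> carrier H; c \<in> carrier C\<rbrakk> \<Longrightarrow> lact H b (ract H f c) \<in> carrier S"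
  unfolding S_carrier by (rule additive_span_incl) blast

lemma S_subgroup: "additive_subgroup (carrier S) H"
  unfolding S_carrier by (rule additive_span_subgroup[OF H.N.M.abelian_group_axioms triples_closed])

lemma S_record: "subgroup_record S H"
  by (simp add: subgroup_record_def H.N.M.abelian_group_axioms S_subgroup HOM_bar_simps(2,3))

lemma S_H: "f \<in> carrier S \<Longrightarrow> f \<in> carrier H"
  using additive_subgroup_closed(1)[OF S_subgroup] by blast

abbreviation "homog_triples \<equiv> (\<Union>n. bar_generators K A B C M X n)"

lemma triple_generator:
  "\<lbrakk>b \<in> homog B p; f \<in> homog H q; c \<in> homog C r\<rbrakk> \<Longrightarrow> lact H b (ract H f c) \<in> homog_triples"
  unfolding bar_generators_def by blast

lemma homog_triples_S: "homog_triples \<subseteq> carrier S"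
  using X.B.graded.homog_carrier H.N.graded.homog_carrier M.B.graded.homog_carrier triple_S
  by (fastforce simp: bar_generators_def)

text \<open>Replace the three factors by homogeneous ones in turn, by linearity.\<close>

lemma homog_triples_span: "additive_span H homog_triples = carrier S"
proof
  show "additive_span H homog_triples \<subseteq> carrier S"
    by (rule additive_span_least[OF H.N.M.abelian_group_axioms S_subgroup homog_triples_S])
  have sub: "homog_triples \<subseteq> carrier H" using homog_triples_S S_H by blast
  note sg = additive_span_subgroup[OF H.N.M.abelian_group_axioms sub]
  note hm = H.N.graded.module
  have 1: "lact H b (ract H f c) \<in> additive_span H homog_triples"
    if b: "b \<in> homog B p" and f: "f \<in> homog H q" and c: "c \<in> carrier C" for b f c p q
  proof (rule M.B.graded.linear_maps_homog_into[OF _ hm sg _ c])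
    show "(\<lambda>c. lact H b (ract H f c)) \<in> linear_maps K C H"
      by (rule linear_maps_compose[OF ract_linear_right lact_linear_right])
        (use b f X.B.graded.homog_carrier H.N.graded.homog_carrier in auto)
    show "lact H b (ract H f c) \<in> additive_span H homog_triples" if "c \<in> homog C r" for c r
      by (rule additive_span_incl[OF triple_generator[OF b f that]])
  qed
  have 2: "lact H b (ract H f c) \<in> additive_span H homog_triples"
    if b: "b \<in> homog B p" and f: "f \<in> carrier H" and c: "c \<in> carrier C" for b f c p
  proof (rule H.N.graded.linear_maps_homog_into[OF _ hm sg _ f])
    show "(\<lambda>f. lact H b (ract H f c)) \<in> linear_maps K H H"
      by (rule linear_maps_compose[OF ract_linear_left lact_linear_right])
        (use b c X.B.graded.homog_carrier in auto)
  qed (use 1 b c in auto)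
  have 3: "lact H b (ract H f c) \<in> additive_span H homog_triples"
    if b: "b \<in> carrier B" and f: "f \<in> carrier H" and c: "c \<in> carrier C" for b f c
    by (rule X.B.graded.linear_maps_homog_into[OF lact_linear_left hm sg _ b])
      (use 2 f c ract_closed in auto)
  show "carrier S \<subseteq> additive_span H homog_triples"
    unfolding S_carrier
    by (rule additive_span_least[OF H.N.M.abelian_group_axioms sg]) (use 3 in blast)
qed

lemma S_linear_into:
  assumes "h \<in> linear_maps K H Q" "module K Q" "additive_subgroup J Q"
    and "\<And>p q r b f c. \<lbrakk>b \<in> homog B p; f \<in> homog H q; c \<in> homog C r\<rbrakk> \<Longrightarrow> h (lact H b (ract H f c)) \<in> J"
    and "f \<in> carrier S"
  shows "h f \<in> J"
proof (rule linear_maps_span_into[OF assms(1) H.N.graded.module assms(2,3), of homog_triples])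
  show "homog_triples \<subseteq> carrier H" using homog_triples_S S_H by blast
  show "f \<in> additive_span H homog_triples" using assms(5) by (simp add: homog_triples_span)
  show "h f \<in> J" if "f \<in> homog_triples" for f
    using that assms(4) unfolding bar_generators_def by blast
qed

lemma bar_generators_homog: "bar_generators K A B C M X n \<subseteq> homog S n"
proof
  fix f assume f: "f \<in> bar_generators K A B C M X n"
  then have "f \<in> carrier S" using homog_triples_S by blast
  moreover have "f \<in> homog H n"
  proof -
    obtain b g c p q r where g: "b \<in> homog B p" "g \<in> homog H q" "c \<in> homog C r" "n = p + q + r"
      "f = lact H b (ract H g c)" using f by (auto simp: bar_generators_def)
    then show ?thesis using lact_homog[OF g(1) ract_homog[OF g(2,3)]] by (simp add: algebra_simps)
  qed
  ultimately show "f \<in> homog S n" by (simp add: HOM_bar_simps(5))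
qed

lemma S_lact_closed:
  assumes b: "b \<in> carrier B" and f: "f \<in> carrier S"
  shows "lact H b f \<in> carrier S"
proof (rule S_linear_into[OF lact_linear_right[OF b] H.N.graded.module S_subgroup _ f])
  fix p q r b' f c assume "b' \<in> homog B p" "f \<in> homog H q" "c \<in> homog C r"
  then have c: "b' \<in> carrier B" "f \<in> carrier H" "c \<in> carrier C"
    using X.B.graded.homog_carrier H.N.graded.homog_carrier M.B.graded.homog_carrier by auto
  then show "lact H b (lact H b' (ract H f c)) \<in> carrier S"
    using b triple_S[OF X.B.mult_closed[OF b c(1)] c(2,3)] by (simp add: lact_assoc ract_closed)
qed

lemma S_ract_closed:
  assumes c: "c \<in> carrier C" and f: "f \<in> carrier S"
  shows "ract H f c \<in> carrier S"
proof (rule S_linear_into[OF ract_linear_left[OF c] H.N.graded.module S_subgroup _ f])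
  fix p q r b f c' assume "b \<in> homog B p" "f \<in> homog H q" "c' \<in> homog C r"
  then have c': "b \<in> carrier B" "f \<in> carrier H" "c' \<in> carrier C"
    using X.B.graded.homog_carrier H.N.graded.homog_carrier M.B.graded.homog_carrier by auto
  then show "ract H (lact H b (ract H f c')) c \<in> carrier S"
    using c triple_S[OF c'(1,2) M.B.mult_closed[OF c'(3) c]] by (simp add: lact_ract ract_assoc ract_closed)
qed

lemma S_dif_closed:
  assumes f: "f \<in> carrier S"
  shows "dif H f \<in> carrier S"
proof (rule S_linear_into[OF H.N.dif_linear H.N.graded.module S_subgroup _ f])
  fix p q r b f c assume bfc: "b \<in> homog B p" "f \<in> homog H q" "c \<in> homog C r"
  then have cl: "b \<in> carrier B" "f \<in> carrier H" "c \<in> carrier C"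
    using X.B.graded.homog_carrier H.N.graded.homog_carrier M.B.graded.homog_carrier by auto
  have dc: "dif B b \<in> carrier B" "dif C c \<in> carrier C" "dif H f \<in> carrier H"
    using cl linear_maps_closed[OF X.B.dif_linear] linear_maps_closed[OF M.B.dif_linear] dif_H_closed by auto
  note tr = triple_S[OF dc(1) cl(2,3)] triple_S[OF cl(1) dc(3) cl(3)] triple_S[OF cl(1,2) dc(2)]
  have "dif H (lact H b (ract H f c)) = lact H (dif B b) (ract H f c) \<oplus>\<^bsub>H\<^esub>
      ksign H p (lact H b (ract H (dif H f) c) \<oplus>\<^bsub>H\<^esub> ksign H q (lact H b (ract H f (dif C c))))"
    using cl dc
    by (simp add: dif_lact[OF bfc(1) ract_homog[OF bfc(2,3)]] dif_ract[OF bfc(2)] ract_closed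
        linear_maps_add[OF lact_linear_right] linear_maps_ksign[OF lact_linear_right H.N.graded.module H.N.graded.module]
        H.N.M.ksign_closed)
  also have "\<dots> \<in> carrier S"
    by (intro additive_subgroup_closed(3)[OF S_subgroup] additive_subgroup_ksign[OF S_subgroup H.N.M.abelian_group_axioms] tr)
  finally show "dif H (lact H b (ract H f c)) \<in> carrier S" .
qed

lemma S_smult_closed: "\<lbrakk>k \<in> carrier K; f \<in> carrier S\<rbrakk> \<Longrightarrow> k \<odot>\<^bsub>H\<^esub> f \<in> carrier S"
proof (rule S_linear_into[where h = "\<lambda>f. k \<odot>\<^bsub>H\<^esub> f", OF _ H.N.graded.module S_subgroup])
  assume k: "k \<in> carrier K"
  show "(\<lambda>f. k \<odot>\<^bsub>H\<^esub> f) \<in> linear_maps K H H"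
    by (rule linear_maps_smult_map[OF H.N.graded.module linear_maps_id k])
  fix p q r b f c assume bfc: "b \<in> homog B p" "f \<in> homog H q" "c \<in> homog C r"
  then have cl: "b \<in> carrier B" "f \<in> carrier H" "c \<in> carrier C"
    using X.B.graded.homog_carrier H.N.graded.homog_carrier M.B.graded.homog_carrier by auto
  then show "k \<odot>\<^bsub>H\<^esub> lact H b (ract H f c) \<in> carrier S"
    using linear_maps_smult[OF lact_linear_left[OF ract_closed[OF cl(2,3)]] k cl(1)]
      triple_S[OF X.B.smult_closed[OF k cl(1)] cl(2,3)] k by simp
qed

lemma S_dg_module: "dg_module K S"
proof (rule dg_submodule_record[OF H.N.dg_module_axioms S_record HOM_bar_simps(4) S_smult_closed
      HOM_bar_simps(5) _ HOM_bar_simps(6) S_dif_closed])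
  have sub: "(\<Union>n. homog S n) \<subseteq> carrier H"
    using S_H by (auto simp: HOM_bar_simps(5))
  show "carrier S \<subseteq> additive_span H (\<Union>n. homog S n)"
    unfolding homog_triples_span[symmetric]
    using bar_generators_homog
    by (intro additive_span_mono H.N.M.abelian_group_axioms sub) (auto intro!: additive_span_incl)
qed auto

lemma S_maps: "map_dg_module K M X S"
  using S_dg_module M.dg_module_axioms X.dg_module_axioms
  by (intro map_dg_module.intro map_dg_module_axioms.intro)
    (auto simp: HOM_bar_simps(2-) S_H H.map_linear H.map_extensional H.map_zero H.map_add H.map_smult
      H.map_homog H.dif_apply)

sublocale S: map_dg_module K M X S
  by (rule S_maps)

lemma S_ksign: "f \<in> carrier S \<Longrightarrow> ksign S n f = ksign H n f"
  by (rule subgroup_record_ksign[OF S_record])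

text \<open>It is unitary because \<open>b f c = u (b f c)\<close> and \<open>b f c = (b f c) v\<close> for local units with \<open>u b = b\<close> and \<open>c v = c\<close>.\<close>

lemma S_dg_bimodule: "dg_bimodule K B C S"
proof (intro dg_bimodule.intro dg_bimodule_axioms.intro S_dg_module X.B.dg_algebra_axioms M.B.dg_algebra_axioms)
  note restrict = linear_maps_restrict[OF _ S_record HOM_bar_simps(4)]
  note codomain = linear_maps_codomain[OF _ S_record HOM_bar_simps(4)]
  show "(\<lambda>b. lact S b f) \<in> linear_maps K B S" if "f \<in> carrier S" for f
    unfolding HOM_bar_simps(7) using that by (intro codomain lact_linear_left S_H S_lact_closed)
  show "(\<lambda>f. lact S b f) \<in> linear_maps K S S" if "b \<in> carrier B" for b
    unfolding HOM_bar_simps(7) using that by (intro codomain[OF restrict] lact_linear_right S_lact_closed)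
  show "(\<lambda>f. ract S f c) \<in> linear_maps K S S" if "c \<in> carrier C" for c
    unfolding HOM_bar_simps(8) using that by (intro codomain[OF restrict] ract_linear_left S_ract_closed)
  show "(\<lambda>c. ract S f c) \<in> linear_maps K C S" if "f \<in> carrier S" for f
    unfolding HOM_bar_simps(8) using that by (intro codomain ract_linear_right S_H S_ract_closed)
  have unitary: "additive_span S G = carrier S" if "G \<subseteq> carrier S" "triples \<subseteq> G" for G
  proof
    show "additive_span S G \<subseteq> carrier S"
      by (rule additive_subgroup_closed(1)[OF additive_span_subgroup[OF S.N.M.abelian_group_axioms that(1)]])
    have "G \<subseteq> carrier H" using that(1) S_H by blast
    then have "carrier S \<subseteq> additive_span H G"
      unfolding S_carrier
      by (intro additive_span_mono H.N.M.abelian_group_axioms subset_trans[OF that(2)])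
        (auto intro: additive_span_incl)
    then show "carrier S \<subseteq> additive_span S G"
      using subgroup_record_span[OF S_record that(1)] by simp
  qed
  show "additive_span S {lact S b f | b f. b \<in> carrier B \<and> f \<in> carrier S} = carrier S"
    unfolding HOM_bar_simps(7)
  proof (rule unitary)
    show "triples \<subseteq> {lact H b f | b f. b \<in> carrier B \<and> f \<in> carrier S}"
    proof clarify
      fix b f c assume bfc: "b \<in> carrier B" "f \<in> carrier H" "c \<in> carrier C"
      obtain u where u: "u \<in> carrier B" "u \<otimes>\<^bsub>B\<^esub> b = b" using X.B.local_units(1)[OF bfc(1)] by blast
      then have "lact H b (ract H f c) = lact H u (lact H b (ract H f c))"
        using bfc by (simp flip: lact_assoc add: ract_closed)
      with u triple_S[OF bfc] show "\<exists>b' g. lact H b (ract H f c) = lact H b' g \<and> b' \<in> carrier B \<and> g \<in> carrier S"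
        by blast
    qed
  qed (auto simp: S_lact_closed)
  show "additive_span S {ract S f c | f c. f \<in> carrier S \<and> c \<in> carrier C} = carrier S"
    unfolding HOM_bar_simps(8)
  proof (rule unitary)
    show "triples \<subseteq> {ract H f c | f c. f \<in> carrier S \<and> c \<in> carrier C}"
    proof clarify
      fix b f c assume bfc: "b \<in> carrier B" "f \<in> carrier H" "c \<in> carrier C"
      obtain u where u: "u \<in> carrier C" "c \<otimes>\<^bsub>C\<^esub> u = c" using M.B.local_units(2)[OF bfc(3)] by blast
      then have "lact H b (ract H f c) = ract H (lact H b (ract H f c)) u"
        using bfc by (simp add: ract_closed lact_ract flip: ract_assoc)
      with u triple_S[OF bfc] show "\<exists>g c'. lact H b (ract H f c) = ract H g c' \<and> g \<in> carrier S \<and> c' \<in> carrier C"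
        by blast
    qed
  qed (auto simp: S_ract_closed)
  show "dif S (ract S (lact S b f) c) = ract S (lact S (dif B b) f) c \<oplus>\<^bsub>S\<^esub>
      ksign S p (ract S (lact S b (dif S f)) c) \<oplus>\<^bsub>S\<^esub> ksign S (p + q) (ract S (lact S b f) (dif C c))"
    if b: "b \<in> homog B p" and f: "f \<in> homog S q" and c: "c \<in> carrier C" for b p f q c
  proof -
    have fH: "f \<in> homog H q" and fS: "f \<in> carrier S" using f by (simp_all add: HOM_bar_simps(5))
    have cl: "b \<in> carrier B" "dif B b \<in> carrier B" "f \<in> carrier H" "dif H f \<in> carrier H" "dif C c \<in> carrier C"
      using b c fS S_H X.B.graded.homog_carrier linear_maps_closed[OF X.B.dif_linear]
        linear_maps_closed[OF M.B.dif_linear] dif_H_closed by auto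
    have sS: "ract H (lact H b (dif H f)) c \<in> carrier S" "ract H (lact H b f) (dif C c) \<in> carrier S"
      using b c cl fS S_dif_closed S_ract_closed S_lact_closed by auto
    show ?thesis
      unfolding HOM_bar_simps(2-4,6-) S_ksign[OF sS(1)] S_ksign[OF sS(2)]
      using cl c
      by (simp add: dif_ract[OF lact_homog[OF b fH]] dif_lact[OF b fH] lact_closed H.N.M.ksign_closed
          linear_maps_add[OF ract_linear_left] linear_maps_ksign[OF ract_linear_left H.N.graded.module H.N.graded.module])
  qed
qed (use X.B.graded.homog_carrier M.B.graded.homog_carrier in
    \<open>auto simp: HOM_bar_simps(5,7,8) lact_assoc ract_assoc lact_ract S_H S_lact_closed S_ract_closed
      lact_homog ract_homog\<close>)

end

section \<open>Composition with bimodule morphisms\<close>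

text \<open>For \<open>a : N \<rightarrow> M\<close> of degree \<open>p\<close> and \<open>c\<close> of degree \<open>r\<close>, precomposition satisfies
  \<open>(b f) \<circ> a = b (f \<circ> a)\<close> and \<open>(f c) \<circ> a = (-1)\<^bsup>p r\<^esup> (f \<circ> a) c\<close>. It therefore maps \<open>B HOM(M, X) C\<close> into
  \<open>B HOM(N, X) C\<close>.\<close>

locale precomposition = MX: HOM_pair K A B C M X + NX: HOM_pair K A B C N X
  for K :: "('k, 'r) ring_scheme" and A :: "('k, 'a, 's) dg_mod_scheme"
    and B :: "('k, 'b, 't) dg_mod_scheme" and C :: "('k, 'c, 'u) dg_mod_scheme"
    and M :: "('k, 'm, 'c, 'a) dg_bimod" and N :: "('k, 'm, 'c, 'a) dg_bimod"
    and X :: "('k, 'x, 'b, 'a) dg_bimod"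
begin

abbreviation "CA \<equiv> bimod_hom K C A N M"

sublocale CA: map_dg_module K N M CA
  by (rule bimod_hom_maps[OF NX.M.dg_bimodule_axioms MX.M.dg_bimodule_axioms])

lemma homog_CA: "homog CA = bimod_maps K C A N M"
  by (rule homog_bimod_hom[OF NX.M.dg_bimodule_axioms MX.M.dg_bimodule_axioms])

lemma CA_lact:
  "\<lbrakk>a \<in> homog CA p; c \<in> homog C r; n \<in> carrier N\<rbrakk> \<Longrightarrow> a (lact N c n) = ksign M (p * r) (lact M c (a n))"
  and CA_right_linear: "a \<in> homog CA p \<Longrightarrow> a \<in> right_linear_maps K A N M p"
  unfolding homog_CA bimod_maps_iff[OF NX.M.dg_bimodule_axioms MX.M.dg_bimodule_axioms] by auto

lemma bilinear_P: "bilinear_map K MX.H CA NX.P (compose (carrier N))"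
  by (rule compose_maps_bilinear[OF CA.map_dg_module_axioms MX.H.map_dg_module_axioms])

lemma homog_H: "\<lbrakk>f \<in> homog MX.H r; a \<in> homog CA p\<rbrakk> \<Longrightarrow> compose (carrier N) f a \<in> homog NX.H (r + p)"
  unfolding MX.homog_H NX.homog_H
  by (rule right_linear_compose[OF CA_right_linear _ NX.M.dg_bimodule_axioms])

lemma closed_H:
  assumes f: "f \<in> carrier MX.H" and a: "a \<in> homog CA p"
  shows "compose (carrier N) f a \<in> carrier NX.H"
  by (rule MX.H.N.graded.linear_maps_homog_into[OF bilinear_map_left[OF bilinear_P] NX.P_module NX.H_subgroup _ f])
    (use a homog_H CA.N.graded.homog_carrier NX.H.N.graded.homog_carrier in blast)+

lemma compose_lact:
  assumes f: "f \<in> carrier MX.H" and a: "a \<in> homog CA p" and b: "b \<in> carrier B"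
  shows "compose (carrier N) (lact MX.H b f) a = lact NX.H b (compose (carrier N) f a)"
proof (rule NX.H.map_eqI)
  show "compose (carrier N) (lact MX.H b f) a \<in> carrier NX.H" using f b by (intro closed_H[OF _ a] MX.lact_closed)
  show "lact NX.H b (compose (carrier N) f a) \<in> carrier NX.H" using f b by (intro closed_H[OF _ a] NX.lact_closed)
  show "compose (carrier N) (lact MX.H b f) a n = lact NX.H b (compose (carrier N) f a) n" if "n \<in> carrier N" for n
    using that CA.map_closed[OF CA.N.graded.homog_carrier[OF a]]
    by (simp add: compose_eq MX.lact_apply NX.lact_apply)
qed

lemma compose_ract:
  assumes f: "f \<in> carrier MX.H" and a: "a \<in> homog CA p" and c: "c \<in> homog C r"
  shows "compose (carrier N) (ract MX.H f c) a = ksign NX.H (p * r) (ract NX.H (compose (carrier N) f a) c)"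
proof (rule NX.H.map_eqI)
  have cc: "c \<in> carrier C" using c by (rule MX.M.B.graded.homog_carrier)
  note fa = closed_H[OF f a]
  show "compose (carrier N) (ract MX.H f c) a \<in> carrier NX.H" using f cc by (intro closed_H[OF _ a] MX.ract_closed)
  show "ksign NX.H (p * r) (ract NX.H (compose (carrier N) f a) c) \<in> carrier NX.H"
    using fa cc by (simp add: NX.ract_closed NX.H.N.M.ksign_closed)
  fix n assume n: "n \<in> carrier N"
  have an: "a n \<in> carrier M" by (rule CA.map_closed[OF CA.N.graded.homog_carrier[OF a] n])
  have lan: "lact M c (a n) \<in> carrier M" using cc an by (rule MX.M.lact_closed)
  have "f (a (lact N c n)) = ksign X (p * r) (f (lact M c (a n)))"
    using CA_lact[OF a c n] linear_maps_ksign[OF MX.H.map_linear[OF f] MX.M.graded.module MX.X.graded.module lan]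
    by simp
  then have "ksign X (p * r) (f (a (lact N c n))) = f (lact M c (a n))"
    using MX.H.map_closed[OF f lan] by (simp add: MX.X.M.ksign_ksign)
  then show "compose (carrier N) (ract MX.H f c) a n
      = ksign NX.H (p * r) (ract NX.H (compose (carrier N) f a) c) n"
    using n an cc fa
    by (simp add: compose_eq MX.ract_apply NX.ract_apply NX.H.ksign_apply NX.ract_closed NX.M.lact_closed)
qed

lemma closed_S:
  assumes f: "f \<in> carrier MX.S" and a: "a \<in> carrier CA"
  shows "compose (carrier N) f a \<in> carrier NX.S"
proof (rule CA.N.graded.linear_maps_homog_into[OF bilinear_map_right[OF bilinear_P MX.S_H[OF f]] NX.P_module _ _ a])
  have "additive_subgroup (carrier NX.S) NX.P"
    using NX.S.subgroup_of_maps by (simp add: subgroup_record_def)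
  then show sg: "additive_subgroup (carrier NX.S) NX.P" .
  fix p a assume a: "a \<in> homog CA p"
  have ac: "a \<in> carrier CA" using a by (rule CA.N.graded.homog_carrier)
  show "compose (carrier N) f a \<in> carrier NX.S"
  proof (rule MX.S_linear_into[OF bilinear_map_left[OF bilinear_P ac] NX.P_module sg _ f])
    fix r s t b f c assume bfc: "b \<in> homog B r" "f \<in> homog MX.H s" "c \<in> homog C t"
    then have cl: "b \<in> carrier B" "f \<in> carrier MX.H" "c \<in> carrier C"
      using MX.X.B.graded.homog_carrier MX.H.N.graded.homog_carrier MX.M.B.graded.homog_carrier by auto
    have "compose (carrier N) (lact MX.H b (ract MX.H f c)) a
        = ksign NX.H (p * t) (lact NX.H b (ract NX.H (compose (carrier N) f a) c))"
      using cl closed_H[OF cl(2) a]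
      by (simp add: compose_lact[OF _ a] compose_ract[OF _ a bfc(3)] MX.ract_closed NX.ract_closed
          linear_maps_ksign[OF NX.lact_linear_right NX.H.N.graded.module NX.H.N.graded.module])
    also have "\<dots> \<in> carrier NX.S"
      using cl closed_H[OF cl(2) a]
      by (intro additive_subgroup_ksign[OF NX.S_subgroup NX.H.N.M.abelian_group_axioms] NX.triple_S)
    finally show "compose (carrier N) (lact MX.H b (ract MX.H f c)) a \<in> carrier NX.S" .
  qed
qed

lemma bilinear_S: "bilinear_map K MX.S CA NX.S (compose (carrier N))"
  by (intro bilinear_mapI closed_S
      linear_maps_codomain[OF bilinear_map_left[OF compose_maps_bilinear[OF CA.map_dg_module_axioms MX.S.map_dg_module_axioms]]
        NX.S.subgroup_of_maps NX.S.map_smult]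
      linear_maps_codomain[OF bilinear_map_right[OF compose_maps_bilinear[OF CA.map_dg_module_axioms MX.S.map_dg_module_axioms]]
        NX.S.subgroup_of_maps NX.S.map_smult])

lemma homog_S:
  assumes f: "f \<in> homog MX.S r" and a: "a \<in> homog CA p"
  shows "compose (carrier N) f a \<in> homog NX.S (r + p)"
  using f homog_H[OF _ a] closed_S[OF _ CA.N.graded.homog_carrier[OF a]] by (simp add: HOM_bar_simps(5))

lemma dif_S:
  assumes f: "f \<in> homog MX.S r" and a: "a \<in> homog CA p"
  shows "dif NX.S (compose (carrier N) f a) = compose (carrier N) (dif MX.S f) a
    \<oplus>\<^bsub>NX.S\<^esub> ksign NX.S r (compose (carrier N) f (dif CA a))"
proof -
  have c: "f \<in> carrier MX.S" "a \<in> carrier CA" "dif MX.S f \<in> carrier MX.S" "dif CA a \<in> carrier CA"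
    using f a MX.S.N.graded.homog_carrier CA.N.graded.homog_carrier
      linear_maps_closed[OF MX.S.N.dif_linear] linear_maps_closed[OF CA.N.dif_linear] by auto
  note cc = closed_S[OF c(1,2)] closed_S[OF c(3,2)] closed_S[OF c(1,4)]
  show ?thesis
  proof (rule NX.S.map_eqI)
    show "dif NX.S (compose (carrier N) f a) \<in> carrier NX.S"
      using cc linear_maps_closed[OF NX.S.N.dif_linear] by blast
    show "compose (carrier N) (dif MX.S f) a \<oplus>\<^bsub>NX.S\<^esub> ksign NX.S r (compose (carrier N) f (dif CA a)) \<in> carrier NX.S"
      using cc by (simp add: NX.S.N.M.ksign_closed NX.S.N.M.a_closed)
    show "dif NX.S (compose (carrier N) f a) n = (compose (carrier N) (dif MX.S f) a
        \<oplus>\<^bsub>NX.S\<^esub> ksign NX.S r (compose (carrier N) f (dif CA a))) n" if "n \<in> carrier N" for n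
      using dif_compose_maps[OF CA.map_dg_module_axioms MX.S.map_dg_module_axioms NX.S.map_dg_module_axioms
          a f homog_S[OF f a] that] that cc
      by (simp add: NX.S.add_apply NX.S.ksign_apply compose_eq)
  qed
qed

end

text \<open>For \<open>\<phi> : X \<rightarrow> Y\<close> of degree \<open>q\<close> and \<open>b\<close> of degree \<open>r\<close>, postcomposition satisfies
  \<open>\<phi> \<circ> (b f) = (-1)\<^bsup>q r\<^esup> b (\<phi> \<circ> f)\<close> and \<open>\<phi> \<circ> (f c) = (\<phi> \<circ> f) c\<close>.\<close>

locale postcomposition = NX: HOM_pair K A B C N X + NY: HOM_pair K A B C N Y
  for K :: "('k, 'r) ring_scheme" and A :: "('k, 'a, 's) dg_mod_scheme"
    and B :: "('k, 'b, 't) dg_mod_scheme" and C :: "('k, 'c, 'u) dg_mod_scheme"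
    and N :: "('k, 'm, 'c, 'a) dg_bimod"
    and X :: "('k, 'x, 'b, 'a) dg_bimod" and Y :: "('k, 'x, 'b, 'a) dg_bimod"
begin

abbreviation "BA \<equiv> bimod_hom K B A X Y"

sublocale BA: map_dg_module K X Y BA
  by (rule bimod_hom_maps[OF NX.X.dg_bimodule_axioms NY.X.dg_bimodule_axioms])

lemma homog_BA: "homog BA = bimod_maps K B A X Y"
  by (rule homog_bimod_hom[OF NX.X.dg_bimodule_axioms NY.X.dg_bimodule_axioms])

lemma BA_lact:
  "\<lbrakk>\<phi> \<in> homog BA q; b \<in> homog B r; x \<in> carrier X\<rbrakk> \<Longrightarrow> \<phi> (lact X b x) = ksign Y (q * r) (lact Y b (\<phi> x))"
  and BA_right_linear: "\<phi> \<in> homog BA q \<Longrightarrow> \<phi> \<in> right_linear_maps K A X Y q"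
  unfolding homog_BA bimod_maps_iff[OF NX.X.dg_bimodule_axioms NY.X.dg_bimodule_axioms] by auto

lemma bilinear_P: "bilinear_map K BA NX.H NY.P (compose (carrier N))"
  by (rule compose_maps_bilinear[OF NX.H.map_dg_module_axioms BA.map_dg_module_axioms])

lemma homog_H: "\<lbrakk>\<phi> \<in> homog BA q; f \<in> homog NX.H r\<rbrakk> \<Longrightarrow> compose (carrier N) \<phi> f \<in> homog NY.H (q + r)"
  unfolding NX.homog_H NY.homog_H
  by (rule right_linear_compose[OF _ BA_right_linear NX.M.dg_bimodule_axioms])

lemma closed_H:
  assumes \<phi>: "\<phi> \<in> homog BA q" and f: "f \<in> carrier NX.H"
  shows "compose (carrier N) \<phi> f \<in> carrier NY.H"
  by (rule NX.H.N.graded.linear_maps_homog_into[OF bilinear_map_right[OF bilinear_P] NY.P_module NY.H_subgroup _ f])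
    (use \<phi> homog_H BA.N.graded.homog_carrier NY.H.N.graded.homog_carrier in blast)+

lemma compose_ract:
  assumes \<phi>: "\<phi> \<in> homog BA q" and f: "f \<in> carrier NX.H" and c: "c \<in> carrier C"
  shows "compose (carrier N) \<phi> (ract NX.H f c) = ract NY.H (compose (carrier N) \<phi> f) c"
proof (rule NY.H.map_eqI)
  show "compose (carrier N) \<phi> (ract NX.H f c) \<in> carrier NY.H" using f c by (intro closed_H[OF \<phi>] NX.ract_closed)
  show "ract NY.H (compose (carrier N) \<phi> f) c \<in> carrier NY.H" using f c by (intro closed_H[OF \<phi>] NY.ract_closed)
  show "compose (carrier N) \<phi> (ract NX.H f c) n = ract NY.H (compose (carrier N) \<phi> f) c n" if "n \<in> carrier N" for n
    using that c by (simp add: compose_eq NX.ract_apply NY.ract_apply NX.M.lact_closed)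
qed

lemma compose_lact:
  assumes \<phi>: "\<phi> \<in> homog BA q" and f: "f \<in> carrier NX.H" and b: "b \<in> homog B r"
  shows "compose (carrier N) \<phi> (lact NX.H b f) = ksign NY.H (q * r) (lact NY.H b (compose (carrier N) \<phi> f))"
proof (rule NY.H.map_eqI)
  have bc: "b \<in> carrier B" using b by (rule NX.X.B.graded.homog_carrier)
  note cf = closed_H[OF \<phi> f]
  show "compose (carrier N) \<phi> (lact NX.H b f) \<in> carrier NY.H" using f bc by (intro closed_H[OF \<phi>] NX.lact_closed)
  show "ksign NY.H (q * r) (lact NY.H b (compose (carrier N) \<phi> f)) \<in> carrier NY.H"
    using cf bc by (simp add: NY.lact_closed NY.H.N.M.ksign_closed)
  show "compose (carrier N) \<phi> (lact NX.H b f) n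
      = ksign NY.H (q * r) (lact NY.H b (compose (carrier N) \<phi> f)) n" if n: "n \<in> carrier N" for n
    using n cf bc BA_lact[OF \<phi> b NX.H.map_closed[OF f n]]
    by (simp add: compose_eq NX.lact_apply NY.lact_apply NY.H.ksign_apply NY.lact_closed)
qed

lemma closed_S:
  assumes \<phi>: "\<phi> \<in> carrier BA" and f: "f \<in> carrier NX.S"
  shows "compose (carrier N) \<phi> f \<in> carrier NY.S"
proof (rule BA.N.graded.linear_maps_homog_into[OF bilinear_map_left[OF bilinear_P NX.S_H[OF f]] NY.P_module _ _ \<phi>])
  have "additive_subgroup (carrier NY.S) NY.P"
    using NY.S.subgroup_of_maps by (simp add: subgroup_record_def)
  then show sg: "additive_subgroup (carrier NY.S) NY.P" .
  fix q \<phi> assume \<phi>: "\<phi> \<in> homog BA q"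
  have \<phi>c: "\<phi> \<in> carrier BA" using \<phi> by (rule BA.N.graded.homog_carrier)
  show "compose (carrier N) \<phi> f \<in> carrier NY.S"
  proof (rule NX.S_linear_into[OF bilinear_map_right[OF bilinear_P \<phi>c] NY.P_module sg _ f])
    fix r s t b f c assume bfc: "b \<in> homog B r" "f \<in> homog NX.H s" "c \<in> homog C t"
    then have cl: "b \<in> carrier B" "f \<in> carrier NX.H" "c \<in> carrier C"
      using NX.X.B.graded.homog_carrier NX.H.N.graded.homog_carrier NX.M.B.graded.homog_carrier by auto
    have "compose (carrier N) \<phi> (lact NX.H b (ract NX.H f c))
        = ksign NY.H (q * r) (lact NY.H b (ract NY.H (compose (carrier N) \<phi> f) c))"
      using cl by (simp add: compose_lact[OF \<phi> _ bfc(1)] compose_ract[OF \<phi>] NX.ract_closed)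
    also have "\<dots> \<in> carrier NY.S"
      using cl closed_H[OF \<phi> cl(2)]
      by (intro additive_subgroup_ksign[OF NY.S_subgroup NY.H.N.M.abelian_group_axioms] NY.triple_S)
    finally show "compose (carrier N) \<phi> (lact NX.H b (ract NX.H f c)) \<in> carrier NY.S" .
  qed
qed

lemma bilinear_S: "bilinear_map K BA NX.S NY.S (compose (carrier N))"
  by (intro bilinear_mapI closed_S
      linear_maps_codomain[OF bilinear_map_left[OF compose_maps_bilinear[OF NX.S.map_dg_module_axioms BA.map_dg_module_axioms]]
        NY.S.subgroup_of_maps NY.S.map_smult]
      linear_maps_codomain[OF bilinear_map_right[OF compose_maps_bilinear[OF NX.S.map_dg_module_axioms BA.map_dg_module_axioms]]
        NY.S.subgroup_of_maps NY.S.map_smult])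

lemma homog_S:
  assumes \<phi>: "\<phi> \<in> homog BA q" and f: "f \<in> homog NX.S r"
  shows "compose (carrier N) \<phi> f \<in> homog NY.S (q + r)"
  using f homog_H[OF \<phi>] closed_S[OF BA.N.graded.homog_carrier[OF \<phi>]] by (simp add: HOM_bar_simps(5))

lemma dif_S:
  assumes \<phi>: "\<phi> \<in> homog BA q" and f: "f \<in> homog NX.S r"
  shows "dif NY.S (compose (carrier N) \<phi> f) = compose (carrier N) (dif BA \<phi>) f
    \<oplus>\<^bsub>NY.S\<^esub> ksign NY.S q (compose (carrier N) \<phi> (dif NX.S f))"
proof -
  have c: "\<phi> \<in> carrier BA" "f \<in> carrier NX.S" "dif BA \<phi> \<in> carrier BA" "dif NX.S f \<in> carrier NX.S"
    using f \<phi> NX.S.N.graded.homog_carrier BA.N.graded.homog_carrier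
      linear_maps_closed[OF NX.S.N.dif_linear] linear_maps_closed[OF BA.N.dif_linear] by auto
  note cc = closed_S[OF c(1,2)] closed_S[OF c(3,2)] closed_S[OF c(1,4)]
  show ?thesis
  proof (rule NY.S.map_eqI)
    show "dif NY.S (compose (carrier N) \<phi> f) \<in> carrier NY.S"
      using cc linear_maps_closed[OF NY.S.N.dif_linear] by blast
    show "compose (carrier N) (dif BA \<phi>) f \<oplus>\<^bsub>NY.S\<^esub> ksign NY.S q (compose (carrier N) \<phi> (dif NX.S f)) \<in> carrier NY.S"
      using cc by (simp add: NY.S.N.M.ksign_closed NY.S.N.M.a_closed)
    show "dif NY.S (compose (carrier N) \<phi> f) n = (compose (carrier N) (dif BA \<phi>) f
        \<oplus>\<^bsub>NY.S\<^esub> ksign NY.S q (compose (carrier N) \<phi> (dif NX.S f))) n" if "n \<in> carrier N" for n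
      using dif_compose_maps[OF NX.S.map_dg_module_axioms BA.map_dg_module_axioms NY.S.map_dg_module_axioms
          f \<phi> homog_S[OF \<phi> f] that] that cc
      by (simp add: NY.S.add_apply NY.S.ksign_apply compose_eq)
  qed
qed

end

section \<open>The action on morphisms\<close>

lemma linear_maps_into_maps:
  assumes "\<And>m. m \<in> carrier M \<Longrightarrow> (\<lambda>l. g l m) \<in> linear_maps K L X"
  shows "(\<lambda>l. \<lambda>m\<in>carrier M. g l m) \<in> linear_maps K L (map_module M X)"
proof (rule linear_mapsI)
  show "(\<lambda>m\<in>carrier M. g l m) \<in> carrier (map_module M X)" if "l \<in> carrier L" for l
    using linear_maps_closed[OF assms that] by (simp add: map_module_def)
  show "(\<lambda>m\<in>carrier M. g (l \<oplus>\<^bsub>L\<^esub> l') m)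
      = (\<lambda>m\<in>carrier M. g l m) \<oplus>\<^bsub>map_module M X\<^esub> (\<lambda>m\<in>carrier M. g l' m)"
    if "l \<in> carrier L" "l' \<in> carrier L" for l l'
    using linear_maps_add[OF assms that] by (auto simp: map_module_def)
  show "(\<lambda>m\<in>carrier M. g (k \<odot>\<^bsub>L\<^esub> l) m) = k \<odot>\<^bsub>map_module M X\<^esub> (\<lambda>m\<in>carrier M. g l m)"
    if "k \<in> carrier K" "l \<in> carrier L" for k l
    using linear_maps_smult[OF assms that] by (auto simp: map_module_def)
qed

text \<open>The degrees \<open>p\<close> and \<open>q\<close> are parameters, so that the formula is bilinear in \<open>a\<close> and \<open>\<phi>\<close>; it is the intended
  one when \<open>a\<close> and \<open>\<phi>\<close> have these degrees.\<close>

definition signed_composite where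
  "signed_composite K A B C M X N Y p q a \<phi> = (\<lambda>f\<in>carrier (HOM_bar K A B C M X).
    graded_extend (HOM_bar K A B C N Y) (HOM_bar K A B C M X)
      (\<lambda>r f. ksign (HOM_bar K A B C N Y) ((q + r) * p)
        (compose (carrier N) \<phi> (compose (carrier N) f a))) f)"

text \<open>The inner extensions take values in all maps: for \<open>a\<close> and \<open>\<phi>\<close> of the wrong degrees the signed composite
  need not be a sum of homogeneous bimodule morphisms.\<close>

definition HOM_bar_map where
  "HOM_bar_map K A B C M X N Y =
    tensor_lift (bimod_hom K B C (HOM_bar K A B C M X) (HOM_bar K A B C N Y)) (\<lambda>a \<phi>.
      graded_extend (map_module (HOM_bar K A B C M X) (HOM_bar K A B C N Y)) (bimod_hom K C A N M)
        (\<lambda>p a. graded_extend (map_module (HOM_bar K A B C M X) (HOM_bar K A B C N Y))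
          (bimod_hom K B A X Y) (\<lambda>q \<phi>. signed_composite K A B C M X N Y p q a \<phi>) \<phi>) a)"

locale HOM_arrow = pre: precomposition K A B C M N X + post: postcomposition K A B C N X Y
  for K :: "('k, 'r) ring_scheme" and A :: "('k, 'a, 's) dg_mod_scheme"
    and B :: "('k, 'b, 't) dg_mod_scheme" and C :: "('k, 'c, 'u) dg_mod_scheme"
    and M :: "('k, 'm, 'c, 'a) dg_bimod" and N :: "('k, 'm, 'c, 'a) dg_bimod"
    and X :: "('k, 'x, 'b, 'a) dg_bimod" and Y :: "('k, 'x, 'b, 'a) dg_bimod"
begin

abbreviation "CA \<equiv> bimod_hom K C A N M"
abbreviation "BA \<equiv> bimod_hom K B A X Y"
abbreviation "S \<equiv> HOM_bar K A B C M X"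
abbreviation "S' \<equiv> HOM_bar K A B C N Y"
abbreviation "BC \<equiv> bimod_hom K B C S S'"
abbreviation "P \<equiv> map_module S S'"
abbreviation "sandwich \<phi> f a \<equiv> compose (carrier N) \<phi> (compose (carrier N) f a)"
abbreviation "\<Psi> \<equiv> signed_composite K A B C M X N Y"
abbreviation "F \<equiv> HOM_bar_map K A B C M X N Y"

sublocale BC: map_dg_module K S S' BC
  by (rule bimod_hom_maps[OF pre.MX.S_dg_bimodule post.NY.S_dg_bimodule])

sublocale S: dg_bimodule K B C S
  by (rule pre.MX.S_dg_bimodule)

sublocale S': dg_bimodule K B C S'
  by (rule post.NY.S_dg_bimodule)

lemma P_module: "module K P"
  by (rule module_map_module[OF pre.MX.S.N.graded.module post.NY.S.N.graded.module])

lemma homog_BC: "homog BC = bimod_maps K B C S S'"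
  by (rule homog_bimod_hom[OF pre.MX.S_dg_bimodule post.NY.S_dg_bimodule])

lemma sandwich_linear:
  shows "\<lbrakk>\<phi> \<in> carrier BA; a \<in> carrier CA\<rbrakk> \<Longrightarrow> (\<lambda>f. sandwich \<phi> f a) \<in> linear_maps K S S'"
    and "\<lbrakk>\<phi> \<in> carrier BA; f \<in> carrier S\<rbrakk> \<Longrightarrow> (\<lambda>a. sandwich \<phi> f a) \<in> linear_maps K CA S'"
    and "\<lbrakk>f \<in> carrier S; a \<in> carrier CA\<rbrakk> \<Longrightarrow> (\<lambda>\<phi>. sandwich \<phi> f a) \<in> linear_maps K BA S'"
  by (rule linear_maps_compose[OF bilinear_map_left[OF pre.bilinear_S] bilinear_map_right[OF post.bilinear_S]],
      assumption+)
    (rule linear_maps_compose[OF bilinear_map_right[OF pre.bilinear_S] bilinear_map_right[OF post.bilinear_S]],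
      assumption+,
      rule bilinear_map_left[OF post.bilinear_S pre.closed_S], assumption+)

lemma source_graded: "graded_module K S" and target_graded: "graded_module K S'"
  by (rule pre.MX.S.N.graded.graded_module_axioms post.NY.S.N.graded.graded_module_axioms)+

lemma sandwich_homog:
  assumes "\<phi> \<in> homog BA q" "f \<in> homog S r" "a \<in> homog CA p"
  shows "sandwich \<phi> f a \<in> homog S' (r + (p + q))"
  using post.homog_S[OF assms(1) pre.homog_S[OF assms(2,3)]] by (simp add: ac_simps)

lemma sandwich_closed:
  assumes "\<phi> \<in> carrier BA" "f \<in> carrier S" "a \<in> carrier CA"
  shows "sandwich \<phi> f a \<in> carrier S'"
  by (rule linear_maps_closed[OF sandwich_linear(1)[OF assms(1,3)] assms(2)])

lemma signed_linear:
  assumes "\<phi> \<in> carrier BA" "a \<in> carrier CA"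
  shows "(\<lambda>f. ksign S' ((q + r) * p) (sandwich \<phi> f a)) \<in> linear_maps K S S'"
  by (rule linear_maps_ksign_map[OF post.NY.S.N.graded.module sandwich_linear(1)[OF assms]])

lemma \<Psi>_linear:
  assumes "\<phi> \<in> carrier BA" "a \<in> carrier CA"
  shows "\<Psi> p q a \<phi> \<in> linear_maps K S S'"
  by (rule linear_maps_cong[OF pre.MX.S.N.graded.graded_extend_linear[OF post.NY.S.N.graded.module signed_linear[OF assms]]
        pre.MX.S.N.graded.module])
    (simp add: signed_composite_def)

lemma \<Psi>_homog_apply:
  assumes "\<phi> \<in> carrier BA" "a \<in> carrier CA" "f \<in> homog S r"
  shows "\<Psi> p q a \<phi> f = ksign S' ((q + r) * p) (sandwich \<phi> f a)"
  using pre.MX.S.N.graded.graded_extend_homog[OF post.NY.S.N.graded.module signed_linear[OF assms(1,2)] assms(3)]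
    pre.MX.S.N.graded.homog_carrier[OF assms(3)]
  by (simp add: signed_composite_def)

lemma \<Psi>_bilinear: "bilinear_map K CA BA P (\<Psi> p q)"
  unfolding signed_composite_def
proof (rule bilinear_mapI)
  fix \<phi> assume \<phi>: "\<phi> \<in> carrier BA"
  show "(\<lambda>a. \<lambda>f\<in>carrier S. graded_extend S' S (\<lambda>r f. ksign S' ((q + r) * p) (sandwich \<phi> f a)) f)
      \<in> linear_maps K CA P"
    by (intro linear_maps_into_maps pre.MX.S.N.graded.graded_extend_parameter pre.CA.N.graded.module post.NY.S.N.graded.module
        linear_maps_ksign_map sandwich_linear \<phi>)
next
  fix a assume a: "a \<in> carrier CA"
  show "(\<lambda>\<phi>. \<lambda>f\<in>carrier S. graded_extend S' S (\<lambda>r f. ksign S' ((q + r) * p) (sandwich \<phi> f a)) f)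
      \<in> linear_maps K BA P"
    by (intro linear_maps_into_maps pre.MX.S.N.graded.graded_extend_parameter post.BA.N.graded.module post.NY.S.N.graded.module
        linear_maps_ksign_map sandwich_linear a)
qed

text \<open>Replacing \<open>f\<close> by \<open>b f c\<close> adds \<open>(|b| + |c|) p\<close> to the exponent. The part \<open>|c| p\<close> cancels the sign that
  arises when \<open>c\<close> is moved past \<open>a\<close>; the part \<open>|b| p\<close> and the sign \<open>|b| q\<close> from moving \<open>b\<close> past \<open>\<phi>\<close> add up to
  the sign required of a morphism of degree \<open>p + q\<close>.\<close>

lemma \<Psi>_bimod:
  assumes a: "a \<in> homog CA p" and \<phi>: "\<phi> \<in> homog BA q"
  shows "\<Psi> p q a \<phi> \<in> bimod_maps K B C S S' (p + q)"
proof -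
  have c: "a \<in> carrier CA" "\<phi> \<in> carrier BA"
    using a \<phi> pre.CA.N.graded.homog_carrier post.BA.N.graded.homog_carrier by auto
  note lin = \<Psi>_linear[OF c(2,1), of p q] and app = \<Psi>_homog_apply[OF c(2,1), where p = p and q = q]
  note mods = pre.MX.S.N.graded.module post.NY.S.N.graded.module
  have deg: "\<Psi> p q a \<phi> \<in> degree_maps K S S' (p + q)"
  proof (rule degree_mapsI[OF lin])
    show "\<Psi> p q a \<phi> \<in> extensional (carrier S)" by (simp add: signed_composite_def)
    show "\<Psi> p q a \<phi> f \<in> homog S' (r + (p + q))" if "f \<in> homog S r" for f r
      unfolding app[OF that] by (intro post.NY.S.N.graded.ksign_homog sandwich_homog \<phi> that a)
  qed
  have right: "\<Psi> p q a \<phi> (ract S f c) = ract S' (\<Psi> p q a \<phi> f) c" if f: "f \<in> homog S r" and c': "c \<in> homog C s" for f r c s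
  proof -
    have fS: "f \<in> carrier S" and cC: "c \<in> carrier C" using f c' pre.MX.S.N.graded.homog_carrier pre.MX.M.B.graded.homog_carrier by auto
    have fH: "f \<in> carrier pre.MX.H" by (rule pre.MX.S_H[OF fS])
    note fa = pre.closed_H[OF fH a]
    note sw = sandwich_closed[OF c(2) fS c(1)]
    have "sandwich \<phi> (ract S f c) a = ksign S' (p * s) (ract S' (sandwich \<phi> f a) c)"
      using cC pre.NX.ract_closed[OF fa cC] post.NY.S_ract_closed[OF cC sw]
      by (simp add: HOM_bar_simps(8) pre.compose_ract[OF fH a c'] post.compose_ract[OF \<phi> fa]
          linear_maps_ksign[OF bilinear_map_right[OF post.bilinear_P c(2)] pre.NX.H.N.graded.module post.NY.P_module]
          flip: post.NY.S.ksign_maps)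
    then show ?thesis
      using sw cC S'.ract_closed[OF sw cC]
      by (simp add: app[OF f] app[OF S.ract_degree[OF f c']] S'.ract_ksign post.NY.S.N.M.ksign_ksign)
        (rule ksign_parity, simp add: algebra_simps)
  qed
  have right': "\<Psi> p q a \<phi> (ract S f c) = ract S' (\<Psi> p q a \<phi> f) c" if f: "f \<in> carrier S" and c': "c \<in> carrier C" for f c
  proof (rule pre.MX.S.N.graded.linear_maps_homog_eq[OF linear_maps_compose[OF S.ract_left[OF c'] lin]
        linear_maps_compose[OF lin S'.ract_left[OF c']] mods(2) _ f])
    fix r f assume f: "f \<in> homog S r"
    have fS: "f \<in> carrier S" using f by (rule pre.MX.S.N.graded.homog_carrier)
    show "\<Psi> p q a \<phi> (ract S f c) = ract S' (\<Psi> p q a \<phi> f) c"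
      by (rule pre.MX.M.B.graded.linear_maps_homog_eq[OF linear_maps_compose[OF S.ract_right[OF fS] lin]
            S'.ract_right[OF linear_maps_closed[OF lin fS]] mods(2) right[OF f] c'])
  qed
  have left: "\<Psi> p q a \<phi> (lact S b f) = ksign S' ((p + q) * s) (lact S' b (\<Psi> p q a \<phi> f))"
    if b: "b \<in> homog B s" and f: "f \<in> homog S r" for b f r s
  proof -
    have fS: "f \<in> carrier S" and bB: "b \<in> carrier B" using f b pre.MX.S.N.graded.homog_carrier pre.MX.X.B.graded.homog_carrier by auto
    have fH: "f \<in> carrier pre.MX.H" by (rule pre.MX.S_H[OF fS])
    note fa = pre.closed_H[OF fH a]
    note sw = sandwich_closed[OF c(2) fS c(1)]
    have "sandwich \<phi> (lact S b f) a = ksign S' (q * s) (lact S' b (sandwich \<phi> f a))"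
      using post.NY.S_lact_closed[OF bB sw]
      by (simp add: HOM_bar_simps(7) pre.compose_lact[OF fH a bB] post.compose_lact[OF \<phi> fa b] post.NY.S_ksign)
    then show ?thesis
      using sw bB S'.lact_closed[OF bB sw]
      by (simp add: app[OF f] app[OF S.lact_degree[OF b f]] S'.lact_ksign post.NY.S.N.M.ksign_ksign)
        (rule ksign_parity, simp add: algebra_simps)
  qed
  have left': "\<Psi> p q a \<phi> (lact S b f) = ksign S' ((p + q) * s) (lact S' b (\<Psi> p q a \<phi> f))"
    if b: "b \<in> homog B s" and f: "f \<in> carrier S" for b f s
  proof -
    have bB: "b \<in> carrier B" using b by (rule pre.MX.X.B.graded.homog_carrier)
    show ?thesis
      by (rule pre.MX.S.N.graded.linear_maps_homog_eq[OF linear_maps_compose[OF S.lact_right[OF bB] lin]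
            linear_maps_ksign_map[OF mods(2) linear_maps_compose[OF lin S'.lact_right[OF bB]]] mods(2) left[OF b] f])
  qed
  show ?thesis
    unfolding bimod_maps_iff[OF S.dg_bimodule_axioms S'.dg_bimodule_axioms] right_linear_maps_def
    using deg right' left' by blast
qed

lemma \<Psi>_homog:
  "\<lbrakk>a \<in> homog CA p; \<phi> \<in> homog BA q\<rbrakk> \<Longrightarrow> \<Psi> p q a \<phi> \<in> homog BC (p + q)"
  unfolding homog_BC by (rule \<Psi>_bimod)

text \<open>The extended map lands in the bimodule morphisms because it does so on homogeneous arguments.\<close>

lemma F_linear: "F \<in> linear_maps K (dg_tensor K CA BA) BC"
  and F_pure: "\<lbrakk>a \<in> homog CA p; \<phi> \<in> homog BA q\<rbrakk> \<Longrightarrow> F (pure_tensor K CA BA a \<phi>) = \<Psi> p q a \<phi>"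
proof -
  interpret T: dg_module_pair K CA BA
    by (intro dg_module_pair.intro pre.CA.N.dg_module_axioms post.BA.N.dg_module_axioms)
  let ?\<Phi> = "\<lambda>a \<phi>. graded_extend P CA (\<lambda>p a. graded_extend P BA (\<lambda>q \<phi>. \<Psi> p q a \<phi>) \<phi>) a"
  note ge = graded_extend_bilinear[OF pre.CA.N.graded.graded_module_axioms post.BA.N.graded.graded_module_axioms
      P_module, of \<Psi>, OF \<Psi>_bilinear]
  have sg: "additive_subgroup (carrier BC) P"
    using BC.subgroup_of_maps by (simp add: subgroup_record_def)
  have 1: "?\<Phi> a \<phi> \<in> carrier BC" if a: "a \<in> homog CA p" and \<phi>: "\<phi> \<in> carrier BA" for a \<phi> p
  proof (rule post.BA.N.graded.linear_maps_homog_into[OF bilinear_map_right[OF ge(1)] P_module sg _ \<phi>])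
    show "a \<in> carrier CA" using a by (rule pre.CA.N.graded.homog_carrier)
    show "?\<Phi> a \<phi> \<in> carrier BC" if "\<phi> \<in> homog BA q" for \<phi> q
      unfolding ge(2)[OF a that]
      using \<Psi>_bimod[OF a that] BC.N.graded.homog_carrier by (simp add: homog_BC)
  qed
  have 2: "?\<Phi> a \<phi> \<in> carrier BC" if a: "a \<in> carrier CA" and \<phi>: "\<phi> \<in> carrier BA" for a \<phi>
    by (rule pre.CA.N.graded.linear_maps_homog_into[OF bilinear_map_left[OF ge(1) \<phi>] P_module sg 1[OF _ \<phi>] a])
  have b: "bilinear_map K CA BA BC ?\<Phi>"
    by (intro bilinear_mapI linear_maps_codomain[OF bilinear_map_left[OF ge(1)] BC.subgroup_of_maps BC.map_smult]
        linear_maps_codomain[OF bilinear_map_right[OF ge(1)] BC.subgroup_of_maps BC.map_smult] 2)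
  show "F \<in> linear_maps K (dg_tensor K CA BA) BC"
    unfolding HOM_bar_map_def by (rule T.tensor_lift_linear(1)[OF BC.N.graded.module b])
  show "F (pure_tensor K CA BA a \<phi>) = \<Psi> p q a \<phi>" if "a \<in> homog CA p" "\<phi> \<in> homog BA q"
    unfolding HOM_bar_map_def
    using that T.tensor_lift_linear(2)[OF BC.N.graded.module b pre.CA.N.graded.homog_carrier post.BA.N.graded.homog_carrier]
      ge(2)[OF that]
    by simp
qed

text \<open>With \<open>f\<close> of degree \<open>r\<close>, the differential of \<open>\<phi> \<circ> f \<circ> a\<close> has one term for each factor. The one with \<open>d(f)\<close>
  is cancelled by the second half of the commutator that defines the differential of maps; the
  other two are the images of \<open>d(a) \<otimes> \<phi>\<close> and \<open>(-1)\<^sup>p a \<otimes> d(\<phi>)\<close>.\<close>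

lemma F_dif:
  assumes a: "a \<in> homog CA p" and \<phi>: "\<phi> \<in> homog BA q"
  shows "F (dif (dg_tensor K CA BA) (pure_tensor K CA BA a \<phi>)) = dif BC (F (pure_tensor K CA BA a \<phi>))"
proof -
  interpret T: dg_module_pair K CA BA
    by (intro dg_module_pair.intro pre.CA.N.dg_module_axioms post.BA.N.dg_module_axioms)
  interpret TD: module K T.D by (rule T.D_module)
  have c: "a \<in> carrier CA" "\<phi> \<in> carrier BA"
    using a \<phi> pre.CA.N.graded.homog_carrier post.BA.N.graded.homog_carrier by auto
  note da = pre.CA.N.dif_degree[OF a] and d\<phi> = post.BA.N.dif_degree[OF \<phi>]
  note dc = pre.CA.N.graded.homog_carrier[OF da] post.BA.N.graded.homog_carrier[OF d\<phi>]
  note \<Psi>h = \<Psi>_homog[OF a \<phi>] \<Psi>_homog[OF da \<phi>] \<Psi>_homog[OF a d\<phi>]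
  note \<Psi>c = \<Psi>h[THEN BC.N.graded.homog_carrier]
  note mods = pre.MX.S.N.graded.module post.NY.S.N.graded.module
  have F: "F (dif T.D (T.pure a \<phi>)) = \<Psi> (p + 1) q (dif CA a) \<phi> \<oplus>\<^bsub>BC\<^esub> ksign BC p (\<Psi> p (q + 1) a (dif BA \<phi>))"
    using c dc a \<phi> da d\<phi>
    by (simp add: T.dif_pure[OF a] linear_maps_add[OF F_linear] linear_maps_ksign[OF F_linear T.D_module BC.N.graded.module]
        TD.M.ksign_closed F_pure)
  have RHS: "\<Psi> (p + 1) q (dif CA a) \<phi> \<oplus>\<^bsub>BC\<^esub> ksign BC p (\<Psi> p (q + 1) a (dif BA \<phi>)) \<in> carrier BC"
    using \<Psi>c by (simp add: BC.N.M.ksign_closed BC.N.M.a_closed)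
  have LHS: "dif BC (\<Psi> p q a \<phi>) \<in> carrier BC"
    using \<Psi>c linear_maps_closed[OF BC.N.dif_linear] by blast
  have "\<Psi> (p + 1) q (dif CA a) \<phi> \<oplus>\<^bsub>BC\<^esub> ksign BC p (\<Psi> p (q + 1) a (dif BA \<phi>)) = dif BC (\<Psi> p q a \<phi>)"
  proof (rule BC.map_eqI[OF RHS LHS])
    fix f assume f: "f \<in> carrier S"
    show "(\<Psi> (p + 1) q (dif CA a) \<phi> \<oplus>\<^bsub>BC\<^esub> ksign BC p (\<Psi> p (q + 1) a (dif BA \<phi>))) f = dif BC (\<Psi> p q a \<phi>) f"
    proof (rule pre.MX.S.N.graded.linear_maps_homog_eq[OF BC.map_linear[OF RHS] BC.map_linear[OF LHS] mods(2) _ f])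
      fix r f assume f: "f \<in> homog S r"
      have fS: "f \<in> carrier S" using f by (rule pre.MX.S.N.graded.homog_carrier)
      note df = pre.MX.S.N.dif_degree[OF f] and dfS = S.dif_X_closed[OF fS]
      let ?s = "ksign S'" and ?u = "sandwich (dif BA \<phi>) f a" and ?v = "sandwich \<phi> (dif S f) a"
        and ?w = "sandwich \<phi> f (dif CA a)"
      have sc: "?u \<in> carrier S'" "?v \<in> carrier S'" "?w \<in> carrier S'" "sandwich \<phi> f a \<in> carrier S'"
        using sandwich_closed c dc fS dfS by auto
      note fa = pre.closed_S[OF fS c(1)] pre.closed_S[OF dfS c(1)] pre.closed_S[OF fS dc(1)]
      note postl = bilinear_map_right[OF post.bilinear_S c(2)]
      have "dif S' (sandwich \<phi> f a) = ?u \<oplus>\<^bsub>S'\<^esub> ?s q (?v \<oplus>\<^bsub>S'\<^esub> ?s r ?w)"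
        using fa
        by (simp add: post.dif_S[OF \<phi> pre.homog_S[OF f a]] pre.dif_S[OF f a] linear_maps_add[OF postl]
            linear_maps_ksign[OF postl pre.NX.S.N.graded.module post.NY.S.N.graded.module] pre.NX.S.N.M.ksign_closed)
      then have "dif S' (\<Psi> p q a \<phi> f) = ?s ((q + r) * p) ?u \<oplus>\<^bsub>S'\<^esub> (?s ((q + r) * p + q) ?v \<oplus>\<^bsub>S'\<^esub> ?s ((q + r) * p + q + r) ?w)"
        using sc
        by (simp add: \<Psi>_homog_apply[OF c(2,1) f] linear_maps_ksign[OF post.NY.S.N.dif_linear mods(2,2)]
            post.NY.S.N.M.ksign_add post.NY.S.N.M.ksign_ksign add.assoc)
      moreover have "?s (p + q + 1) (\<Psi> p q a \<phi> (dif S f)) = ?s (p + q + 1 + (q + (r + 1)) * p) ?v"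
        using sc by (simp add: \<Psi>_homog_apply[OF c(2,1) df] post.NY.S.N.M.ksign_ksign)
      ultimately have "dif BC (\<Psi> p q a \<phi>) f = ?s ((q + r) * p) ?u \<oplus>\<^bsub>S'\<^esub>
          (?s ((q + r) * p + q) ?v \<oplus>\<^bsub>S'\<^esub> ?s ((q + r) * p + q + r) ?w) \<oplus>\<^bsub>S'\<^esub> ?s (p + q + 1 + (q + (r + 1)) * p) ?v"
        using BC.dif_apply[OF \<Psi>h(1) fS] by simp
      also have "\<dots> = ?s ((q + r) * p) ?u \<oplus>\<^bsub>S'\<^esub> ?s ((q + r) * p + q + r) ?w \<oplus>\<^bsub>S'\<^esub>
          (?s ((q + r) * p + q) ?v \<oplus>\<^bsub>S'\<^esub> ?s (p + q + 1 + (q + (r + 1)) * p) ?v)"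
        using sc by (simp add: post.NY.S.N.M.a_ac)
      also have "?s ((q + r) * p + q) ?v \<oplus>\<^bsub>S'\<^esub> ?s (p + q + 1 + (q + (r + 1)) * p) ?v = \<zero>\<^bsub>S'\<^esub>"
        using sc by (auto simp: ksign_def post.NY.S.N.M.r_neg post.NY.S.N.M.l_neg)
      finally have L: "dif BC (\<Psi> p q a \<phi>) f = ?s ((q + r) * p) ?u \<oplus>\<^bsub>S'\<^esub> ?s ((q + r) * p + q + r) ?w"
        using sc by simp
      have "(\<Psi> (p + 1) q (dif CA a) \<phi> \<oplus>\<^bsub>BC\<^esub> ksign BC p (\<Psi> p (q + 1) a (dif BA \<phi>))) f =
          ?s ((q + r) * (p + 1)) ?w \<oplus>\<^bsub>S'\<^esub> ?s (p + (q + 1 + r) * p) ?u"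
        using fS sc \<Psi>c
        by (simp add: BC.add_apply BC.ksign_apply \<Psi>_homog_apply[OF c(2) dc(1) f] \<Psi>_homog_apply[OF dc(2) c(1) f]
            post.NY.S.N.M.ksign_ksign)
      also have "\<dots> = ?s ((q + r) * p + q + r) ?w \<oplus>\<^bsub>S'\<^esub> ?s ((q + r) * p) ?u"
      proof -
        have "?s ((q + r) * (p + 1)) ?w = ?s ((q + r) * p + q + r) ?w" "?s (p + (q + 1 + r) * p) ?u = ?s ((q + r) * p) ?u"
          by (rule ksign_parity, auto)+
        then show ?thesis by simp
      qed
      finally show "(\<Psi> (p + 1) q (dif CA a) \<phi> \<oplus>\<^bsub>BC\<^esub> ksign BC p (\<Psi> p (q + 1) a (dif BA \<phi>))) f = dif BC (\<Psi> p q a \<phi>) f"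
        unfolding L using sc by (simp add: post.NY.S.N.M.a_comm)
    qed
  qed
  then show ?thesis unfolding F F_pure[OF a \<phi>] .
qed

end

section \<open>The functor\<close>

lemma HOM_arrowI:
  assumes "dg_bimodule K C A M" "dg_bimodule K C A N" "dg_bimodule K B A X" "dg_bimodule K B A Y"
  shows "HOM_arrow K A B C M N X Y"
  using assms
  by (intro HOM_arrow.intro precomposition.intro postcomposition.intro HOM_pair.intro)

lemma HOM_bar_map_Id:
  assumes M: "dg_bimodule K C A M" and X: "dg_bimodule K B A X"
    and i: "(\<lambda>m\<in>carrier M. m) \<in> homog (bimod_hom K C A M M) 0" "(\<lambda>x\<in>carrier X. x) \<in> homog (bimod_hom K B A X X) 0"
  shows "HOM_bar_map K A B C M X M X (pure_tensor K (bimod_hom K C A M M) (bimod_hom K B A X X)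
      (\<lambda>m\<in>carrier M. m) (\<lambda>x\<in>carrier X. x)) = (\<lambda>f\<in>carrier (HOM_bar K A B C M X). f)"
proof -
  interpret HOM_arrow K A B C M M X X by (intro HOM_arrowI M X)
  let ?i = "\<lambda>m\<in>carrier M. m" and ?j = "\<lambda>x\<in>carrier X. x"
  note ij = pre.CA.N.graded.homog_carrier[OF i(1)] post.BA.N.graded.homog_carrier[OF i(2)]
  note lin = \<Psi>_linear[OF ij(2,1), of 0 0]
  have "\<Psi> 0 0 ?i ?j f = f" if f: "f \<in> carrier S" for f
  proof (rule pre.MX.S.N.graded.linear_maps_homog_eq[OF lin linear_maps_id pre.MX.S.N.graded.module _ f])
    fix r f assume f: "f \<in> homog S r"
    have fS: "f \<in> carrier S" using f by (rule pre.MX.S.N.graded.homog_carrier)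
    have "sandwich ?j f ?i = f"
      using pre.MX.S.map_closed[OF fS] pre.MX.S.map_extensional[OF fS]
      by (auto simp: compose_def fun_eq_iff extensional_def)
    then show "\<Psi> 0 0 ?i ?j f = f" by (simp add: \<Psi>_homog_apply[OF ij(2,1) f])
  qed
  then show ?thesis
    unfolding F_pure[OF i] signed_composite_def by (auto simp: fun_eq_iff)
qed

text \<open>The exponent \<open>p q' + p p'\<close> collects the signs of the composition in the tensor product and in the
  opposite category. Modulo 2 both sides carry
  \<open>(q + r) p + (q' + r + p + q) p'\<close> in front of \<open>\<psi> \<circ> \<phi> \<circ> f \<circ> a \<circ> b\<close>.\<close>

lemma HOM_bar_map_Comp:
  fixes K :: "('k, 'r) ring_scheme" and A :: "('k, 'a, 's) dg_mod_scheme"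
    and B :: "('k, 'b, 't) dg_mod_scheme" and C :: "('k, 'c, 'u) dg_mod_scheme"
    and M1 M2 M3 :: "('k, 'm, 'c, 'a) dg_bimod" and X1 X2 X3 :: "('k, 'x, 'b, 'a) dg_bimod"
  assumes M: "dg_bimodule K C A M1" "dg_bimodule K C A M2" "dg_bimodule K C A M3"
    and X: "dg_bimodule K B A X1" "dg_bimodule K B A X2" "dg_bimodule K B A X3"
    and a: "a \<in> homog (bimod_hom K C A M2 M1) p" and \<phi>: "\<phi> \<in> homog (bimod_hom K B A X1 X2) q"
    and b: "b \<in> homog (bimod_hom K C A M3 M2) p'" and \<psi>: "\<psi> \<in> homog (bimod_hom K B A X2 X3) q'"
    and ab: "compose (carrier M3) a b \<in> homog (bimod_hom K C A M3 M1) (p + p')"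
    and \<psi>\<phi>: "compose (carrier X1) \<psi> \<phi> \<in> homog (bimod_hom K B A X1 X3) (q' + q)"
  shows "ksign (bimod_hom K B C (HOM_bar K A B C M1 X1) (HOM_bar K A B C M3 X3)) (p * q' + p * p')
      (HOM_bar_map K A B C M1 X1 M3 X3 (pure_tensor K (bimod_hom K C A M3 M1) (bimod_hom K B A X1 X3)
        (compose (carrier M3) a b) (compose (carrier X1) \<psi> \<phi>)))
    = compose (carrier (HOM_bar K A B C M1 X1))
      (HOM_bar_map K A B C M2 X2 M3 X3 (pure_tensor K (bimod_hom K C A M3 M2) (bimod_hom K B A X2 X3) b \<psi>))
      (HOM_bar_map K A B C M1 X1 M2 X2 (pure_tensor K (bimod_hom K C A M2 M1) (bimod_hom K B A X1 X2) a \<phi>))"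
proof -
  interpret A12: HOM_arrow K A B C M1 M2 X1 X2 by (intro HOM_arrowI M X)
  interpret A23: HOM_arrow K A B C M2 M3 X2 X3 by (intro HOM_arrowI M X)
  interpret A13: HOM_arrow K A B C M1 M3 X1 X3 by (intro HOM_arrowI M X)
  note c = A12.pre.CA.N.graded.homog_carrier[OF a] A12.post.BA.N.graded.homog_carrier[OF \<phi>]
    A23.pre.CA.N.graded.homog_carrier[OF b] A23.post.BA.N.graded.homog_carrier[OF \<psi>]
    A13.pre.CA.N.graded.homog_carrier[OF ab] A13.post.BA.N.graded.homog_carrier[OF \<psi>\<phi>]
  note l12 = A12.\<Psi>_linear[OF c(2,1), of p q] and l23 = A23.\<Psi>_linear[OF c(4,3), of p' q']
  let ?n = "p * q' + p * p'"
  have \<Psi>13: "A13.\<Psi> (p + p') (q' + q) (compose (carrier M3) a b) (compose (carrier X1) \<psi> \<phi>) \<in> carrier A13.BC"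
    using A13.\<Psi>_bimod[OF ab \<psi>\<phi>] A13.BC.N.graded.homog_carrier by (simp add: A13.homog_BC)
  note l13 = A13.BC.map_linear[OF A13.BC.N.M.ksign_closed[OF \<Psi>13, of ?n]]
  show ?thesis
    unfolding A13.F_pure[OF ab \<psi>\<phi>] A12.F_pure[OF a \<phi>] A23.F_pure[OF b \<psi>]
  proof (rule extensionalityI[OF A13.BC.map_extensional[OF A13.BC.N.M.ksign_closed[OF \<Psi>13]] compose_extensional])
    fix f assume f: "f \<in> carrier A12.S"
    have "ksign A13.BC ?n (A13.\<Psi> (p + p') (q' + q) (compose (carrier M3) a b) (compose (carrier X1) \<psi> \<phi>)) f
      = A23.\<Psi> p' q' b \<psi> (A12.\<Psi> p q a \<phi> f)"
    proof (rule graded_module.linear_maps_homog_eq[OF A12.source_graded l13 linear_maps_compose[OF l12 l23] graded_module.module[OF A13.target_graded] _ f])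
      fix r f assume f: "f \<in> homog A12.S r"
      have fS: "f \<in> carrier A12.S" using f by (rule graded_module.homog_carrier[OF A12.source_graded])
      note sw = A12.sandwich_homog[OF \<phi> f a]
      note swc = graded_module.homog_carrier[OF A12.target_graded sw]
      have "A13.sandwich (compose (carrier X1) \<psi> \<phi>) f (compose (carrier M3) a b)
          = A23.sandwich \<psi> (A12.sandwich \<phi> f a) b"
        using A12.pre.CA.map_closed[OF c(1)] A23.pre.CA.map_closed[OF c(3)] A12.pre.MX.S.map_closed[OF fS]
        by (auto simp: compose_def fun_eq_iff)
      moreover have "A23.\<Psi> p' q' b \<psi> (A12.\<Psi> p q a \<phi> f) =
          ksign A13.S' ((q + r) * p + (q' + (r + (p + q))) * p') (A23.sandwich \<psi> (A12.sandwich \<phi> f a) b)"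
        unfolding A12.\<Psi>_homog_apply[OF c(2,1) f]
          linear_maps_ksign[OF l23 graded_module.module[OF A12.target_graded] graded_module.module[OF A13.target_graded] swc] A23.\<Psi>_homog_apply[OF c(4,3) sw]
        by (rule abelian_group.ksign_ksign[OF module.axioms(2)[OF graded_module.module[OF A13.target_graded]] A23.sandwich_closed[OF c(4) swc c(3)]])
      moreover have "ksign A13.BC ?n (A13.\<Psi> (p + p') (q' + q) (compose (carrier M3) a b) (compose (carrier X1) \<psi> \<phi>)) f
          = ksign A13.S' (?n + (q' + q + r) * (p + p'))
            (A13.sandwich (compose (carrier X1) \<psi> \<phi>) f (compose (carrier M3) a b))"
        unfolding A13.BC.ksign_apply[OF \<Psi>13 fS] A13.\<Psi>_homog_apply[OF c(6,5) f]
        by (rule abelian_group.ksign_ksign[OF module.axioms(2)[OF graded_module.module[OF A13.target_graded]] A13.sandwich_closed[OF c(6) fS c(5)]])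
      moreover have "ksign A13.S' (?n + (q' + q + r) * (p + p')) u
          = ksign A13.S' ((q + r) * p + (q' + (r + (p + q))) * p') u" for u
        by (rule ksign_parity) auto
      ultimately show "ksign A13.BC ?n (A13.\<Psi> (p + p') (q' + q) (compose (carrier M3) a b) (compose (carrier X1) \<psi> \<phi>)) f
        = A23.\<Psi> p' q' b \<psi> (A12.\<Psi> p q a \<phi> f)" by simp
    qed
    then show "ksign A13.BC ?n (A13.\<Psi> (p + p') (q' + q) (compose (carrier M3) a b) (compose (carrier X1) \<psi> \<phi>)) f
      = compose (carrier A12.S) (A23.\<Psi> p' q' b \<psi>) (A12.\<Psi> p q a \<phi>) f"
      using f by (simp add: compose_eq)
  qed
qed

lemma HOM_bar_dg_functor:
  fixes K :: "('k, 'r) ring_scheme"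
    and A :: "('k, 'a, 's) dg_mod_scheme"
    and B :: "('k, 'b, 't) dg_mod_scheme"
    and C :: "('k, 'c, 'u) dg_mod_scheme"
    and CA :: "(('k, 'm, 'c, 'a) dg_bimod, 'k, 'm \<Rightarrow> 'm) dg_cat"
    and BA :: "(('k, 'x, 'b, 'a) dg_bimod, 'k, 'x \<Rightarrow> 'x) dg_cat"
    and BC :: "(('k, 'm \<Rightarrow> 'x, 'b, 'c) dg_bimod, 'k, ('m \<Rightarrow> 'x) \<Rightarrow> ('m \<Rightarrow> 'x)) dg_cat"
  assumes K: "cring K"
  defines "CA \<equiv> bimod_cat K C A" and "BA \<equiv> bimod_cat K B A" and "BC \<equiv> bimod_cat K B C"
  shows "dg_functor K (dg_tensor_cat K (dg_op CA) BA) BC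
    (\<lambda>(M, X). HOM_bar K A B C M X) (\<lambda>(M, X) (N, Y). HOM_bar_map K A B C M X N Y)"
proof -
  interpret CA: dg_category K CA unfolding CA_def by (rule bimod_dg_category[OF K])
  interpret BA: dg_category K BA unfolding BA_def by (rule bimod_dg_category[OF K])
  interpret BC: dg_category K BC unfolding BC_def by (rule bimod_dg_category[OF K])
  interpret op: dg_category K "dg_op CA" by (rule CA.op_dg_category)
  interpret T: dg_category_pair K "dg_op CA" BA
    by (intro dg_category_pair.intro op.dg_category_axioms BA.dg_category_axioms)
  have simps: "Obj CA = {X. dg_bimodule K C A X}" "Obj BA = {X. dg_bimodule K B A X}"
      "Obj BC = {X. dg_bimodule K B C X}"
      "Hom CA = bimod_hom K C A" "Hom BA = bimod_hom K B A" "Hom BC = bimod_hom K B C"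
      "Comp CA M N L = compose (carrier M)" "Comp BA X Y Z = compose (carrier X)"
      "Comp BC V W U = compose (carrier V)"
      "Id CA M = (\<lambda>x\<in>carrier M. x)" "Id BA X = (\<lambda>x\<in>carrier X. x)" "Id BC V = (\<lambda>x\<in>carrier V. x)"
    for M N L X Y Z U V W
    by (auto simp: CA_def BA_def BC_def bimod_cat_def fun_eq_iff)
  have Obj: "U \<in> Obj T.\<T> \<longleftrightarrow> dg_bimodule K C A (fst U) \<and> dg_bimodule K B A (snd U)" for U
    by (cases U) (simp add: dg_tensor_cat_simps simps)
  have Hom: "Hom T.\<T> (M, X) (N, Y) = dg_tensor K (bimod_hom K C A N M) (bimod_hom K B A X Y)" for M X N Y
    by (simp add: dg_tensor_cat_simps simps)
  have gen: "\<exists>a \<phi> p q. f = pure_tensor K (bimod_hom K C A N M) (bimod_hom K B A X Y) a \<phi> \<and> p + q = n \<and>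
      a \<in> homog (bimod_hom K C A N M) p \<and> \<phi> \<in> homog (bimod_hom K B A X Y) q"
    if "f \<in> T.generators (M, X) (N, Y) n" for f M X N Y n
    using that by (auto simp: T.generators_def simps)
  show ?thesis
  proof (rule dg_functorI[OF T.tensor_dg_category BC.dg_category_axioms, where G = T.generators])
    show "homog_generators (Hom T.\<T> U V) (T.generators U V)" if "U \<in> Obj T.\<T>" "V \<in> Obj T.\<T>" for U V
      using that by (rule T.tensor_generators)
  next
    fix U assume U: "U \<in> Obj T.\<T>"
    obtain M X where UX: "U = (M, X)" by fastforce
    have MX: "dg_bimodule K C A M" "dg_bimodule K B A X" using U by (simp_all add: Obj UX)
    interpret HOM_pair K A B C M X by (intro HOM_pair.intro MX)
    show "(case U of (M, X) \<Rightarrow> HOM_bar K A B C M X) \<in> Obj BC"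
      by (simp add: UX simps S_dg_bimodule)
    have "Id CA M \<in> homog (Hom CA M M) 0" "Id BA X \<in> homog (Hom BA X X) 0"
      using CA.Id_homog[of M] BA.Id_homog[of X] MX by (simp_all add: simps)
    then show "(case U of (M, X) \<Rightarrow> \<lambda>(N, Y). HOM_bar_map K A B C M X N Y) U (Id T.\<T> U)
        = Id BC (case U of (M, X) \<Rightarrow> HOM_bar K A B C M X)"
      using HOM_bar_map_Id[OF MX] by (simp add: UX dg_tensor_cat_simps simps)
  next
    fix U V assume U: "U \<in> Obj T.\<T>" "V \<in> Obj T.\<T>"
    obtain M X N Y where UX: "U = (M, X)" "V = (N, Y)" by fastforce
    have MX: "dg_bimodule K C A M" "dg_bimodule K C A N" "dg_bimodule K B A X" "dg_bimodule K B A Y"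
      using U by (simp_all add: Obj UX)
    interpret A: HOM_arrow K A B C M N X Y by (intro HOM_arrowI MX)
    show "(case U of (M, X) \<Rightarrow> \<lambda>(N, Y). HOM_bar_map K A B C M X N Y) V
        \<in> linear_maps K (Hom T.\<T> U V) (Hom BC (case U of (M, X) \<Rightarrow> HOM_bar K A B C M X)
          (case V of (M, X) \<Rightarrow> HOM_bar K A B C M X))"
      using A.F_linear by (simp add: UX Hom simps)
    fix f n assume "f \<in> T.generators U V n"
    then obtain a \<phi> p q where f: "f = pure_tensor K A.CA A.BA a \<phi>" "p + q = n" "a \<in> homog A.CA p" "\<phi> \<in> homog A.BA q"
      using gen unfolding UX by blast
    show "(case U of (M, X) \<Rightarrow> \<lambda>(N, Y). HOM_bar_map K A B C M X N Y) V f
        \<in> homog (Hom BC (case U of (M, X) \<Rightarrow> HOM_bar K A B C M X) (case V of (M, X) \<Rightarrow> HOM_bar K A B C M X)) n"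
      using A.\<Psi>_bimod[OF f(3,4)] f(2) by (simp add: UX simps f(1) A.F_pure[OF f(3,4)] A.homog_BC)
    show "(case U of (M, X) \<Rightarrow> \<lambda>(N, Y). HOM_bar_map K A B C M X N Y) V (dif (Hom T.\<T> U V) f)
        = dif (Hom BC (case U of (M, X) \<Rightarrow> HOM_bar K A B C M X) (case V of (M, X) \<Rightarrow> HOM_bar K A B C M X))
          ((case U of (M, X) \<Rightarrow> \<lambda>(N, Y). HOM_bar_map K A B C M X N Y) V f)"
      using A.F_dif[OF f(3,4)] by (simp add: UX simps Hom f(1))
  next
    fix U V W f g m n
    assume U: "U \<in> Obj T.\<T>" "V \<in> Obj T.\<T>" "W \<in> Obj T.\<T>"
      and fg: "f \<in> T.generators U V n" "g \<in> T.generators V W m"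
    obtain M1 X1 M2 X2 M3 X3 where UX: "U = (M1, X1)" "V = (M2, X2)" "W = (M3, X3)" by fastforce
    have M: "dg_bimodule K C A M1" "dg_bimodule K C A M2" "dg_bimodule K C A M3"
      and X: "dg_bimodule K B A X1" "dg_bimodule K B A X2" "dg_bimodule K B A X3"
      using U by (simp_all add: Obj UX)
    have oC: "M1 \<in> Obj CA" "M2 \<in> Obj CA" "M3 \<in> Obj CA" and oB: "X1 \<in> Obj BA" "X2 \<in> Obj BA" "X3 \<in> Obj BA"
      using M X by (simp_all add: simps)
    interpret A13: HOM_arrow K A B C M1 M3 X1 X3 by (intro HOM_arrowI M X)
    interpret T13: dg_module_pair K A13.CA A13.BA
      by (intro dg_module_pair.intro A13.pre.CA.N.dg_module_axioms A13.post.BA.N.dg_module_axioms)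
    obtain a \<phi> p q where f: "f = pure_tensor K (bimod_hom K C A M2 M1) (bimod_hom K B A X1 X2) a \<phi>"
        "a \<in> homog (bimod_hom K C A M2 M1) p" "\<phi> \<in> homog (bimod_hom K B A X1 X2) q"
      using gen fg(1) unfolding UX by blast
    obtain b \<psi> p' q' where g: "g = pure_tensor K (bimod_hom K C A M3 M2) (bimod_hom K B A X2 X3) b \<psi>"
        "b \<in> homog (bimod_hom K C A M3 M2) p'" "\<psi> \<in> homog (bimod_hom K B A X2 X3) q'"
      using gen fg(2) unfolding UX by blast
    have h: "a \<in> homog (Hom CA M2 M1) p" "\<phi> \<in> homog (Hom BA X1 X2) q" "b \<in> homog (Hom CA M3 M2) p'"
        "\<psi> \<in> homog (Hom BA X2 X3) q'"
      using f g by (simp_all add: simps)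
    have ab: "compose (carrier M3) a b \<in> homog A13.CA (p + p')"
      and \<psi>\<phi>: "compose (carrier X1) \<psi> \<phi> \<in> homog A13.BA (q' + q)"
      using CA.Comp_degree[OF oC(3,2,1) h(1,3)] BA.Comp_degree[OF oB h(4,2)] by (simp_all add: simps)
    have opc: "Comp (dg_op CA) M1 M2 M3 b a = ksign A13.CA (p * p') (compose (carrier M3) a b)"
      using CA.op_Comp(2)[OF oC h(3,1)] by (simp add: simps)
    note cc = A13.pre.CA.N.graded.homog_carrier[OF ab] A13.post.BA.N.graded.homog_carrier[OF \<psi>\<phi>]
    have "Comp T.\<T> (M1, X1) (M2, X2) (M3, X3) g f
        = ksign T13.D (p * q') (T13.pure (ksign A13.CA (p * p') (compose (carrier M3) a b)) (compose (carrier X1) \<psi> \<phi>))"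
      using T.tensor_Comp(2)[of M1 M2 M3 X1 X2 X3 b \<psi> q' a p \<phi>] oC oB h CA.Hom_carrier[OF oC(3,2) h(3)]
        BA.Hom_carrier[OF oB(1,2) h(2)]
      by (simp add: f(1) g(1) dg_tensor_cat_simps simps opc)
    then have "Comp T.\<T> (M1, X1) (M2, X2) (M3, X3) g f
        = ksign T13.D (p * q' + p * p') (T13.pure (compose (carrier M3) a b) (compose (carrier X1) \<psi> \<phi>))"
      using cc T13.pure_carrier[OF cc] module.axioms(2)[OF T13.D_module]
      by (simp add: T13.pure_ksign_left abelian_group.ksign_ksign)
    then have "A13.F (Comp T.\<T> (M1, X1) (M2, X2) (M3, X3) g f) = ksign A13.BC (p * q' + p * p')
        (A13.F (T13.pure (compose (carrier M3) a b) (compose (carrier X1) \<psi> \<phi>)))"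
      using linear_maps_ksign[OF A13.F_linear T13.D_module A13.BC.N.graded.module T13.pure_carrier[OF cc]] by simp
    then show "(case U of (M, X) \<Rightarrow> \<lambda>(N, Y). HOM_bar_map K A B C M X N Y) W (Comp T.\<T> U V W g f)
        = Comp BC (case U of (M, X) \<Rightarrow> HOM_bar K A B C M X) (case V of (M, X) \<Rightarrow> HOM_bar K A B C M X)
            (case W of (M, X) \<Rightarrow> HOM_bar K A B C M X)
          ((case V of (M, X) \<Rightarrow> \<lambda>(N, Y). HOM_bar_map K A B C M X N Y) W g)
          ((case U of (M, X) \<Rightarrow> \<lambda>(N, Y). HOM_bar_map K A B C M X N Y) V f)"
      using HOM_bar_map_Comp[OF M X f(2,3) g(2,3) ab \<psi>\<phi>] by (simp add: UX simps f(1) g(1))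
  qed
qed

theorem proposition8p2:
  fixes K :: "('k, 'r) ring_scheme"
    and A :: "('k, 'a, 's) dg_mod_scheme"
    and B :: "('k, 'b, 't) dg_mod_scheme"
    and C :: "('k, 'c, 'u) dg_mod_scheme"
    and CA :: "(('k, 'm, 'c, 'a) dg_bimod, 'k, 'm \<Rightarrow> 'm) dg_cat"
    and BA :: "(('k, 'x, 'b, 'a) dg_bimod, 'k, 'x \<Rightarrow> 'x) dg_cat"
    and BC :: "(('k, 'm \<Rightarrow> 'x, 'b, 'c) dg_bimod, 'k, ('m \<Rightarrow> 'x) \<Rightarrow> ('m \<Rightarrow> 'x)) dg_cat"
  assumes "cring K" and "dg_algebra K A" and "dg_algebra K B" and "dg_algebra K C"
  defines "CA \<equiv> bimod_cat K C A" and "BA \<equiv> bimod_cat K B A" and "BC \<equiv> bimod_cat K B C"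
  shows "\<exists>F. dg_functor K (dg_tensor_cat K (dg_op CA) BA) BC
        (\<lambda>(M, X). HOM_bar K A B C M X) F \<and>
      (\<forall>M\<in>Obj CA. \<forall>N\<in>Obj CA. \<forall>X\<in>Obj BA. \<forall>Y\<in>Obj BA.
        \<forall>p q r. \<forall>\<alpha>\<in>homog (Hom CA N M) p. \<forall>\<phi>\<in>homog (Hom BA X Y) q.
        \<forall>f\<in>homog (HOM_bar K A B C M X) r.
          F (M, X) (N, Y) (pure_tensor K (Hom (dg_op CA) M N) (Hom BA X Y) \<alpha> \<phi>) f =
            ksign (HOM_bar K A B C N Y) ((q + r) * p)
              (compose (carrier N) \<phi> (compose (carrier N) f \<alpha>)))"
proof (intro exI conjI ballI allI)
  show "dg_functor K (dg_tensor_cat K (dg_op CA) BA) BC (\<lambda>(M, X). HOM_bar K A B C M X)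
      (\<lambda>(M, X) (N, Y). HOM_bar_map K A B C M X N Y)"
    unfolding CA_def BA_def BC_def by (rule HOM_bar_dg_functor[OF assms(1)])
next
  interpret CA: dg_category K CA unfolding CA_def by (rule bimod_dg_category[OF assms(1)])
  fix M N X Y p q r \<alpha> \<phi> f
  assume o: "M \<in> Obj CA" "N \<in> Obj CA" "X \<in> Obj BA" "Y \<in> Obj BA"
    and \<alpha>: "\<alpha> \<in> homog (Hom CA N M) p" and \<phi>: "\<phi> \<in> homog (Hom BA X Y) q"
    and f: "f \<in> homog (HOM_bar K A B C M X) r"
  have MX: "dg_bimodule K C A M" "dg_bimodule K C A N" "dg_bimodule K B A X" "dg_bimodule K B A Y"
    using o by (simp_all add: CA_def BA_def bimod_cat_simps)
  interpret A: HOM_arrow K A B C M N X Y by (intro HOM_arrowI MX)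
  have h: "\<alpha> \<in> homog A.CA p" "\<phi> \<in> homog A.BA q"
    using \<alpha> \<phi> by (simp_all add: CA_def BA_def bimod_cat_simps)
  note c = A.pre.CA.N.graded.homog_carrier[OF h(1)] A.post.BA.N.graded.homog_carrier[OF h(2)]
  have "A.F (pure_tensor K A.CA A.BA \<alpha> \<phi>) f = ksign (HOM_bar K A B C N Y) ((q + r) * p)
      (compose (carrier N) \<phi> (compose (carrier N) f \<alpha>))"
    unfolding A.F_pure[OF h] by (rule A.\<Psi>_homog_apply[OF c(2,1) f])
  then show "(case (M, X) of (M, X) \<Rightarrow> \<lambda>(N, Y). HOM_bar_map K A B C M X N Y) (N, Y)
      (pure_tensor K (Hom (dg_op CA) M N) (Hom BA X Y) \<alpha> \<phi>) f =
    ksign (HOM_bar K A B C N Y) ((q + r) * p) (compose (carrier N) \<phi> (compose (carrier N) f \<alpha>))"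
    unfolding CA.dg_op_simps by (simp add: CA_def BA_def bimod_cat_simps)
qed

end
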